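(* Let $\varepsilon$ be a relevant character. Then for $w_\star\in\mathfrak m_{\mathbb C_p}$ with $v_p(w_\star)\in(0,1)$ and every $n\ge1$, the $n$th slope of $\mathrm{NP}(G^{(\varepsilon)}(w_\star,-))$ is $$v_p(w_\star)\cdot\big(\deg g_n^{(\varepsilon)}-\deg g_{n-1}^{(\varepsilon)}\big).$$ Moreover, these slopes are strictly increasing with respect to $n$.
   Context: Basic notation. $p\ge 5$ is a prime, $v_p$ is the valuation on $\mathbb C_p$ with $v_p(p)=1$, $\mathfrak m_{\mathbb C_p}$ is the maximal ideal of $\mathcal O_{\mathbb C_p}$. $E$ is a finite extension of $\mathbb Q_p(\sqrt p)$ with ring of integers $\mathcal O$, uniformizer $\varpi$ and residue field $\mathbb F$. $\Delta=\mathbb F_p^\times$, $\omega:\Delta\to\mathbb Z_p^\times$ is the Teichmüller character, bars denote reduction mod $p$. For $m\in\mathbb Z$, $\{m\}$ is the unique integer in $[0,p-2]$ congruent to $m$ mod $p-1$. $K_p=\mathrm{GL}_2(\mathbb Z_p)$, $\mathrm{Iw}_p=\begin{pmatrix}\mathbb Z_p^\times&\mathbb Z_p\\ p\mathbb Z_p&\mathbb Z_p^\times\end{pmatrix}$. All Hom spaces are spaces of continuous homomorphisms. The module. Fix an integer $1\le a\le p-4$. $\widetilde{\mathrm H}$ is a finitely generated projective right $\mathcal O[[K_p]]$-module (with its canonical topology) with a right action of $\mathrm{GL}_2(\mathbb Q_p)$ extending the $K_p$-action, such that: (i) $\widetilde{\mathrm H}/(\varpi,I)$, with $I$ the augmentation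 ideal of $\mathcal O[[1+p\mathrm M_2(\mathbb Z_p)]]$, is isomorphic as a right $\mathbb F[\mathrm{GL}_2(\mathbb F_p)]$-module to the projective envelope of $\mathrm{Sym}^a\mathbb F^{\oplus2}$ (homogeneous polynomials of degree $a$, right action $h|_{\left(\begin{smallmatrix}\alpha&\beta\\ \gamma&\delta\end{smallmatrix}\right)}(X,Y)=h(\alpha X+\beta Y,\gamma X+\delta Y)$); (ii) $\mathrm{diag}(p,p)$ acts trivially; (iii) $\widetilde{\mathrm H}\cong\widetilde{\mathrm H}_0\widehat\otimes_{\mathcal O}\mathcal O[[1+p\mathbb Z_p]]$ as $\mathcal O[\mathrm{GL}_2(\mathbb Q_p)]$-modules, where scalar matrices in $1+p\mathbb Z_p$ act trivially on $\widetilde{\mathrm H}_0$ and $\mathrm{GL}_2(\mathbb Q_p)$ acts on $\mathcal O[[1+p\mathbb Z_p]]$ through $\det$ followed by $p^rd\mapsto d/\omega(\bar d)$ ($r\in\mathbb Z$, $d\in\mathbb Z_p^\times$). Relevant characters. A relevant character is a character of $\Delta^2$ of the form $\varepsilon=\omega^{-s_\varepsilon}\times\omega^{a+s_\varepsilon}$ with $s_\varepsilon\in\{0,\dots,p-2\}$. Put $\varepsilon_1=\omega^{-s_\varepsilon}$, $\tilde\varepsilon_1=\varepsilon_1\times\varepsilon_1$, $k_\varepsilon=2+\{a+2s_\varepsilon\}$. Abstract classical forms. For $k\ge2$, characters $\psi$ of $\Delta^2$ and $\eta$ of $\Delta$: $\mathrm S_k^{\mathrm{Iw}}(\psi)=\mathrm{Hom}_{\mathcal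 O[\mathrm{Iw}_p]}(\widetilde{\mathrm H},\mathcal O[z]^{\le k-2}\otimes\psi)$ and $\mathrm S_k^{\mathrm{ur}}(\eta)=\mathrm{Hom}_{\mathcal O[K_p]}(\widetilde{\mathrm H},\mathcal O[z]^{\le k-2}\otimes\eta\circ\det)$, where on polynomials of degree $\le k-2$ the right action is $f|_{\left(\begin{smallmatrix}\alpha&\beta\\ \gamma&\delta\end{smallmatrix}\right)}(z)=(\gamma z+\delta)^{k-2}f\big(\frac{\alpha z+\beta}{\gamma z+\delta}\big)$, $\psi$ is the character $\left(\begin{smallmatrix}\alpha&\beta\\ \gamma&\delta\end{smallmatrix}\right)\mapsto\psi(\bar\alpha,\bar\delta)$ of $\mathrm{Iw}_p$, and $\eta\circ\det$ is $g\mapsto\eta(\overline{\det g})$. These are finite free $\mathcal O$-modules of ranks $d_k^{\mathrm{Iw}}(\psi)$, $d_k^{\mathrm{ur}}(\eta)$. Ghost series. For $k\in\mathbb Z$, $w_k=\exp(p(k-2))-1$. $G^{(\varepsilon)}(w,t)=1+\sum_{n\ge1}g^{(\varepsilon)}_n(w)t^n$, $g_0^{(\varepsilon)}=1$, with $g^{(\varepsilon)}_n(w)=\prod_{k\ge2,\,k\equiv k_\varepsilon\bmod(p-1)}(w-w_k)^{m_n(k)}$ (a finite product), where, with $d_k^{\mathrm{Iw}}=d_k^{\mathrm{Iw}}(\tilde\varepsilon_1)$ and $d_k^{\mathrm{ur}}=d_k^{\mathrm{ur}}(\varepsilon_1)$, $m_n(k)=\min\{n-d_k^{\mathrm{ur}},\,d_k^{\mathrm{Iw}}-d_k^{\mathrm{ur}}-n\}$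 if $d_k^{\mathrm{ur}}<n<d_k^{\mathrm{Iw}}-d_k^{\mathrm{ur}}$ and $m_n(k)=0$ otherwise. $\mathrm{NP}(\sum c_nt^n)$ is the lower convex hull of the points $(n,v_p(c_n))$; its slopes are listed in non-decreasing order with multiplicity, starting with the 1st. *)

theory Defs
  imports
    "HOL-Analysis.Analysis"
    "HOL-Algebra.Module"
    "HOL-Algebra.Subrings"
    "HOL-Algebra.Generated_Groups"
    "HOL-Number_Theory.Cong"
    "HOL-Computational_Algebra.Polynomial"
begin

section \<open>The field of p-adic complex numbers\<close>

text \<open>
  The ambient field is a type of classes \<^class>\<open>field_char_0\<close> and \<^class>\<open>complete_space\<close>, with
  absolute value \<open>|x| = dist x 0\<close>. The predicate \<open>is_Cp\<close> says that it is the completion of an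
  algebraic closure of the p-adic numbers, for the absolute value with \<open>|p| = 1/p\<close>. As the type is
  complete, the closure of the rationals in it is the completion of the rationals.
\<close>

definition vp :: "nat \<Rightarrow> 'c::{field_char_0,complete_space} \<Rightarrow> ereal" where
  "vp p x = (if x = 0 then \<infinity> else ereal (- log (real p) (dist x 0)))"

definition Qp :: "'c::{field_char_0,complete_space} set" where
  "Qp = closure \<rat>"

definition Qp_alg :: "'c::{field_char_0,complete_space} set" where
  "Qp_alg = {x. \<exists>f. f \<noteq> 0 \<and> (\<forall>i. Polynomial.coeff f i \<in> Qp) \<and> poly f x = 0}"

definition is_Cp :: "nat \<Rightarrow> 'c::{field_char_0,complete_space} itself \<Rightarrow> bool" where
  "is_Cp p (_ :: 'c itself) \<longleftrightarrow>
     (\<forall>x y::'c. dist x y = dist (x - y) 0) \<and>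
     (\<forall>x y::'c. dist (x * y) 0 = dist x 0 * dist y 0) \<and>
     (\<forall>x y::'c. dist (x + y) 0 \<le> max (dist x 0) (dist y 0)) \<and>
     dist (of_nat p :: 'c) 0 = 1 / real p \<and>
     (\<forall>f::'c poly. degree f > 0 \<longrightarrow> (\<forall>i. Polynomial.coeff f i \<in> Qp_alg) \<longrightarrow> (\<exists>x\<in>Qp_alg. poly f x = 0)) \<and>
     closure (Qp_alg :: 'c set) = UNIV"

definition Zp :: "nat \<Rightarrow> 'c::{field_char_0,complete_space} set" where
  "Zp p = {x \<in> Qp. 0 \<le> vp p x}"

definition Zp_units :: "nat \<Rightarrow> 'c::{field_char_0,complete_space} set" where
  "Zp_units p = {x \<in> Qp. vp p x = 0}"

definition ring_on :: "'a::comm_ring_1 set \<Rightarrow> 'a ring" where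
  "ring_on A = \<lparr>carrier = A, mult = (*), one = 1, zero = 0, add = (+)\<rparr>"

definition finite_ext_Qp_sqrt_p :: "nat \<Rightarrow> 'c::{field_char_0,complete_space} set \<Rightarrow> bool" where
  "finite_ext_Qp_sqrt_p p E \<longleftrightarrow> subfield E (ring_on UNIV) \<and>
     (\<exists>r. r ^ 2 = of_nat p \<and>
       (let L = {x + y * r | x y. x \<in> Qp \<and> y \<in> Qp} in
         L \<subseteq> E \<and> (\<exists>B. finite B \<and> B \<subseteq> E \<and> (\<forall>x\<in>E. \<exists>c\<in>B \<rightarrow> L. x = (\<Sum>b\<in>B. c b * b)))))"

definition integers :: "nat \<Rightarrow> 'c::{field_char_0,complete_space} set \<Rightarrow> 'c set" where
  "integers p E = {x \<in> E. 0 \<le> vp p x}"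

definition uniformizer :: "nat \<Rightarrow> 'c::{field_char_0,complete_space} set \<Rightarrow> 'c \<Rightarrow> bool" where
  "uniformizer p E \<pi> \<longleftrightarrow> \<pi> \<in> integers p E \<and>
     {x \<in> E. 0 < vp p x} = (\<lambda>y. \<pi> * y) ` integers p E"

text \<open>
  The residue field is a type \<open>'f\<close> together with the reduction map from the ring of integers;
  the values of the map elsewhere are irrelevant. The field with p elements is then the prime field
  of \<open>'f\<close>, and restricted to the p-adic integers the map is reduction modulo p.
\<close>

definition residue_map ::
    "nat \<Rightarrow> 'c::{field_char_0,complete_space} set \<Rightarrow> ('c \<Rightarrow> 'f::field) \<Rightarrow> bool" where
  "residue_map p E red \<longleftrightarrow>
     red \<in> ring_hom (ring_on (integers p E)) (ring_on UNIV) \<and>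
     red ` integers p E = UNIV \<and>
     {x \<in> integers p E. red x = 0} = {x \<in> integers p E. 0 < vp p x}"

definition Fp :: "'f::field set" where
  "Fp = range of_int"

definition \<Delta> :: "'f::field set" where
  "\<Delta> = Fp - {0}"

definition teichmueller ::
    "nat \<Rightarrow> ('c::{field_char_0,complete_space} \<Rightarrow> 'f::field) \<Rightarrow> 'f \<Rightarrow> 'c" where
  "teichmueller p red x = (THE t. t \<in> Zp_units p \<and> t ^ (p - 1) = 1 \<and> red t = x)"


section \<open>Groups\<close>

definition GL2 :: "'a::comm_ring_1 set \<Rightarrow> ('a^2^2) monoid" where
  "GL2 A = \<lparr>carrier = {g. (\<forall>i j. g $ i $ j \<in> A) \<and> (\<exists>u\<in>A. det g * u = 1)},
            mult = (**), one = mat 1\<rparr>"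

definition congruence_subgroup ::
    "nat \<Rightarrow> nat \<Rightarrow> ('c::{field_char_0,complete_space}^2^2) set" where
  "congruence_subgroup p n =
     {g \<in> carrier (GL2 (Zp p)). \<forall>i j. ereal (real n) \<le> vp p ((g - mat 1) $ i $ j)}"

definition Iwahori :: "nat \<Rightarrow> ('c::{field_char_0,complete_space}^2^2) set" where
  "Iwahori p = {g. g $ 1 $ 1 \<in> Zp_units p \<and> g $ 1 $ 2 \<in> Zp p \<and>
                   g $ 2 $ 1 \<in> (\<lambda>x. of_nat p * x) ` Zp p \<and> g $ 2 $ 2 \<in> Zp_units p}"

text \<open>\<open>one_units_subgroup p n\<close> consists of the \<open>x\<close> in \<open>1 + p Zp\<close> with \<open>x \<equiv> 1\<close> modulo \<open>p ^ n\<close>.\<close>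

definition one_units_subgroup :: "nat \<Rightarrow> nat \<Rightarrow> 'c::{field_char_0,complete_space} set" where
  "one_units_subgroup p n = {x \<in> Zp p. 1 \<le> vp p (x - 1) \<and> ereal (real n) \<le> vp p (x - 1)}"

definition one_units :: "nat \<Rightarrow> ('c::{field_char_0,complete_space}) monoid" where
  "one_units p = \<lparr>carrier = one_units_subgroup p 1, mult = (*), one = 1\<rparr>"

text \<open>\<open>one_unit_part\<close> is the map \<open>p ^ r * d \<mapsto> d / \<omega>(d)\<close> for an integer \<open>r\<close> and a p-adic unit \<open>d\<close>.\<close>

definition one_unit_part ::
    "nat \<Rightarrow> ('c::{field_char_0,complete_space} \<Rightarrow> 'f::field) \<Rightarrow> 'c \<Rightarrow> 'c" where
  "one_unit_part p red x = (THE y. \<exists>(r::int) d. d \<in> Zp_units p \<and> x = of_nat p powi r * d \<and>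
                                   y = d / teichmueller p red (red d))"


section \<open>Right modules\<close>

text \<open>
  A right module over a not necessarily commutative ring is stored in the record type
  \<^type>\<open>module\<close>, with \<open>r \<odot> x\<close> standing for the right multiplication of \<open>x\<close> by \<open>r\<close>. The
  multiplicative fields of the record are not used.
\<close>

locale right_module = R?: ring R + M?: abelian_group M
  for R :: "('r, 's) ring_scheme" (structure) and M :: "('r, 'm, 't) module_scheme" (structure) +
  assumes act_closed: "r \<in> carrier R \<Longrightarrow> x \<in> carrier M \<Longrightarrow> r \<odot>\<^bsub>M\<^esub> x \<in> carrier M"
    and act_l_distr: "r \<in> carrier R \<Longrightarrow> s \<in> carrier R \<Longrightarrow> x \<in> carrier M \<Longrightarrow>
          (r \<oplus>\<^bsub>R\<^esub> s) \<odot>\<^bsub>M\<^esub> x = r \<odot>\<^bsub>M\<^esub> x \<oplus>\<^bsub>M\<^esub> s \<odot>\<^bsub>M\<^esub> x"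
    and act_r_distr: "r \<in> carrier R \<Longrightarrow> x \<in> carrier M \<Longrightarrow> y \<in> carrier M \<Longrightarrow>
          r \<odot>\<^bsub>M\<^esub> (x \<oplus>\<^bsub>M\<^esub> y) = r \<odot>\<^bsub>M\<^esub> x \<oplus>\<^bsub>M\<^esub> r \<odot>\<^bsub>M\<^esub> y"
    and act_assoc: "r \<in> carrier R \<Longrightarrow> s \<in> carrier R \<Longrightarrow> x \<in> carrier M \<Longrightarrow>
          (r \<otimes>\<^bsub>R\<^esub> s) \<odot>\<^bsub>M\<^esub> x = s \<odot>\<^bsub>M\<^esub> (r \<odot>\<^bsub>M\<^esub> x)"
    and act_one: "x \<in> carrier M \<Longrightarrow> \<one>\<^bsub>R\<^esub> \<odot>\<^bsub>M\<^esub> x = x"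

definition mod_hom ::
    "('r, 's) ring_scheme \<Rightarrow> ('r, 'm, 't) module_scheme \<Rightarrow> ('r, 'n, 'u) module_scheme \<Rightarrow> ('m \<Rightarrow> 'n) set"
  where
  "mod_hom R M N = {f \<in> carrier M \<rightarrow> carrier N.
     (\<forall>x\<in>carrier M. \<forall>y\<in>carrier M. f (x \<oplus>\<^bsub>M\<^esub> y) = f x \<oplus>\<^bsub>N\<^esub> f y) \<and>
     (\<forall>r\<in>carrier R. \<forall>x\<in>carrier M. f (r \<odot>\<^bsub>M\<^esub> x) = r \<odot>\<^bsub>N\<^esub> f x)}"

definition free_module :: "('r, 's) ring_scheme \<Rightarrow> nat \<Rightarrow> ('r, nat \<Rightarrow> 'r) module" where
  "free_module R n = \<lparr>carrier = {..<n} \<rightarrow>\<^sub>E carrier R, mult = undefined, one = undefined,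
     zero = (\<lambda>i\<in>{..<n}. \<zero>\<^bsub>R\<^esub>), add = (\<lambda>x y. \<lambda>i\<in>{..<n}. x i \<oplus>\<^bsub>R\<^esub> y i),
     smult = (\<lambda>r x. \<lambda>i\<in>{..<n}. x i \<otimes>\<^bsub>R\<^esub> r)\<rparr>"

definition fg_projective :: "('r, 's) ring_scheme \<Rightarrow> ('r, 'm, 't) module_scheme \<Rightarrow> bool" where
  "fg_projective R M \<longleftrightarrow> right_module R M \<and>
     (\<exists>n. \<exists>i\<in>mod_hom R M (free_module R n). \<exists>q\<in>mod_hom R (free_module R n) M.
        \<forall>x\<in>carrier M. q (i x) = x)"

text \<open>
  A projective envelope is a projective module with an essential epimorphism. (Over the group ring
  of a finite group over a field, a projective envelope of a finite-dimensional module is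
  finitely generated.)
\<close>

definition projective_envelope ::
    "('r, 's) ring_scheme \<Rightarrow> ('r, 'm, 't) module_scheme \<Rightarrow> ('r, 'n, 'u) module_scheme \<Rightarrow> bool" where
  "projective_envelope R P S \<longleftrightarrow> fg_projective R P \<and>
     (\<exists>f\<in>mod_hom R P S. f ` carrier P = carrier S \<and>
        (\<forall>N. submodule N R P \<and> f ` N = carrier S \<longrightarrow> N = carrier P))"

definition free_rank :: "('r, 's) ring_scheme \<Rightarrow> ('r, 'm, 't) module_scheme \<Rightarrow> nat" where
  "free_rank R M = (THE d. \<exists>f\<in>mod_hom R (free_module R d) M. bij_betw f (carrier (free_module R d)) (carrier M))"

definition restrict_scalars :: "('s \<Rightarrow> 'r) \<Rightarrow> ('r, 'm, 't) module_scheme \<Rightarrow> ('s, 'm) module" where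
  "restrict_scalars h M = \<lparr>carrier = carrier M, mult = mult M, one = one M, zero = zero M,
     add = add M, smult = (\<lambda>c. smult M (h c))\<rparr>"

text \<open>
  For a (compact) topological ring carried by a topological type, the canonical topology of a finitely
  generated module is the quotient topology of any surjection from a free module of finite rank.
  Equivalently, it is the final topology for all linear maps from such free modules.
\<close>

definition canonical_topology ::
    "('r::topological_space, 's) ring_scheme \<Rightarrow> ('r, 'm, 't) module_scheme \<Rightarrow> 'm topology" where
  "canonical_topology R M = topology (\<lambda>U. U \<subseteq> carrier M \<and>
     (\<forall>n. \<forall>f\<in>mod_hom R (free_module R n) M.
        openin (top_of_set (carrier (free_module R n))) {x \<in> carrier (free_module R n). f x \<in> U}))"

lemma openin_canonical_topology:
  fixes R :: "('r::topological_space, 's) ring_scheme" and M :: "('r, 'm, 't) module_scheme"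
  shows "openin (canonical_topology R M) U \<longleftrightarrow> U \<subseteq> carrier M \<and>
     (\<forall>n. \<forall>f\<in>mod_hom R (free_module R n) M.
        openin (top_of_set (carrier (free_module R n))) {x \<in> carrier (free_module R n). f x \<in> U})"
  (is "_ \<longleftrightarrow> ?P U")
proof -
  have inter: "?P (S \<inter> T)" if S: "?P S" and T: "?P T" for S T
  proof -
    have eq: "{x \<in> A. f x \<in> S \<inter> T} = {x \<in> A. f x \<in> S} \<inter> {x \<in> A. f x \<in> T}"
      for A :: "(nat \<Rightarrow> 'r) set" and f
      by auto
    from S T show ?thesis
      unfolding eq by (intro conjI allI ballI openin_Int) auto
  qed
  have union: "?P (\<Union>\<K>)" if K: "\<forall>S\<in>\<K>. ?P S" for \<K>
  proof -
    have eq: "{x \<in> A. f x \<in> \<Union>\<K>} = \<Union>((\<lambda>S. {x \<in> A. f x \<in> S}) ` \<K>)"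
      for A :: "(nat \<Rightarrow> 'r) set" and f
      by auto
    from K show ?thesis
      unfolding eq by (intro conjI allI ballI openin_Union) auto
  qed
  have "istopology ?P"
    unfolding istopology_def
    by (rule conjI; intro allI impI) (rule inter, assumption, assumption, rule union, assumption)
  then show ?thesis
    unfolding canonical_topology_def by (simp add: topology_inverse')
qed


section \<open>Group rings and completed group rings\<close>

definition group_ring :: "'a::comm_ring_1 set \<Rightarrow> ('g, 'x) monoid_scheme \<Rightarrow> ('g \<Rightarrow> 'a) ring" where
  "group_ring A G = \<lparr>
     carrier = {f. (\<forall>g\<in>carrier G. f g \<in> A) \<and> (\<forall>g. g \<notin> carrier G \<longrightarrow> f g = 0)},
     mult = (\<lambda>e f g. \<Sum>(h, k) \<in> {(h, k). h \<in> carrier G \<and> k \<in> carrier G \<and> h \<otimes>\<^bsub>G\<^esub> k = g}. e h * f k),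
     one = (\<lambda>g. if g = \<one>\<^bsub>G\<^esub> then 1 else 0),
     zero = (\<lambda>g. 0),
     add = (\<lambda>e f g. e g + f g)\<rparr>"

abbreviation K_level ::
    "nat \<Rightarrow> nat \<Rightarrow> ('c::{field_char_0,complete_space}^2^2) set monoid" where
  "K_level p n \<equiv> GL2 (Zp p) Mod congruence_subgroup p n"

text \<open>
  \<open>iwasawa_ring p A\<close> is the inverse limit over \<open>n\<close> of the group rings of \<open>K_level p n\<close> with
  coefficients in \<open>A\<close>. Its topology is the subspace topology of the function space.
\<close>

definition iwasawa_ring ::
    "nat \<Rightarrow> 'c::{field_char_0,complete_space} set \<Rightarrow> (nat \<Rightarrow> ('c^2^2) set \<Rightarrow> 'c) ring" where
  "iwasawa_ring p A = \<lparr>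
     carrier = {x. \<forall>n. x n \<in> carrier (group_ring A (K_level p n)) \<and>
                    (\<forall>C\<in>carrier (K_level p n).
                       x n C = (\<Sum>D\<in>{D \<in> carrier (K_level p (Suc n)). D \<subseteq> C}. x (Suc n) D))},
     mult = (\<lambda>x y n. x n \<otimes>\<^bsub>group_ring A (K_level p n)\<^esub> y n),
     one = (\<lambda>n. \<one>\<^bsub>group_ring A (K_level p n)\<^esub>),
     zero = (\<lambda>n. \<zero>\<^bsub>group_ring A (K_level p n)\<^esub>),
     add = (\<lambda>x y n. x n \<oplus>\<^bsub>group_ring A (K_level p n)\<^esub> y n)\<rparr>"

text \<open>\<open>pt p c g\<close> is the element \<open>c [g]\<close> of the completed group ring.\<close>

definition pt ::
    "nat \<Rightarrow> 'c::{field_char_0,complete_space} \<Rightarrow> 'c^2^2 \<Rightarrow> nat \<Rightarrow> ('c^2^2) set \<Rightarrow> 'c" where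
  "pt p c g = (\<lambda>n C. if C \<in> carrier (K_level p n) \<and> g \<in> C then c else 0)"

text \<open>
  The augmentation ideal of the completed group ring of the first congruence subgroup, inside the
  ring for the whole group: elements supported on that subgroup (no mass on disjoint cosets), of
  total mass zero. \<open>K_level p 0\<close> is trivial, so the total mass is the value there.
\<close>

definition augmentation_ideal ::
    "nat \<Rightarrow> 'c::{field_char_0,complete_space} set \<Rightarrow> (nat \<Rightarrow> ('c^2^2) set \<Rightarrow> 'c) set" where
  "augmentation_ideal p A = {x \<in> carrier (iwasawa_ring p A).
     (\<forall>n C. C \<inter> congruence_subgroup p 1 = {} \<longrightarrow> x n C = 0) \<and> x 0 (carrier (GL2 (Zp p))) = 0}"

abbreviation scalars_of ::
    "nat \<Rightarrow> (nat \<Rightarrow> ('c::{field_char_0,complete_space}^2^2) set \<Rightarrow> 'c, 'h) module \<Rightarrow> ('c, 'h) module"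
  where "scalars_of p H \<equiv> restrict_scalars (\<lambda>c. pt p c (mat 1)) H"


section \<open>Polynomial representations\<close>

text \<open>
  \<open>slash d g f (z) = (\<gamma> z + \<delta>) ^ d * f ((\<alpha> z + \<beta>) / (\<gamma> z + \<delta>))\<close> for \<open>degree f \<le> d\<close>, where the rows of
  \<open>g\<close> are \<open>(\<alpha>, \<beta>)\<close> and \<open>(\<gamma>, \<delta>)\<close>, with denominators cleared.
\<close>

definition slash :: "nat \<Rightarrow> 'a::comm_ring_1^2^2 \<Rightarrow> 'a poly \<Rightarrow> 'a poly" where
  "slash d g f = (\<Sum>i\<le>d. Polynomial.smult (Polynomial.coeff f i)
     ([:g $ 1 $ 2, g $ 1 $ 1:] ^ i * [:g $ 2 $ 2, g $ 2 $ 1:] ^ (d - i)))"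

definition poly_module :: "'a::comm_ring_1 set \<Rightarrow> nat \<Rightarrow> ('a, 'a poly) module" where
  "poly_module A d = \<lparr>carrier = {f. degree f \<le> d \<and> (\<forall>i. Polynomial.coeff f i \<in> A)},
     mult = undefined, one = undefined, zero = 0, add = (+), smult = Polynomial.smult\<rparr>"

text \<open>
  A homogeneous polynomial \<open>h(X, Y)\<close> of degree \<open>a\<close> is encoded by \<open>h(z, 1)\<close>; the action
  \<open>h(\<alpha> X + \<beta> Y, \<gamma> X + \<delta> Y)\<close> then becomes \<open>slash a\<close>.
\<close>

definition Sym_module :: "nat \<Rightarrow> ('f::field^2^2 \<Rightarrow> 'f, 'f poly) module" where
  "Sym_module a = \<lparr>carrier = {f. degree f \<le> a}, mult = undefined, one = undefined,
     zero = 0, add = (+),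
     smult = (\<lambda>r f. \<Sum>g\<in>carrier (GL2 Fp). Polynomial.smult (r g) (slash a g f))\<rparr>"


section \<open>The module\<close>

text \<open>Right modules over \<open>A[G]\<close>, as \<open>A\<close>-modules with a linear right action of \<open>G\<close>\<close>

definition right_rep ::
    "('r, 's) ring_scheme \<Rightarrow> ('g, 'x) monoid_scheme \<Rightarrow> ('r, 'm, 't) module_scheme \<Rightarrow>
     ('m \<Rightarrow> 'g \<Rightarrow> 'm) \<Rightarrow> bool" where
  "right_rep A G M act \<longleftrightarrow> right_module A M \<and>
     (\<forall>g\<in>carrier G. (\<lambda>x. act x g) \<in> mod_hom A M M) \<and>
     (\<forall>x\<in>carrier M. act x \<one>\<^bsub>G\<^esub> = x) \<and>
     (\<forall>g\<in>carrier G. \<forall>h\<in>carrier G. \<forall>x\<in>carrier M. act x (g \<otimes>\<^bsub>G\<^esub> h) = act (act x g) h)"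

definition topological_module ::
    "('r::topological_space, 's) ring_scheme \<Rightarrow> ('r, 'm, 't) module_scheme \<Rightarrow> 'm topology \<Rightarrow> bool" where
  "topological_module A M T \<longleftrightarrow> topspace T = carrier M \<and>
     continuous_map (prod_topology T T) T (\<lambda>(x, y). x \<oplus>\<^bsub>M\<^esub> y) \<and>
     continuous_map (prod_topology (top_of_set (carrier A)) T) T (\<lambda>(c, x). c \<odot>\<^bsub>M\<^esub> x)"

text \<open>
  The completed tensor product of a compact Hausdorff module \<open>M\<close> with the completed group ring of
  \<open>\<Gamma> = 1 + p Zp\<close>. As the group rings of the finite quotients \<open>\<Gamma> / \<Gamma>\<^sub>n\<close> are finite free
  and \<open>M\<close> is complete, it is the inverse limit over \<open>n\<close> of the modules of \<open>M\<close>-valued functions on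
  \<open>\<Gamma> / \<Gamma>\<^sub>n\<close>, with summation over fibres as transition maps.
\<close>

abbreviation \<Gamma>_level :: "nat \<Rightarrow> nat \<Rightarrow> ('c::{field_char_0,complete_space}) set monoid" where
  "\<Gamma>_level p n \<equiv> one_units p Mod one_units_subgroup p (Suc n)"

definition completed_tensor ::
    "nat \<Rightarrow> ('c::{field_char_0,complete_space}, 'm) module \<Rightarrow> ('c, nat \<Rightarrow> 'c set \<Rightarrow> 'm) module" where
  "completed_tensor p M = \<lparr>
     carrier = {\<mu>. \<forall>n. (\<forall>C. C \<notin> carrier (\<Gamma>_level p n) \<longrightarrow> \<mu> n C = \<zero>\<^bsub>M\<^esub>) \<and>
                     (\<forall>C\<in>carrier (\<Gamma>_level p n). \<mu> n C \<in> carrier M \<and>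
                        \<mu> n C = (\<Oplus>\<^bsub>M\<^esub>D\<in>{D \<in> carrier (\<Gamma>_level p (Suc n)). D \<subseteq> C}. \<mu> (Suc n) D))},
     mult = undefined, one = undefined,
     zero = (\<lambda>n C. \<zero>\<^bsub>M\<^esub>),
     add = (\<lambda>\<mu> \<nu> n C. \<mu> n C \<oplus>\<^bsub>M\<^esub> \<nu> n C),
     smult = (\<lambda>c \<mu> n C. c \<odot>\<^bsub>M\<^esub> \<mu> n C)\<rparr>"

text \<open>
  The diagonal action \<open>(x \<otimes> [\<gamma>]) g = x g \<otimes> [\<gamma> \<delta>]\<close>, where \<open>\<delta>\<close> is the image of \<open>det g\<close> in \<open>1 + p Zp\<close>:
  the mass of the result at a coset \<open>C\<close> comes from the coset \<open>C \<delta>\<^sup>-\<^sup>1\<close>.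
\<close>

definition completed_tensor_act ::
    "nat \<Rightarrow> ('c::{field_char_0,complete_space} \<Rightarrow> 'f::field) \<Rightarrow> ('c, 'm) module \<Rightarrow>
     ('m \<Rightarrow> 'c^2^2 \<Rightarrow> 'm) \<Rightarrow> (nat \<Rightarrow> 'c set \<Rightarrow> 'm) \<Rightarrow> 'c^2^2 \<Rightarrow> nat \<Rightarrow> 'c set \<Rightarrow> 'm" where
  "completed_tensor_act p red M act \<mu> g = (\<lambda>n C.
     if C \<in> carrier (\<Gamma>_level p n)
     then act (\<mu> n (C #>\<^bsub>one_units p\<^esub> inverse (one_unit_part p red (det g)))) g
     else \<zero>\<^bsub>M\<^esub>)"

text \<open>
  \<open>H\<close> is the module over the completed group ring, and \<open>H_act\<close> the action of \<open>GL2 Qp\<close>. Condition (i)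
  is witnessed by \<open>P\<close> and the map \<open>\<theta>\<close> that induces the isomorphism from the quotient of \<open>H\<close> onto \<open>P\<close>.
  Condition (iii) is witnessed by \<open>H0\<close> with its topology \<open>T0\<close> and action \<open>H0_act\<close>, and the
  isomorphism \<open>\<Phi>\<close>.
\<close>

locale ghost_setting =
  fixes p a :: nat
    and E :: "'c::{field_char_0,complete_space} set"
    and \<pi> :: 'c
    and red :: "'c \<Rightarrow> 'f::field"
    and H :: "(nat \<Rightarrow> ('c^2^2) set \<Rightarrow> 'c, 'h) module"
    and H_act :: "'h \<Rightarrow> 'c^2^2 \<Rightarrow> 'h"
    and P :: "('f^2^2 \<Rightarrow> 'f, 'q) module"
    and \<theta> :: "'h \<Rightarrow> 'q"
    and H0 :: "('c, 'h0) module"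
    and T0 :: "'h0 topology"
    and H0_act :: "'h0 \<Rightarrow> 'c^2^2 \<Rightarrow> 'h0"
    and \<Phi> :: "'h \<Rightarrow> nat \<Rightarrow> 'c set \<Rightarrow> 'h0"
  assumes prime_p: "prime p" and p_ge_5: "p \<ge> 5" and Cp: "is_Cp p TYPE('c)"
    and E_ext: "finite_ext_Qp_sqrt_p p E"
    and uniformizer: "uniformizer p E \<pi>"
    and residue_map: "residue_map p E red"
    and a_ge_1: "1 \<le> a" and a_le: "a \<le> p - 4"
    and H_projective: "fg_projective (iwasawa_ring p (integers p E)) H"
    and H_act_rep: "right_rep (ring_on (integers p E)) (GL2 Qp) (scalars_of p H) H_act"
    and H_act_extends: "\<And>x g. x \<in> carrier H \<Longrightarrow> g \<in> carrier (GL2 (Zp p)) \<Longrightarrow>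
          H_act x g = pt p 1 g \<odot>\<^bsub>H\<^esub> x"
    and P_envelope: "projective_envelope (group_ring UNIV (GL2 Fp)) P (Sym_module a)"
    and \<theta>_surj: "\<theta> ` carrier H = carrier P"
    and \<theta>_add: "\<And>x y. x \<in> carrier H \<Longrightarrow> y \<in> carrier H \<Longrightarrow> \<theta> (x \<oplus>\<^bsub>H\<^esub> y) = \<theta> x \<oplus>\<^bsub>P\<^esub> \<theta> y"
    and \<theta>_act: "\<And>x c g. x \<in> carrier H \<Longrightarrow> c \<in> integers p E \<Longrightarrow> g \<in> carrier (GL2 (Zp p)) \<Longrightarrow>
          \<theta> (pt p c g \<odot>\<^bsub>H\<^esub> x) = (\<lambda>h. if h = map_matrix red g then red c else 0) \<odot>\<^bsub>P\<^esub> \<theta> x"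
    and \<theta>_kernel: "{x \<in> carrier H. \<theta> x = \<zero>\<^bsub>P\<^esub>} =
          generate (add_monoid H)
            {r \<odot>\<^bsub>H\<^esub> x | r x. r \<in> insert (pt p \<pi> (mat 1)) (augmentation_ideal p (integers p E)) \<and>
                             x \<in> carrier H}"
    and diag_p_trivial: "\<And>x. x \<in> carrier H \<Longrightarrow> H_act x (mat (of_nat p)) = x"
    and H0_rep: "right_rep (ring_on (integers p E)) (GL2 Qp) H0 H0_act"
    and H0_topological: "topological_module (ring_on (integers p E)) H0 T0"
    and H0_compact: "compact_space T0" and H0_Hausdorff: "Hausdorff_space T0"
    and H0_act_continuous: "\<And>g. g \<in> carrier (GL2 Qp) \<Longrightarrow> continuous_map T0 T0 (\<lambda>x. H0_act x g)"
    and H0_scalars_trivial: "\<And>x c. x \<in> carrier H0 \<Longrightarrow> c \<in> carrier (one_units p) \<Longrightarrow>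
          H0_act x (mat c) = x"
    and \<Phi>_hom: "\<Phi> \<in> mod_hom (ring_on (integers p E)) (scalars_of p H) (completed_tensor p H0)"
    and \<Phi>_bij: "bij_betw \<Phi> (carrier H) (carrier (completed_tensor p H0))"
    and \<Phi>_equivariant: "\<And>x g. x \<in> carrier H \<Longrightarrow> g \<in> carrier (GL2 Qp) \<Longrightarrow>
          \<Phi> (H_act x g) = completed_tensor_act p red H0 H0_act (\<Phi> x) g"


section \<open>Abstract classical forms\<close>

text \<open>
  Continuous homomorphisms that are equivariant for the subgroup \<open>U\<close>, from \<open>H\<close> to the polynomials of
  degree at most \<open>k - 2\<close> twisted by the character \<open>\<tau>\<close> of \<open>U\<close>.
\<close>

definition forms ::
    "nat \<Rightarrow> 'c::{field_char_0,complete_space} set \<Rightarrow> (nat \<Rightarrow> ('c^2^2) set \<Rightarrow> 'c, 'h) module \<Rightarrow>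
     ('c^2^2) set \<Rightarrow> ('c^2^2 \<Rightarrow> 'c) \<Rightarrow> nat \<Rightarrow> ('c, 'h \<Rightarrow> 'c poly) module" where
  "forms p E H U \<tau> k = \<lparr>
     carrier = {\<phi> \<in> extensional (carrier H).
       \<phi> \<in> mod_hom (ring_on (integers p E)) (scalars_of p H) (poly_module (integers p E) (k - 2)) \<and>
       (\<forall>i. continuous_map (canonical_topology (iwasawa_ring p (integers p E)) H) euclidean
              (\<lambda>x. Polynomial.coeff (\<phi> x) i)) \<and>
       (\<forall>u\<in>U. \<forall>x\<in>carrier H.
          \<phi> (pt p 1 u \<odot>\<^bsub>H\<^esub> x) = Polynomial.smult (\<tau> u) (slash (k - 2) u (\<phi> x)))},
     mult = undefined, one = undefined,
     zero = (\<lambda>x\<in>carrier H. 0),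
     add = (\<lambda>\<phi> \<psi>. \<lambda>x\<in>carrier H. \<phi> x + \<psi> x),
     smult = (\<lambda>c \<phi>. \<lambda>x\<in>carrier H. Polynomial.smult c (\<phi> x))\<rparr>"

definition d_Iw ::
    "nat \<Rightarrow> 'c::{field_char_0,complete_space} set \<Rightarrow> ('c \<Rightarrow> 'f::field) \<Rightarrow>
     (nat \<Rightarrow> ('c^2^2) set \<Rightarrow> 'c, 'h) module \<Rightarrow> ('f \<times> 'f \<Rightarrow> 'c) \<Rightarrow> nat \<Rightarrow> nat" where
  "d_Iw p E red H \<psi> k = free_rank (ring_on (integers p E))
     (forms p E H (Iwahori p) (\<lambda>g. \<psi> (red (g $ 1 $ 1), red (g $ 2 $ 2))) k)"

definition d_ur ::
    "nat \<Rightarrow> 'c::{field_char_0,complete_space} set \<Rightarrow> ('c \<Rightarrow> 'f::field) \<Rightarrow>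
     (nat \<Rightarrow> ('c^2^2) set \<Rightarrow> 'c, 'h) module \<Rightarrow> ('f \<Rightarrow> 'c) \<Rightarrow> nat \<Rightarrow> nat" where
  "d_ur p E red H \<eta> k = free_rank (ring_on (integers p E))
     (forms p E H (carrier (GL2 (Zp p))) (\<lambda>g. \<eta> (red (det g))) k)"


section \<open>Relevant characters and the ghost series\<close>

definition char_of_exponent ::
    "nat \<Rightarrow> nat \<Rightarrow> ('c::{field_char_0,complete_space} \<Rightarrow> 'f::field) \<Rightarrow> nat \<Rightarrow> 'f \<times> 'f \<Rightarrow> 'c" where
  "char_of_exponent p a red s = (\<lambda>(x, y)\<in>\<Delta> \<times> \<Delta>.
     teichmueller p red x powi (- int s) * teichmueller p red y powi (int a + int s))"

definition relevant_character ::
    "nat \<Rightarrow> nat \<Rightarrow> ('c::{field_char_0,complete_space} \<Rightarrow> 'f::field) \<Rightarrow> ('f \<times> 'f \<Rightarrow> 'c) \<Rightarrow> bool" where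
  "relevant_character p a red \<epsilon> \<longleftrightarrow> (\<exists>s\<in>{0..p - 2}. \<epsilon> = char_of_exponent p a red s)"

definition exponent ::
    "nat \<Rightarrow> nat \<Rightarrow> ('c::{field_char_0,complete_space} \<Rightarrow> 'f::field) \<Rightarrow> ('f \<times> 'f \<Rightarrow> 'c) \<Rightarrow> nat" where
  "exponent p a red \<epsilon> = (THE s. s \<in> {0..p - 2} \<and> \<epsilon> = char_of_exponent p a red s)"

definition \<epsilon>\<^sub>1 ::
    "nat \<Rightarrow> nat \<Rightarrow> ('c::{field_char_0,complete_space} \<Rightarrow> 'f::field) \<Rightarrow> ('f \<times> 'f \<Rightarrow> 'c) \<Rightarrow> 'f \<Rightarrow> 'c" where
  "\<epsilon>\<^sub>1 p a red \<epsilon> = (\<lambda>x\<in>\<Delta>. teichmueller p red x powi (- int (exponent p a red \<epsilon>)))"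

definition k_of ::
    "nat \<Rightarrow> nat \<Rightarrow> ('c::{field_char_0,complete_space} \<Rightarrow> 'f::field) \<Rightarrow> ('f \<times> 'f \<Rightarrow> 'c) \<Rightarrow> nat" where
  "k_of p a red \<epsilon> = 2 + (a + 2 * exponent p a red \<epsilon>) mod (p - 1)"

definition padic_exp :: "'c::{field_char_0,complete_space} \<Rightarrow> 'c" where
  "padic_exp x = (\<Sum>n. x ^ n / fact n)"

definition w_point :: "nat \<Rightarrow> int \<Rightarrow> 'c::{field_char_0,complete_space}" where
  "w_point p k = padic_exp (of_nat p * of_int (k - 2)) - 1"

definition ghost_mult ::
    "nat \<Rightarrow> nat \<Rightarrow> 'c::{field_char_0,complete_space} set \<Rightarrow> ('c \<Rightarrow> 'f::field) \<Rightarrow>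
     (nat \<Rightarrow> ('c^2^2) set \<Rightarrow> 'c, 'h) module \<Rightarrow> ('f \<times> 'f \<Rightarrow> 'c) \<Rightarrow> nat \<Rightarrow> nat \<Rightarrow> nat" where
  "ghost_mult p a E red H \<epsilon> n k =
     (let \<eta> = \<epsilon>\<^sub>1 p a red \<epsilon>;
          dIw = d_Iw p E red H (\<lambda>(x, y). \<eta> x * \<eta> y) k;
          dur = d_ur p E red H \<eta> k
      in if dur < n \<and> n < dIw - dur then min (n - dur) (dIw - dur - n) else 0)"

text \<open>For \<open>n = 0\<close> all multiplicities vanish, and the coefficient is \<open>1\<close>.\<close>

definition ghost_coeff ::
    "nat \<Rightarrow> nat \<Rightarrow> 'c::{field_char_0,complete_space} set \<Rightarrow> ('c \<Rightarrow> 'f::field) \<Rightarrow>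
     (nat \<Rightarrow> ('c^2^2) set \<Rightarrow> 'c, 'h) module \<Rightarrow> ('f \<times> 'f \<Rightarrow> 'c) \<Rightarrow> nat \<Rightarrow> 'c poly" where
  "ghost_coeff p a E red H \<epsilon> n =
     (\<Prod>k\<in>{k. k \<ge> 2 \<and> [k = k_of p a red \<epsilon>] (mod (p - 1)) \<and> ghost_mult p a E red H \<epsilon> n k \<noteq> 0}.
        [:- w_point p (int k), 1:] ^ ghost_mult p a E red H \<epsilon> n k)"


section \<open>Newton polygons\<close>

text \<open>
  The lower convex hull of the points \<open>(n, v(c n))\<close>, as a function of the abscissa. Points with
  \<open>c n = 0\<close> lie at infinity.
\<close>

definition newton_polygon ::
    "nat \<Rightarrow> (nat \<Rightarrow> 'c::{field_char_0,complete_space}) \<Rightarrow> real \<Rightarrow> ereal" where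
  "newton_polygon p c x =
     Inf (ereal ` {y. (x, y) \<in> convex hull {(real n, real_of_ereal (vp p (c n))) | n. c n \<noteq> 0}})"

text \<open>
  Multiplicity is horizontal length, and the polygon of a series with constant term \<open>1\<close> starts at
  abscissa \<open>0\<close>, so the \<open>n\<close>th slope is that of the segment over \<open>{n - 1..n}\<close>.
\<close>

definition is_newton_slope ::
    "nat \<Rightarrow> (nat \<Rightarrow> 'c::{field_char_0,complete_space}) \<Rightarrow> nat \<Rightarrow> real \<Rightarrow> bool" where
  "is_newton_slope p c n s \<longleftrightarrow> \<bar>newton_polygon p c (real n - 1)\<bar> \<noteq> \<infinity> \<and>
     (\<forall>x\<in>{real n - 1..real n}.
        newton_polygon p c x = newton_polygon p c (real n - 1) + ereal (s * (x - (real n - 1))))"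

end

theory Submission
  imports Defs
begin

text \<open>
  Why the slopes are as claimed. The zeros \<open>w\<^sub>k\<close> of the coefficient \<open>g\<^sub>n\<close> all have valuation at least
  one (\<open>w_point_small\<close>), so at a point \<open>w\<close> with valuation strictly between zero and one each factor
  \<open>w - w\<^sub>k\<close> has the valuation of \<open>w\<close>, and \<open>g\<^sub>n(w)\<close> has valuation \<open>v(w) \<cdot> deg g\<^sub>n\<close> (\<open>av_ghost_coeff\<close>). The
  polygon is therefore that of the points \<open>(n, v(w) \<cdot> deg g\<^sub>n)\<close>, and both claims follow once the
  sequence \<open>deg g\<^sub>n\<close> is known to be strictly convex at every \<open>n \<ge> 1\<close> (\<open>newton_polygon_convex\<close>).

  For one weight the multiplicity is a tent in \<open>n\<close>: it rises with slope one from the unramified rank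
  \<open>u\<close>, turns at half of the Iwahori rank \<open>2 c\<close>, and falls back to zero at \<open>2 c - u\<close>. So the second
  difference of \<open>deg g\<^sub>n\<close> counts the weights with \<open>u = n\<close> and those with \<open>2 c - u = n\<close>, minus twice
  those with \<open>c = n\<close>. As the weight runs through the class of \<open>k\<^sub>\<epsilon>\<close>, the half-rank \<open>c\<close> grows by
  one at each step, so it meets \<open>n\<close> at most once, whereas \<open>u\<close> takes each value \<open>n \<ge> 1\<close> at least three times
  (\<open>tent_sums_convex\<close>, \<open>ghost_degree_convex\<close>).

  What remains is to compute both ranks. Forms reduce modulo the uniformizer to equivariant maps
  from the projective envelope \<open>P\<close> to twisted polynomials over the residue field, for the image of the level
  group in \<open>GL\<^sub>2(F\<^sub>p)\<close>. As the module is projective, every such map lifts: coordinates in a free module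
  over the completed group ring are measures on \<open>K\<^sub>p\<close>, and integrating equivariant polynomial-valued functions
  against them gives forms (\<open>lift_form\<close>). By Nakayama's lemma lifts of a basis form a basis, so the
  rank is the dimension of the space of reduced maps (\<open>free_rank_forms\<close>).

  The dimension of the maps from \<open>P\<close> to a representation is the multiplicity of \<open>Sym\<^sup>a\<close> among its
  constituents; it is additive in exact sequences because \<open>P\<close> is projective. Polynomials of degree below \<open>p\<close> are irreducible, which
  settles \<open>HomP\<close> in these degrees (\<open>has_dim_irreducible\<close>). The representation induced from a character of the Borel
  subgroup is an extension of two of them, of degrees \<open>b\<close> and \<open>p - 1 - b\<close> (\<open>has_dim_character\<close>). Polynomials
  of degree \<open>m \<ge> p\<close> are an extension of an induced representation by the multiples of the invariant form of
  degree \<open>p + 1\<close> (\<open>has_dim_G_step\<close>). This gives explicit counts of residue classes: \<open>c\<close> is the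
  number of \<open>i \<le> k - 2\<close> in one class modulo \<open>p - 1\<close>, and \<open>u\<close> counts thresholds that are reached in
  two arithmetic progressions of difference \<open>p + 1\<close> in the number of the weight, shifted against each
  other by \<open>a + 2\<close>. As \<open>1 \<le> a \<le> p - 4\<close>, any two thresholds are at least three steps apart
  (\<open>ur_count_thresholds\<close>), and this is where the three weights come from.
\<close>

text \<open>The bare names would denote the fields of the records for modules and polynomial rings.\<close>

abbreviation coeff :: "'a::zero poly \<Rightarrow> nat \<Rightarrow> 'a" where "coeff \<equiv> Polynomial.coeff"

abbreviation smult :: "'a::comm_semiring_0 \<Rightarrow> 'a poly \<Rightarrow> 'a poly" where "smult \<equiv> Polynomial.smult"

abbreviation monom :: "'a::zero \<Rightarrow> nat \<Rightarrow> 'a poly" where "monom \<equiv> Polynomial.monom"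

section \<open>The action on polynomials\<close>

lemma slash_add: "slash d g (f + f') = slash d g f + slash d g f'"
  by (simp add: slash_def smult_add_left sum.distrib)

lemma smult_sum_right: "smult c (\<Sum>x\<in>S. f x) = (\<Sum>x\<in>S. smult c (f x))"
  by (induction S rule: infinite_finite_induct) (simp_all add: smult_add_right)

lemma slash_smult: "slash d g (smult c f) = smult c (slash d g f)"
  by (simp add: slash_def smult_sum_right)

lemma slash_0 [simp]: "slash d g 0 = 0"
  by (simp add: slash_def)

lemma slash_sum: "slash d g (\<Sum>x\<in>S. f x) = (\<Sum>x\<in>S. slash d g (f x))"
  by (induction S rule: infinite_finite_induct) (simp_all add: slash_add)

lemma coeff_slash:
  "coeff (slash d g f) k = (\<Sum>i\<le>d. coeff f i *
     coeff ([:g $ 1 $ 2, g $ 1 $ 1:] ^ i * [:g $ 2 $ 2, g $ 2 $ 1:] ^ (d - i)) k)"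
  by (simp add: slash_def coeff_sum)

lemma degree_linear_power_le: "degree ([:x, y:] ^ i :: 'a::comm_ring_1 poly) \<le> i"
proof -
  have "degree ([:x, y:] ^ i) \<le> degree [:x, y:] * i"
    by (rule degree_power_le)
  also have "\<dots> \<le> 1 * i"
    by (intro mult_right_mono) auto
  finally show ?thesis by simp
qed

lemma degree_linear_powers_le:
  "degree ([:x, y:] ^ i * [:x', y':] ^ j :: 'a::comm_ring_1 poly) \<le> i + j"
  by (meson add_mono degree_linear_power_le degree_mult_le order_trans)

lemma degree_slash: "degree (slash d g f) \<le> d"
  unfolding slash_def
proof (intro degree_sum_le)
  fix i assume "i \<in> {..d}"
  then show "degree (smult (coeff f i)
      ([:g $ 1 $ 2, g $ 1 $ 1:] ^ i * [:g $ 2 $ 2, g $ 2 $ 1:] ^ (d - i))) \<le> d"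
    using degree_linear_powers_le[of "g $ 1 $ 2" "g $ 1 $ 1" i "g $ 2 $ 2" "g $ 2 $ 1" "d - i"]
    by (auto intro: order_trans[OF degree_smult_le])
qed auto

lemma slash_monom:
  assumes "i \<le> d"
  shows "slash d g (monom c i) =
    smult c ([:g $ 1 $ 2, g $ 1 $ 1:] ^ i * [:g $ 2 $ 2, g $ 2 $ 1:] ^ (d - i))"
proof -
  have "slash d g (monom c i) = (\<Sum>j\<le>d. if j = i then
     smult c ([:g $ 1 $ 2, g $ 1 $ 1:] ^ i * [:g $ 2 $ 2, g $ 2 $ 1:] ^ (d - i)) else 0)"
    unfolding slash_def by (intro sum.cong) auto
  with assms show ?thesis by simp
qed

text \<open>
  In homogeneous coordinates \<open>slash d g\<close> is the substitution of linear forms, and the degree \<open>d\<close> only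
  records the power of the second coordinate; hence it is multiplicative.
\<close>

lemma slash_mult:
  assumes "degree f \<le> d" "degree f' \<le> e"
  shows "slash (d + e) g (f * f') = slash d g f * slash e g f'"
proof -
  have mono: "slash (d + e) g (monom c i * monom c' j) = slash d g (monom c i) * slash e g (monom c' j)"
    if "i \<le> d" "j \<le> e" for i j c c'
  proof -
    have *: "(d + e) - (i + j) = (d - i) + (e - j)" and "i + j \<le> d + e" using that by auto
    then show ?thesis
      using that unfolding mult_monom
      by (subst (1 2 3) slash_monom) (simp_all only: * power_add mult_ac mult_smult_left mult_smult_right smult_smult)
  qed
  have "f * f' = (\<Sum>i\<le>d. \<Sum>j\<le>e. monom (coeff f i) i * monom (coeff f' j) j)"
    unfolding sum_product[symmetric] using assms by (simp add: poly_as_sum_of_monoms')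
  then have "slash (d + e) g (f * f') =
    (\<Sum>i\<le>d. \<Sum>j\<le>e. slash d g (monom (coeff f i) i) * slash e g (monom (coeff f' j) j))"
    by (simp add: slash_sum mono)
  also have "\<dots> = slash d g (\<Sum>i\<le>d. monom (coeff f i) i) *
      slash e g (\<Sum>i\<le>e. monom (coeff f' i) i)"
    by (simp add: slash_sum sum_product)
  finally show ?thesis using assms by (simp add: poly_as_sum_of_monoms')
qed

lemma slash_power:
  assumes "degree f \<le> d"
  shows "slash (d * n) g (f ^ n) = slash d g f ^ n"
proof (induction n)
  case 0
  show ?case by (simp add: slash_def)
next
  case (Suc n)
  have "degree (f ^ n) \<le> d * n"
    using degree_power_le[of f n] assms by (meson mult_le_mono1 order_trans)
  then show ?case using slash_mult[OF assms, of "f ^ n" "d * n" g] Suc by simp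
qed

lemma matrix2_mult_entry:
  "((g :: 'a::comm_ring_1^2^2) ** h) $ i $ j = g $ i $ 1 * h $ 1 $ j + g $ i $ 2 * h $ 2 $ j"
  by (simp add: matrix_matrix_mult_def sum_2)

lemma slash_linear:
  "slash 1 h [:x, y:] = [:x * h $ 2 $ 2 + y * h $ 1 $ 2, x * h $ 2 $ 1 + y * h $ 1 $ 1:]"
  by (simp add: slash_def atMost_Suc)

lemma slash_compose:
  assumes "degree f \<le> d"
  shows "slash d (g ** h) f = slash d h (slash d g f)"
proof -
  have mono: "slash d (g ** h) (monom c i) = slash d h (slash d g (monom c i))" if "i \<le> d" for c i
  proof -
    let ?A = "[:g $ 1 $ 2, g $ 1 $ 1:]" and ?B = "[:g $ 2 $ 2, g $ 2 $ 1:]"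
    have "slash d h (?A ^ i * ?B ^ (d - i)) = slash i h (?A ^ i) * slash (d - i) h (?B ^ (d - i))"
      using slash_mult[of "?A ^ i" i "?B ^ (d - i)" "d - i" h] that by (simp add: degree_linear_power_le)
    also have "\<dots> = slash 1 h ?A ^ i * slash 1 h ?B ^ (d - i)"
      using slash_power[of ?A 1 i h] slash_power[of ?B 1 "d - i" h] by simp
    also have "\<dots> = [:(g ** h) $ 1 $ 2, (g ** h) $ 1 $ 1:] ^ i * [:(g ** h) $ 2 $ 2, (g ** h) $ 2 $ 1:] ^ (d - i)"
      unfolding slash_linear by (simp add: matrix2_mult_entry algebra_simps)
    finally show ?thesis using that by (simp add: slash_monom slash_smult)
  qed
  have "f = (\<Sum>i\<le>d. monom (coeff f i) i)"
    using assms by (simp add: poly_as_sum_of_monoms')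
  then have "slash d (g ** h) f = (\<Sum>i\<le>d. slash d (g ** h) (monom (coeff f i) i))"
    by (metis slash_sum)
  also have "\<dots> = slash d h (slash d g (\<Sum>i\<le>d. monom (coeff f i) i))"
    by (simp add: slash_sum mono)
  finally show ?thesis using assms by (simp add: poly_as_sum_of_monoms')
qed

lemma slash_mat_1:
  assumes "degree f \<le> d"
  shows "slash d (mat 1) f = f"
proof -
  have one: "[:1:] ^ n = (1 :: 'a poly)" for n
    by (metis one_pCons power_one)
  have "slash d (mat 1) f = (\<Sum>i\<le>d. monom (coeff f i) i)"
    by (simp add: slash_def mat_def monom_altdef one)
  with assms show ?thesis by (simp add: poly_as_sum_of_monoms')
qed

lemma slash_raise_degree:
  assumes "degree f \<le> d"
  shows "slash (Suc d) g f = slash d g f * [:g $ 2 $ 2, g $ 2 $ 1:]"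
  using slash_mult[OF assms, of 1 1 g] by (simp add: slash_def)

lemma coeff_linear_powers_top:
  "coeff ([:x, y:] ^ i * [:x', y':] ^ j :: 'a::comm_ring_1 poly) (i + j) = y ^ i * y' ^ j"
proof -
  have *: "coeff ([:x, y:] ^ i :: 'a poly) i = y ^ i" for x y i
  proof (induction i)
    case (Suc i)
    have "coeff ([:x, y:] ^ i) (Suc i) = 0"
      using degree_linear_power_le[of x y i] by (intro coeff_eq_0) simp
    with Suc show ?case by simp
  qed auto
  have "coeff ([:x, y:] ^ i * [:x', y':] ^ j) (i + j) =
      (\<Sum>k\<le>i + j. if k = i then y ^ i * y' ^ j else 0)"
    unfolding coeff_mult
  proof (intro sum.cong refl)
    fix k assume "k \<in> {..i + j}"
    consider "k < i" | "k = i" | "k > i" by linarith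
    then show "coeff ([:x, y:] ^ i) k * coeff ([:x', y':] ^ j) (i + j - k) =
        (if k = i then y ^ i * y' ^ j else 0)"
    proof cases
      case 1
      then have "coeff ([:x', y':] ^ j) (i + j - k) = 0"
        using degree_linear_power_le[of x' y' j] by (intro coeff_eq_0) linarith
      with 1 show ?thesis by simp
    next
      case 3
      then have "coeff ([:x, y:] ^ i) k = 0"
        using degree_linear_power_le[of x y i] by (intro coeff_eq_0) linarith
      with 3 show ?thesis by simp
    qed (simp add: *)
  qed
  then show ?thesis by simp
qed

lemma coeff_slash_top:
  "coeff (slash d g f) d = (\<Sum>i\<le>d. coeff f i * (g $ 1 $ 1 ^ i * g $ 2 $ 1 ^ (d - i)))"
  unfolding coeff_slash
proof (intro sum.cong refl)
  fix i assume "i \<in> {..d}"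
  then show "coeff f i * coeff ([:g $ 1 $ 2, g $ 1 $ 1:] ^ i * [:g $ 2 $ 2, g $ 2 $ 1:] ^ (d - i)) d =
    coeff f i * (g $ 1 $ 1 ^ i * g $ 2 $ 1 ^ (d - i))"
    using coeff_linear_powers_top[of "g $ 1 $ 2" "g $ 1 $ 1" i "g $ 2 $ 2" "g $ 2 $ 1" "d - i"] by simp
qed

text \<open>At the columns \<open>(t, 1)\<close> and \<open>(1, 0)\<close> the top coefficient is the value at \<open>t\<close> and the value at infinity.\<close>

lemma coeff_slash_top_affine:
  assumes "degree f \<le> d" "g $ 2 $ 1 = 1"
  shows "coeff (slash d g f) d = poly f (g $ 1 $ 1)"
proof -
  have "poly f (g $ 1 $ 1) = poly (\<Sum>i\<le>d. monom (coeff f i) i) (g $ 1 $ 1)"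
    using assms by (simp add: poly_as_sum_of_monoms')
  then show ?thesis using assms by (simp add: coeff_slash_top poly_sum poly_monom)
qed

lemma coeff_slash_top_upper:
  assumes "g $ 2 $ 1 = 0"
  shows "coeff (slash d g f) d = coeff f d * g $ 1 $ 1 ^ d"
proof -
  have "coeff (slash d g f) d =
      (\<Sum>i\<le>d. if i = d then coeff f d * g $ 1 $ 1 ^ d else 0)"
    unfolding coeff_slash_top using assms by (intro sum.cong refl) (auto simp: power_0_left)
  then show ?thesis by simp
qed

section \<open>Dimensions of spaces of polynomial-valued functions\<close>

text \<open>
  The vector spaces below consist of polynomial-valued functions. For such a space this predicate
  names its dimension by exhibiting a basis.
\<close>

definition fun_basis :: "('q \<Rightarrow> 'f::field poly) set \<Rightarrow> nat \<Rightarrow> (nat \<Rightarrow> 'q \<Rightarrow> 'f poly) \<Rightarrow> bool" where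
  "fun_basis S d b \<longleftrightarrow> (\<forall>i<d. b i \<in> S) \<and>
     (\<forall>f\<in>S. \<exists>c. f = (\<lambda>x. \<Sum>i<d. smult (c i) (b i x))) \<and>
     (\<forall>c. (\<lambda>x. \<Sum>i<d. smult (c i) (b i x)) = (\<lambda>_. 0) \<longrightarrow> (\<forall>i<d. c i = 0))"

definition has_dim :: "('q \<Rightarrow> 'f::field poly) set \<Rightarrow> nat \<Rightarrow> bool" where
  "has_dim S d \<longleftrightarrow> (\<exists>b. fun_basis S d b)"

lemma fun_basisD:
  assumes "fun_basis S d b"
  shows "\<And>i. i < d \<Longrightarrow> b i \<in> S"
    and "\<And>f. f \<in> S \<Longrightarrow> \<exists>c. f = (\<lambda>x. \<Sum>i<d. smult (c i) (b i x))"
    and "\<And>c. (\<lambda>x. \<Sum>i<d. smult (c i) (b i x)) = (\<lambda>_. 0) \<Longrightarrow> \<forall>i<d. c i = 0"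
  using assms unfolding fun_basis_def by simp_all

definition fun_subspace :: "('q \<Rightarrow> 'f::field poly) set \<Rightarrow> bool" where
  "fun_subspace S \<longleftrightarrow> (\<lambda>_. 0) \<in> S \<and>
     (\<forall>f\<in>S. \<forall>h\<in>S. (\<lambda>x. f x + h x) \<in> S) \<and> (\<forall>c. \<forall>f\<in>S. (\<lambda>x. smult c (f x)) \<in> S)"

definition linear_on_fun ::
    "('q \<Rightarrow> 'f::field poly) set \<Rightarrow> (('q \<Rightarrow> 'f poly) \<Rightarrow> 'r \<Rightarrow> 'f poly) \<Rightarrow> bool" where
  "linear_on_fun S T \<longleftrightarrow>
     (\<forall>f\<in>S. \<forall>h\<in>S. T (\<lambda>x. f x + h x) = (\<lambda>x. T f x + T h x)) \<and>
     (\<forall>c. \<forall>f\<in>S. T (\<lambda>x. smult c (f x)) = (\<lambda>x. smult c (T f x)))"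

lemma fun_subspaceD:
  assumes "fun_subspace S"
  shows "(\<lambda>_. 0) \<in> S"
    and "f \<in> S \<Longrightarrow> h \<in> S \<Longrightarrow> (\<lambda>x. f x + h x) \<in> S"
    and "f \<in> S \<Longrightarrow> (\<lambda>x. smult c (f x)) \<in> S"
  using assms by (simp_all add: fun_subspace_def)

lemma linear_on_funD:
  assumes "linear_on_fun S T"
  shows "f \<in> S \<Longrightarrow> h \<in> S \<Longrightarrow> T (\<lambda>x. f x + h x) = (\<lambda>x. T f x + T h x)"
    and "f \<in> S \<Longrightarrow> T (\<lambda>x. smult c (f x)) = (\<lambda>x. smult c (T f x))"
  using assms by (simp_all add: linear_on_fun_def)

lemma fun_subspace_combination:
  assumes "fun_subspace S" "\<And>i. i < (n::nat) \<Longrightarrow> b i \<in> S"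
  shows "(\<lambda>x. \<Sum>i<n. smult (c i) (b i x)) \<in> S"
  using assms(2)
proof (induction n)
  case 0
  then show ?case using assms(1) by (simp add: fun_subspace_def)
next
  case (Suc n)
  then show ?case using assms(1) by (simp add: fun_subspace_def)
qed

lemma linear_on_fun_combination:
  assumes "fun_subspace S" "linear_on_fun S T" "\<And>i. i < (n::nat) \<Longrightarrow> b i \<in> S"
  shows "T (\<lambda>x. \<Sum>i<n. smult (c i) (b i x)) = (\<lambda>x. \<Sum>i<n. smult (c i) (T (b i) x))"
  using assms(3)
proof (induction n)
  case 0
  have "(\<lambda>_. 0) \<in> S" using assms(1) by (simp add: fun_subspace_def)
  then have "\<And>c. T (\<lambda>x. smult c ((\<lambda>_. 0) x)) = (\<lambda>x. smult c (T (\<lambda>_. 0) x))"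
    using assms(2) unfolding linear_on_fun_def by (elim conjE) (drule spec, erule bspec)
  from this[of 0] have "T (\<lambda>x. smult 0 0) = (\<lambda>x. smult 0 (T (\<lambda>_. 0) x))" .
  then show ?case by simp
next
  case (Suc n)
  have "(\<lambda>x. \<Sum>i<n. smult (c i) (b i x)) \<in> S"
    using fun_subspace_combination[OF assms(1)] Suc.prems by simp
  moreover have "(\<lambda>x. smult (c n) (b n x)) \<in> S"
    using Suc.prems assms(1) by (simp add: fun_subspace_def)
  ultimately show ?case
    using Suc assms(2) unfolding linear_on_fun_def by simp
qed

text \<open>
  Dimensions add along a short exact sequence \<open>0 \<rightarrow> S1 \<rightarrow> S \<rightarrow> S2 \<rightarrow> 0\<close> with maps \<open>J\<close> and \<open>T\<close>: the images
  of a basis of \<open>S1\<close> together with preimages of a basis of \<open>S2\<close> form a basis of \<open>S\<close>.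
\<close>

lemma has_dim_exact:
  fixes S :: "('q \<Rightarrow> 'f::field poly) set" and S1 :: "('r \<Rightarrow> 'f poly) set" and S2 :: "('s \<Rightarrow> 'f poly) set"
  assumes S: "fun_subspace S" and S1: "fun_subspace S1" 
    and T: "linear_on_fun S T" "\<And>f. f \<in> S \<Longrightarrow> T f \<in> S2" "\<And>h. h \<in> S2 \<Longrightarrow> \<exists>f\<in>S. T f = h"
    and J: "linear_on_fun S1 J" "\<And>f. f \<in> S1 \<Longrightarrow> J f \<in> S" "\<And>f. f \<in> S1 \<Longrightarrow> J f = (\<lambda>_. 0) \<Longrightarrow> f = (\<lambda>_. 0)"
    and ker: "\<And>f. f \<in> S1 \<Longrightarrow> T (J f) = (\<lambda>_. 0)" "\<And>f. f \<in> S \<Longrightarrow> T f = (\<lambda>_. 0) \<Longrightarrow> \<exists>h\<in>S1. J h = f"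
    and d: "has_dim S1 d1" "has_dim S2 d2"
  shows "has_dim S (d1 + d2)"
proof -
  from d obtain b1 b2 where B: "fun_basis S1 d1 b1" "fun_basis S2 d2 b2"
    unfolding has_dim_def by blast
  note b1 = fun_basisD[OF B(1)] and b2 = fun_basisD[OF B(2)]
  define t where "t i = (SOME f. f \<in> S \<and> T f = b2 i)" for i
  have tt: "t i \<in> S \<and> T (t i) = b2 i" if "i < d2" for i
  proof -
    have "\<exists>f. f \<in> S \<and> T f = b2 i"
      using T(3)[OF b2(1)[OF that]] unfolding Bex_def .
    then show ?thesis unfolding t_def by (rule someI_ex)
  qed
  then have t: "\<And>i. i < d2 \<Longrightarrow> t i \<in> S" "\<And>i. i < d2 \<Longrightarrow> T (t i) = b2 i"
    by simp_all
  define b where "b i = (if i < d1 then J (b1 i) else t (i - d1))" for i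
  have sum_split: "(\<Sum>i<d1 + d2. smult (c i) (b i x)) =
     (\<Sum>i<d1. smult (c i) (J (b1 i) x)) + (\<Sum>i<d2. smult (c (d1 + i)) (t i x))" for c x
  proof -
    have "{..<d1 + d2} = {..<d1} \<union> (+) d1 ` {..<d2}"
      by (simp add: lessThan_atLeast0 image_add_atLeastLessThan ivl_disj_un add.commute)
    then have "(\<Sum>i<d1 + d2. smult (c i) (b i x)) =
       (\<Sum>i<d1. smult (c i) (b i x)) + (\<Sum>i\<in>(+) d1 ` {..<d2}. smult (c i) (b i x))"
      by (simp only:) (rule sum.union_disjoint, auto)
    then show ?thesis by (simp add: sum.reindex b_def)
  qed
  have Jc: "J (\<lambda>x. \<Sum>i<d1. smult (c i) (b1 i x)) = (\<lambda>x. \<Sum>i<d1. smult (c i) (J (b1 i) x))" for c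
    by (rule linear_on_fun_combination[OF S1 J(1)]) (rule b1)
  have Tc: "T (\<lambda>x. \<Sum>i<d2. smult (c i) (t i x)) = (\<lambda>x. \<Sum>i<d2. smult (c i) (b2 i x))" for c
    using linear_on_fun_combination[OF S T(1), of d2 t c] t by simp
  have JS: "(\<lambda>x. \<Sum>i<d1. smult (c i) (J (b1 i) x)) \<in> S" for c
    by (rule fun_subspace_combination[OF S]) (auto intro: b1 J)
  have tS: "(\<lambda>x. \<Sum>i<d2. smult (c i) (t i x)) \<in> S" for c
    by (rule fun_subspace_combination[OF S]) (auto intro: t)
  have "b i \<in> S" if "i < d1 + d2" for i
    using that by (auto simp: b_def intro: b1 J t)
  moreover have "\<exists>c. f = (\<lambda>x. \<Sum>i<d1 + d2. smult (c i) (b i x))" if f: "f \<in> S" for f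
  proof -
    from b2(2)[OF T(2)[OF f]] obtain c2 where c2: "T f = (\<lambda>x. \<Sum>i<d2. smult (c2 i) (b2 i x))"
      by (rule exE)
    define h where "h = (\<lambda>x. f x + smult (-1) (\<Sum>i<d2. smult (c2 i) (t i x)))"
    have m: "(\<lambda>x. smult (-1) (\<Sum>i<d2. smult (c2 i) (t i x))) \<in> S"
      by (rule fun_subspaceD(3)[OF S tS])
    have hS: "h \<in> S" unfolding h_def by (rule fun_subspaceD(2)[OF S f m])
    have "T h = (\<lambda>x. T f x + T (\<lambda>x. smult (-1) (\<Sum>i<d2. smult (c2 i) (t i x))) x)"
      unfolding h_def by (rule linear_on_funD(1)[OF T(1) f m])
    also have "T (\<lambda>x. smult (-1) (\<Sum>i<d2. smult (c2 i) (t i x))) =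
        (\<lambda>x. smult (-1) (T (\<lambda>x. \<Sum>i<d2. smult (c2 i) (t i x)) x))"
      by (rule linear_on_funD(2)[OF T(1) tS])
    finally have "T h = (\<lambda>_. 0)" by (simp add: Tc c2)
    from ker(2)[OF hS this] obtain k where k: "k \<in> S1" "J k = h" by (rule bexE)
    from b1(2)[OF k(1)] obtain c1 where c1: "k = (\<lambda>x. \<Sum>i<d1. smult (c1 i) (b1 i x))" by (rule exE)
    have "f x = (\<Sum>i<d1 + d2. smult ((\<lambda>i. if i < d1 then c1 i else c2 (i - d1)) i) (b i x))" for x
    proof -
      have "h x = (\<Sum>i<d1. smult (c1 i) (J (b1 i) x))"
        using fun_cong[OF Jc, of c1 x] unfolding c1[symmetric] k(2) .
      then show ?thesis unfolding sum_split by (simp add: h_def algebra_simps)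
    qed
    then show ?thesis by (intro exI ext)
  qed
  moreover have "\<forall>i<d1 + d2. c i = 0"
    if z: "(\<lambda>x. \<Sum>i<d1 + d2. smult (c i) (b i x)) = (\<lambda>_. 0)" for c
  proof -
    let ?u = "\<lambda>x. \<Sum>i<d1. smult (c i) (J (b1 i) x)"
    let ?v = "\<lambda>x. \<Sum>i<d2. smult (c (d1 + i)) (t i x)"
    have z': "(\<lambda>x. ?u x + ?v x) = (\<lambda>_. 0)" using z unfolding sum_split .
    have z0: "T (\<lambda>_. 0) = (\<lambda>_. 0)" using linear_on_fun_combination[OF S T(1), of 0] by simp
    have "T (\<lambda>x. ?u x + ?v x) = (\<lambda>x. T ?u x + T ?v x)"
      by (rule linear_on_funD(1)[OF T(1) JS tS])
    moreover have "T ?u = (\<lambda>_. 0)"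
      using ker(1)[OF fun_subspace_combination[OF S1, of d1 b1 c]] b1(1) by (simp add: Jc)
    ultimately have "(\<lambda>x. \<Sum>i<d2. smult (c (d1 + i)) (b2 i x)) = (\<lambda>_. 0)"
      unfolding z' z0 Tc by (simp add: fun_eq_iff)
    then have c2: "\<forall>i<d2. c (d1 + i) = 0" by (rule b2(3))
    then have "?v = (\<lambda>_. 0)" by simp
    with z' have "?u = (\<lambda>_. 0)" by (simp add: fun_eq_iff)
    then have "(\<lambda>x. \<Sum>i<d1. smult (c i) (b1 i x)) = (\<lambda>_. 0)"
      using J(3)[OF fun_subspace_combination[OF S1, of d1 b1 c]] b1(1) by (simp add: Jc)
    then have "\<forall>i<d1. c i = 0" by (rule b1(3))
    with c2 show ?thesis by (metis add_diff_inverse_nat nat_add_left_cancel_less)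
  qed
  ultimately show ?thesis unfolding has_dim_def fun_basis_def by (intro exI[of _ b]) simp
qed

lemma has_dim_zero: "has_dim {\<lambda>_. 0} 0"
  by (auto simp: has_dim_def fun_basis_def)

lemma has_dim_line:
  assumes "fun_subspace S" "f \<in> S" "f \<noteq> (\<lambda>_. 0)" "\<And>h. h \<in> S \<Longrightarrow> \<exists>c. h = (\<lambda>x. smult c (f x))"
  shows "has_dim S 1"
proof -
  from assms(3) obtain x0 where "f x0 \<noteq> 0" by fastforce
  then have "c = 0" if "(\<lambda>x. smult c (f x)) = (\<lambda>_. 0)" for c
    using fun_cong[OF that, of x0] by simp
  then show ?thesis
    unfolding has_dim_def fun_basis_def using assms(2,4)
    by (intro exI[of _ "\<lambda>_. f"]) (auto, metis)
qed

section \<open>The prime field\<close>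

locale char_p =
  fixes p :: nat and ty :: "'f::field itself"
  assumes prime_p: "prime p" and char_p: "of_nat p = (0 :: 'f)"
begin

lemma CHAR_eq: "CHAR('f) = p"
proof -
  have d: "CHAR('f) dvd p" using char_p by (simp add: of_nat_eq_0_iff_char_dvd)
  have "CHAR('f) \<noteq> 1" by simp
  with d prime_p show ?thesis by (meson prime_nat_iff)
qed

lemma p_gt_1: "p > 1"
  using prime_p by (rule prime_gt_1_nat)

lemma of_nat_eq_0_iff_p: "of_nat n = (0 :: 'f) \<longleftrightarrow> p dvd n"
  by (simp add: of_nat_eq_0_iff_char_dvd CHAR_eq)

lemma of_int_eq_0_iff_p: "of_int n = (0 :: 'f) \<longleftrightarrow> int p dvd n"
proof (cases "n \<ge> 0")
  case True
  then obtain m where "n = int m" using nonneg_int_cases by blast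
  then show ?thesis by (simp add: of_nat_eq_0_iff_p)
next
  case False
  then obtain m where "n = - int m" by (metis int_cases2 linorder_not_le nat_int of_nat_0_le_iff)
  then show ?thesis by (simp add: of_nat_eq_0_iff_p)
qed

lemma Fp_eq: "(Fp :: 'f set) = of_nat ` {..<p}"
proof
  show "(Fp :: 'f set) \<subseteq> of_nat ` {..<p}"
  proof
    fix x :: 'f assume "x \<in> Fp"
    then obtain n where n: "x = of_int n" unfolding Fp_def by auto
    have "(of_int n :: 'f) - of_int (n mod int p) = of_int (n - n mod int p)" by simp
    also have "\<dots> = 0" unfolding of_int_eq_0_iff_p by simp
    finally have "x = of_nat (nat (n mod int p))"
      using n p_gt_1 by simp
    moreover have "nat (n mod int p) < p" using p_gt_1 by (simp add: nat_less_iff)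
    ultimately show "x \<in> of_nat ` {..<p}" by blast
  qed
  show "of_nat ` {..<p} \<subseteq> (Fp :: 'f set)"
    unfolding Fp_def by (rule image_subsetI) (metis of_int_of_nat_eq rangeI)
qed

lemma finite_Fp [simp]: "finite (Fp :: 'f set)"
  unfolding Fp_eq by simp

lemma card_Fp: "card (Fp :: 'f set) = p"
proof -
  have inj: "inj_on (of_nat :: nat \<Rightarrow> 'f) {..<p}"
  proof (rule inj_onI)
    have *: "m = n" if "m \<le> n" "n < p" "(of_nat m :: 'f) = of_nat n" for m n
    proof -
      have "of_nat (n - m) = (0 :: 'f)" using that by (simp add: of_nat_diff)
      then have "p dvd n - m" by (simp add: of_nat_eq_0_iff_p)
      have "n - m = 0"
      proof (rule ccontr)
        assume "n - m \<noteq> 0"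
        with \<open>p dvd n - m\<close> have "p \<le> n - m" by (simp add: dvd_imp_le)
        with that(2) show False by simp
      qed
      with that(1) show ?thesis by simp
    qed
    fix m n assume mn: "m \<in> {..<p}" "n \<in> {..<p}" "(of_nat m :: 'f) = of_nat n"
    show "m = n"
    proof (cases "m \<le> n")
      case True
      then show ?thesis by (rule *) (use mn in simp, rule mn)
    next
      case False
      then have "n = m" by (intro *) (simp, use mn in simp, rule mn(3)[symmetric])
      then show ?thesis ..
    qed
  qed
  show ?thesis unfolding Fp_eq by (simp add: card_image[OF inj])
qed

lemma Fp_of_int [simp]: "(of_int n :: 'f) \<in> Fp"
  unfolding Fp_def by (rule rangeI)

lemma Fp_of_nat [simp]: "(of_nat k :: 'f) \<in> Fp"
  using Fp_of_int[of "int k"] by (simp del: Fp_of_int)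

lemma Fp_0 [simp]: "(0 :: 'f) \<in> Fp" and Fp_1 [simp]: "(1 :: 'f) \<in> Fp"
  using Fp_of_nat[of 0] Fp_of_nat[of 1] by (simp_all del: Fp_of_nat)

lemma Fp_cases:
  assumes "(x :: 'f) \<in> Fp"
  obtains n where "x = of_int n"
  using assms unfolding Fp_def by (elim imageE)

lemma Fp_add [simp]: "(x :: 'f) \<in> Fp \<Longrightarrow> y \<in> Fp \<Longrightarrow> x + y \<in> Fp"
  by (elim Fp_cases) (metis Fp_of_int(1) of_int_add)

lemma Fp_mult [simp]: "(x :: 'f) \<in> Fp \<Longrightarrow> y \<in> Fp \<Longrightarrow> x * y \<in> Fp"
  by (elim Fp_cases) (metis Fp_of_int(1) of_int_mult)

lemma Fp_minus [simp]: "(x :: 'f) \<in> Fp \<Longrightarrow> - x \<in> Fp"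
  by (elim Fp_cases) (metis Fp_of_int(1) of_int_minus)

lemma Fp_diff [simp]: "(x :: 'f) \<in> Fp \<Longrightarrow> y \<in> Fp \<Longrightarrow> x - y \<in> Fp"
  by (elim Fp_cases) (metis Fp_of_int(1) of_int_diff)

lemma Fp_power [simp]: "(x :: 'f) \<in> Fp \<Longrightarrow> x ^ n \<in> Fp"
  by (induction n) auto

lemma frobenius_add: "(x + y) ^ p = x ^ p + (y :: 'f) ^ p"
  by (rule freshmans_dream) (simp_all add: CHAR_eq prime_p)

lemma frobenius_poly: "(x + y) ^ p = x ^ p + (y :: 'f poly) ^ p"
  by (rule freshmans_dream) (simp_all add: CHAR_eq prime_p)

lemma Fp_power_p: "(x :: 'f) \<in> Fp \<Longrightarrow> x ^ p = x"
proof -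
  have "of_nat n ^ p = (of_nat n :: 'f)" for n
  proof (induction n)
    case 0
    show ?case using p_gt_1 by simp
  next
    case (Suc n)
    have "of_nat (Suc n) ^ p = (1 + of_nat n :: 'f) ^ p" by simp
    also have "\<dots> = 1 ^ p + of_nat n ^ p" by (rule frobenius_add)
    finally show ?case by (simp add: Suc)
  qed
  then show "x \<in> Fp \<Longrightarrow> x ^ p = x" unfolding Fp_eq by auto
qed

lemma Fp_power_p_minus_1: "(x :: 'f) \<in> Fp \<Longrightarrow> x \<noteq> 0 \<Longrightarrow> x ^ (p - 1) = 1"
proof -
  assume "x \<in> Fp" "x \<noteq> 0"
  moreover have "x ^ p = x * x ^ (p - 1)" using p_gt_1 by (simp add: power_eq_if)
  ultimately show ?thesis using Fp_power_p[of x] by simp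
qed

lemma Fp_inverse [simp]: "(x :: 'f) \<in> Fp \<Longrightarrow> inverse x \<in> Fp"
proof (cases "x = 0")
  case False
  assume x: "x \<in> Fp"
  have "x * x ^ (p - 2) = x ^ (p - 1)"
  proof -
    have "p - 1 = Suc (p - 2)" using p_gt_1 by simp
    then show ?thesis by simp
  qed
  then have "x * x ^ (p - 2) = 1"
    using Fp_power_p_minus_1[OF x False] by simp
  then have "inverse x = x ^ (p - 2)" by (rule inverse_unique)
  then show ?thesis using x by simp
qed auto

lemma Fp_divide [simp]: "(x :: 'f) \<in> Fp \<Longrightarrow> y \<in> Fp \<Longrightarrow> x / y \<in> Fp"
  by (simp add: divide_inverse)

lemma power_mod_exponent:
  assumes "(x :: 'f) \<in> Fp" "x \<noteq> 0" "[i = j] (mod (p - 1))"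
  shows "x ^ i = x ^ j"
proof -
  have "x ^ i = x ^ (i mod (p - 1))" for i
  proof -
    have "x ^ i = x ^ ((p - 1) * (i div (p - 1)) + i mod (p - 1))" by simp
    also have "\<dots> = x ^ (i mod (p - 1))"
      unfolding power_add power_mult Fp_power_p_minus_1[OF assms(1,2)] by simp
    finally show ?thesis .
  qed
  from this[of i] this[of j] assms(3) show ?thesis by (simp add: cong_def)
qed

text \<open>
  Otherwise the remainder \<open>r\<close> of \<open>j\<close> would give a polynomial \<open>z ^ r - 1\<close> with more than \<open>r\<close> roots.
\<close>

lemma exponent_dvd:
  assumes "\<And>x :: 'f. x \<in> Fp \<Longrightarrow> x \<noteq> 0 \<Longrightarrow> x ^ j = 1"
  shows "(p - 1) dvd j"
proof (rule ccontr)
  assume n: "\<not> (p - 1) dvd j"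
  define r where "r = j mod (p - 1)"
  have r: "0 < r" "r < p - 1" using n p_gt_1 by (auto simp: r_def mod_greater_zero_iff_not_dvd)
  let ?f = "monom 1 r - 1 :: 'f poly"
  have deg: "degree ?f \<le> r" by (intro degree_diff_le) (auto simp: degree_monom_le)
  have "coeff ?f r \<noteq> 0" using r by simp
  then have nz: "?f \<noteq> 0" by (metis coeff_0)
  have "Fp - {0} \<subseteq> {x. poly ?f x = 0}"
  proof
    fix x :: 'f assume x: "x \<in> Fp - {0}"
    have "x ^ r = x ^ j" using x by (intro power_mod_exponent) (auto simp: r_def cong_def)
    with x assms show "x \<in> {x. poly ?f x = 0}" by (simp add: poly_monom)
  qed
  then have "card (Fp - {0 :: 'f}) \<le> card {x. poly ?f x = 0}"
    using nz by (intro card_mono poly_roots_finite)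
  also have "\<dots> \<le> degree ?f" using nz by (rule card_poly_roots_bound)
  finally have "p - 1 \<le> r" using deg by (simp add: card_Fp)
  with r show False by simp
qed

lemma vanishing_on_Fp:
  assumes "degree f < p" "\<And>t :: 'f. t \<in> Fp \<Longrightarrow> poly f t = 0"
  shows "f = 0"
proof (rule ccontr)
  assume nz: "f \<noteq> 0"
  have "card (Fp :: 'f set) \<le> card {x. poly f x = 0}"
    using nz assms(2) by (intro card_mono poly_roots_finite) auto
  also have "\<dots> \<le> degree f" using nz by (rule card_poly_roots_bound)
  finally show False using assms(1) by (simp add: card_Fp)
qed

text \<open>The values of \<open>\<Sum>t\<in>Fp. t ^ e\<close> are what makes interpolation on the projective line over \<open>Fp\<close> explicit.\<close>

lemma sum_powers_Fp:
  "(\<Sum>t\<in>Fp. (t :: 'f) ^ e) = (if e > 0 \<and> (p - 1) dvd e then -1 else 0)"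
proof (cases "e = 0")
  case True
  then show ?thesis by (simp add: card_Fp char_p)
next
  case e: False
  show ?thesis
  proof (cases "(p - 1) dvd e")
    case True
    have "(\<Sum>t\<in>Fp. (t :: 'f) ^ e) = (\<Sum>t\<in>(Fp :: 'f set). if t = 0 then 0 else 1)"
    proof (intro sum.cong refl)
      fix t :: 'f assume "t \<in> Fp"
      then show "t ^ e = (if t = 0 then 0 else 1)"
        using power_mod_exponent[of t e 0] True e by (auto simp: cong_def power_0_left)
    qed
    also have "\<dots> = (\<Sum>t\<in>Fp - {0 :: 'f}. 1)"
      by (intro sum.mono_neutral_cong_right) auto
    also have "\<dots> = of_nat (card (Fp - {0 :: 'f}))"
      by simp
    also have "\<dots> = -1"
      using p_gt_1 by (simp add: card_Fp of_nat_diff char_p)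
    finally show ?thesis using True e by simp
  next
    case False
    then obtain c :: 'f where c: "c \<in> Fp" "c \<noteq> 0" "c ^ e \<noteq> 1" using exponent_dvd by blast
    have "(\<Sum>t\<in>Fp. (t :: 'f) ^ e) = (\<Sum>t\<in>Fp. (c * t) ^ e)"
      by (rule sum.reindex_bij_witness[of _ "\<lambda>t. c * t" "\<lambda>t. t / c"]) (use c in auto)
    also have "\<dots> = c ^ e * (\<Sum>t\<in>Fp. t ^ e)" by (simp add: power_mult_distrib sum_distrib_left)
    finally have "(c ^ e - 1) * (\<Sum>t\<in>Fp. (t :: 'f) ^ e) = 0" by (simp add: algebra_simps)
    with c False show ?thesis by simp
  qed
qed

subsection \<open>Interpolation\<close>

text \<open>The Lagrange basis for the points of \<open>Fp\<close>; in characteristic \<open>p\<close> its coefficients are powers.\<close>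

definition lagrange :: "'f \<Rightarrow> 'f poly" where
  "lagrange t = 1 - (\<Sum>i<p. monom (t ^ (p - 1 - i)) i)"

lemma coeff_lagrange:
  assumes "i > 0"
  shows "coeff (lagrange t) i = (if i < p then - (t ^ (p - 1 - i)) else 0)"
proof -
  have "coeff (lagrange t) i = - (\<Sum>k<p. if k = i then t ^ (p - 1 - i) else 0)"
    using assms by (auto simp: lagrange_def coeff_sum intro!: sum.cong)
  then show ?thesis by simp
qed

lemma degree_lagrange: "degree (lagrange t) < p"
  by (rule degree_lessI) (use p_gt_1 in \<open>auto simp: coeff_lagrange\<close>)

lemma poly_lagrange:
  assumes "s \<in> Fp" "t \<in> Fp"
  shows "poly (lagrange t) s = (if s = t then 1 else 0)"
proof -
  have ev: "poly (lagrange t) s = 1 - (\<Sum>i<p. t ^ (p - 1 - i) * s ^ i)"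
    by (simp add: lagrange_def poly_sum poly_monom)
  show ?thesis
  proof (cases "s = t")
    case True
    have "(\<Sum>i<p. t ^ (p - 1 - i) * t ^ i) = (\<Sum>i<p. t ^ (p - 1))"
    proof (intro sum.cong refl)
      fix i assume "i \<in> {..<p}"
      then have "p - 1 - i + i = p - 1" by simp
      then show "t ^ (p - 1 - i) * t ^ i = t ^ (p - 1)" by (metis power_add)
    qed
    also have "\<dots> = of_nat p * t ^ (p - 1)" by simp
    also have "\<dots> = 0" unfolding char_p by simp
    finally have "poly (lagrange t) t = 1 - 0" using ev True by (simp only:)
    with True show ?thesis by simp
  next
    case False
    have "(\<Sum>i<p. t ^ (p - 1 - i) * s ^ i) = (\<Sum>i<p. t ^ (p - Suc i) * s ^ i)" by simp
    then have "s ^ p - t ^ p = (s - t) * (\<Sum>i<p. t ^ (p - 1 - i) * s ^ i)"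
      using power_diff_sumr2[of s p t] by (simp only:)
    then have "(s - t) * (\<Sum>i<p. t ^ (p - 1 - i) * s ^ i) = s - t"
      using assms by (simp only: Fp_power_p)
    with False have "(\<Sum>i<p. t ^ (p - 1 - i) * s ^ i) = 1"
      by (metis mult_cancel_left2 right_minus_eq)
    then have "poly (lagrange t) s = 1 - 1" using ev by (simp only:)
    then show ?thesis using False by simp
  qed
qed

lemma poly_interpolate:
  assumes "s \<in> Fp"
  shows "poly (\<Sum>t\<in>Fp. smult (h t) (lagrange t)) s = h s"
proof -
  have "poly (\<Sum>t\<in>Fp. smult (h t) (lagrange t)) s = (\<Sum>t\<in>Fp. if t = s then h s else 0)"
    unfolding poly_sum by (intro sum.cong refl) (use assms in \<open>auto simp: poly_lagrange\<close>)
  then show ?thesis using assms by simp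
qed

lemma degree_interpolate: "degree (\<Sum>t\<in>Fp. smult (h t) (lagrange t)) < p"
  using p_gt_1 by (intro degree_sum_less) (auto intro: le_less_trans[OF degree_smult_le] degree_lagrange)

lemma coeff_interpolate:
  assumes "0 < i" "i < p"
  shows "coeff (\<Sum>t\<in>Fp. smult (h t) (lagrange t)) i = - (\<Sum>t\<in>Fp. h t * t ^ (p - 1 - i))"
  using assms by (simp add: coeff_sum coeff_lagrange sum_negf)

lemma binomial_nonzero:
  assumes "i \<le> n" "n < p"
  shows "of_nat (n choose i) \<noteq> (0 :: 'f)"
proof
  assume "of_nat (n choose i) = (0 :: 'f)"
  then have "p dvd n choose i" by (simp add: of_nat_eq_0_iff_p)
  then have "p dvd fact i * fact (n - i) * (n choose i)" by simp
  then have "p dvd fact n" using binomial_fact_lemma[OF assms(1)] by simp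
  then show False using prime_p assms(2) by (simp add: prime_dvd_fact_iff)
qed

lemma coeff_linear_power:
  "coeff ([:x, y:] ^ n) i = of_nat (n choose i) * x ^ (n - i) * (y :: 'f) ^ i"
proof -
  have "[:x, y:] ^ n = (monom y 1 + [:x:]) ^ n" by (simp add: monom_altdef)
  also have "\<dots> = (\<Sum>k\<le>n. of_nat (n choose k) * monom y 1 ^ k * [:x:] ^ (n - k))"
    by (rule binomial_ring)
  also have "\<dots> = (\<Sum>k\<le>n. monom (of_nat (n choose k) * x ^ (n - k) * y ^ k) k)"
    by (intro sum.cong refl)
      (simp add: monom_power of_nat_poly poly_const_pow mult_monom mult_ac flip: monom_0)
  finally have "coeff ([:x, y:] ^ n) i =
      (\<Sum>k\<le>n. if k = i then of_nat (n choose i) * x ^ (n - i) * y ^ i else 0)"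
    by (simp only: coeff_sum coeff_monom) (intro sum.cong refl, simp)
  then show ?thesis by (cases "i \<le> n") (simp_all add: binomial_eq_0)
qed

text \<open>
  A Vandermonde argument: the power \<open>(t - z) ^ n\<close> has the coefficients \<open>t ^ (n - i)\<close> up to nonzero
  factors, and the power sums over \<open>Fp\<close> invert this matrix except for the constant term.
\<close>

lemma powers_of_linear_span:
  fixes F :: "'f poly"
  assumes n: "n < p" "degree F \<le> n"
  shows "\<exists>c d. F = (\<Sum>t\<in>Fp. smult (c t) ([:t, -1:] ^ n)) + [:d:]"
proof -
  define e where "e i = - (coeff F i * (-1) ^ i / of_nat (n choose i))" for i
  define c where "c t = (\<Sum>i\<in>{1..n}. e i * t ^ (p - 1 - n + i))" for t
  define d where "d = coeff F 0 - coeff (\<Sum>t\<in>Fp. smult (c t) ([:t, -1:] ^ n)) 0"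
  have "coeff ((\<Sum>t\<in>Fp. smult (c t) ([:t, -1:] ^ n)) + [:d:]) i = coeff F i" for i
  proof -
    consider "i = 0" | "0 < i" "i \<le> n" | "i > n" by linarith
    then show ?thesis
    proof cases
      case 1
      then show ?thesis by (simp add: d_def)
    next
      case 2
      have inner: "(\<Sum>t\<in>Fp. c t * t ^ (n - i)) = - e i"
      proof -
        have "(\<Sum>t\<in>Fp. c t * t ^ (n - i)) = (\<Sum>t\<in>Fp. \<Sum>k\<in>{1..n}. e k * t ^ (p - 1 - n + k + (n - i)))"
          by (simp add: c_def sum_distrib_right power_add mult.assoc)
        also have "\<dots> = (\<Sum>k\<in>{1..n}. e k * (\<Sum>t\<in>Fp. t ^ (p - 1 - n + k + (n - i))))"
          by (subst sum.swap) (simp add: sum_distrib_left)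
        also have "\<dots> = (\<Sum>k\<in>{1..n}. if k = i then - e i else 0)"
        proof (intro sum.cong refl)
          fix k assume k: "k \<in> {1..n}"
          have dv: "(p - 1) dvd (p - 1 - n + k + (n - i)) \<longleftrightarrow> k = i"
          proof
            assume "(p - 1) dvd (p - 1 - n + k + (n - i))"
            then obtain q where q: "p - 1 - n + k + (n - i) = (p - 1) * q" by (elim dvdE)
            obtain r where r: "n = i + r" using 2 by (metis le_Suc_ex)
            obtain r' where r': "p = Suc n + r'" using n by (metis Suc_leI le_Suc_ex)
            have q': "r' + k + r = (n + r') * q" using q unfolding r' by (simp add: r)
            have "0 < r' + k + r" "r' + k + r < (n + r') * 2" using k 2 r by auto
            then have "0 < (n + r') * q" "(n + r') * q < (n + r') * 2" by (simp_all only: q')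
            then have "0 < q" "q < 2" by (simp, metis mult_less_cancel1)
            then have "q = 1" by linarith
            with q' r show "k = i" by simp
          next
            assume "k = i"
            then have "p - 1 - n + k + (n - i) = p - 1" using 2 n by simp
            then show "(p - 1) dvd (p - 1 - n + k + (n - i))" by simp
          qed
          show "e k * (\<Sum>t\<in>Fp. t ^ (p - 1 - n + k + (n - i))) = (if k = i then - e i else 0)"
            unfolding sum_powers_Fp dv using k by simp
        qed
        also have "\<dots> = - e i" using 2 by simp
        finally show ?thesis .
      qed
      have "coeff ((\<Sum>t\<in>Fp. smult (c t) ([:t, -1:] ^ n)) + [:d:]) i =
          (\<Sum>t\<in>Fp. c t * (of_nat (n choose i) * t ^ (n - i) * (-1) ^ i))"
        using 2 by (simp add: coeff_sum coeff_linear_power coeff_pCons split: nat.split)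
      also have "\<dots> = (\<Sum>t\<in>Fp. c t * t ^ (n - i)) * (of_nat (n choose i) * (-1) ^ i)"
        unfolding sum_distrib_right by (intro sum.cong refl) (simp add: mult_ac)
      also have "\<dots> = coeff F i"
        using binomial_nonzero[of i n] 2 n by (simp add: inner e_def flip: power_add mult_2)
      finally show ?thesis .
    next
      case 3
      then have "coeff F i = 0" using n by (intro coeff_eq_0) simp
      with 3 show ?thesis
        by (simp add: coeff_sum coeff_linear_power binomial_eq_0 coeff_pCons split: nat.split)
    qed
  qed
  then have "F = (\<Sum>t\<in>Fp. smult (c t) ([:t, -1:] ^ n)) + [:d:]"
    by (intro poly_eqI) simp
  then show ?thesis by blast
qed

text \<open>The invariant form of degree \<open>p + 1\<close>: the product of all linear forms over \<open>Fp\<close> up to scalars.\<close>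

definition dickson :: "'f poly" where "dickson = monom 1 p - monom 1 1"

lemma degree_dickson: "degree dickson = p"
proof (rule antisym)
  show "degree dickson \<le> p"
    using p_gt_1 unfolding dickson_def
    by (intro degree_diff_le) (auto simp: degree_monom_le degree_monom_eq)
  have "coeff dickson p \<noteq> 0" using p_gt_1 by (simp add: dickson_def)
  then show "p \<le> degree dickson" by (rule le_degree)
qed

lemma dickson_nonzero: "dickson \<noteq> 0"
  using degree_dickson p_gt_1 by force

lemma dickson_dvd:
  assumes "\<And>t :: 'f. t \<in> Fp \<Longrightarrow> poly f t = 0"
  shows "dickson dvd f"
proof -
  have "f mod dickson = 0"
  proof (rule vanishing_on_Fp)
    show "degree (f mod dickson) < p"
      using degree_mod_less'[of dickson f] dickson_nonzero degree_dickson p_gt_1 by (metis degree_0 gr_zeroI not_less_zero)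
    fix t :: 'f assume t: "t \<in> Fp"
    then have "poly dickson t = 0" by (simp add: dickson_def poly_monom Fp_power_p)
    moreover have "poly f t = poly (f div dickson) t * poly dickson t + poly (f mod dickson) t"
      by (metis div_mult_mod_eq poly_add poly_mult)
    ultimately show "poly (f mod dickson) t = 0" using assms[OF t] by simp
  qed
  then show ?thesis by (simp add: mod_eq_0_iff_dvd)
qed

text \<open>
  It is the form \<open>X^p Y - X Y^p\<close>, the determinant with rows \<open>(X^p, Y^p)\<close> and \<open>(X, Y)\<close>;
  substitutions over \<open>Fp\<close> commute with the Frobenius map.
\<close>

lemma slash_dickson:
  assumes "\<And>i j. (g :: 'f^2^2) $ i $ j \<in> Fp"
  shows "slash (p + 1) g dickson = smult (det g) dickson"
proof -
  have lin1: "[:x, y:] = monom x 0 + monom y 1" for x y :: 'f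
    by (simp add: monom_altdef)
  have lin: "[:x, y:] ^ p = monom x 0 + monom y p" if "x \<in> Fp" "y \<in> Fp" for x y :: 'f
    unfolding lin1 frobenius_poly using that by (simp add: monom_power Fp_power_p)
  let ?A = "[:g $ 1 $ 2, g $ 1 $ 1:]" and ?B = "[:g $ 2 $ 2, g $ 2 $ 1:]"
  have "slash (p + 1) g (monom 1 p) = smult 1 (?A ^ p * ?B ^ (p + 1 - p))"
    by (rule slash_monom) simp
  then have m1: "slash (p + 1) g (monom 1 p) = ?A ^ p * ?B"
    by (simp only: smult_1_left diff_add_inverse power_one_right)
  have "slash (p + 1) g (monom 1 1) = smult 1 (?A ^ 1 * ?B ^ (p + 1 - 1))"
    by (rule slash_monom) simp
  then have m2: "slash (p + 1) g (monom 1 1) = ?A * ?B ^ p"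
    by (simp only: smult_1_left add_diff_cancel_right' power_one_right)
  have "slash (p + 1) g dickson = ?A ^ p * ?B - ?A * ?B ^ p"
    using slash_add[of "p + 1" g "dickson" "monom 1 1"]
    by (simp only: dickson_def diff_add_cancel m1 m2 eq_diff_eq)
  also have "\<dots> = (monom (g $ 1 $ 2) 0 + monom (g $ 1 $ 1) p) * ?B
      - ?A * (monom (g $ 2 $ 2) 0 + monom (g $ 2 $ 1) p)"
    by (simp only: lin[OF assms assms])
  also have "\<dots> = smult (det g) dickson"
    unfolding lin1
    by (rule poly_eqI) (simp add: det_2 dickson_def algebra_simps mult_monom)
  finally show ?thesis .
qed

end

lemma slash_0_const: "slash 0 g [:c:] = [:c:]"
  by (simp add: slash_def)

section \<open>Coordinates on projective modules\<close>

definition gen :: "('r, 's) ring_scheme \<Rightarrow> nat \<Rightarrow> nat \<Rightarrow> nat \<Rightarrow> 'r" where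
  "gen R N l = (\<lambda>k\<in>{..<N}. if k = l then \<one>\<^bsub>R\<^esub> else \<zero>\<^bsub>R\<^esub>)"

lemma carrier_free: "carrier (free_module R N) = {..<N} \<rightarrow>\<^sub>E carrier R"
  by (simp add: free_module_def)

lemma gen_closed: "ring R \<Longrightarrow> gen R N l \<in> carrier (free_module R N)"
  by (auto simp: gen_def carrier_free ring.ring_simprules)

lemma smult_gen:
  assumes "ring R" "r \<in> carrier R"
  shows "r \<odot>\<^bsub>free_module R N\<^esub> gen R N l = (\<lambda>k\<in>{..<N}. if k = l then r else \<zero>\<^bsub>R\<^esub>)"
proof -
  interpret R: ring R by fact
  show ?thesis using assms(2) by (auto simp: free_module_def gen_def restrict_def)
qed

lemma free_add: "x \<oplus>\<^bsub>free_module R N\<^esub> y = (\<lambda>k\<in>{..<N}. x k \<oplus>\<^bsub>R\<^esub> y k)"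
  by (simp add: free_module_def)

lemma free_expand:
  fixes L :: "(nat \<Rightarrow> 'r) \<Rightarrow> 'v::ab_group_add"
  assumes R: "ring R"
    and L: "\<And>x y. x \<in> carrier (free_module R N) \<Longrightarrow> y \<in> carrier (free_module R N) \<Longrightarrow>
      L (x \<oplus>\<^bsub>free_module R N\<^esub> y) = L x + L y"
    and y: "y \<in> carrier (free_module R N)"
  shows "L y = (\<Sum>l<N. L (y l \<odot>\<^bsub>free_module R N\<^esub> gen R N l))"
proof -
  define cut where "cut S = (\<lambda>k\<in>{..<N}. if k \<in> S then y k else \<zero>\<^bsub>R\<^esub>)" for S :: "nat set"
  interpret R: ring R by fact
  have yR: "y l \<in> carrier R" if "l < N" for l using y that by (auto simp: carrier_free)
  have cutF: "cut S \<in> carrier (free_module R N)" for S by (auto simp: cut_def carrier_free yR)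
  have "L (cut S) = (\<Sum>l\<in>S. L (y l \<odot>\<^bsub>free_module R N\<^esub> gen R N l))" if "finite S" "S \<subseteq> {..<N}" for S
    using that
  proof (induction S rule: finite_induct)
    case empty
    have "cut {} \<oplus>\<^bsub>free_module R N\<^esub> cut {} = cut {}"
      by (auto simp: free_add cut_def restrict_def)
    then have "L (cut {}) = L (cut {}) + L (cut {})" using L[OF cutF cutF, of "{}" "{}"] by simp
    then show ?case by (simp only: add_cancel_right_right) simp
  next
    case (insert l S)
    have l: "l < N" using insert.prems by simp
    have "cut (insert l S) = cut S \<oplus>\<^bsub>free_module R N\<^esub> (y l \<odot>\<^bsub>free_module R N\<^esub> gen R N l)"
      unfolding smult_gen[OF R yR[OF l]] free_add
      using insert.hyps by (auto simp: cut_def restrict_def fun_eq_iff yR)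
    moreover have "y l \<odot>\<^bsub>free_module R N\<^esub> gen R N l \<in> carrier (free_module R N)"
      unfolding smult_gen[OF R yR[OF l]] by (auto simp: carrier_free yR l)
    ultimately show ?case using insert L[OF cutF] by (simp add: add.commute)
  qed
  from this[of "{..<N}"] have "L (cut {..<N}) = (\<Sum>l<N. L (y l \<odot>\<^bsub>free_module R N\<^esub> gen R N l))" by simp
  moreover have "cut {..<N} = y"
  proof
    fix l show "cut {..<N} l = y l" using y by (cases "l < N") (auto simp: cut_def carrier_free PiE_iff extensional_def)
  qed
  ultimately show ?thesis by simp
qed

text \<open>
  The coordinates of an embedding of a finitely generated projective module into a free module as a
  direct summand, and the images of the standard generators: every additive map to the group
  \<open>'v\<close> is recovered from its values on the multiples of these.
\<close>

definition coords :: "('r, 's) ring_scheme \<Rightarrow> ('r, 'm, 't) module_scheme \<Rightarrow> 'v::ab_group_add itself \<Rightarrow>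
    nat \<Rightarrow> (nat \<Rightarrow> 'm \<Rightarrow> 'r) \<Rightarrow> (nat \<Rightarrow> 'm) \<Rightarrow> bool" where
  "coords R M (_ :: 'v itself) n \<kappa> b \<longleftrightarrow> (\<forall>j<n. b j \<in> carrier M) \<and> (\<forall>j<n. \<forall>x\<in>carrier M. \<kappa> j x \<in> carrier R) \<and>
     (\<forall>j<n. \<forall>x\<in>carrier M. \<forall>y\<in>carrier M. \<kappa> j (x \<oplus>\<^bsub>M\<^esub> y) = \<kappa> j x \<oplus>\<^bsub>R\<^esub> \<kappa> j y) \<and>
     (\<forall>j<n. \<forall>x\<in>carrier M. \<forall>r\<in>carrier R. \<kappa> j (r \<odot>\<^bsub>M\<^esub> x) = \<kappa> j x \<otimes>\<^bsub>R\<^esub> r) \<and>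
     (\<forall>L :: 'm \<Rightarrow> 'v. (\<forall>x\<in>carrier M. \<forall>y\<in>carrier M. L (x \<oplus>\<^bsub>M\<^esub> y) = L x + L y) \<longrightarrow>
        (\<forall>x\<in>carrier M. L x = (\<Sum>j<n. L (\<kappa> j x \<odot>\<^bsub>M\<^esub> b j))))"

lemma coordsD:
  fixes L :: "'m \<Rightarrow> 'v::ab_group_add"
  assumes "coords R M TYPE('v) n \<kappa> b"
  shows "j < n \<Longrightarrow> b j \<in> carrier M" and "j < n \<Longrightarrow> x \<in> carrier M \<Longrightarrow> \<kappa> j x \<in> carrier R"
    and "j < n \<Longrightarrow> x \<in> carrier M \<Longrightarrow> y \<in> carrier M \<Longrightarrow> \<kappa> j (x \<oplus>\<^bsub>M\<^esub> y) = \<kappa> j x \<oplus>\<^bsub>R\<^esub> \<kappa> j y"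
    and "j < n \<Longrightarrow> x \<in> carrier M \<Longrightarrow> r \<in> carrier R \<Longrightarrow> \<kappa> j (r \<odot>\<^bsub>M\<^esub> x) = \<kappa> j x \<otimes>\<^bsub>R\<^esub> r"
    and "(\<And>x y. x \<in> carrier M \<Longrightarrow> y \<in> carrier M \<Longrightarrow> L (x \<oplus>\<^bsub>M\<^esub> y) = L x + L y) \<Longrightarrow> x \<in> carrier M \<Longrightarrow>
      L x = (\<Sum>j<n. L (\<kappa> j x \<odot>\<^bsub>M\<^esub> b j))"
  using assms unfolding coords_def by simp_all

lemma coords_exist:
  fixes R :: "('r, 's) ring_scheme" and M :: "('r, 'm, 't) module_scheme"
  assumes "fg_projective R M"
  shows "\<exists>n \<kappa> b. coords R M TYPE('v::ab_group_add) n \<kappa> b"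
proof -
  from assms obtain n i q where i: "i \<in> mod_hom R M (free_module R n)"
    and q: "q \<in> mod_hom R (free_module R n) M" and qi: "\<And>x. x \<in> carrier M \<Longrightarrow> q (i x) = x"
    and R: "ring R"
    unfolding fg_projective_def right_module_def by blast
  define F where "F = free_module R n"
  have iF: "i x \<in> carrier F" if "x \<in> carrier M" for x using i that by (auto simp: mod_hom_def F_def)
  have iR: "i x j \<in> carrier R" if "x \<in> carrier M" "j < n" for x j
    using iF[OF that(1)] that(2) by (auto simp: F_def carrier_free)
  have qs: "q (r \<odot>\<^bsub>F\<^esub> x) = r \<odot>\<^bsub>M\<^esub> q x" if "r \<in> carrier R" "x \<in> carrier F" for r x
    using q that by (auto simp: mod_hom_def F_def)
  have "coords R M TYPE('v) n (\<lambda>j x. i x j) (\<lambda>j. q (gen R n j))"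
    unfolding coords_def
  proof (intro conjI allI ballI impI)
    fix j show "q (gen R n j) \<in> carrier M" using q gen_closed[OF R] by (auto simp: mod_hom_def)
  next
    fix j x assume "j < n" "x \<in> carrier M"
    then show "i x j \<in> carrier R" by (intro iR)
  next
    fix j x y assume j: "j < n" and x: "x \<in> carrier M" and y: "y \<in> carrier M"
    have "i (x \<oplus>\<^bsub>M\<^esub> y) = i x \<oplus>\<^bsub>F\<^esub> i y" using i x y by (auto simp: mod_hom_def F_def)
    then show "i (x \<oplus>\<^bsub>M\<^esub> y) j = i x j \<oplus>\<^bsub>R\<^esub> i y j" using j by (simp add: F_def free_add)
  next
    fix j x r assume j: "j < n" and x: "x \<in> carrier M" and r: "r \<in> carrier R"
    have "i (r \<odot>\<^bsub>M\<^esub> x) = r \<odot>\<^bsub>F\<^esub> i x" using i x r by (auto simp: mod_hom_def F_def)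
    then show "i (r \<odot>\<^bsub>M\<^esub> x) j = i x j \<otimes>\<^bsub>R\<^esub> r" using j by (simp add: F_def free_module_def)
  next
    fix L :: "'m \<Rightarrow> 'v" and x
    assume L: "\<forall>x\<in>carrier M. \<forall>y\<in>carrier M. L (x \<oplus>\<^bsub>M\<^esub> y) = L x + L y" and x: "x \<in> carrier M"
    have "L (q (i x)) = (\<Sum>j<n. L (q (i x j \<odot>\<^bsub>F\<^esub> gen R n j)))"
      unfolding F_def by (rule free_expand[OF R]) (use L q iF[OF x] in \<open>auto simp: F_def mod_hom_def Pi_iff\<close>)
    also have "\<dots> = (\<Sum>j<n. L (i x j \<odot>\<^bsub>M\<^esub> q (gen R n j)))"
      using iR[OF x] gen_closed[OF R] by (intro sum.cong refl) (simp add: qs[unfolded F_def] F_def)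
    finally show "L x = (\<Sum>j<n. L (i x j \<odot>\<^bsub>M\<^esub> q (gen R n j)))" using qi[OF x] by simp
  qed
  then show ?thesis by blast
qed

section \<open>Two by two matrices\<close>

definition mat2 :: "'a \<Rightarrow> 'a \<Rightarrow> 'a \<Rightarrow> 'a \<Rightarrow> 'a^2^2" where
  "mat2 x y z t = (\<chi> i j. if i = 1 then (if j = 1 then x else y) else (if j = 1 then z else t))"

lemma mat2_entries [simp]:
  "mat2 x y z t $ 1 $ 1 = x" "mat2 x y z t $ 1 $ 2 = y"
  "mat2 x y z t $ 2 $ 1 = z" "mat2 x y z t $ 2 $ 2 = t"
  by (simp_all add: mat2_def)

lemma mat1_entries [simp]:
  "(mat 1 :: 'a::zero_neq_one^2^2) $ 1 $ 1 = 1" "(mat 1 :: 'a^2^2) $ 1 $ 2 = 0"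
  "(mat 1 :: 'a^2^2) $ 2 $ 1 = 0" "(mat 1 :: 'a^2^2) $ 2 $ 2 = 1"
  by (simp_all add: mat_def)

lemma matrix2_eqI:
  assumes "g $ 1 $ 1 = h $ 1 $ 1" "g $ 1 $ 2 = h $ 1 $ 2" "g $ 2 $ 1 = h $ 2 $ 1" "g $ 2 $ 2 = h $ 2 $ 2"
  shows "(g :: 'a^2^2) = h"
  using assms by (simp add: vec_eq_iff forall_2)

lemma GL2_simps [simp]: "mult (GL2 A) = (**)" "one (GL2 A) = mat 1"
  by (simp_all add: GL2_def)

lemma in_GL2_iff: "g \<in> carrier (GL2 A) \<longleftrightarrow> (\<forall>i j. g $ i $ j \<in> A) \<and> (\<exists>u\<in>A. det g * u = 1)"
  by (simp add: GL2_def)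

lemma det_mat2 [simp]: "det (mat2 x y z t :: 'a::comm_ring_1^2^2) = x * t - y * z"
  by (simp add: det_2)

definition inv2 :: "'a::field^2^2 \<Rightarrow> 'a^2^2" where
  "inv2 g = mat2 (g $ 2 $ 2 / det g) (- g $ 1 $ 2 / det g) (- g $ 2 $ 1 / det g) (g $ 1 $ 1 / det g)"

lemma inv2_entries [simp]:
  "inv2 g $ 1 $ 1 = g $ 2 $ 2 / det g" "inv2 g $ 1 $ 2 = - g $ 1 $ 2 / det g"
  "inv2 g $ 2 $ 1 = - g $ 2 $ 1 / det g" "inv2 g $ 2 $ 2 = g $ 1 $ 1 / det g"
  by (simp_all add: inv2_def)

lemma inv2_left:
  fixes g :: "'a::field^2^2"
  assumes "det g \<noteq> 0"
  shows "inv2 g ** g = mat 1"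
proof (rule matrix2_eqI)
  have d: "g $ 2 $ 2 * g $ 1 $ 1 - g $ 1 $ 2 * g $ 2 $ 1 = det g" by (simp add: det_2)
  show "(inv2 g ** g) $ 1 $ 1 = (mat 1 :: 'a^2^2) $ 1 $ 1" "(inv2 g ** g) $ 2 $ 2 = (mat 1 :: 'a^2^2) $ 2 $ 2"
    using assms d by (simp_all add: matrix2_mult_entry algebra_simps flip: diff_divide_distrib)
qed (simp_all add: matrix2_mult_entry)

lemma inv2_right:
  fixes g :: "'a::field^2^2"
  assumes "det g \<noteq> 0"
  shows "g ** inv2 g = mat 1"
proof (rule matrix2_eqI)
  have d: "g $ 2 $ 2 * g $ 1 $ 1 - g $ 1 $ 2 * g $ 2 $ 1 = det g" by (simp add: det_2)
  show "(g ** inv2 g) $ 1 $ 1 = (mat 1 :: 'a^2^2) $ 1 $ 1" "(g ** inv2 g) $ 2 $ 2 = (mat 1 :: 'a^2^2) $ 2 $ 2"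
    using assms d by (simp_all add: matrix2_mult_entry algebra_simps flip: diff_divide_distrib)
qed (simp_all add: matrix2_mult_entry)

lemma det_inv2: "det g \<noteq> 0 \<Longrightarrow> det (inv2 g) = inverse (det g)"
  using arg_cong[OF inv2_left, of g det] by (simp add: det_mul inverse_eq_divide nonzero_eq_divide_eq)

lemma inv2_unique:
  assumes "det g \<noteq> 0" "g ** h = mat 1"
  shows "inv2 g = h"
  using arg_cong[OF assms(2), of "(**) (inv2 g)"] assms(1)
  by (simp add: matrix_mul_assoc inv2_left)

section \<open>The projective envelope\<close>

locale envelope = char_p p "TYPE('f::field)" for p :: nat +
  fixes a :: nat and P :: "('f::field^2^2 \<Rightarrow> 'f, 'q) module" (structure)
  assumes a_ge: "1 \<le> a" and a_le: "a + 4 \<le> p"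
    and envelope: "projective_envelope (group_ring UNIV (GL2 Fp)) P (Sym_module a)"
begin

abbreviation G :: "('f^2^2) set" where "G \<equiv> carrier (GL2 Fp)"

abbreviation R :: "('f^2^2 \<Rightarrow> 'f) ring" where "R \<equiv> group_ring UNIV (GL2 Fp)"

definition B :: "('f^2^2) set" where "B = {g \<in> G. g $ 2 $ 1 = 0}"

definition ptP :: "'f \<Rightarrow> 'f^2^2 \<Rightarrow> 'f^2^2 \<Rightarrow> 'f" where
  "ptP c g = (\<lambda>h. if h = g then c else 0)"

lemma in_G_iff: "g \<in> G \<longleftrightarrow> (\<forall>i j. g $ i $ j \<in> Fp) \<and> det g \<noteq> 0"
proof -
  have "\<exists>u\<in>Fp. det g * u = 1" if "\<forall>i j. g $ i $ j \<in> Fp" "det g \<noteq> 0"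
    using that by (intro bexI[of _ "inverse (det g)"]) (auto simp: det_2)
  then show ?thesis unfolding in_GL2_iff by auto
qed

lemma G_entry [simp]: "g \<in> G \<Longrightarrow> g $ i $ j \<in> Fp" and G_det [simp]: "g \<in> G \<Longrightarrow> det g \<noteq> 0"
  by (simp_all add: in_G_iff)

lemma G_det_Fp [simp]: "g \<in> G \<Longrightarrow> det g \<in> Fp"
  by (simp add: det_2)

lemma mat2_in_G: "x \<in> Fp \<Longrightarrow> y \<in> Fp \<Longrightarrow> z \<in> Fp \<Longrightarrow> t \<in> Fp \<Longrightarrow> x * t - y * z \<noteq> 0 \<Longrightarrow> mat2 x y z t \<in> G"
  by (simp add: in_G_iff forall_2)

lemma G_mult [simp]: "g \<in> G \<Longrightarrow> h \<in> G \<Longrightarrow> g ** h \<in> G"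
  unfolding in_G_iff by (simp add: det_mul matrix2_mult_entry)

lemma G_1 [simp]: "mat 1 \<in> G"
  unfolding in_G_iff by (simp add: forall_2)

lemma G_inv2 [simp]: "g \<in> G \<Longrightarrow> inv2 g \<in> G"
  using det_inv2[of g] by (simp add: in_G_iff[of "inv2 g"] forall_2)

lemma inv2_cancel:
  "g \<in> G \<Longrightarrow> (h ** g) ** inv2 g = h" "g \<in> G \<Longrightarrow> (h ** inv2 g) ** g = h"
  "g \<in> G \<Longrightarrow> inv2 g ** (g ** k) = k" "g \<in> G \<Longrightarrow> g ** (inv2 g ** k) = k"
proof -
  assume g: "g \<in> G"
  show "(h ** g) ** inv2 g = h" "(h ** inv2 g) ** g = h"
    using g by (simp_all add: inv2_left inv2_right flip: matrix_mul_assoc)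
  show "inv2 g ** (g ** k) = k" "g ** (inv2 g ** k) = k"
    using g by (simp_all add: inv2_left inv2_right matrix_mul_assoc)
qed

lemma G_right_cancel: "u \<in> G \<Longrightarrow> g ** u = h ** u \<longleftrightarrow> g = h"
  by (metis inv2_cancel(1))

lemma finite_G [simp]: "finite G"
proof (rule finite_subset)
  show "G \<subseteq> (\<lambda>(x, y, z, t). mat2 x y z t) ` (Fp \<times> Fp \<times> Fp \<times> Fp)"
  proof
    fix g assume g: "g \<in> G"
    have "g = mat2 (g $ 1 $ 1) (g $ 1 $ 2) (g $ 2 $ 1) (g $ 2 $ 2)" by (rule matrix2_eqI) simp_all
    with g show "g \<in> (\<lambda>(x, y, z, t). mat2 x y z t) ` (Fp \<times> Fp \<times> Fp \<times> Fp)"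
      by (intro image_eqI[of _ _ "(g $ 1 $ 1, g $ 1 $ 2, g $ 2 $ 1, g $ 2 $ 2)"]) auto
  qed
qed auto

lemma sum_translate:
  assumes "u \<in> G"
  shows "(\<Sum>g\<in>G. \<phi> (g ** u)) = (\<Sum>g\<in>G. \<phi> g)"
  by (rule sum.reindex_bij_witness[of _ "\<lambda>g. g ** inv2 u" "\<lambda>g. g ** u"])
    (use assms in \<open>auto simp: inv2_cancel\<close>)

lemma ptP_in_R [simp]: "g \<in> G \<Longrightarrow> ptP c g \<in> carrier R"
  by (auto simp: group_ring_def ptP_def)

lemma R_mult_ptP:
  assumes "u \<in> G" "g \<in> G"
  shows "(e \<otimes>\<^bsub>R\<^esub> ptP c u) (g ** u) = e g * c"
proof -
  let ?S = "{(h, k). h \<in> G \<and> k \<in> G \<and> h ** k = g ** u}"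
  have "finite ?S" by (rule finite_subset[of _ "G \<times> G"]) auto
  then have "(\<Sum>(h, k)\<in>?S. e h * ptP c u k) = (\<Sum>(h, k)\<in>{(g, u)}. e h * ptP c u k)"
  proof (intro sum.mono_neutral_right ballI)
    show "{(g, u)} \<subseteq> ?S" using assms by simp
    fix i assume i: "i \<in> ?S - {(g, u)}"
    obtain h k where hk: "i = (h, k)" by force
    have "k \<noteq> u" using i assms G_right_cancel[of u h g] unfolding hk by auto
    then show "(case i of (h, k) \<Rightarrow> e h * ptP c u k) = 0" by (simp add: hk ptP_def)
  qed
  then show ?thesis by (simp add: group_ring_def ptP_def)
qed

lemma ptP_mult:
  assumes "g \<in> G" "h \<in> G"
  shows "ptP c g \<otimes>\<^bsub>R\<^esub> ptP d h = ptP (c * d) (g ** h)"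
proof
  fix k
  show "(ptP c g \<otimes>\<^bsub>R\<^esub> ptP d h) k = ptP (c * d) (g ** h) k"
  proof (cases "k \<in> G")
    case True
    have "(ptP c g \<otimes>\<^bsub>R\<^esub> ptP d h) ((k ** inv2 h) ** h) = ptP c g (k ** inv2 h) * d"
      by (rule R_mult_ptP) (use assms True in auto)
    moreover have "k ** inv2 h = g \<longleftrightarrow> k = g ** h" using assms True by (metis inv2_cancel(1,2))
    ultimately show ?thesis using assms True by (simp add: inv2_cancel) (simp add: ptP_def)
  next
    case False
    then have no: "{(x, y). x \<in> G \<and> y \<in> G \<and> x ** y = k} = {}" by auto
    have "(ptP c g \<otimes>\<^bsub>R\<^esub> ptP d h) k =
        (\<Sum>(x, y)\<in>{(x, y). x \<in> G \<and> y \<in> G \<and> x ** y = k}. ptP c g x * ptP d h y)"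
      by (simp add: group_ring_def)
    also have "\<dots> = 0" unfolding no by simp
    finally have "(ptP c g \<otimes>\<^bsub>R\<^esub> ptP d h) k = 0" .
    moreover have "k \<noteq> g ** h" using False assms by auto
    ultimately show ?thesis by (simp add: ptP_def)
  qed
qed

lemma R_one: "\<one>\<^bsub>R\<^esub> = ptP 1 (mat 1)"
  by (simp add: group_ring_def ptP_def)

lemma R_add: "x \<oplus>\<^bsub>R\<^esub> y = (\<lambda>g. x g + y g)"
  by (simp add: group_ring_def)

lemma RM: "right_module R P" and fgP: "fg_projective R P"
  using envelope by (simp_all add: projective_envelope_def fg_projective_def)

lemma abelian_P: "abelian_group P"
  using RM by (simp_all add: right_module_def)

abbreviation act :: "'q \<Rightarrow> 'f^2^2 \<Rightarrow> 'q" where "act x g \<equiv> ptP 1 g \<odot> x"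

lemma P_closed [simp]: "g \<in> G \<Longrightarrow> x \<in> carrier P \<Longrightarrow> ptP c g \<odot> x \<in> carrier P"
  by (rule right_module.act_closed[OF RM]) auto

lemma P_add_closed [simp]: "x \<in> carrier P \<Longrightarrow> y \<in> carrier P \<Longrightarrow> x \<oplus> y \<in> carrier P"
  using abelian_P by (simp add: abelian_groupE(1))

lemma ptP_ptP:
  assumes "g \<in> G" "h \<in> G" "x \<in> carrier P"
  shows "ptP d h \<odot> (ptP c g \<odot> x) = ptP (c * d) (g ** h) \<odot> x"
  using right_module.act_assoc[OF RM, of "ptP c g" "ptP d h" x] assms by (simp add: ptP_mult)

lemma act_mat_1 [simp]: "x \<in> carrier P \<Longrightarrow> act x (mat 1) = x"
  using right_module.act_one[OF RM, of x] by (simp add: R_one)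

text \<open>
  An element of the group ring is the sum of its values at the group elements, so additive maps
  see only the action of multiples of group elements.
\<close>

lemma additive_R_act:
  fixes L :: "'q \<Rightarrow> 'f poly"
  assumes L: "\<And>x y. x \<in> carrier P \<Longrightarrow> y \<in> carrier P \<Longrightarrow> L (x \<oplus> y) = L x + L y"
    and r: "r \<in> carrier R" and x: "x \<in> carrier P"
  shows "L (r \<odot> x) = (\<Sum>g\<in>G. L (ptP (r g) g \<odot> x))"
proof -
  define cut where "cut S = (\<lambda>g. if g \<in> S then r g else 0)" for S
  have cutR: "cut S \<in> carrier R" for S using r by (auto simp: cut_def group_ring_def)
  have cl: "s \<odot> x \<in> carrier P" if "s \<in> carrier R" for s
    using right_module.act_closed[OF RM that x] .
  have "L (cut S \<odot> x) = (\<Sum>g\<in>S. L (ptP (r g) g \<odot> x))" if "S \<subseteq> G" for S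
  proof -
    have "finite S" using that by (rule finite_subset) simp
    then show ?thesis using that
    proof (induction S rule: finite_induct)
      case empty
      have "cut {} \<oplus>\<^bsub>R\<^esub> cut {} = cut {}" by (simp add: R_add cut_def)
      then have "L (cut {} \<odot> x) = L (cut {} \<odot> x) + L (cut {} \<odot> x)"
        using right_module.act_l_distr[OF RM cutR[of "{}"] cutR[of "{}"] x] L[OF cl[OF cutR] cl[OF cutR]] by metis
      then have "L (cut {} \<odot> x) = 0" by (metis add_cancel_right_right)
      then show ?case by simp
    next
      case (insert g S)
      have gG: "g \<in> G" using insert.prems by simp
      have "cut (insert g S) = cut S \<oplus>\<^bsub>R\<^esub> ptP (r g) g"
        using insert.hyps by (auto simp: R_add cut_def ptP_def)
      then have "L (cut (insert g S) \<odot> x) = L (cut S \<odot> x) + L (ptP (r g) g \<odot> x)"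
        using right_module.act_l_distr[OF RM cutR[of S] ptP_in_R[OF gG, of "r g"] x] L cl[OF cutR[of S]] x gG by simp
      then show ?case using insert by simp
    qed
  qed
  from this[of G] have "L (cut G \<odot> x) = (\<Sum>g\<in>G. L (ptP (r g) g \<odot> x))" by simp
  moreover have "cut G = r" using r by (auto simp: cut_def group_ring_def)
  ultimately show ?thesis by simp
qed

text \<open>
  In terms of the values \<open>\<kappa> j x g\<close> of the coordinates, every additive map to polynomials is recovered
  from its values on the translates of the generators \<open>b j\<close>.
\<close>

abbreviation dual_basis :: "nat \<Rightarrow> (nat \<Rightarrow> 'q \<Rightarrow> 'f^2^2 \<Rightarrow> 'f) \<Rightarrow> (nat \<Rightarrow> 'q) \<Rightarrow> bool" where
  "dual_basis \<equiv> coords R P TYPE('f poly)"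

lemma dual_basisD:
  assumes db: "dual_basis n \<kappa> b"
  shows "j < n \<Longrightarrow> b j \<in> carrier P"
    and "j < n \<Longrightarrow> x \<in> carrier P \<Longrightarrow> y \<in> carrier P \<Longrightarrow> \<kappa> j (x \<oplus> y) g = \<kappa> j x g + \<kappa> j y g"
    and "j < n \<Longrightarrow> x \<in> carrier P \<Longrightarrow> h \<in> G \<Longrightarrow> g \<in> G \<Longrightarrow> \<kappa> j (ptP c h \<odot> x) (g ** h) = \<kappa> j x g * c"
    and "(\<And>x y. x \<in> carrier P \<Longrightarrow> y \<in> carrier P \<Longrightarrow> L (x \<oplus> y) = L x + L y) \<Longrightarrow> x \<in> carrier P \<Longrightarrow>
      L x = (\<Sum>j<n. \<Sum>g\<in>G. L (ptP (\<kappa> j x g) g \<odot> b j) :: 'f poly)"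
proof -
  note cD = coordsD[OF db]
  assume L: "\<And>x y. x \<in> carrier P \<Longrightarrow> y \<in> carrier P \<Longrightarrow> L (x \<oplus> y) = L x + L y" and x: "x \<in> carrier P"
  have "L x = (\<Sum>j<n. L (\<kappa> j x \<odot> b j))" by (rule cD(5)[OF L x])
  then show "L x = (\<Sum>j<n. \<Sum>g\<in>G. L (ptP (\<kappa> j x g) g \<odot> b j))"
    using additive_R_act[of L] L cD(1,2) x by simp
qed (simp_all add: coordsD[OF db] R_add R_mult_ptP)

subsection \<open>Equivariant maps to polynomials\<close>

text \<open>
  The maps vanish outside the carrier so that they form a linear space of functions.
\<close>

definition HomP :: "('f^2^2) set \<Rightarrow> nat \<Rightarrow> ('f^2^2 \<Rightarrow> 'f) \<Rightarrow> ('q \<Rightarrow> 'f poly) set" where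
  "HomP U m \<tau> = {f. (\<forall>x. x \<notin> carrier P \<longrightarrow> f x = 0) \<and> (\<forall>x. degree (f x) \<le> m) \<and>
     (\<forall>x\<in>carrier P. \<forall>y\<in>carrier P. f (x \<oplus> y) = f x + f y) \<and>
     (\<forall>x\<in>carrier P. \<forall>c. \<forall>u\<in>U. f (ptP c u \<odot> x) = smult (c * \<tau> u) (slash m u (f x)))}"

lemma HomPD:
  assumes "f \<in> HomP U m \<tau>"
  shows "x \<notin> carrier P \<Longrightarrow> f x = 0" and "degree (f x) \<le> m"
    and "x \<in> carrier P \<Longrightarrow> y \<in> carrier P \<Longrightarrow> f (x \<oplus> y) = f x + f y"
    and "x \<in> carrier P \<Longrightarrow> u \<in> U \<Longrightarrow> f (ptP c u \<odot> x) = smult (c * \<tau> u) (slash m u (f x))"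
  using assms by (simp_all add: HomP_def)

lemma HomPI:
  assumes "\<And>x. x \<notin> carrier P \<Longrightarrow> f x = 0" and "\<And>x. x \<in> carrier P \<Longrightarrow> degree (f x) \<le> m"
    and "\<And>x y. x \<in> carrier P \<Longrightarrow> y \<in> carrier P \<Longrightarrow> f (x \<oplus> y) = f x + f y"
    and "\<And>x u c. x \<in> carrier P \<Longrightarrow> u \<in> U \<Longrightarrow> f (ptP c u \<odot> x) = smult (c * \<tau> u) (slash m u (f x))"
  shows "f \<in> HomP U m \<tau>"
proof -
  have "degree (f x) \<le> m" for x using assms(1,2) by (cases "x \<in> carrier P") simp_all
  then show ?thesis using assms by (simp add: HomP_def)
qed

lemma fun_subspace_HomP: "fun_subspace (HomP U m \<tau>)"
  unfolding fun_subspace_def HomP_def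
  by (auto simp: slash_add slash_smult smult_add_right degree_add_le mult.commute
      intro: order_trans[OF degree_smult_le])

lemma HomP_cong:
  assumes "\<And>u. u \<in> U \<Longrightarrow> \<tau> u = \<tau>' u"
  shows "HomP U m \<tau> = HomP U m \<tau>'"
  using assms by (auto simp: HomP_def)

text \<open>
  On a free module an equivariant map is given by any family of polynomials that is equivariant in the
  group variable; the coordinates restrict it to \<open>P\<close>.
\<close>

lemma HomP_of_family:
  assumes db: "dual_basis n \<kappa> b" and U: "U \<subseteq> G"
    and deg: "\<And>j g. j < n \<Longrightarrow> g \<in> G \<Longrightarrow> degree (w j g) \<le> m"
    and equiv: "\<And>j g u. j < n \<Longrightarrow> g \<in> G \<Longrightarrow> u \<in> U \<Longrightarrow> w j (g ** u) = smult (\<tau> u) (slash m u (w j g))"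
  shows "(\<lambda>x. if x \<in> carrier P then \<Sum>j<n. \<Sum>g\<in>G. smult (\<kappa> j x g) (w j g) else 0) \<in> HomP U m \<tau>"
proof (rule HomPI; (simp split del: if_split)?)
  fix x
  show "degree (\<Sum>j<n. \<Sum>g\<in>G. smult (\<kappa> j x g) (w j g)) \<le> m"
    by (intro degree_sum_le) (auto intro: order_trans[OF degree_smult_le] deg)
next
  fix x y assume "x \<in> carrier P" "y \<in> carrier P"
  then show "(\<Sum>j<n. \<Sum>g\<in>G. smult (\<kappa> j (x \<oplus> y) g) (w j g)) =
     (\<Sum>j<n. \<Sum>g\<in>G. smult (\<kappa> j x g) (w j g)) + (\<Sum>j<n. \<Sum>g\<in>G. smult (\<kappa> j y g) (w j g))"
    by (simp add: dual_basisD(2)[OF db] smult_add_left sum.distrib)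
next
  fix x u c assume x: "x \<in> carrier P" and u: "u \<in> U"
  have "(\<Sum>g\<in>G. smult (\<kappa> j (ptP c u \<odot> x) g) (w j g)) =
      smult (c * \<tau> u) (slash m u (\<Sum>g\<in>G. smult (\<kappa> j x g) (w j g)))"
    if j: "j < n" for j
  proof -
    have uG: "u \<in> G" using u U by auto
    have "(\<Sum>g\<in>G. smult (\<kappa> j (ptP c u \<odot> x) g) (w j g)) =
        (\<Sum>g\<in>G. smult (\<kappa> j (ptP c u \<odot> x) (g ** u)) (w j (g ** u)))"
      by (rule sum_translate[OF uG, symmetric])
    also have "\<dots> = (\<Sum>g\<in>G. smult (\<kappa> j x g * c * \<tau> u) (slash m u (w j g)))"
      by (intro sum.cong refl) (simp add: dual_basisD(3)[OF db j x uG] equiv[OF j _ u])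
    also have "\<dots> = smult (c * \<tau> u) (slash m u (\<Sum>g\<in>G. smult (\<kappa> j x g) (w j g)))"
      by (simp add: slash_sum slash_smult smult_sum_right mult_ac)
    finally show ?thesis .
  qed
  moreover have "ptP c u \<odot> x \<in> carrier P" using x u U by auto
  ultimately show "(if ptP c u \<odot> x \<in> carrier P
      then \<Sum>j<n. \<Sum>g\<in>G. smult (\<kappa> j (ptP c u \<odot> x) g) (w j g) else 0) =
     smult (c * \<tau> u) (slash m u (\<Sum>j<n. \<Sum>g\<in>G. smult (\<kappa> j x g) (w j g)))"
    by (simp add: slash_sum smult_sum_right)
qed

lemma HomP_reproduce:
  assumes db: "dual_basis n \<kappa> b" and f: "f \<in> HomP U m \<tau>" and 1: "mat 1 \<in> U" "\<tau> (mat 1) = 1"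
    and x: "x \<in> carrier P"
  shows "f x = (\<Sum>j<n. \<Sum>g\<in>G. smult (\<kappa> j x g) (f (act (b j) g)))"
proof -
  have "f x = (\<Sum>j<n. \<Sum>g\<in>G. f (ptP (\<kappa> j x g) g \<odot> b j))"
    by (rule dual_basisD(4)[OF db HomPD(3)[OF f] x])
  also have "\<dots> = (\<Sum>j<n. \<Sum>g\<in>G. smult (\<kappa> j x g) (f (act (b j) g)))"
  proof (intro sum.cong refl)
    fix j g assume j: "j \<in> {..<n}" and g: "g \<in> G"
    have bj: "b j \<in> carrier P" using dual_basisD(1)[OF db] j by simp
    have "ptP (\<kappa> j x g) g \<odot> b j = ptP (\<kappa> j x g) (mat 1) \<odot> act (b j) g"
      using ptP_ptP[OF g G_1 bj, of "\<kappa> j x g" 1] by simp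
    also have "f \<dots> = smult (\<kappa> j x g) (f (act (b j) g))"
      using HomPD(4)[OF f, of "act (b j) g" "mat 1" "\<kappa> j x g"] 1 g bj HomPD(2)[OF f]
      by (simp add: slash_mat_1)
    finally show "f (ptP (\<kappa> j x g) g \<odot> b j) = smult (\<kappa> j x g) (f (act (b j) g))" .
  qed
  finally show ?thesis .
qed

subsection \<open>Cosets of the Borel subgroup\<close>

lemma B_sub_G: "B \<subseteq> G" by (auto simp: B_def)

lemma B_D [simp]: "u \<in> B \<Longrightarrow> u \<in> G" "u \<in> B \<Longrightarrow> u $ 2 $ 1 = 0"
  by (simp_all add: B_def)

lemma B_diag: "u \<in> B \<Longrightarrow> det u = u $ 1 $ 1 * u $ 2 $ 2" "u \<in> B \<Longrightarrow> u $ 1 $ 1 \<noteq> 0" "u \<in> B \<Longrightarrow> u $ 2 $ 2 \<noteq> 0"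
proof -
  assume u: "u \<in> B"
  show *: "det u = u $ 1 $ 1 * u $ 2 $ 2" using u by (simp add: det_2)
  have "det u \<noteq> 0" using u by simp
  then show "u $ 1 $ 1 \<noteq> 0" "u $ 2 $ 2 \<noteq> 0" unfolding * by auto
qed

lemma B_mult [simp]: "u \<in> B \<Longrightarrow> v \<in> B \<Longrightarrow> u ** v \<in> B"
  unfolding B_def by (simp add: matrix2_mult_entry)

lemma B_1 [simp]: "mat 1 \<in> B"
  unfolding B_def by simp

lemma B_mult_diag:
  assumes "v \<in> B" shows "(u ** v) $ 1 $ 1 = u $ 1 $ 1 * v $ 1 $ 1"
    "u \<in> B \<Longrightarrow> (u ** v) $ 2 $ 2 = u $ 2 $ 2 * v $ 2 $ 2" "(u ** v) $ 2 $ 1 = u $ 2 $ 1 * v $ 1 $ 1"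
  using assms by (simp_all add: matrix2_mult_entry)

text \<open>Representatives of the cosets \<open>g B\<close>, that is of the points \<open>t\<close> and infinity of the projective line.\<close>

definition pnt :: "'f \<Rightarrow> 'f^2^2" where "pnt t = mat2 t (-1) 1 0"

definition rep :: "'f^2^2 \<Rightarrow> 'f^2^2" where
  "rep g = (if g $ 2 $ 1 = 0 then mat 1 else pnt (g $ 1 $ 1 / g $ 2 $ 1))"

definition cof :: "'f^2^2 \<Rightarrow> 'f^2^2" where "cof g = inv2 (rep g) ** g"

definition Rep :: "('f^2^2) set" where "Rep = insert (mat 1) (pnt ` Fp)"

lemma pnt_G [simp]: "t \<in> Fp \<Longrightarrow> pnt t \<in> G"
  by (simp add: pnt_def mat2_in_G)

lemma det_pnt [simp]: "det (pnt t) = 1"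
  by (simp add: pnt_def)

lemma pnt_entries [simp]: "pnt t $ 1 $ 1 = t" "pnt t $ 2 $ 1 = 1"
  by (simp_all add: pnt_def)

lemma rep_in_Rep [simp]: "g \<in> G \<Longrightarrow> rep g \<in> Rep"
  by (simp add: rep_def Rep_def)

lemma Rep_G [simp]: "r \<in> Rep \<Longrightarrow> r \<in> G"
  by (auto simp: Rep_def)

lemma det_Rep: "r \<in> Rep \<Longrightarrow> det r = 1"
  by (auto simp: Rep_def)

lemma rep_Rep: "r \<in> Rep \<Longrightarrow> rep r = r"
  by (auto simp: Rep_def rep_def)

lemma rep_cof: "g \<in> G \<Longrightarrow> rep g ** cof g = g"
  unfolding cof_def by (rule inv2_cancel) simp

lemma cof_B [simp]: "g \<in> G \<Longrightarrow> cof g \<in> B"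
proof -
  assume g: "g \<in> G"
  then have "cof g \<in> G" by (simp add: cof_def)
  moreover have "cof g $ 2 $ 1 = 0"
    by (simp add: cof_def rep_def matrix2_mult_entry pnt_def det_2)
  ultimately show ?thesis unfolding B_def by simp
qed

lemma det_cof: "g \<in> G \<Longrightarrow> det (cof g) = det g"
  by (metis rep_cof det_mul det_Rep rep_in_Rep mult_1)

lemma rep_mult_B: "u \<in> B \<Longrightarrow> rep (g ** u) = rep g"
  using B_diag(2)[of u] by (simp add: rep_def B_mult_diag)

lemma cof_mult_B: "u \<in> B \<Longrightarrow> cof (g ** u) = cof g ** u"
  by (simp add: cof_def rep_mult_B matrix_mul_assoc)

text \<open>
  The sum is over the finite set of cosets \<open>g B\<close>, which \<open>h\<close> permutes.
\<close>

lemma sum_Rep_translate: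
  assumes h: "h \<in> G" and \<phi>: "\<And>g u. g \<in> G \<Longrightarrow> u \<in> B \<Longrightarrow> \<phi> (g ** u) = \<phi> g"
  shows "(\<Sum>r\<in>Rep. \<phi> (h ** r)) = (\<Sum>r\<in>Rep. \<phi> r)"
proof (rule sum.reindex_bij_witness[of _ "\<lambda>r. rep (inv2 h ** r)" "\<lambda>r. rep (h ** r)"])
  have *: "rep (k ** rep (l ** r)) = r" if "r \<in> Rep" "k \<in> G" "l \<in> G" "\<And>m :: 'f^2^2. k ** (l ** m) = m" for k l r
  proof -
    have lr: "l ** r \<in> G" using that by simp
    have "k ** rep (l ** r) ** cof (l ** r) = r"
      using rep_cof[OF lr] that(4)[of r] by (metis matrix_mul_assoc)
    then show ?thesis using rep_mult_B[OF cof_B[OF lr]] rep_Rep[OF that(1)] by metis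
  qed
  fix r assume r: "r \<in> Rep"
  show "rep (inv2 h ** rep (h ** r)) = r" "rep (h ** rep (inv2 h ** r)) = r"
    using r h by (auto intro!: * simp: inv2_cancel)
  show "rep (h ** r) \<in> Rep" "rep (inv2 h ** r) \<in> Rep" using r h by auto
  have hr: "h ** r \<in> G" using h r by simp
  show "\<phi> (rep (h ** r)) = \<phi> (h ** r)"
    using \<phi>[of "rep (h ** r)" "cof (h ** r)"] rep_cof[OF hr] hr by simp
qed

lemma sum_Rep: "(\<Sum>r\<in>Rep. \<phi> r) = \<phi> (mat 1) + (\<Sum>t\<in>Fp. \<phi> (pnt t))"
proof -
  have "inj_on pnt Fp" by (rule inj_onI) (metis pnt_entries(1))
  moreover have "mat 1 \<notin> pnt ` Fp" by (metis imageE mat1_entries(3) pnt_entries(2) zero_neq_one)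
  ultimately show ?thesis by (simp add: Rep_def sum.reindex)
qed

definition chB :: "nat \<Rightarrow> nat \<Rightarrow> 'f^2^2 \<Rightarrow> 'f" where "chB x y u = u $ 1 $ 1 ^ x * u $ 2 $ 2 ^ y"

definition chG :: "nat \<Rightarrow> 'f^2^2 \<Rightarrow> 'f" where "chG j u = det u ^ j"

lemma chB_mult: "u \<in> B \<Longrightarrow> v \<in> B \<Longrightarrow> chB x y (u ** v) = chB x y u * chB x y v"
  by (simp add: chB_def B_mult_diag power_mult_distrib mult_ac)

lemma chB_1 [simp]: "chB x y (mat 1) = 1" and chG_1 [simp]: "chG j (mat 1) = 1"
  by (simp_all add: chB_def chG_def)

lemma chG_mult: "chG j (u ** v) = chG j u * chG j v"
  by (simp add: chG_def det_mul power_mult_distrib)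

lemma HomP_0_const:
  assumes "h \<in> HomP U 0 \<tau>"
  shows "h x = [:coeff (h x) 0:]"
  using HomPD(2)[OF assms, of x] by (metis degree_eq_zeroE coeff_pCons_0 le_zero_eq)

lemma HomP_B_translate:
  assumes "h \<in> HomP B 0 (chB x y)" "q \<in> carrier P" "g \<in> G" "u \<in> B"
  shows "coeff (h (act q (g ** u))) 0 = chB x y u * coeff (h (act q g)) 0"
proof -
  have "act q (g ** u) = act (act q g) u" using ptP_ptP[of g u q 1 1] assms by simp
  then have "h (act q (g ** u)) = smult (chB x y u) (slash 0 u (h (act q g)))"
    using HomPD(4)[OF assms(1), of "act q g" u 1] assms by simp
  also have "slash 0 u (h (act q g)) = h (act q g)"
    using HomP_0_const[OF assms(1)] slash_0_const by metis
  finally show ?thesis by simp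
qed

text \<open>
  By projectivity of \<open>P\<close>, a map to a character of \<open>B\<close> lifts along the top coefficient as soon as each of its
  orbit functions lifts to an equivariant family of polynomials.
\<close>

lemma lift_top_coeff:
  assumes U: "U \<subseteq> G" and h: "h \<in> HomP B 0 (chB x y)"
    and lift: "\<And>q. q \<in> carrier P \<Longrightarrow> \<exists>w. \<forall>g\<in>G. degree (w g) \<le> k \<and> coeff (w g) k = coeff (h (act q g)) 0 \<and>
      (\<forall>u\<in>U. w (g ** u) = smult (\<tau> u) (slash k u (w g)))"
  shows "\<exists>f\<in>HomP U k \<tau>. (\<lambda>z. [:coeff (f z) k:]) = h"
proof -
  obtain n \<kappa> b where db: "dual_basis n \<kappa> b" using coords_exist[OF fgP] by blast
  have "\<forall>j. \<exists>w. j < n \<longrightarrow> (\<forall>g\<in>G. degree (w g) \<le> k \<and> coeff (w g) k = coeff (h (act (b j) g)) 0 \<and>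
      (\<forall>u\<in>U. w (g ** u) = smult (\<tau> u) (slash k u (w g))))"
    using lift[OF dual_basisD(1)[OF db]] by blast
  then obtain w where w: "\<And>j g. j < n \<Longrightarrow> g \<in> G \<Longrightarrow> degree (w j g) \<le> k \<and> coeff (w j g) k = coeff (h (act (b j) g)) 0 \<and>
      (\<forall>u\<in>U. w j (g ** u) = smult (\<tau> u) (slash k u (w j g)))"
    by metis
  define f where "f = (\<lambda>z. if z \<in> carrier P then \<Sum>j<n. \<Sum>g\<in>G. smult (\<kappa> j z g) (w j g) else 0)"
  have "f \<in> HomP U k \<tau>"
    unfolding f_def by (rule HomP_of_family[OF db U]) (use w in blast)+
  moreover have "[:coeff (f z) k:] = h z" for z
  proof (cases "z \<in> carrier P")
    case True
    have "[:coeff (f z) k:] = (\<Sum>j<n. \<Sum>g\<in>G. smult (\<kappa> j z g) [:coeff (w j g) k:])"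
      using True by (intro poly_eqI) (auto simp: f_def coeff_sum coeff_pCons split: nat.split)
    also have "\<dots> = (\<Sum>j<n. \<Sum>g\<in>G. smult (\<kappa> j z g) (h (act (b j) g)))"
      by (intro sum.cong refl) (simp add: w flip: HomP_0_const[OF h])
    also have "\<dots> = h z" by (rule HomP_reproduce[OF db h _ _ True, symmetric]) simp_all
    finally show ?thesis .
  next
    case False
    then show ?thesis using HomPD(1)[OF h] by (simp add: f_def)
  qed
  ultimately show ?thesis by (intro bexI[of _ f]) auto
qed

text \<open>The filtration of the polynomials by degree is stable under \<open>B\<close>; by projectivity of \<open>P\<close> dimensions add up.\<close>

lemma has_dim_B_step:
  assumes d1: "has_dim (HomP B m (chB x (Suc y))) d1" and d2: "has_dim (HomP B 0 (chB (x + Suc m) y)) d2"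
  shows "has_dim (HomP B (Suc m) (chB x y)) (d1 + d2)"
proof -
  let ?T = "\<lambda>(f :: 'q \<Rightarrow> 'f poly) q. [:coeff (f q) (Suc m):]"
  have low: "f \<in> HomP B m (chB x (Suc y)) \<longleftrightarrow> f \<in> HomP B (Suc m) (chB x y) \<and> ?T f = (\<lambda>_. 0)" for f
  proof -
    have deg: "degree F \<le> m \<longleftrightarrow> degree F \<le> Suc m \<and> coeff F (Suc m) = 0" for F :: "'f poly"
      by (metis Suc_n_not_le_n coeff_eq_0 eq_zero_or_degree_less le_SucI le_degree le_less_Suc_eq degree_0 le0 not_less_eq_eq order_le_less)
    have sl: "smult (c * chB x (Suc y) u) (slash m u F) = smult (c * chB x y u) (slash (Suc m) u F)"
      if "degree F \<le> m" "u \<in> B" for c u F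
      using that by (simp add: slash_raise_degree chB_def mult_ac)
    show ?thesis
      unfolding HomP_def by (auto simp: deg fun_eq_iff sl)
  qed
  show ?thesis
  proof (rule has_dim_exact[where T = ?T and J = "\<lambda>f. f"])
    show "linear_on_fun (HomP B (Suc m) (chB x y)) ?T" "linear_on_fun (HomP B m (chB x (Suc y))) (\<lambda>f. f)"
      by (simp_all add: linear_on_fun_def)
    fix f assume f: "f \<in> HomP B (Suc m) (chB x y)"
    show "?T f \<in> HomP B 0 (chB (x + Suc m) y)"
      by (rule HomPI) (use HomPD[OF f] in \<open>auto simp: coeff_slash_top_upper slash_0_const chB_def power_add mult_ac\<close>)
  next
    fix h assume h: "h \<in> HomP B 0 (chB (x + Suc m) y)"
    show "\<exists>f\<in>HomP B (Suc m) (chB x y). ?T f = h"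
    proof (rule lift_top_coeff[OF B_sub_G h], intro exI ballI conjI)
      fix q g assume q: "q \<in> carrier P" and g: "g \<in> G"
      let ?w = "\<lambda>g. smult (chB x y (cof g)) (slash (Suc m) (cof g) (monom (coeff (h (act q (rep g))) 0) (Suc m)))"
      show "degree (?w g) \<le> Suc m" by (rule order_trans[OF degree_smult_le degree_slash])
      show "coeff (?w g) (Suc m) = coeff (h (act q g)) 0"
        using HomP_B_translate[OF h q, of "rep g" "cof g"] g
        by (simp add: rep_cof coeff_slash_top_upper chB_def power_add mult_ac)
      show "?w (g ** u) = smult (chB x y u) (slash (Suc m) u (?w g))" if "u \<in> B" for u
        using that g by (simp add: rep_mult_B cof_mult_B chB_mult slash_compose degree_monom_le slash_smult mult_ac)
    qed
  next
    fix f assume "f \<in> HomP B (Suc m) (chB x y)" "?T f = (\<lambda>_. 0)"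
    then show "\<exists>h\<in>HomP B m (chB x (Suc y)). h = f" using low by blast
  qed (use low d1 d2 fun_subspace_HomP in auto)
qed

end

context envelope
begin

subsection \<open>Reduction of the degree\<close>

lemma top_rep:
  assumes "g \<in> G" "degree F \<le> m"
  shows "coeff (slash m g F) m = coeff (slash m (rep g) F) m * cof g $ 1 $ 1 ^ m"
proof -
  have "slash m g F = slash m (cof g) (slash m (rep g) F)"
    using slash_compose[OF assms(2), of "rep g" "cof g"] rep_cof[OF assms(1)] by simp
  then show ?thesis using assms(1) by (simp add: coeff_slash_top_upper)
qed

lemma HomP_top:
  assumes "f \<in> HomP G m (chG j)" "x \<in> carrier P" "g \<in> G"
  shows "coeff (f (act x g)) m = chG j g * coeff (slash m g (f x)) m"
  using HomPD(4)[OF assms, of 1] by simp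

text \<open>
  By equivariance a map is determined by the top coefficients of its values: translating by
  \<open>pnt t\<close> moves the point at infinity to \<open>t\<close>.
\<close>

lemma HomP_value:
  assumes "f \<in> HomP G m (chG j)" "x \<in> carrier P" "t \<in> Fp"
  shows "poly (f x) t = coeff (f (act x (pnt t))) m"
  using HomP_top[OF assms(1,2), of "pnt t"] assms HomPD(2)[OF assms(1)]
  by (simp add: chG_def coeff_slash_top_affine)

lemma chB_chG: "u \<in> B \<Longrightarrow> chB (m + j) j u = chG j u * u $ 1 $ 1 ^ m"
  by (simp add: chB_def chG_def B_diag power_add power_mult_distrib mult_ac)

lemma top_coeff_HomP:
  assumes f: "f \<in> HomP G m (chG j)"
  shows "(\<lambda>x. [:coeff (f x) m:]) \<in> HomP B 0 (chB (m + j) j)"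
  by (rule HomPI)
    (use HomPD[OF f] in \<open>auto simp: coeff_slash_top_upper slash_0_const chB_chG mult_ac\<close>)

lemma linear_on_fun_top_coeff: "linear_on_fun S (\<lambda>f x. [:coeff (f x) m:])"
  by (simp add: linear_on_fun_def)

text \<open>
  A function on \<open>G\<close> that is equivariant under \<open>B\<close> is a section over the projective line, given by its
  values at the points of \<open>Fp\<close> and at infinity. In degree at least \<open>p\<close> there are enough polynomials to attain them:
  interpolate on \<open>Fp\<close>, then correct at infinity by \<open>z ^ m - z ^ (m - (p - 1))\<close>, which vanishes on \<open>Fp\<close>.
\<close>

lemma interpolation:
  assumes m: "p \<le> m" and \<phi>: "\<And>g u. g \<in> G \<Longrightarrow> u \<in> B \<Longrightarrow> \<phi> (g ** u) = chB (m + j) j u * \<phi> g"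
  shows "\<exists>W. degree W \<le> m \<and> (\<forall>g\<in>G. chG j g * coeff (slash m g W) m = \<phi> g)"
proof -
  define W1 where "W1 = (\<Sum>t\<in>Fp. smult (\<phi> (pnt t)) (lagrange t))"
  define W where "W = W1 + smult (\<phi> (mat 1)) (monom 1 m - monom 1 (m - (p - 1)))"
  have deg1: "degree W1 < p" unfolding W1_def by (rule degree_interpolate)
  have degW: "degree W \<le> m"
    unfolding W_def using deg1 m
    by (intro degree_add_le order_trans[OF degree_smult_le] degree_diff_le)
      (auto intro: order_trans[OF degree_monom_le])
  have val: "poly W t = \<phi> (pnt t)" if t: "t \<in> Fp" for t
  proof -
    have "t ^ m = t ^ (m - (p - 1))"
    proof (cases "t = 0")
      case True
      then show ?thesis using m p_gt_1 by (auto simp: power_0_left)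
    next
      case False
      have "m = m - (p - 1) + (p - 1)" using m by simp
      then have "[m = m - (p - 1)] (mod (p - 1))" unfolding cong_def by (metis mod_add_self2)
      then show ?thesis by (rule power_mod_exponent[OF t False])
    qed
    then show ?thesis using poly_interpolate[OF t, of "\<lambda>t. \<phi> (pnt t)"] by (simp add: W_def W1_def poly_monom)
  qed
  have "coeff W1 m = 0" using deg1 m by (intro coeff_eq_0) simp
  moreover have "m \<noteq> m - (p - 1)" using m p_gt_1 by simp
  ultimately have top: "coeff W m = \<phi> (mat 1)" by (simp add: W_def)
  have "chG j g * coeff (slash m g W) m = \<phi> g" if g: "g \<in> G" for g
  proof -
    have r: "coeff (slash m r W) m = \<phi> r" if "r \<in> Rep" for r
      using that val top degW by (auto simp: Rep_def slash_mat_1 coeff_slash_top_affine)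
    have "\<phi> g = chB (m + j) j (cof g) * \<phi> (rep g)"
      using \<phi>[of "rep g" "cof g"] g by (simp add: rep_cof)
    also have "\<dots> = chG j (cof g) * (coeff (slash m (rep g) W) m * cof g $ 1 $ 1 ^ m)"
      using g by (simp add: r chB_chG mult_ac)
    also have "\<dots> = chG j g * coeff (slash m g W) m"
      unfolding top_rep[OF g degW] using g by (simp add: chG_def det_cof)
    finally show ?thesis ..
  qed
  with degW show ?thesis by blast
qed

lemma slash_dickson_mult:
  assumes u: "u \<in> G" and F: "degree F \<le> k"
  shows "slash (p + 1 + k) u (dickson * F) = smult (det u) (dickson * slash k u F)"
proof -
  have "slash (p + 1) u dickson = smult (det u) dickson" by (rule slash_dickson) (use u in simp)
  then show ?thesis using slash_mult[of dickson "p + 1" F k u] F by (simp add: degree_dickson)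
qed

text \<open>
  The form \<open>dickson\<close> vanishes at all points of the projective line over \<open>Fp\<close>, so the polynomials of
  degree \<open>m \<ge> p\<close> modulo its multiples are the functions on these points, that is the
  representation induced from a character of \<open>B\<close>. By reciprocity, equivariant maps into the latter
  are \<open>B\<close>-equivariant maps to a line: take top coefficients.
\<close>

lemma has_dim_G_step:
  assumes m: "p \<le> m"
    and d1: "has_dim (if m = p then {\<lambda>_. 0} else HomP G (m - p - 1) (chG (Suc j))) d1"
    and d2: "has_dim (HomP B 0 (chB (m + j) j)) d2"
  shows "has_dim (HomP G m (chG j)) (d1 + d2)"
proof -
  let ?S1 = "if m = p then {\<lambda>_. 0} else HomP G (m - p - 1) (chG (Suc j))"
  let ?T = "\<lambda>(f :: 'q \<Rightarrow> 'f poly) x. [:coeff (f x) m:]"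
  let ?J = "\<lambda>(f :: 'q \<Rightarrow> 'f poly) x. dickson * f x"
  have sub: "fun_subspace ?S1"
    by (cases "m = p") (auto simp: fun_subspace_HomP, simp add: fun_subspace_def)
  have degS1: "m > p \<and> degree (f x) \<le> m - p - 1" if "f \<in> ?S1" "f x \<noteq> 0" for f x
    using that m HomPD(2) by (cases "m = p") auto
  show ?thesis
  proof (rule has_dim_exact[where T = ?T and J = ?J])
    show "linear_on_fun (HomP G m (chG j)) ?T" by (rule linear_on_fun_top_coeff)
    show "linear_on_fun ?S1 ?J" by (simp add: linear_on_fun_def algebra_simps)
    fix f assume "f \<in> HomP G m (chG j)"
    then show "?T f \<in> HomP B 0 (chB (m + j) j)" by (rule top_coeff_HomP)
  next
    fix h assume h: "h \<in> HomP B 0 (chB (m + j) j)"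
    show "\<exists>f\<in>HomP G m (chG j). ?T f = h"
    proof (rule lift_top_coeff[OF order_refl h])
      fix q assume q: "q \<in> carrier P"
      obtain W where W: "degree W \<le> m" "\<forall>g\<in>G. chG j g * coeff (slash m g W) m = coeff (h (act q g)) 0"
        using interpolation[OF m HomP_B_translate[OF h q]] by blast
      show "\<exists>w. \<forall>g\<in>G. degree (w g) \<le> m \<and> coeff (w g) m = coeff (h (act q g)) 0 \<and>
          (\<forall>u\<in>G. w (g ** u) = smult (chG j u) (slash m u (w g)))"
        by (intro exI[of _ "\<lambda>g. smult (chG j g) (slash m g W)"])
          (auto simp: W chG_mult slash_compose slash_smult mult_ac degree_slash intro: order_trans[OF degree_smult_le])
    qed
  next
    fix f assume f: "f \<in> ?S1"
    show "?J f \<in> HomP G m (chG j)"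
    proof (cases "m = p")
      case True
      then show ?thesis using f fun_subspaceD(1)[OF fun_subspace_HomP] by simp
    next
      case False
      then have f': "f \<in> HomP G (m - p - 1) (chG (Suc j))" using f by simp
      have mm: "p + 1 + (m - p - 1) = m" using False m by simp
      show ?thesis
      proof (rule HomPI)
        fix x
        show "degree (dickson * f x) \<le> m"
          using HomPD(2)[OF f', of x] degree_mult_le[of dickson "f x"] mm by (simp add: degree_dickson)
      next
        fix x u c assume x: "x \<in> carrier P" and u: "u \<in> G"
        have "slash m u (dickson * f x) = smult (det u) (dickson * slash (m - p - 1) u (f x))"
          using slash_dickson_mult[OF u HomPD(2)[OF f'], of x] unfolding mm .
        then show "dickson * f (ptP c u \<odot> x) = smult (c * chG j u) (slash m u (dickson * f x))"
          using HomPD(4)[OF f' x u, of c] by (simp add: chG_def mult_ac)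
      qed (use HomPD[OF f'] in \<open>auto simp: algebra_simps\<close>)
    qed
    show "f = (\<lambda>_. 0)" if "?J f = (\<lambda>_. 0)"
      using that dickson_nonzero by (simp add: fun_eq_iff)
    show "?T (?J f) = (\<lambda>_. 0)"
    proof
      fix x
      have "coeff (dickson * f x) m = 0"
      proof (cases "f x = 0")
        case False
        have "degree (dickson * f x) < m"
          using degS1[OF f False] degree_mult_le[of dickson "f x"] unfolding degree_dickson by linarith
        then show ?thesis by (rule coeff_eq_0)
      qed simp
      then show "?T (?J f) x = 0" by simp
    qed
  next
    fix f assume f: "f \<in> HomP G m (chG j)" and z: "?T f = (\<lambda>_. 0)"
    have c0: "coeff (f x) m = 0" for x using fun_cong[OF z, of x] by simp
    have dv: "dickson dvd f x" for x
    proof (cases "x \<in> carrier P")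
      case True
      show ?thesis by (rule dickson_dvd) (simp add: HomP_value[OF f True] c0)
    qed (simp add: HomPD(1)[OF f])
    define h where "h x = f x div dickson" for x
    have fh: "f x = dickson * h x" for x using dv[of x] by (simp add: h_def)
    have degh: "m > p \<and> degree (h x) \<le> m - p - 1" if "h x \<noteq> 0" for x
    proof -
      have "degree (f x) = p + degree (h x)"
        unfolding fh using that dickson_nonzero by (simp add: degree_mult_eq degree_dickson)
      moreover have "degree (f x) \<noteq> m"
        using c0[of x] that dickson_nonzero fh[of x] by (metis leading_coeff_0_iff no_zero_divisors)
      ultimately show ?thesis using HomPD(2)[OF f, of x] by linarith
    qed
    have "h \<in> ?S1"
    proof (cases "m = p")
      case True
      then show ?thesis using degh by (auto simp: fun_eq_iff)
    next
      case False
      have mm: "p + 1 + (m - p - 1) = m" using False m by simp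
      have deg': "degree (h x) \<le> m - p - 1" for x using degh[of x] by (cases "h x = 0") auto
      have canc: "F = F'" if "dickson * F = dickson * F'" for F F' :: "'f poly"
        using that dickson_nonzero by simp
      have "h \<in> HomP G (m - p - 1) (chG (Suc j))"
      proof (rule HomPI)
        fix x assume "x \<notin> carrier P"
        then show "h x = 0" using HomPD(1)[OF f] by (simp add: h_def)
      next
        fix x y assume "x \<in> carrier P" "y \<in> carrier P"
        then have "f (x \<oplus> y) = f x + f y" by (rule HomPD(3)[OF f])
        then have "dickson * h (x \<oplus> y) = dickson * (h x + h y)" by (simp only: fh distrib_left)
        then show "h (x \<oplus> y) = h x + h y" by (rule canc)
      next
        fix x u c assume x: "x \<in> carrier P" and u: "u \<in> G"
        have "slash m u (dickson * h x) = smult (det u) (dickson * slash (m - p - 1) u (h x))"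
          using slash_dickson_mult[OF u deg', of x] unfolding mm .
        then have "dickson * h (ptP c u \<odot> x) =
            dickson * smult (c * chG (Suc j) u) (slash (m - p - 1) u (h x))"
          using HomPD(4)[OF f x u, of c] unfolding fh by (simp add: chG_def mult_ac)
        then show "h (ptP c u \<odot> x) = smult (c * chG (Suc j) u) (slash (m - p - 1) u (h x))"
          by (rule canc)
      qed (rule deg')
      then show ?thesis using False by simp
    qed
    moreover have "?J h = f" by (simp add: fun_eq_iff fh)
    ultimately show "\<exists>h\<in>?S1. ?J h = f" by (intro bexI)
  qed (use sub d1 d2 fun_subspace_HomP in auto)
qed

subsection \<open>Characters of the Borel subgroup\<close>

lemma inv2_mult: "g \<in> G \<Longrightarrow> h \<in> G \<Longrightarrow> inv2 (g ** h) = inv2 h ** inv2 g"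
proof (rule inv2_unique)
  assume g: "g \<in> G" and h: "h \<in> G"
  then show "det (g ** h) \<noteq> 0" by (simp add: det_mul)
  have "(g ** h) ** (inv2 h ** inv2 g) = g ** (h ** (inv2 h ** inv2 g))" by (simp flip: matrix_mul_assoc)
  also have "\<dots> = mat 1" using g h by (simp add: inv2_cancel inv2_right)
  finally show "(g ** h) ** (inv2 h ** inv2 g) = mat 1" .
qed

lemma slash_1: "slash n g 1 = [:g $ 2 $ 2, g $ 2 $ 1:] ^ n"
  using slash_monom[of 0 n g 1] by (simp flip: monom_0)

lemma cof_Rep: "r \<in> Rep \<Longrightarrow> cof r = mat 1"
  by (simp add: cof_def rep_Rep inv2_left)

text \<open>
  The transform of a function on \<open>G\<close> that is equivariant for a character of \<open>B\<close>: the intertwining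
  operator from the induced representation to the polynomials of degree \<open>n\<close>.
\<close>

definition Tr :: "nat \<Rightarrow> ('f^2^2 \<Rightarrow> 'f) \<Rightarrow> 'f poly" where
  "Tr n \<omega> = (\<Sum>r\<in>Rep. smult (\<omega> r) (slash n (inv2 r) 1))"

lemma Tr_eq: "Tr n \<omega> = [:\<omega> (mat 1):] + (\<Sum>t\<in>Fp. smult (\<omega> (pnt t)) ([:t, -1:] ^ n))"
proof -
  have "inv2 (pnt t) $ 2 $ 2 = t" "inv2 (pnt t) $ 2 $ 1 = -1" for t by (simp_all add: pnt_def)
  then have "slash n (inv2 (pnt t)) 1 = [:t, -1:] ^ n" for t by (simp only: slash_1)
  moreover have "slash n (inv2 (mat 1)) 1 = (1 :: 'f poly)"
    by (simp add: slash_1 flip: one_pCons)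
  ultimately show ?thesis unfolding Tr_def sum_Rep by (simp only:) simp
qed

lemma degree_Tr: "degree (Tr n \<omega>) \<le> n"
  unfolding Tr_def by (intro degree_sum_le order_trans[OF degree_smult_le degree_slash]) (simp add: Rep_def)

lemma Tr_sum: "Tr n (\<lambda>g. \<Sum>i\<in>I. c i * \<omega> i g) = (\<Sum>i\<in>I. smult (c i) (Tr n (\<omega> i)))"
  unfolding Tr_def smult_sum_right smult_sum by (subst sum.swap) simp

text \<open>
  The transform is a sum over the cosets of \<open>B\<close> of a function \<open>\<phi>\<close> with values in polynomials that
  is well defined on these cosets, and \<open>h\<close> permutes them.
\<close>

lemma Tr_translate:
  assumes b: "1 \<le> b" "b \<le> p - 1" and h: "h \<in> G"
    and \<omega>: "\<And>g u. g \<in> G \<Longrightarrow> u \<in> B \<Longrightarrow> \<omega> (g ** u) = chB (b + v) v u * \<omega> g"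
  shows "Tr (p - 1 - b) (\<lambda>g. \<omega> (h ** g)) =
    smult (chG (b + v) h) (slash (p - 1 - b) h (Tr (p - 1 - b) \<omega>))"
proof -
  define n where "n = p - 1 - b"
  define \<phi> where "\<phi> g = smult (\<omega> g / chG (b + v) g) (slash n (inv2 g) 1)" for g
  have chnz: "chG k g \<noteq> 0" if "g \<in> G" for g k using that by (simp add: chG_def)
  have inv: "\<phi> (g ** u) = \<phi> g" if g: "g \<in> G" and u: "u \<in> B" for g u
  proof -
    have uG: "u \<in> G" using u by simp
    have u22: "u $ 2 $ 2 \<in> Fp" "u $ 2 $ 2 \<noteq> 0" using u B_diag by simp_all
    have "inv2 u $ 2 $ 2 = 1 / u $ 2 $ 2" "inv2 u $ 2 $ 1 = 0"
      using B_diag[OF u] u by simp_all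
    then have "slash n (inv2 u) 1 = [:1 / u $ 2 $ 2:] ^ n" by (simp only: slash_1 pCons_0_0)
    then have "slash n (inv2 u) 1 = smult (1 / u $ 2 $ 2 ^ n) 1"
      by (simp add: poly_const_pow power_one_over)
    then have 1: "slash n (inv2 (g ** u)) 1 = smult (1 / u $ 2 $ 2 ^ n) (slash n (inv2 g) 1)"
      unfolding inv2_mult[OF g uG] using slash_smult[of n "inv2 g" "1 / u $ 2 $ 2 ^ n" 1]
      by (subst slash_compose) simp_all
    have "chB (b + v) v u * u $ 2 $ 2 ^ b = chG (b + v) u"
      using B_diag[OF u] by (simp add: chB_def chG_def power_mult_distrib power_add mult_ac)
    moreover have "u $ 2 $ 2 ^ b * u $ 2 $ 2 ^ n = 1"
      using Fp_power_p_minus_1[OF u22] b by (simp add: n_def flip: power_add)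
    ultimately have "chG (b + v) u * u $ 2 $ 2 ^ n = chB (b + v) v u * 1"
      by (simp only: mult.assoc flip: \<open>chB (b + v) v u * u $ 2 $ 2 ^ b = chG (b + v) u\<close>)
    then have "chB (b + v) v u = chG (b + v) u * u $ 2 $ 2 ^ n" by simp
    then show ?thesis
      using u22 chnz[OF uG] chnz[OF g] by (simp add: \<phi>_def \<omega>[OF g u] 1 chG_mult field_simps)
  qed
  have "Tr n (\<lambda>g. \<omega> (h ** g)) = (\<Sum>r\<in>Rep. smult (chG (b + v) h) (slash n h (\<phi> (h ** r))))"
    unfolding Tr_def
  proof (intro sum.cong refl)
    fix r assume r: "r \<in> Rep"
    then have rG: "r \<in> G" by simp
    have "inv2 r = inv2 (h ** r) ** h"
      unfolding inv2_mult[OF h rG] using h by (simp add: inv2_cancel)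
    then have "slash n (inv2 r) 1 = slash n h (slash n (inv2 (h ** r)) 1)"
      by (simp add: slash_compose)
    moreover have "chG (b + v) (h ** r) = chG (b + v) h" using det_Rep[OF r] by (simp add: chG_def det_mul)
    ultimately show "smult (\<omega> (h ** r)) (slash n (inv2 r) 1) =
        smult (chG (b + v) h) (slash n h (\<phi> (h ** r)))"
      using chnz[OF h, of "b + v"] by (simp add: \<phi>_def slash_smult)
  qed
  also have "\<dots> = smult (chG (b + v) h) (slash n h (\<Sum>r\<in>Rep. \<phi> (h ** r)))"
    by (simp add: slash_sum smult_sum_right)
  also have "(\<Sum>r\<in>Rep. \<phi> (h ** r)) = (\<Sum>r\<in>Rep. \<phi> r)"
    by (rule sum_Rep_translate[OF h inv])
  also have "(\<Sum>r\<in>Rep. \<phi> r) = Tr n \<omega>"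
    unfolding Tr_def \<phi>_def by (intro sum.cong refl) (simp add: det_Rep chG_def)
  finally show ?thesis by (simp add: n_def)
qed

text \<open>
  On the functions that come from polynomials of degree \<open>b\<close> the transform vanishes: its coefficients are
  power sums over \<open>Fp\<close> of exponent at most \<open>p - 1\<close>, and the contribution of the exponent \<open>p - 1\<close>
  cancels the value at infinity.
\<close>

lemma Tr_polynomial_values:
  assumes b: "1 \<le> b" "b \<le> p - 1" and w: "degree w \<le> b"
    and \<omega>: "\<omega> (mat 1) = coeff w b" "\<And>t. t \<in> Fp \<Longrightarrow> \<omega> (pnt t) = poly w t"
  shows "Tr (p - 1 - b) \<omega> = 0"
proof (rule poly_eqI)
  fix i
  define n where "n = p - 1 - b"
  have pv: "poly w t = (\<Sum>k\<le>b. coeff w k * t ^ k)" for t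
  proof -
    have "poly w t = poly (\<Sum>k\<le>b. monom (coeff w k) k) t"
      using w by (simp add: poly_as_sum_of_monoms')
    then show ?thesis by (simp add: poly_sum poly_monom)
  qed
  have S: "(\<Sum>t\<in>Fp. poly w t * t ^ (n - i)) = (if i = 0 then - coeff w b else 0)" if "i \<le> n"
  proof -
    have "(\<Sum>t\<in>Fp. poly w t * t ^ (n - i)) = (\<Sum>k\<le>b. coeff w k * (\<Sum>t\<in>Fp. t ^ (k + (n - i))))"
      unfolding pv by (simp add: sum_distrib_right sum_distrib_left power_add mult.assoc sum.swap[of _ Fp])
    also have "\<dots> = (\<Sum>k\<le>b. if k = b then (if i = 0 then - coeff w b else 0) else 0)"
    proof (intro sum.cong refl)
      fix k assume k: "k \<in> {..b}"
      have "k + (n - i) \<le> p - 1" using k b by (simp add: n_def)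
      then have "(0 < k + (n - i) \<and> (p - 1) dvd (k + (n - i))) \<longleftrightarrow> k + (n - i) = p - 1"
        using p_gt_1 by (auto dest: dvd_imp_le)
      also have "\<dots> \<longleftrightarrow> k = b \<and> i = 0" using k b that by (auto simp: n_def)
      finally have e: "(0 < k + (n - i) \<and> (p - 1) dvd (k + (n - i))) \<longleftrightarrow> k = b \<and> i = 0" .
      show "coeff w k * (\<Sum>t\<in>Fp. t ^ (k + (n - i))) =
          (if k = b then (if i = 0 then - coeff w b else 0) else 0)"
        unfolding sum_powers_Fp e by auto
    qed
    also have "\<dots> = (if i = 0 then - coeff w b else 0)" by simp
    finally show ?thesis .
  qed
  have "coeff (Tr n \<omega>) i = coeff [:coeff w b:] i +
      (\<Sum>t\<in>Fp. poly w t * (of_nat (n choose i) * t ^ (n - i) * (-1) ^ i))"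
    unfolding Tr_eq by (simp add: coeff_sum coeff_linear_power \<omega>)
  also have "(\<Sum>t\<in>Fp. poly w t * (of_nat (n choose i) * t ^ (n - i) * (-1) ^ i)) =
      of_nat (n choose i) * (-1) ^ i * (\<Sum>t\<in>Fp. poly w t * t ^ (n - i))"
    unfolding sum_distrib_left by (intro sum.cong refl) (simp add: mult_ac)
  also have "coeff [:coeff w b:] i + \<dots> = 0"
    using S by (cases "i \<le> n") (auto simp: coeff_pCons binomial_eq_0 split: nat.split)
  finally show "coeff (Tr (p - 1 - b) \<omega>) i = coeff 0 i" by (simp add: n_def)
qed

text \<open>
  Conversely, when the transform vanishes, its coefficients say that the interpolating polynomial of the
  values on \<open>Fp\<close> has degree at most \<open>b\<close> and takes the right value at infinity.
\<close>

lemma Tr_zero_interpolate: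
  assumes b: "1 \<le> b" "b \<le> p - 1" and z: "Tr (p - 1 - b) \<omega> = 0"
  defines "w \<equiv> (\<Sum>t\<in>Fp. smult (\<omega> (pnt t)) (lagrange t))"
  shows "degree w \<le> b" "coeff w b = \<omega> (mat 1)" "\<And>t. t \<in> Fp \<Longrightarrow> poly w t = \<omega> (pnt t)"
proof -
  define n where "n = p - 1 - b"
  have S: "(\<Sum>t\<in>Fp. \<omega> (pnt t) * t ^ (n - i)) = (if i = 0 then - \<omega> (mat 1) else 0)" if i: "i \<le> n" for i
  proof -
    have "0 = coeff (Tr n \<omega>) i" using z by (simp add: n_def)
    also have "\<dots> = coeff [:\<omega> (mat 1):] i +
        (\<Sum>t\<in>Fp. \<omega> (pnt t) * (of_nat (n choose i) * t ^ (n - i) * (-1) ^ i))"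
      unfolding Tr_eq by (simp add: coeff_sum coeff_linear_power)
    also have "(\<Sum>t\<in>Fp. \<omega> (pnt t) * (of_nat (n choose i) * t ^ (n - i) * (-1) ^ i)) =
        of_nat (n choose i) * (-1) ^ i * (\<Sum>t\<in>Fp. \<omega> (pnt t) * t ^ (n - i))"
      unfolding sum_distrib_left by (intro sum.cong refl) (simp add: mult_ac)
    finally have e: "0 = coeff [:\<omega> (mat 1):] i +
        of_nat (n choose i) * (-1) ^ i * (\<Sum>t\<in>Fp. \<omega> (pnt t) * t ^ (n - i))" .
    show ?thesis
    proof (cases "i = 0")
      case True
      then show ?thesis using e by (simp add: eq_neg_iff_add_eq_0 add.commute)
    next
      case False
      have "of_nat (n choose i) \<noteq> (0 :: 'f)" using i p_gt_1 by (intro binomial_nonzero) (auto simp: n_def)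
      then show ?thesis using e False by (simp add: coeff_pCons split: nat.splits)
    qed
  qed
  have c: "coeff w i = (if i = b then \<omega> (mat 1) else 0)" if "b \<le> i" "i < p" for i
  proof -
    have "p - 1 - i = n - (i - b)" "i - b \<le> n" using that by (auto simp: n_def)
    then have "coeff w i = - (if i - b = 0 then - \<omega> (mat 1) else 0)"
      using that b S[of "i - b"] unfolding w_def by (subst coeff_interpolate) auto
    then show ?thesis using that by auto
  qed
  have degp: "degree w < p" unfolding w_def by (rule degree_interpolate)
  show "degree w \<le> b"
  proof (rule degree_le, intro allI impI)
    fix i assume i: "b < i"
    show "coeff w i = 0"
      using c[of i] i degp by (cases "i < p") (auto intro: coeff_eq_0)
  qed
  show "coeff w b = \<omega> (mat 1)" using c[of b] b p_gt_1 by simp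
  show "\<And>t. t \<in> Fp \<Longrightarrow> poly w t = \<omega> (pnt t)"
    unfolding w_def using poly_interpolate[of _ "\<lambda>t. \<omega> (pnt t)"] by simp
qed

text \<open>
  Maps to a character of \<open>B\<close> are maps to the induced representation. The transform maps the latter to the
  polynomials of degree \<open>p - 1 - b\<close>, with kernel the polynomials of degree \<open>b\<close>; it is onto by the
  Vandermonde argument, and surjectivity passes to \<open>Hom\<close> because \<open>P\<close> is projective.
\<close>

lemma has_dim_character:
  assumes b: "1 \<le> b" "b \<le> p - 1"
    and d1: "has_dim (HomP G b (chG v)) d1" and d2: "has_dim (HomP G (p - 1 - b) (chG (b + v))) d2"
  shows "has_dim (HomP B 0 (chB (b + v) v)) (d1 + d2)"
proof -
  define n where "n = p - 1 - b"
  let ?\<omega> = "\<lambda>(l :: 'q \<Rightarrow> 'f poly) x g. coeff (l (act x g)) 0"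
  let ?T = "\<lambda>(l :: 'q \<Rightarrow> 'f poly) x. if x \<in> carrier P then Tr n (?\<omega> l x) else 0"
  let ?J = "\<lambda>(f :: 'q \<Rightarrow> 'f poly) x. [:coeff (f x) b:]"
  have act_eq: "act (ptP c h \<odot> x) g = ptP c (h ** g) \<odot> x" if "x \<in> carrier P" "h \<in> G" "g \<in> G" for x c h g
    using ptP_ptP[of h g x 1 c] that by simp
  have \<omega>_scale: "?\<omega> l (ptP c h \<odot> x) g = c * ?\<omega> l x (h ** g)"
    if l: "l \<in> HomP B 0 (chB (b + v) v)" and "x \<in> carrier P" "h \<in> G" "g \<in> G" for l x c h g
  proof -
    have "ptP c (h ** g) \<odot> x = ptP c (mat 1) \<odot> act x (h ** g)"
      using ptP_ptP[of "h ** g" "mat 1" x c 1] that by simp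
    then show ?thesis
      using that HomPD(4)[OF l, of "act x (h ** g)" "mat 1" c] HomPD(2)[OF l]
      by (simp add: act_eq slash_mat_1)
  qed
  have \<omega>_add: "?\<omega> l (x \<oplus> y) g = ?\<omega> l x g + ?\<omega> l y g"
    if l: "l \<in> HomP B 0 (chB (b + v) v)" and xy: "x \<in> carrier P" "y \<in> carrier P" and g: "g \<in> G" for l x y g
    using right_module.act_r_distr[OF RM, of "ptP 1 g" x y] HomPD(3)[OF l, of "act x g" "act y g"] xy g by simp
  show ?thesis
  proof (rule has_dim_exact[where T = ?T and J = ?J])
    show "linear_on_fun (HomP B 0 (chB (b + v) v)) ?T"
      by (auto simp: linear_on_fun_def fun_eq_iff Tr_def smult_add_left sum.distrib smult_sum_right)
    show "linear_on_fun (HomP G b (chG v)) ?J" by (rule linear_on_fun_top_coeff)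
    fix l assume l: "l \<in> HomP B 0 (chB (b + v) v)"
    show "?T l \<in> HomP G (p - 1 - b) (chG (b + v))"
    proof (rule HomPI)
      fix x y assume xy: "x \<in> carrier P" "y \<in> carrier P"
      note \<omega>_add[OF l xy]
      then have "Tr n (?\<omega> l (x \<oplus> y)) = Tr n (?\<omega> l x) + Tr n (?\<omega> l y)"
        by (simp add: Tr_def smult_add_left sum.distrib)
      then show "?T l (x \<oplus> y) = ?T l x + ?T l y" using xy by simp
    next
      fix x u c assume x: "x \<in> carrier P" and u: "u \<in> G"
      have "Tr n (?\<omega> l (ptP c u \<odot> x)) = smult c (Tr n (\<lambda>g. ?\<omega> l x (u ** g)))"
        unfolding Tr_def smult_sum_right using \<omega>_scale[OF l x u] by (intro sum.cong refl) simp
      also have "\<dots> = smult (c * chG (b + v) u) (slash n u (Tr n (?\<omega> l x)))"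
        unfolding n_def by (subst Tr_translate[OF b u]) (use HomP_B_translate[OF l x] in simp_all)
      finally show "?T l (ptP c u \<odot> x) = smult (c * chG (b + v) u) (slash (p - 1 - b) u (?T l x))"
        using x u by (simp add: n_def)
    qed (auto simp: degree_Tr n_def)
  next
    fix f assume f: "f \<in> HomP G (p - 1 - b) (chG (b + v))"
    obtain N \<kappa> e where db: "dual_basis N \<kappa> e" using coords_exist[OF fgP] by blast
    have "\<exists>c d. f (e j) = (\<Sum>t\<in>Fp. smult (c t) ([:t, -1:] ^ n)) + [:d:]" for j
      by (rule powers_of_linear_span) (use p_gt_1 HomPD(2)[OF f] in \<open>auto simp: n_def\<close>)
    then obtain c d where cd: "\<And>j. f (e j) = (\<Sum>t\<in>Fp. smult (c j t) ([:t, -1:] ^ n)) + [:d j:]"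
      by metis
    define \<omega> where "\<omega> j g = chB (b + v) v (cof g) *
      (if rep g $ 2 $ 1 = 0 then d j else c j (rep g $ 1 $ 1))" for j g
    have \<omega>B: "\<omega> j (g ** u) = chB (b + v) v u * \<omega> j g" if "g \<in> G" "u \<in> B" for j g u
      using that by (simp add: \<omega>_def rep_mult_B cof_mult_B chB_mult mult_ac)
    have Tr\<omega>: "Tr n (\<omega> j) = f (e j)" for j
    proof -
      have "\<omega> j (mat 1) = d j" by (simp add: \<omega>_def cof_Rep rep_Rep Rep_def)
      moreover have "\<omega> j (pnt t) = c j t" if "t \<in> Fp" for t
        using that by (simp add: \<omega>_def cof_Rep rep_Rep Rep_def)
      ultimately show ?thesis unfolding Tr_eq cd by (simp add: add.commute)
    qed
    define l where "l = (\<lambda>x. if x \<in> carrier P then \<Sum>j<N. \<Sum>g\<in>G. smult (\<kappa> j x g) [:\<omega> j g:] else 0)"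
    have lH: "l \<in> HomP B 0 (chB (b + v) v)"
      unfolding l_def by (rule HomP_of_family[OF db B_sub_G]) (simp_all add: \<omega>B slash_0_const)
    have "?T l x = f x" for x
    proof (cases "x \<in> carrier P")
      case True
      have "?\<omega> l x r = (\<Sum>j<N. \<Sum>g\<in>G. \<kappa> j x g * \<omega> j (g ** r))" if r: "r \<in> Rep" for r
      proof -
        have "?\<omega> l x r = (\<Sum>j<N. \<Sum>g\<in>G. \<kappa> j (act x r) g * \<omega> j g)"
          using True r by (simp add: l_def coeff_sum)
        also have "\<dots> = (\<Sum>j<N. \<Sum>g\<in>G. \<kappa> j (act x r) (g ** r) * \<omega> j (g ** r))"
          using r by (intro sum.cong refl sum_translate[symmetric]) simp
        also have "\<dots> = (\<Sum>j<N. \<Sum>g\<in>G. \<kappa> j x g * \<omega> j (g ** r))"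
          using dual_basisD(3)[OF db _ True] r by (intro sum.cong refl) simp
        finally show ?thesis .
      qed
      then have "Tr n (?\<omega> l x) = Tr n (\<lambda>r. \<Sum>j<N. \<Sum>g\<in>G. \<kappa> j x g * \<omega> j (g ** r))"
        unfolding Tr_def by simp
      also have "\<dots> = Tr n (\<lambda>r. \<Sum>j<N. 1 * (\<Sum>g\<in>G. \<kappa> j x g * \<omega> j (g ** r)))" by simp
      also have "\<dots> = (\<Sum>j<N. \<Sum>g\<in>G. smult (\<kappa> j x g) (Tr n (\<lambda>r. \<omega> j (g ** r))))"
        unfolding Tr_sum by simp
      also have "\<dots> = (\<Sum>j<N. \<Sum>g\<in>G. smult (\<kappa> j x g) (f (act (e j) g)))"
      proof (intro sum.cong refl)
        fix j g assume j: "j \<in> {..<N}" and g: "g \<in> G"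
        have "Tr n (\<lambda>r. \<omega> j (g ** r)) = smult (chG (b + v) g) (slash n g (f (e j)))"
          using Tr_translate[OF b g, of "\<omega> j" v, OF \<omega>B] unfolding n_def[symmetric] Tr\<omega> .
        also have "\<dots> = f (act (e j) g)"
          using HomPD(4)[OF f _ g, of "e j" 1] dual_basisD(1)[OF db] j by (simp add: n_def)
        finally show "smult (\<kappa> j x g) (Tr n (\<lambda>r. \<omega> j (g ** r))) =
          smult (\<kappa> j x g) (f (act (e j) g))" by simp
      qed
      also have "\<dots> = f x" by (rule HomP_reproduce[OF db f _ _ True, symmetric]) simp_all
      finally show ?thesis using True by simp
    next
      case False
      then show ?thesis using HomPD(1)[OF f] by simp
    qed
    then show "\<exists>l\<in>HomP B 0 (chB (b + v) v). ?T l = f" using lH by (intro bexI[of _ l]) auto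
  next
    fix f assume f: "f \<in> HomP G b (chG v)"
    show "?J f \<in> HomP B 0 (chB (b + v) v)" by (rule top_coeff_HomP[OF f])
    show "f = (\<lambda>_. 0)" if z: "?J f = (\<lambda>_. 0)"
    proof
      fix x
      have c0: "coeff (f y) b = 0" for y using fun_cong[OF z, of y] by simp
      show "f x = 0"
      proof (cases "x \<in> carrier P")
        case True
        show ?thesis
          by (rule vanishing_on_Fp)
            (use HomPD(2)[OF f, of x] b p_gt_1 in \<open>auto simp: HomP_value[OF f True] c0\<close>)
      qed (rule HomPD(1)[OF f])
    qed
    show "?T (?J f) = (\<lambda>_. 0)"
    proof
      fix x
      have "Tr n (?\<omega> (?J f) x) = 0" if x: "x \<in> carrier P"
        unfolding n_def
        by (rule Tr_polynomial_values[OF b HomPD(2)[OF f, of x]]) (use HomP_value[OF f x] x in simp_all)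
      then show "?T (?J f) x = 0" by simp
    qed
  next
    fix l assume l: "l \<in> HomP B 0 (chB (b + v) v)" and z: "?T l = (\<lambda>_. 0)"
    define f where "f x = (if x \<in> carrier P then \<Sum>t\<in>Fp. smult (?\<omega> l x (pnt t)) (lagrange t) else 0)" for x
    have Tz: "Tr (p - 1 - b) (?\<omega> l x) = 0" if "x \<in> carrier P" for x
      using fun_cong[OF z, of x] that by (simp add: n_def)
    have f1: "degree (f x) \<le> b" "coeff (f x) b = ?\<omega> l x (mat 1)"
      "\<And>t. t \<in> Fp \<Longrightarrow> poly (f x) t = ?\<omega> l x (pnt t)" if "x \<in> carrier P" for x
      using Tr_zero_interpolate[OF b Tz[OF that]] that by (simp_all add: f_def)
    have top: "chG v g * coeff (slash b g (f x)) b = ?\<omega> l x g" if x: "x \<in> carrier P" and g: "g \<in> G" for x g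
    proof -
      have r: "coeff (slash b r (f x)) b = ?\<omega> l x r" if "r \<in> Rep" for r
        using that f1[OF x] by (auto simp: Rep_def slash_mat_1 coeff_slash_top_affine)
      have "?\<omega> l x g = chB (b + v) v (cof g) * ?\<omega> l x (rep g)"
        using HomP_B_translate[OF l x, of "rep g" "cof g"] g by (simp add: rep_cof)
      also have "\<dots> = chG v (cof g) * (coeff (slash b (rep g) (f x)) b * cof g $ 1 $ 1 ^ b)"
        using g by (simp add: r chB_chG mult_ac)
      also have "\<dots> = chG v g * coeff (slash b g (f x)) b"
        unfolding top_rep[OF g f1(1)[OF x]] using g by (simp add: chG_def det_cof)
      finally show ?thesis ..
    qed
    have "f \<in> HomP G b (chG v)"
    proof (rule HomPI)
      fix x y assume xy: "x \<in> carrier P" "y \<in> carrier P"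
      note \<omega>_add[OF l xy]
      then show "f (x \<oplus> y) = f x + f y"
        using xy by (simp add: f_def smult_add_left sum.distrib)
    next
      fix x u c assume x: "x \<in> carrier P" and u: "u \<in> G"
      let ?x = "ptP c u \<odot> x"
      let ?F = "smult (c * chG v u) (slash b u (f x))"
      have xP: "?x \<in> carrier P" using x u by simp
      have "f ?x - ?F = 0"
      proof (rule vanishing_on_Fp)
        show "degree (f ?x - ?F) < p"
        proof (rule le_less_trans)
          show "degree (f ?x - ?F) \<le> b"
            by (intro degree_diff_le f1[OF xP] order_trans[OF degree_smult_le degree_slash])
          show "b < p" using b p_gt_1 by linarith
        qed
        fix t :: 'f assume t: "t \<in> Fp"
        have ut: "u ** pnt t \<in> G" using u t by simp
        have "poly (slash b u (f x)) t = coeff (slash b (pnt t) (slash b u (f x))) b"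
          by (simp add: coeff_slash_top_affine degree_slash)
        also have "\<dots> = coeff (slash b (u ** pnt t) (f x)) b"
          by (simp add: slash_compose f1(1)[OF x])
        finally have "chG v u * poly (slash b u (f x)) t = ?\<omega> l x (u ** pnt t)"
          using top[OF x ut] by (simp add: chG_def det_mul)
        moreover have "poly (f ?x) t = c * ?\<omega> l x (u ** pnt t)"
          using f1(3)[OF xP t] \<omega>_scale[OF l x u, of "pnt t" c] t by simp
        ultimately show "poly (f ?x - ?F) t = 0" by (simp add: mult.assoc)
      qed
      then show "f ?x = ?F" by simp
    qed (use f1 in \<open>auto simp: f_def\<close>)
    moreover have "?J f x = l x" for x
    proof (cases "x \<in> carrier P")
      case True
      then show ?thesis using f1(2)[OF True] HomP_0_const[OF l, of x] by simp
    qed (simp add: f_def HomPD(1)[OF l])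
    ultimately show "\<exists>f\<in>HomP G b (chG v). ?J f = l" by (intro bexI[of _ f]) auto
  qed (use d1 d2 fun_subspace_HomP in auto)
qed

end

context envelope
begin

subsection \<open>Polynomials of small degree\<close>

lemma translation_value:
  assumes "degree F \<le> m"
  shows "poly (slash m (mat2 1 1 0 1) F) t = poly F (t + 1 :: 'f)"
proof -
  have "poly (slash m (mat2 1 1 0 1) F) t = coeff (slash m (pnt t) (slash m (mat2 1 1 0 1) F)) m"
    by (simp add: coeff_slash_top_affine degree_slash)
  also have "\<dots> = coeff (slash m (mat2 1 1 0 1 ** pnt t) F) m"
    by (simp add: slash_compose assms)
  also have "\<dots> = poly F (t + 1)"
    using coeff_slash_top_affine[OF assms, of "mat2 1 1 0 1 ** pnt t"] by (simp add: matrix2_mult_entry pnt_def)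
  finally show ?thesis .
qed

text \<open>
  Being fixed under \<open>z \<mapsto> z + 1\<close> forces equal values at all \<open>p\<close> points of \<open>Fp\<close>.
\<close>

lemma translation_fixed_const:
  assumes "degree F \<le> m" "m < p" "slash m (mat2 1 1 0 1) F = (F :: 'f poly)"
  shows "F = [:poly F 0:]"
proof -
  have step: "poly F (of_nat n) = poly F 0" for n
  proof (induction n)
    case (Suc n)
    have "poly F (of_nat n + 1) = poly F (of_nat n)"
      using translation_value[OF assms(1), of "of_nat n"] assms(3) by simp
    with Suc show ?case by (simp add: add.commute)
  qed simp
  have "F - [:poly F 0:] = 0"
  proof (rule vanishing_on_Fp)
    show "degree (F - [:poly F 0:]) < p"
      using assms by (intro le_less_trans[OF degree_diff_le[of _ m]]) auto
    fix t :: 'f assume "t \<in> Fp"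
    then show "poly (F - [:poly F 0:]) t = 0" unfolding Fp_eq using step by auto
  qed
  then show ?thesis by simp
qed

lemma slash_unipotent:
  assumes "degree F \<le> m"
  shows "slash m (mat2 1 x 0 1) F = slash (degree F) (mat2 1 x 0 1) (F :: 'f poly)"
proof -
  have "slash (degree F + k) (mat2 1 x 0 1) F = slash (degree F) (mat2 1 x 0 1) F" for k
  proof (induction k)
    case (Suc k)
    have "slash (Suc (degree F + k)) (mat2 1 x 0 1) F = slash (degree F + k) (mat2 1 x 0 1) F * [:1, 0:]"
      using slash_raise_degree[of F "degree F + k" "mat2 1 x 0 1"] by simp
    then show ?case using Suc by (simp flip: one_pCons)
  qed simp
  from this[of "m - degree F"] show ?thesis using assms by simp
qed

text \<open>
  Irreducibility in degrees below \<open>p\<close>: differences under a unipotent translation lower the degree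
  until a nonzero constant is reached, and the translates of the constants span by the
  Vandermonde argument.
\<close>

lemma polynomials_irreducible:
  assumes m: "m < p"
    and W: "\<And>F. F \<in> W \<Longrightarrow> degree F \<le> m" "\<And>F F'. F \<in> W \<Longrightarrow> F' \<in> W \<Longrightarrow> F + F' \<in> W"
      "\<And>c F. F \<in> W \<Longrightarrow> smult c F \<in> W" "\<And>g F. g \<in> G \<Longrightarrow> F \<in> W \<Longrightarrow> slash m g F \<in> W"
    and F0: "F0 \<in> W" "F0 \<noteq> (0 :: 'f poly)"
    and F: "degree F \<le> m"
  shows "F \<in> W"
proof -
  define u :: "'f^2^2" where "u = mat2 1 1 0 1"
  have uG: "u \<in> G" unfolding u_def by (rule mat2_in_G) auto
  have diff: "F1 - F2 \<in> W" if "F1 \<in> W" "F2 \<in> W" for F1 F2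
    using W(2)[OF that(1) W(3)[OF that(2), of "-1"]] by simp
  obtain F1 where F1: "F1 \<in> W" "F1 \<noteq> 0" and min: "\<And>F. F \<in> W \<Longrightarrow> F \<noteq> 0 \<Longrightarrow> degree F1 \<le> degree F"
    using ex_has_least_nat[of "\<lambda>F. F \<in> W \<and> F \<noteq> 0" F0 degree] F0 by blast
  have "slash m u F1 - F1 = 0"
  proof (rule ccontr)
    assume nz: "slash m u F1 - F1 \<noteq> 0"
    have dW: "slash m u F1 - F1 \<in> W" by (intro diff W(4) uG F1)
    have u: "slash m u F1 = slash (degree F1) u F1" unfolding u_def by (rule slash_unipotent[OF W(1)[OF F1(1)]])
    then have "degree (slash m u F1 - F1) \<le> degree F1" by (intro degree_diff_le) (simp_all add: degree_slash)
    moreover have "coeff (slash m u F1 - F1) (degree F1) = 0" unfolding u by (simp add: coeff_slash_top_upper u_def)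
    ultimately have "degree (slash m u F1 - F1) < degree F1"
      using nz by (metis leading_coeff_0_iff le_neq_implies_less)
    with min[OF dW nz] show False by simp
  qed
  then have "F1 = [:poly F1 0:]"
    using translation_fixed_const[OF W(1)[OF F1(1)] m] by (simp add: u_def)
  then obtain c where c: "F1 = [:c:]" by blast
  with F1 have "c \<noteq> 0" by auto
  then have one: "1 \<in> W" using W(3)[OF F1(1), of "1 / c"] c by (simp flip: one_pCons)
  have zero: "0 \<in> W" using W(3)[OF one, of 0] by simp
  obtain c d where cd: "F = (\<Sum>t\<in>Fp. smult (c t) ([:t, -1:] ^ m)) + [:d:]"
    using powers_of_linear_span[OF m F] by blast
  have pow: "[:t, -1:] ^ m \<in> W" if "t \<in> Fp" for t
  proof -
    have "inv2 (pnt t) $ 2 $ 2 = t" "inv2 (pnt t) $ 2 $ 1 = -1" by (simp_all add: pnt_def)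
    then have "slash m (inv2 (pnt t)) 1 = [:t, -1:] ^ m" by (simp only: slash_1)
    then show ?thesis using W(4)[OF _ one, of "inv2 (pnt t)"] that by simp
  qed
  have "(\<Sum>t\<in>T. smult (c t) ([:t, -1:] ^ m)) \<in> W" if "finite T" "T \<subseteq> Fp" for T
    using that by (induction T rule: finite_induct) (auto intro!: zero W(2,3) pow)
  moreover have "[:d:] \<in> W" using W(3)[OF one, of d] by simp
  ultimately show ?thesis unfolding cd by (intro W(2)) auto
qed

lemma HomP_kernel_submodule:
  assumes f: "f \<in> HomP G m \<tau>"
  shows "submodule {x \<in> carrier P. f x = 0} R P"
proof -
  interpret P: abelian_group P by (rule abelian_P)
  have f0: "f \<zero> = 0"
    using HomPD(3)[OF f, of "\<zero>" "\<zero>"] P.zero_closed P.r_zero by (metis add_cancel_right_right)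
  have "f (\<ominus> x) = - f x" if "x \<in> carrier P" for x
    using HomPD(3)[OF f that, of "\<ominus> x"] that f0 by (simp add: P.r_neg eq_neg_iff_add_eq_0 add.commute)
  moreover have "inv\<^bsub>add_monoid P\<^esub> x = \<ominus> x" for x by (simp add: a_inv_def)
  ultimately have "subgroup {x \<in> carrier P. f x = 0} (add_monoid P)"
    by (intro subgroup.intro) (auto simp: f0 HomPD(3)[OF f])
  moreover have "f (r \<odot> x) = 0" if "r \<in> carrier R" "x \<in> carrier P" "f x = 0" for r x
  proof -
    have "f (r \<odot> x) = (\<Sum>g\<in>G. f (ptP (r g) g \<odot> x))"
      by (rule additive_R_act) (use that HomPD(3)[OF f] in auto)
    also have "\<dots> = 0"
      using that by (intro sum.neutral ballI) (simp add: HomPD(4)[OF f])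
    finally show ?thesis .
  qed
  ultimately show ?thesis
    unfolding submodule_def submodule_axioms_def using right_module.act_closed[OF RM] by auto
qed

text \<open>
  A nonzero map from the envelope to polynomials of degree below \<open>p\<close> is onto, and its kernel lies in
  the kernel of the covering of \<open>Sym\<close> because the covering is essential. So it is a multiple of
  the covering; comparing the action of the torus on the constants identifies the degree and the twist.
\<close>

lemma has_dim_irreducible:
  assumes m: "m < p"
  shows "has_dim (HomP G m (chG j)) (if m = a \<and> (p - 1) dvd j then 1 else 0)"
proof -
  from envelope obtain \<pi> where \<pi>: "\<pi> \<in> mod_hom R P (Sym_module a)" "\<pi> ` carrier P = carrier (Sym_module a)"
    and ess': "\<forall>N. submodule N R P \<and> \<pi> ` N = carrier (Sym_module a) \<longrightarrow> N = carrier P"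
    unfolding projective_envelope_def by (elim conjE bexE) (rule that)
  have ess: "N = carrier P" if "submodule N R P" "\<pi> ` N = carrier (Sym_module a)" for N
    using ess' that by simp
  have Sym: "carrier (Sym_module a) = {F :: 'f poly. degree F \<le> a}" by (simp add: Sym_module_def)
  have \<pi>deg: "degree (\<pi> x) \<le> a" if "x \<in> carrier P" for x using \<pi>(2) that Sym by blast
  have \<pi>add: "\<pi> (x \<oplus> y) = \<pi> x + \<pi> y" if "x \<in> carrier P" "y \<in> carrier P" for x y
    using \<pi>(1) that by (simp add: mod_hom_def Sym_module_def)
  have \<pi>act: "\<pi> (ptP c g \<odot> x) = smult c (slash a g (\<pi> x))" if x: "x \<in> carrier P" and g: "g \<in> G" for x c g
  proof -
    have "\<pi> (ptP c g \<odot> x) = (\<Sum>h\<in>G. smult (ptP c g h) (slash a h (\<pi> x)))"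
      using \<pi>(1) x ptP_in_R[OF g] by (simp add: mod_hom_def Sym_module_def)
    also have "\<dots> = (\<Sum>h\<in>G. if h = g then smult c (slash a g (\<pi> x)) else 0)"
      by (intro sum.cong refl) (simp add: ptP_def)
    finally show ?thesis using g by simp
  qed
  have am: "a < p" using a_le by simp
  define \<pi>0 where "\<pi>0 x = (if x \<in> carrier P then \<pi> x else 0)" for x
  have main: "m = a \<and> (p - 1) dvd j \<and> (\<exists>c. f = (\<lambda>x. smult c (\<pi>0 x)))"
    if f: "f \<in> HomP G m (chG j)" and fnz: "f \<noteq> (\<lambda>_. 0)" for f
  proof -
    define N where "N = {x \<in> carrier P. f x = 0}"
    have sub: "submodule N R P" unfolding N_def by (rule HomP_kernel_submodule[OF f])
    obtain x0 where x0: "x0 \<in> carrier P" "f x0 \<noteq> 0"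
      using fnz HomPD(1)[OF f] by (metis ext)
    have scal: "ptP c (mat 1) \<odot> x \<in> carrier P" "f (ptP c (mat 1) \<odot> x) = smult c (f x)"
      "\<pi> (ptP c (mat 1) \<odot> x) = smult c (\<pi> x)" if "x \<in> carrier P" for c x
      using that HomPD(4)[OF f that G_1, of c] HomPD(2)[OF f] \<pi>act[OF that G_1, of c] \<pi>deg[OF that]
      by (simp_all add: slash_mat_1)
    have N0: "\<pi> x = 0" if "x \<in> N" for x
    proof (rule ccontr)
      assume nz: "\<pi> x \<noteq> 0"
      have "F \<in> \<pi> ` N" if "degree F \<le> a" for F
      proof (rule polynomials_irreducible[OF am _ _ _ _ _ nz that])
        fix F F' assume "F \<in> \<pi> ` N" "F' \<in> \<pi> ` N"
        then obtain y y' where "y \<in> N" "y' \<in> N" "F = \<pi> y" "F' = \<pi> y'" by blast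
        then show "F + F' \<in> \<pi> ` N"
          by (intro image_eqI[of _ _ "y \<oplus> y'"]) (auto simp: \<pi>add N_def HomPD(3)[OF f])
      next
        fix c F assume "F \<in> \<pi> ` N"
        then obtain y where "y \<in> N" "F = \<pi> y" by blast
        then show "smult c F \<in> \<pi> ` N"
          by (intro image_eqI[of _ _ "ptP c (mat 1) \<odot> y"]) (auto simp: scal N_def)
      next
        fix g F assume "g \<in> G" "F \<in> \<pi> ` N"
        then obtain y where "y \<in> N" "F = \<pi> y" by blast
        then show "slash a g F \<in> \<pi> ` N" using \<open>g \<in> G\<close>
          by (intro image_eqI[of _ _ "act y g"]) (auto simp: \<pi>act N_def HomPD(4)[OF f])
      qed (use \<open>x \<in> N\<close> \<pi>deg in \<open>auto simp: N_def\<close>)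
      then have "\<pi> ` N = carrier (Sym_module a)"
        using \<pi>deg by (auto simp: Sym N_def)
      then have "N = carrier P" by (rule ess[OF sub])
      then have "x0 \<in> N" using x0 by simp
      with x0 show False by (simp add: N_def)
    qed
    have eq: "\<pi> x = \<pi> y" if "x \<in> carrier P" "y \<in> carrier P" "f x = f y" for x y
    proof -
      have "x \<oplus> (ptP (-1) (mat 1) \<odot> y) \<in> N"
        using that by (simp add: N_def scal HomPD(3)[OF f])
      from N0[OF this] show ?thesis using that by (simp add: \<pi>add scal)
    qed
    \<comment> \<open>Those values for which \<open>f\<close> and the covering agree up to the factor \<open>k\<close> are stable under the
      group, hence contain everything once they contain \<open>1\<close>. For \<open>k = 0\<close> the covering vanishes there,
      whatever the two twists are.\<close>
    have graph: "\<exists>x\<in>carrier P. f x = F \<and> \<pi> x = smult k F"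
      if x1: "x1 \<in> carrier P" "f x1 = 1" "\<pi> x1 = [:k:]" and k: "k = 0 \<or> (m = a \<and> (p - 1) dvd j)"
        and F: "degree F \<le> m" for x1 k F
    proof -
      define W where "W = {F. \<exists>x\<in>carrier P. f x = F \<and> \<pi> x = smult k F}"
      have ch: "chG j g = 1" if "(p - 1) dvd j" "g \<in> G" for g
        using that power_mod_exponent[of "det g" j 0] by (simp add: chG_def cong_def dvd_eq_mod_eq_0)
      have "F \<in> W"
      proof (rule polynomials_irreducible[OF m _ _ _ _ _ _ F])
        fix F F' assume "F \<in> W" "F' \<in> W"
        then obtain y y' where "y \<in> carrier P" "y' \<in> carrier P" "f y = F" "f y' = F'"
          "\<pi> y = smult k F" "\<pi> y' = smult k F'" unfolding W_def by blast
        then show "F + F' \<in> W" unfolding W_def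
          by (intro CollectI bexI[of _ "y \<oplus> y'"]) (auto simp: \<pi>add HomPD(3)[OF f] smult_add_right)
      next
        fix c F assume "F \<in> W"
        then obtain y where "y \<in> carrier P" "f y = F" "\<pi> y = smult k F" unfolding W_def by blast
        then show "smult c F \<in> W" unfolding W_def
          by (intro CollectI bexI[of _ "ptP c (mat 1) \<odot> y"]) (auto simp: scal mult.commute)
      next
        fix g F assume g: "g \<in> G" and "F \<in> W"
        then obtain y where y: "y \<in> carrier P" "f y = F" "\<pi> y = smult k F" unfolding W_def by blast
        let ?y = "ptP (1 / chG j g) g \<odot> y"
        have "chG j g \<noteq> 0" using g by (simp add: chG_def)
        then have "f ?y = slash m g F" using y g by (simp add: HomPD(4)[OF f])
        moreover have "\<pi> ?y = smult k (slash m g F)"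
          using y g k ch[OF _ g] by (auto simp: \<pi>act slash_smult)
        ultimately show "slash m g F \<in> W" unfolding W_def using y g by (intro CollectI bexI[of _ ?y]) auto
      next
        show "1 \<in> W" unfolding W_def using x1 by (intro CollectI bexI[of _ x1]) auto
      qed (use HomPD(2)[OF f] in \<open>auto simp: W_def\<close>)
      then show ?thesis by (simp add: W_def)
    qed
    have "1 \<in> f ` carrier P"
    proof (rule polynomials_irreducible[OF m _ _ _ _ _ x0(2)])
      fix F F' assume "F \<in> f ` carrier P" "F' \<in> f ` carrier P"
      then obtain y y' where "y \<in> carrier P" "y' \<in> carrier P" "F = f y" "F' = f y'" by blast
      then show "F + F' \<in> f ` carrier P"
        by (intro image_eqI[of _ _ "y \<oplus> y'"]) (auto simp: HomPD(3)[OF f])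
    next
      fix c F assume "F \<in> f ` carrier P"
      then obtain y where "y \<in> carrier P" "F = f y" by blast
      then show "smult c F \<in> f ` carrier P"
        by (intro image_eqI[of _ _ "ptP c (mat 1) \<odot> y"]) (auto simp: scal)
    next
      fix g F assume g: "g \<in> G" and "F \<in> f ` carrier P"
      then obtain y where "y \<in> carrier P" "F = f y" by blast
      moreover have "chG j g \<noteq> 0" using g by (simp add: chG_def)
      ultimately show "slash m g F \<in> f ` carrier P" using g
        by (intro image_eqI[of _ _ "ptP (1 / chG j g) g \<odot> y"]) (auto simp: HomPD(4)[OF f])
    qed (use x0 HomPD(2)[OF f] in auto)
    then obtain x1 where x1: "x1 \<in> carrier P" "f x1 = 1" by force
    define u :: "'f^2^2" where "u = mat2 1 1 0 1"
    have uG: "u \<in> G" unfolding u_def by (rule mat2_in_G) auto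
    have "f (act x1 u) = f x1"
      using HomPD(4)[OF f x1(1) uG, of 1] x1(2) by (simp add: slash_1 u_def chG_def flip: one_pCons)
    then have "\<pi> (act x1 u) = \<pi> x1" using x1 uG by (intro eq) auto
    then have "slash a u (\<pi> x1) = \<pi> x1" using \<pi>act[OF x1(1) uG, of 1] by simp
    then have "\<pi> x1 = [:poly (\<pi> x1) 0:]"
      using translation_fixed_const[OF \<pi>deg[OF x1(1)] am] by (simp add: u_def)
    then obtain c where c: "\<pi> x1 = [:c:]" by blast
    have "c \<noteq> 0"
    proof
      assume c0: "c = 0"
      have "1 \<in> \<pi> ` carrier P" unfolding \<pi>(2) Sym by simp
      then obtain y where y: "y \<in> carrier P" "\<pi> y = 1" by force
      obtain x where "x \<in> carrier P" "f x = f y" "\<pi> x = 0"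
        using graph[OF x1 c _ HomPD(2)[OF f, of y]] c0 by auto
      with eq[of x y] y show False by simp
    qed
    \<comment> \<open>The torus element acts on the constants in \<open>Sym\<close> by the left side, and on those among the values
      of \<open>f\<close> by the right side.\<close>
    have torus: "\<delta> ^ a = (\<alpha> * \<delta>) ^ j * \<delta> ^ m" if "\<alpha> \<in> Fp" "\<delta> \<in> Fp" "\<alpha> \<noteq> 0" "\<delta> \<noteq> 0" for \<alpha> \<delta> :: 'f
    proof -
      define t where "t = mat2 \<alpha> 0 0 \<delta>"
      define k where "k = (\<alpha> * \<delta>) ^ j * \<delta> ^ m"
      have tG: "t \<in> G" unfolding t_def by (rule mat2_in_G) (use that in auto)
      have "f (act x1 t) = f (ptP k (mat 1) \<odot> x1)"
        using HomPD(4)[OF f x1(1) tG, of 1] x1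
        by (simp add: slash_1 t_def chG_def scal k_def poly_const_pow)
      then have "\<pi> (act x1 t) = \<pi> (ptP k (mat 1) \<odot> x1)" using x1 tG by (intro eq) auto
      moreover have "\<pi> (act x1 t) = smult c (slash a t 1)"
        using \<pi>act[OF x1(1) tG, of 1] slash_smult[of a t c 1] by (simp add: c)
      moreover have "slash a t 1 = [:\<delta> ^ a:]" by (simp add: slash_1 t_def poly_const_pow)
      ultimately have "[:c * \<delta> ^ a:] = [:k * c:]" using x1 by (simp add: scal c)
      then show ?thesis using \<open>c \<noteq> 0\<close> by (simp add: k_def)
    qed
    have dvd: "(p - 1) dvd j"
      by (rule exponent_dvd) (use torus[of _ 1] in simp)
    have da: "\<delta> ^ a = \<delta> ^ m" if "\<delta> \<in> Fp" "\<delta> \<noteq> 0" for \<delta> :: 'f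
      using torus[of "1 / \<delta>" \<delta>] that by simp
    have "m = a"
    proof (cases "a \<le> m")
      case True
      have "(p - 1) dvd (m - a)"
        by (rule exponent_dvd) (use da True in \<open>auto simp: power_diff\<close>)
      moreover have "m - a < p - 1" using m a_ge a_le by linarith
      ultimately show ?thesis using True by (metis diff_is_0_eq le_antisym nat_dvd_not_less neq0_conv)
    next
      case False
      have "(p - 1) dvd (a - m)"
        by (rule exponent_dvd) (use da False in \<open>auto simp: power_diff\<close>)
      moreover have "a - m < p - 1" using a_le a_ge by linarith
      ultimately show ?thesis using False by (metis diff_is_0_eq nat_dvd_not_less neq0_conv nat_le_linear)
    qed
    moreover have "f x = smult (1 / c) (\<pi>0 x)" for x
    proof (cases "x \<in> carrier P")
      case True
      obtain y where y: "y \<in> carrier P" "f y = f x" "\<pi> y = smult c (f x)"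
        using graph[OF x1 c _ HomPD(2)[OF f, of x]] \<open>m = a\<close> dvd by auto
      then have "\<pi> x = smult c (f x)" using eq[OF True y(1)] by simp
      then show ?thesis using True \<open>c \<noteq> 0\<close> by (simp add: \<pi>0_def)
    qed (simp add: \<pi>0_def HomPD(1)[OF f])
    ultimately show ?thesis using dvd by (intro conjI exI[of _ "1 / c"] ext)
  qed
  show ?thesis
  proof (cases "m = a \<and> (p - 1) dvd j")
    case True
    have ch: "chG j g = 1" if "g \<in> G" for g
      using that True power_mod_exponent[of "det g" j 0] by (simp add: chG_def cong_def dvd_eq_mod_eq_0)
    have "\<pi>0 \<in> HomP G m (chG j)"
      by (rule HomPI) (use True ch in \<open>auto simp: \<pi>0_def \<pi>deg \<pi>add \<pi>act\<close>)
    moreover have "\<pi>0 \<noteq> (\<lambda>_. 0)"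
    proof
      assume z: "\<pi>0 = (\<lambda>_. 0)"
      have "1 \<in> \<pi> ` carrier P" unfolding \<pi>(2) Sym by simp
      then obtain y where "y \<in> carrier P" "\<pi> y = 1" by force
      with fun_cong[OF z, of y] show False by (simp add: \<pi>0_def)
    qed
    moreover have "\<exists>c. h = (\<lambda>x. smult c (\<pi>0 x))" if "h \<in> HomP G m (chG j)" for h
    proof (cases "h = (\<lambda>_. 0)")
      case True
      then show ?thesis by (intro exI[of _ 0]) simp
    next
      case False
      then show ?thesis using main[OF that] by simp
    qed
    ultimately have "has_dim (HomP G m (chG j)) 1" by (intro has_dim_line fun_subspace_HomP)
    with True show ?thesis by simp
  next
    case False
    have "HomP G m (chG j) = {\<lambda>_. 0}"
    proof (rule equalityI; rule subsetI)
      fix f assume "f \<in> HomP G m (chG j)"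
      then show "f \<in> {\<lambda>_. 0}" using main[of f] False by (metis singletonI)
    qed (use fun_subspaceD(1)[OF fun_subspace_HomP] in simp)
    then have "has_dim (HomP G m (chG j)) 0" using has_dim_zero by simp
    moreover have "(if m = a \<and> (p - 1) dvd j then 1 else 0) = (0 :: nat)" using False by simp
    ultimately show ?thesis by (simp only:)
  qed
qed

subsection \<open>The dimension formulas\<close>

text \<open>
  The multiplicity of \<open>Sym\<close> in the representation induced from the character with exponents \<open>x\<close> and
  \<open>y\<close>: the degrees of its two constituents are \<open>b \<equiv> x - y\<close> and \<open>p - 1 - b\<close>.
\<close>

definition eB :: "nat \<Rightarrow> nat \<Rightarrow> nat" where
  "eB x y = (if [x = a] (mod (p - 1)) \<and> (p - 1) dvd y then 1 else 0) +
     (if (p - 1) dvd x \<and> [y = a] (mod (p - 1)) then 1 else 0)"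

lemma has_dim_chB: "has_dim (HomP B 0 (chB x y)) (eB x y)"
proof -
  define q where "q = p - 1"
  have q: "q \<ge> 4" "a + 3 \<le> q" using a_le a_ge by (auto simp: q_def)
  \<comment> \<open>The representative of \<open>x - y\<close> in \<open>{1..p - 1}\<close>; the residue zero is represented by \<open>p - 1\<close>.\<close>
  define b where "b = (let r = (x + (q - y mod q)) mod q in if r = 0 then q else r)"
  have b: "1 \<le> b" "b \<le> q" using q by (auto simp: b_def Let_def intro: less_imp_le)
  have "[b = x + (q - y mod q)] (mod q)" by (simp add: b_def Let_def cong_def)
  then have "[b + y = x + (q - y mod q) + y] (mod q)" by (rule cong_add_rcancel_nat[THEN iffD2])
  moreover have "x + (q - y mod q) + y = x + q * (1 + y div q)"
  proof -
    have "y = q * (y div q) + y mod q" by simp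
    moreover have "q - y mod q + y mod q = q" using q by (simp add: less_imp_le)
    moreover have "q * (1 + y div q) = q + q * (y div q)" by simp
    ultimately show ?thesis by linarith
  qed
  ultimately have bx: "[b + y = x] (mod q)" by (simp only: cong_def mod_mult_self2)
  have "HomP B 0 (chB x y) = HomP B 0 (chB (b + y) y)"
  proof (rule HomP_cong)
    fix u assume u: "u \<in> B"
    then have "u $ 1 $ 1 ^ x = u $ 1 $ 1 ^ (b + y)"
      using bx B_diag[OF u] by (intro power_mod_exponent) (auto simp: q_def cong_sym)
    then show "chB x y u = chB (b + y) y u" by (simp add: chB_def)
  qed
  moreover have "has_dim (HomP B 0 (chB (b + y) y))
    ((if b = a \<and> (p - 1) dvd y then 1 else 0) + (if p - 1 - b = a \<and> (p - 1) dvd (b + y) then 1 else 0))"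
    by (rule has_dim_character[OF b[unfolded q_def] has_dim_irreducible has_dim_irreducible])
      (use b p_gt_1 in \<open>auto simp: q_def\<close>)
  moreover have "(if b = a \<and> (p - 1) dvd y then 1 else 0) +
      (if p - 1 - b = a \<and> (p - 1) dvd (b + y) then 1 else 0) = eB x y"
  proof -
    have 1: "b = a \<longleftrightarrow> [x = a] (mod q)" if "q dvd y"
    proof -
      have "[b + y = b] (mod q)" using that by (auto simp: cong_def elim!: dvdE)
      then have "[x = a] (mod q) \<longleftrightarrow> [b = a] (mod q)" using bx by (meson cong_sym cong_trans)
      also have "\<dots> \<longleftrightarrow> b = a"
      proof (cases "b = q")
        case True
        then show ?thesis using q a_ge by (auto simp: cong_def)
      next
        case False
        then show ?thesis using q b by (simp add: cong_def)
      qed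
      finally show ?thesis ..
    qed
    have 2: "q dvd (b + y) \<longleftrightarrow> q dvd x" using bx by (rule cong_dvd_iff)
    have 3: "q - b = a \<longleftrightarrow> [y = a] (mod q)" if d: "q dvd (b + y)"
    proof
      assume "q - b = a"
      then have ab: "a + b = q" using b a_ge by simp
      have "[y + b = a + b] (mod q)"
        using d unfolding ab by (simp add: cong_def add.commute dvd_eq_mod_eq_0)
      then show "[y = a] (mod q)" by (simp add: cong_add_rcancel_nat)
    next
      assume "[y = a] (mod q)"
      then have "[b + y = b + a] (mod q)" by (simp add: cong_add_lcancel_nat)
      then have "q dvd b + a" using d by (simp add: cong_dvd_iff)
      then obtain k where k: "b + a = q * k" by (elim dvdE)
      have "0 < q * k" "q * k < q * 2" using b q a_ge unfolding k[symmetric] by auto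
      then have "0 < k" "k < 2" by (simp, metis mult_less_cancel1)
      then have "k = 1" by simp
      with k show "q - b = a" by simp
    qed
    show ?thesis unfolding eB_def q_def[symmetric] using 1 2 3 by auto
  qed
  ultimately show ?thesis by simp
qed

lemma has_dim_B: "has_dim (HomP B m (chB x y)) (\<Sum>i\<le>m. eB (x + i) (y + (m - i)))"
proof (induction m arbitrary: y)
  case 0
  then show ?case using has_dim_chB[of x y] by simp
next
  case (Suc m)
  have "(\<Sum>i\<le>m. eB (x + i) (Suc y + (m - i))) + eB (x + Suc m) y = (\<Sum>i\<le>Suc m. eB (x + i) (y + (Suc m - i)))"
    by (simp add: Suc_diff_le)
  then show ?case using has_dim_B_step[OF Suc.IH[of "Suc y"] has_dim_chB[of "x + Suc m" y]] by simp
qed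

text \<open>
  Dividing by the invariant form \<open>i\<close> times lowers the degree by \<open>i (p + 1)\<close> and raises the twist by \<open>i\<close>; the
  two terms count the steps at which the first and the second constituent of the induced representation is
  \<open>Sym\<close>.
\<close>

definition dim_ur :: "nat \<Rightarrow> nat \<Rightarrow> nat" where
  "dim_ur m j = card {i. i * (p + 1) + a \<le> m \<and> (p - 1) dvd (j + i)} +
     card {i. i * (p + 1) + p \<le> m \<and> [j + i = a] (mod (p - 1))}"

lemma card_shift:
  fixes s m :: nat
  assumes "\<And>i. Q' i \<longleftrightarrow> Q (Suc i)"
  shows "card {i. i * (p + 1) + s \<le> m \<and> Q i} = (if s \<le> m \<and> Q 0 then 1 else 0) +
    (if p + 1 \<le> m then card {i. i * (p + 1) + s \<le> m - p - 1 \<and> Q' i} else 0)"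
proof -
  let ?A = "{i. i * (p + 1) + s \<le> m \<and> Q i}"
  let ?B = "if s \<le> m \<and> Q 0 then {0 :: nat} else {}"
  let ?C = "if p + 1 \<le> m then {i. i * (p + 1) + s \<le> m - p - 1 \<and> Q' i} else {}"
  have eq: "?A = ?B \<union> Suc ` ?C"
  proof (rule Set.set_eqI)
    fix i show "i \<in> ?A \<longleftrightarrow> i \<in> ?B \<union> Suc ` ?C"
      using assms by (cases i) auto
  qed
  have "finite ?C"
  proof (rule finite_subset)
    show "?C \<subseteq> {..m}" by auto
  qed simp
  then have "card ?A = card ?B + card (Suc ` ?C)"
    unfolding eq by (intro card_Un_disjoint) auto
  also have "card (Suc ` ?C) = card ?C" by (rule card_image) simp
  finally show ?thesis by auto
qed

lemma dim_ur_step: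
  "dim_ur m j = (if a \<le> m \<and> (p - 1) dvd j then 1 else 0) + (if p \<le> m \<and> [j = a] (mod (p - 1)) then 1 else 0) +
     (if p + 1 \<le> m then dim_ur (m - p - 1) (Suc j) else 0)"
proof -
  have A: "card {i. i * (p + 1) + a \<le> m \<and> (p - 1) dvd (j + i)} = (if a \<le> m \<and> (p - 1) dvd (j + 0) then 1 else 0) +
      (if p + 1 \<le> m then card {i. i * (p + 1) + a \<le> m - p - 1 \<and> (p - 1) dvd (Suc j + i)} else 0)"
    by (rule card_shift) simp
  have B: "card {i. i * (p + 1) + p \<le> m \<and> [j + i = a] (mod (p - 1))} = (if p \<le> m \<and> [j + 0 = a] (mod (p - 1)) then 1 else 0) +
      (if p + 1 \<le> m then card {i. i * (p + 1) + p \<le> m - p - 1 \<and> [Suc j + i = a] (mod (p - 1))} else 0)"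
    by (rule card_shift) simp
  show ?thesis unfolding dim_ur_def A B by (cases "p + 1 \<le> m") (simp_all only: if_True if_False add_0_left add_0_right add_ac)
qed

lemma has_dim_G:
  assumes "[m + 2 * j = a] (mod (p - 1))"
  shows "has_dim (HomP G m (chG j)) (dim_ur m j)"
  using assms
proof (induction m arbitrary: j rule: less_induct)
  case (less m)
  define q where "q = p - 1"
  have q: "q \<ge> 4" "a + 3 \<le> q" "p = q + 1" using a_le a_ge by (auto simp: q_def)
  have c: "[m + 2 * j = a] (mod q)" using less.prems by (simp add: q_def)
  have j0: "[m + j = a] (mod q) \<longleftrightarrow> True" "[m = a] (mod q)" if "q dvd j"
  proof -
    have j: "j mod q = 0" "2 * j mod q = 0" using that by auto
    have "(m + j) mod q = (m + 2 * j) mod q" "m mod q = (m + 2 * j) mod q"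
      using j by (metis mod_add_right_eq add.right_neutral)+
    then show "[m + j = a] (mod q) \<longleftrightarrow> True" "[m = a] (mod q)" using c by (simp_all add: cong_def)
  qed
  have ja: "q dvd (m + j)" if "[j = a] (mod q)"
  proof -
    have "[(m + j) + j = 0 + a] (mod q)" using c by (simp add: mult_2 add.assoc)
    moreover have "[(m + j) + j = (m + j) + a] (mod q)" using that by (simp add: cong_add_lcancel_nat)
    ultimately have "[(m + j) + a = 0 + a] (mod q)" by (meson cong_sym cong_trans)
    then have "[m + j = 0] (mod q)" by (simp only: cong_add_rcancel_nat)
    then show ?thesis by (simp add: cong_0_iff)
  qed
  show ?case
  proof (cases "m < p")
    case True
    have "m = a \<longleftrightarrow> a \<le> m" if "q dvd j"
    proof
      assume "a \<le> m"
      have "[m = a] (mod q)" by (rule j0(2)[OF that])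
      then have "q dvd m - a" using \<open>a \<le> m\<close> by (simp add: cong_altdef_nat)
      moreover have "m - a < q" using True q a_ge by simp
      ultimately show "m = a" using \<open>a \<le> m\<close> by (metis diff_is_0_eq le_antisym nat_dvd_not_less neq0_conv)
    qed simp
    then have "dim_ur m j = (if m = a \<and> (p - 1) dvd j then 1 else 0)"
      using True unfolding q_def by (subst dim_ur_step) auto
    then show ?thesis using has_dim_irreducible[OF True] by simp
  next
    case False
    then have m: "p \<le> m" by simp
    have e: "eB (m + j) j = (if (p - 1) dvd j then 1 else 0) + (if [j = a] (mod (p - 1)) then 1 else 0)"
      unfolding eB_def q_def[symmetric] using j0 ja by auto
    have "has_dim (if m = p then {\<lambda>_. 0} else HomP G (m - p - 1) (chG (Suc j)))
        (if p + 1 \<le> m then dim_ur (m - p - 1) (Suc j) else 0)"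
    proof (cases "m = p")
      case True
      then show ?thesis by (simp add: has_dim_zero)
    next
      case False
      have "(m - p - 1) + 2 * Suc j + q = m + 2 * j" using False m q by simp
      then have "[(m - p - 1) + 2 * Suc j = a] (mod q)" using c by (metis cong_def mod_add_self2)
      then have "has_dim (HomP G (m - p - 1) (chG (Suc j))) (dim_ur (m - p - 1) (Suc j))"
        by (intro less.IH) (use False m p_gt_1 in \<open>auto simp: q_def\<close>)
      then show ?thesis using False m by simp
    qed
    moreover have "(if p + 1 \<le> m then dim_ur (m - p - 1) (Suc j) else 0) + eB (m + j) j = dim_ur m j"
      unfolding e using m a_le by (subst dim_ur_step) simp
    ultimately show ?thesis using has_dim_G_step[OF m _ has_dim_chB] by metis
  qed
qed

end

section \<open>The p-adic absolute value\<close>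

locale padic =
  fixes p :: nat and ty :: "'c::{field_char_0,complete_space} itself"
  assumes prime_p: "prime p" and Cp: "is_Cp p TYPE('c)"
begin

abbreviation av :: "'c \<Rightarrow> real" where "av x \<equiv> dist x 0"

lemma dist_av: "dist x y = av (x - y)"
  and av_mult: "av (x * y) = av x * av y"
  and av_add: "av (x + y) \<le> max (av x) (av y)"
  and av_p: "av (of_nat p) = 1 / real p"
  using Cp unfolding is_Cp_def by blast+

lemma p_gt_1: "p > 1"
  using prime_p by (rule prime_gt_1_nat)

lemma av_1 [simp]: "av 1 = 1"
proof -
  have "av 1 = av 1 * av 1" using av_mult[of 1 1] by simp
  moreover have "av 1 \<noteq> 0" by simp
  ultimately show ?thesis by simp
qed

lemma av_minus [simp]: "av (- x) = av x"
  using dist_av[of 0 x] by (simp add: dist_commute)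

lemma av_diff: "av (x - y) \<le> max (av x) (av y)"
  using av_add[of x "- y"] by simp

lemma av_diff_commute: "av (x - y) = av (y - x)"
  by (metis av_minus minus_diff_eq)

lemma av_power: "av (x ^ n) = av x ^ n"
  by (induction n) (simp_all add: av_mult)

lemma av_inverse: "av (inverse x) = inverse (av x)"
proof (cases "x = 0")
  case False
  have "av x * av (inverse x) = 1" using False by (simp flip: av_mult)
  then show ?thesis by (metis inverse_unique)
qed simp

lemma av_divide: "av (x / y) = av x / av y"
  by (simp add: divide_inverse av_mult av_inverse)

lemma av_add_le: "av x \<le> r \<Longrightarrow> av y \<le> r \<Longrightarrow> av (x + y) \<le> r"
  using av_add[of x y] by simp

lemma av_diff_le: "av x \<le> r \<Longrightarrow> av y \<le> r \<Longrightarrow> av (x - y) \<le> r"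
  using av_diff[of x y] by simp

lemma av_mult_le_1: "av x \<le> 1 \<Longrightarrow> av y \<le> r \<Longrightarrow> av (x * y) \<le> r"
  unfolding av_mult using mult_mono[of "av x" 1 "av y" r] by simp

lemma av_sum_le: "(\<And>i. i \<in> I \<Longrightarrow> av (f i) \<le> r) \<Longrightarrow> 0 \<le> r \<Longrightarrow> av (\<Sum>i\<in>I. f i) \<le> r"
  by (induction I rule: infinite_finite_induct) (auto intro: av_add_le)

lemma av_eq_of_close: "av (x - y) < av y \<Longrightarrow> av x = av y"
proof -
  assume h: "av (x - y) < av y"
  have "av x \<le> max (av (x - y)) (av y)" using av_add[of "x - y" y] by simp
  moreover have "av y \<le> max (av x) (av (x - y))" using av_diff[of x "x - y"] by simp
  ultimately show ?thesis using h by linarith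
qed

lemma av_of_nat_le_1: "av (of_nat n) \<le> 1"
  by (induction n) (auto intro: av_add_le)

lemma av_of_int_le_1: "av (of_int n) \<le> 1"
  by (cases n) (simp_all add: av_of_nat_le_1 del: of_nat_Suc)

lemma av_p_power: "av (of_nat p ^ n) = (1 / real p) ^ n"
  by (simp add: av_power av_p)

lemma av_of_int_dvd: "int p ^ n dvd m \<Longrightarrow> av (of_int m) \<le> (1 / real p) ^ n"
proof -
  assume "int p ^ n dvd m"
  then obtain k where "m = int p ^ n * k" by (elim dvdE)
  then have "av (of_int m) = (1 / real p) ^ n * av (of_int k)" by (simp add: av_mult av_p_power)
  also have "\<dots> \<le> (1 / real p) ^ n * 1" by (intro mult_left_mono av_of_int_le_1) simp
  finally show ?thesis by simp
qed

lemma av_of_int_unit: "\<not> int p dvd m \<Longrightarrow> av (of_int m) = 1"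
proof -
  assume n: "\<not> int p dvd m"
  have "coprime (int p) m" using n prime_p by (simp add: prime_imp_coprime)
  then obtain u v where uv: "u * int p + v * m = 1" using bezout_int[of "int p" m] by auto
  have "av (of_int (v * m)) = 1"
  proof (rule ccontr)
    assume "av (of_int (v * m)) \<noteq> 1"
    then have 1: "av (of_int (v * m)) < 1" using av_of_int_le_1[of "v * m"] by simp
    have 2: "av (of_int (u * int p)) \<le> (1 / real p) ^ 1" by (rule av_of_int_dvd) simp
    have "of_int (u * int p) + of_int (v * m) = (1 :: 'c)"
      by (simp only: uv of_int_1 flip: of_int_add)
    then have "1 \<le> max (av (of_int (u * int p))) (av (of_int (v * m)))"
      using av_add[of "of_int (u * int p)" "of_int (v * m)"] by simp
    moreover have "(1 / real p) ^ 1 < 1" using p_gt_1 by simp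
    ultimately show False using 1 2 by (simp only: le_max_iff_disj) linarith
  qed
  then have 1: "av (of_int v) * av (of_int m) = 1" by (simp add: av_mult)
  have "av (of_int v) * av (of_int m) \<le> 1 * av (of_int m)"
    by (intro mult_right_mono av_of_int_le_1) simp
  with 1 av_of_int_le_1[of m] show ?thesis by simp
qed

lemma av_of_int_lt_1: "av (of_int m) < 1 \<longleftrightarrow> int p dvd m"
proof
  assume "int p dvd m"
  then have "av (of_int m) \<le> (1 / real p) ^ 1" by (intro av_of_int_dvd) simp
  also have "(1 / real p) ^ 1 < 1" using p_gt_1 by simp
  finally show "av (of_int m) < 1" .
qed (use av_of_int_unit in force)

lemma inverse_p_power_tendsto: "(\<lambda>n. (1 / real p) ^ n) \<longlonglongrightarrow> 0"
  using p_gt_1 by (intro LIMSEQ_power_zero) simp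

lemma ex_p_power_lt: "e > 0 \<Longrightarrow> \<exists>n\<ge>m. (1 / real p) ^ n < e"
proof -
  assume "e > 0"
  with inverse_p_power_tendsto have "\<forall>\<^sub>F n in sequentially. (1 / real p) ^ n < e"
    by (rule order_tendstoD)
  then obtain N where "\<forall>n\<ge>N. (1 / real p) ^ n < e" by (auto simp: eventually_sequentially)
  then show ?thesis by (intro exI[of _ "max m N"]) simp
qed

lemma eq_0_if_small: "(\<And>n. av x \<le> (1 / real p) ^ n) \<Longrightarrow> x = 0"
proof (rule ccontr)
  assume h: "\<And>n. av x \<le> (1 / real p) ^ n" and "x \<noteq> 0"
  then obtain n where "(1 / real p) ^ n < av x" using ex_p_power_lt[of "av x" 0] by auto
  with h[of n] show False by simp
qed

subsection \<open>Valuations\<close>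

lemma log_p_le_iff: "x > 0 \<Longrightarrow> y > 0 \<Longrightarrow> log (real p) x \<le> log (real p) y \<longleftrightarrow> x \<le> y"
  using p_gt_1 by simp

lemma vp_ge_iff: "ereal (real n) \<le> vp p x \<longleftrightarrow> av x \<le> (1 / real p) ^ n"
proof (cases "x = 0")
  case False
  have "log (real p) ((1 / real p) ^ n) = - real n"
    using p_gt_1 by (simp add: log_nat_power log_divide)
  then have "real n \<le> - log (real p) (av x) \<longleftrightarrow> log (real p) (av x) \<le> log (real p) ((1 / real p) ^ n)" by auto
  also have "\<dots> \<longleftrightarrow> av x \<le> (1 / real p) ^ n" using False p_gt_1 by (intro log_p_le_iff) auto
  finally show ?thesis using False by (simp add: vp_def)
qed (simp add: vp_def)

lemma vp_nonneg_iff: "0 \<le> vp p x \<longleftrightarrow> av x \<le> 1"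
  using vp_ge_iff[of 0 x] by (simp add: zero_ereal_def)

lemma vp_ge_1_iff: "1 \<le> vp p x \<longleftrightarrow> av x \<le> 1 / real p"
  using vp_ge_iff[of 1 x] by (simp add: one_ereal_def)

lemma vp_pos_iff: "0 < vp p x \<longleftrightarrow> av x < 1"
proof (cases "x = 0")
  case False
  then show ?thesis using p_gt_1 by (simp add: vp_def zero_ereal_def)
qed (simp add: vp_def)

lemma vp_eq_0_iff: "vp p x = 0 \<longleftrightarrow> av x = 1"
  using vp_nonneg_iff[of x] vp_pos_iff[of x] by (metis order_le_less order_less_irrefl)

subsection \<open>Limits\<close>

lemma tendsto_av: "X \<longlonglongrightarrow> L \<longleftrightarrow> (\<forall>e>0. \<exists>N. \<forall>n\<ge>N. av (X n - L) < e)"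
proof -
  have "dist (X n) L = av (X n - L)" for n by (rule dist_av)
  then show ?thesis unfolding lim_sequentially by (simp only:)
qed

lemma tendsto_add_av: "X \<longlonglongrightarrow> x \<Longrightarrow> Y \<longlonglongrightarrow> y \<Longrightarrow> (\<lambda>n. X n + Y n :: 'c) \<longlonglongrightarrow> x + y"
  unfolding tendsto_av
proof (intro allI impI)
  fix e :: real assume X: "\<forall>e>0. \<exists>N. \<forall>n\<ge>N. av (X n - x) < e" and Y: "\<forall>e>0. \<exists>N. \<forall>n\<ge>N. av (Y n - y) < e" and e: "e > 0"
  from X e obtain N1 where N1: "\<forall>n\<ge>N1. av (X n - x) < e" by blast
  from Y e obtain N2 where N2: "\<forall>n\<ge>N2. av (Y n - y) < e" by blast
  have "av (X n + Y n - (x + y)) < e" if "n \<ge> max N1 N2" for n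
  proof -
    have "av (X n + Y n - (x + y)) = av ((X n - x) + (Y n - y))" by (simp add: algebra_simps)
    also have "\<dots> \<le> max (av (X n - x)) (av (Y n - y))" by (rule av_add)
    also have "\<dots> < e" using N1 N2 that by simp
    finally show ?thesis .
  qed
  then show "\<exists>N. \<forall>n\<ge>N. av (X n + Y n - (x + y)) < e" by blast
qed

lemma tendsto_mult_left_av: "X \<longlonglongrightarrow> x \<Longrightarrow> (\<lambda>n. c * X n :: 'c) \<longlonglongrightarrow> c * x"
proof (cases "c = 0")
  case False
  assume X: "X \<longlonglongrightarrow> x"
  show ?thesis unfolding tendsto_av
  proof (intro allI impI)
    fix e :: real assume "e > 0"
    then have "e / av c > 0" using False by simp
    then obtain N where "\<forall>n\<ge>N. av (X n - x) < e / av c" using X unfolding tendsto_av by blast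
    then have "av (c * X n - c * x) < e" if "n \<ge> N" for n
    proof -
      have "c * X n - c * x = c * (X n - x)" by (simp add: right_diff_distrib)
      then have "av (c * X n - c * x) = av c * av (X n - x)" by (simp only: av_mult)
      moreover have "av c * av (X n - x) < e"
        using \<open>\<forall>n\<ge>N. av (X n - x) < e / av c\<close> that False
        by (simp add: pos_less_divide_eq mult.commute)
      ultimately show ?thesis by simp
    qed
    then show "\<exists>N. \<forall>n\<ge>N. av (c * X n - c * x) < e" by blast
  qed
qed auto

lemma tendsto_sum_av: "(\<And>i. i \<in> I \<Longrightarrow> (\<lambda>n. X i n) \<longlonglongrightarrow> x i) \<Longrightarrow> (\<lambda>n. \<Sum>i\<in>I. X i n :: 'c) \<longlonglongrightarrow> (\<Sum>i\<in>I. x i)"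
  by (induction I rule: infinite_finite_induct) (auto intro: tendsto_add_av)

lemma tendsto_av_le:
  assumes "X \<longlonglongrightarrow> L" "\<And>n. n \<ge> N \<Longrightarrow> av (X n - y) \<le> r" "0 \<le> r"
  shows "av (L - y) \<le> r"
proof (rule ccontr)
  assume n: "\<not> av (L - y) \<le> r"
  then have pos: "av (L - y) > 0" using assms(3) by linarith
  then obtain M where M: "\<forall>n\<ge>M. av (X n - L) < av (L - y)" using assms(1) unfolding tendsto_av by blast
  define n where "n = max N M"
  have "av (X n - y - (L - y)) < av (L - y)" using M by (simp add: n_def)
  then have "av (X n - y) = av (L - y)" by (rule av_eq_of_close)
  with assms(2)[of n] n show False by (simp add: n_def)
qed

lemma tendsto_same:
  assumes "X \<longlonglongrightarrow> x" "\<And>n. av (X n - Y n) \<le> (1 / real p) ^ n" 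
  shows "Y \<longlonglongrightarrow> (x :: 'c)"
  unfolding tendsto_av
proof (intro allI impI)
  fix e :: real assume e: "e > 0"
  obtain N where N: "\<forall>n\<ge>N. av (X n - x) < e" using assms(1) e unfolding tendsto_av by blast
  have "\<forall>\<^sub>F n in sequentially. (1 / real p) ^ n < e"
    using inverse_p_power_tendsto e by (rule order_tendstoD)
  then obtain M where M: "\<forall>n\<ge>M. (1 / real p) ^ n < e" by (auto simp: eventually_sequentially)
  have "av (Y n - x) < e" if "n \<ge> max N M" for n
  proof -
    have "av (Y n - x) = av ((X n - x) - (X n - Y n))" by simp
    also have "\<dots> \<le> max (av (X n - x)) (av (X n - Y n))" by (rule av_diff)
    also have "\<dots> < e" using N M assms(2)[of n] that le_less_trans[of _ "(1 / real p) ^ n" e] by simp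
    finally show ?thesis .
  qed
  then show "\<exists>N. \<forall>n\<ge>N. av (Y n - x) < e" by blast
qed

lemma Cauchy_av:
  assumes "\<And>e. e > 0 \<Longrightarrow> \<exists>N. \<forall>n\<ge>N. av (X (Suc n) - X n) < e"
  shows "Cauchy (X :: nat \<Rightarrow> 'c)"
proof (rule metric_CauchyI)
  fix e :: real assume e: "e > 0"
  from assms[OF e] obtain N where N: "\<And>n. n \<ge> N \<Longrightarrow> av (X (Suc n) - X n) < e" by blast
  have step: "av (X (N + k) - X N) < e" for k
  proof (induction k)
    case (Suc k)
    have "X (N + Suc k) - X N = (X (Suc (N + k)) - X (N + k)) + (X (N + k) - X N)" by simp
    then have "av (X (N + Suc k) - X N) \<le> max (av (X (Suc (N + k)) - X (N + k))) (av (X (N + k) - X N))"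
      using av_add by metis
    also have "\<dots> < e" using N[of "N + k"] Suc by simp
    finally show ?case .
  qed (use e in simp)
  have "dist (X m) (X n) < e" if "m \<ge> N" "n \<ge> N" for m n
  proof -
    have "X m - X n = (X m - X N) - (X n - X N)" by simp
    then have "av (X m - X n) \<le> max (av (X m - X N)) (av (X n - X N))"
      using av_diff by metis
    then have "dist (X m) (X n) \<le> max (av (X m - X N)) (av (X n - X N))"
      using dist_av[of "X m" "X n"] by simp
    also have "\<dots> < e" using step[of "m - N"] step[of "n - N"] that by simp
    finally show ?thesis .
  qed
  then show "\<exists>M. \<forall>m\<ge>M. \<forall>n\<ge>M. dist (X m) (X n) < e" by blast
qed

lemma convergent_p_power:
  assumes "\<And>n. av (X (Suc n) - X n) \<le> (1 / real p) ^ n"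
  shows "\<exists>L. X \<longlonglongrightarrow> L \<and> (\<forall>n. av (L - X n) \<le> (1 / real p) ^ n)"
proof -
  have mono: "(1 / real p) ^ m \<le> (1 / real p) ^ n" if "n \<le> m" for m n
    using p_gt_1 that by (intro power_decreasing) auto
  have "Cauchy X"
  proof (rule Cauchy_av)
    fix e :: real assume "e > 0"
    then obtain n where n: "(1 / real p) ^ n < e" using ex_p_power_lt by blast
    have "av (X (Suc m) - X m) < e" if "m \<ge> n" for m
      using assms[of m] mono[OF that] n by linarith
    then show "\<exists>N. \<forall>n\<ge>N. av (X (Suc n) - X n) < e" by blast
  qed
  then obtain L where L: "X \<longlonglongrightarrow> L" using Cauchy_convergent_iff convergent_def by blast
  moreover have "av (L - X n) \<le> (1 / real p) ^ n" for n
  proof (rule tendsto_av_le[OF L])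
    fix m assume "n \<le> m"
    then show "av (X m - X n) \<le> (1 / real p) ^ n"
    proof (induction m rule: dec_induct)
      case (step m)
      have "X (Suc m) - X n = (X (Suc m) - X m) + (X m - X n)" by simp
      then show ?case using av_add_le[of "X (Suc m) - X m" "(1 / real p) ^ n" "X m - X n"]
        assms[of m] mono[of n m] step by simp
    qed simp
  qed simp
  ultimately show ?thesis by blast
qed

subsection \<open>The p-adic numbers\<close>

lemma Qp_iff: "x \<in> (Qp :: 'c set) \<longleftrightarrow> (\<forall>e>0. \<exists>y\<in>\<rat>. av (y - x) < e)"
proof -
  have "dist y x = av (y - x)" for y by (rule dist_av)
  then show ?thesis unfolding Qp_def closure_approachable by (simp only:)
qed

lemma Qp_rat: "x \<in> \<rat> \<Longrightarrow> x \<in> (Qp :: 'c set)"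
  unfolding Qp_def using closure_subset by blast

lemma Qp_of_int [simp]: "of_int n \<in> (Qp :: 'c set)" and Qp_of_nat [simp]: "of_nat k \<in> (Qp :: 'c set)"
  by (simp_all add: Qp_rat)

lemma Qp_0 [simp]: "0 \<in> (Qp :: 'c set)" and Qp_1 [simp]: "1 \<in> (Qp :: 'c set)"
  by (simp_all add: Qp_rat)

lemma closed_Qp: "closed (Qp :: 'c set)"
  by (simp add: Qp_def)

lemma Qp_minus [simp]: "x \<in> (Qp :: 'c set) \<Longrightarrow> - x \<in> Qp"
  unfolding Qp_iff
proof (intro allI impI)
  fix e :: real assume "\<forall>e>0. \<exists>y\<in>\<rat>. av (y - x) < e" "e > 0"
  then obtain y where y: "y \<in> \<rat>" "av (y - x) < e" by blast
  have "av (- y - - x) = av (y - x)" by (metis av_minus minus_diff_eq minus_diff_minus)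
  then show "\<exists>y\<in>\<rat>. av (y - - x) < e" using y by (intro bexI[of _ "- y"]) auto
qed

lemma Qp_add [simp]: "x \<in> (Qp :: 'c set) \<Longrightarrow> y \<in> Qp \<Longrightarrow> x + y \<in> Qp"
proof -
  assume x: "x \<in> Qp" and y: "y \<in> (Qp :: 'c set)"
  show "x + y \<in> Qp" unfolding Qp_iff
  proof (intro allI impI)
    fix e :: real assume e: "e > 0"
    obtain u where u: "u \<in> \<rat>" "av (u - x) < e" using x e unfolding Qp_iff by blast
    obtain v where v: "v \<in> \<rat>" "av (v - y) < e" using y e unfolding Qp_iff by blast
    have "av (u + v - (x + y)) = av ((u - x) + (v - y))" by (simp add: algebra_simps)
    also have "\<dots> < e" using av_add[of "u - x" "v - y"] u v by simp
    finally show "\<exists>z\<in>\<rat>. av (z - (x + y)) < e" using u v by (intro bexI[of _ "u + v"]) auto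
  qed
qed

lemma Qp_diff [simp]: "x \<in> (Qp :: 'c set) \<Longrightarrow> y \<in> Qp \<Longrightarrow> x - y \<in> Qp"
  using Qp_add[of x "- y"] by simp

lemma Qp_mult [simp]: "x \<in> (Qp :: 'c set) \<Longrightarrow> y \<in> Qp \<Longrightarrow> x * y \<in> Qp"
proof -
  assume x: "x \<in> Qp" and y: "y \<in> (Qp :: 'c set)"
  show "x * y \<in> Qp" unfolding Qp_iff
  proof (intro allI impI)
    fix e :: real assume e: "e > 0"
    define M where "M = max 1 (max (av x) (av y))"
    have M: "M \<ge> 1" "av x \<le> M" "av y \<le> M" by (auto simp: M_def)
    define d where "d = min 1 (e / M)"
    have d: "d > 0" "d \<le> 1" "d \<le> e / M" using e M by (auto simp: d_def)
    obtain u where u: "u \<in> \<rat>" "av (u - x) < d" using x d unfolding Qp_iff by blast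
    obtain v where v: "v \<in> \<rat>" "av (v - y) < d" using y d unfolding Qp_iff by blast
    have "av u \<le> M" using av_add[of "u - x" x] u d M by simp
    then have 1: "av (u * (v - y)) < e"
      unfolding av_mult using v d M mult_left_mono[of "av (v - y)" "e / M" M] mult_right_mono[of "av u" M "av (v - y)"] e
      by (smt (verit) divide_pos_pos mult_strict_left_mono nonzero_mult_div_cancel_left times_divide_eq_right zero_le_dist)
    have 2: "av (y * (u - x)) < e"
      unfolding av_mult using u d M mult_left_mono[of "av (u - x)" "e / M" M] mult_right_mono[of "av y" M "av (u - x)"] e
      by (smt (verit) divide_pos_pos mult_strict_left_mono nonzero_mult_div_cancel_left times_divide_eq_right zero_le_dist)
    have "av (u * v - x * y) = av (u * (v - y) + y * (u - x))" by (simp add: algebra_simps)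
    also have "\<dots> < e" using av_add[of "u * (v - y)" "y * (u - x)"] 1 2 by simp
    finally show "\<exists>z\<in>\<rat>. av (z - x * y) < e" using u v by (intro bexI[of _ "u * v"]) auto
  qed
qed

lemma Qp_inverse [simp]: "x \<in> (Qp :: 'c set) \<Longrightarrow> inverse x \<in> Qp"
proof (cases "x = 0")
  case False
  assume x: "x \<in> Qp"
  show ?thesis unfolding Qp_iff
  proof (intro allI impI)
    fix e :: real assume e: "e > 0"
    define d where "d = min (av x) (e * av x ^ 2)"
    have "d > 0" using e False by (simp add: d_def)
    then obtain u where u: "u \<in> \<rat>" "av (u - x) < d" using x unfolding Qp_iff by blast
    have ux: "av u = av x" using u by (intro av_eq_of_close) (simp add: d_def)
    then have u0: "u \<noteq> 0" using False by auto
    have "inverse u - inverse x = - ((u - x) / (u * x))" using u0 False by (simp add: field_simps)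
    then have "av (inverse u - inverse x) = av (u - x) / av x ^ 2"
      by (simp add: av_divide av_mult ux power2_eq_square)
    also have "\<dots> < e" using u False by (simp add: d_def field_simps)
    finally show "\<exists>y\<in>\<rat>. av (y - inverse x) < e" using u by (intro bexI[of _ "inverse u"]) auto
  qed
qed auto

lemma Qp_divide [simp]: "x \<in> (Qp :: 'c set) \<Longrightarrow> y \<in> Qp \<Longrightarrow> x / y \<in> Qp"
  by (simp add: divide_inverse)

lemma Qp_power [simp]: "x \<in> (Qp :: 'c set) \<Longrightarrow> x ^ n \<in> Qp"
  by (induction n) auto

lemma Zp_iff: "x \<in> Zp p \<longleftrightarrow> x \<in> Qp \<and> av x \<le> 1"
  by (auto simp: Zp_def vp_nonneg_iff)

lemma Zp_units_iff: "x \<in> Zp_units p \<longleftrightarrow> x \<in> Qp \<and> av x = 1"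
  by (auto simp: Zp_units_def vp_eq_0_iff)

lemma Zp_closed [simp]:
  "x \<in> (Zp p :: 'c set) \<Longrightarrow> y \<in> Zp p \<Longrightarrow> x + y \<in> Zp p" "x \<in> (Zp p :: 'c set) \<Longrightarrow> y \<in> Zp p \<Longrightarrow> x - y \<in> Zp p"
  "x \<in> (Zp p :: 'c set) \<Longrightarrow> y \<in> Zp p \<Longrightarrow> x * y \<in> Zp p" "x \<in> (Zp p :: 'c set) \<Longrightarrow> - x \<in> Zp p"
  "0 \<in> (Zp p :: 'c set)" "1 \<in> (Zp p :: 'c set)" "of_int k \<in> (Zp p :: 'c set)" "of_nat m \<in> (Zp p :: 'c set)"
  by (auto simp: Zp_iff av_of_int_le_1 av_of_nat_le_1 intro: av_add_le av_diff_le av_mult_le_1)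

text \<open>
  Rationals are dense in the p-adic numbers, and modulo \<open>p ^ n\<close> an integral rational has an
  integral representative because its denominator is a unit.
\<close>

lemma Zp_approx_nat:
  assumes x: "x \<in> (Zp p :: 'c set)"
  shows "\<exists>k<p ^ n. av (x - of_nat k) \<le> (1 / real p) ^ n"
proof -
  have pos: "(1 / real p) ^ n > 0" using p_gt_1 by simp
  obtain r where r: "r \<in> \<rat>" "av (r - x) < (1 / real p) ^ n"
    using x pos unfolding Zp_iff Qp_iff by blast
  have "(1 / real p) ^ n \<le> 1" using p_gt_1 by (intro power_le_one) auto
  then have r1: "av r \<le> 1" using av_add[of "r - x" x] x r by (auto simp: Zp_iff)
  obtain k l :: int where kl: "r = of_int k / of_int l" "l > 0" "coprime k l"
    using Rats_cases'[OF r(1)] by metis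
  have "\<not> int p dvd l"
  proof
    assume d: "int p dvd l"
    have "\<not> int p dvd k"
    proof
      assume "int p dvd k"
      then have "is_unit (int p)" using coprime_common_divisor[OF kl(3) _ d] by simp
      then show False using p_gt_1 by simp
    qed
    then have "av (of_int k) = 1" by (rule av_of_int_unit)
    then have "av r = 1 / av (of_int l)" by (simp add: kl av_divide)
    moreover have "av (of_int l) < 1" using d av_of_int_lt_1 by simp
    moreover have "av (of_int l) > 0" using kl(2) by simp
    ultimately show False using r1 by (simp add: field_simps)
  qed
  then have l1: "av (of_int l) = 1" and "coprime (int p) l"
    using av_of_int_unit prime_p by (simp_all add: prime_imp_coprime)
  then have "coprime l (int p ^ n)" by (simp add: coprime_commute)
  then obtain c where c: "[l * c = 1] (mod (int p ^ n))" using cong_solve_coprime_int by blast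
  have dv: "int p ^ n dvd k * (1 - l * c)" using c by (simp add: cong_iff_dvd_diff dvd_diff_commute)
  have "r - of_int (k * c) = of_int (k * (1 - l * c)) / of_int l"
    using kl(2) by (simp add: kl(1) field_simps)
  then have 2: "av (r - of_int (k * c)) \<le> (1 / real p) ^ n"
    using av_of_int_dvd[OF dv] by (simp add: av_divide l1)
  define m where "m = nat (k * c mod int p ^ n)"
  have ppos: "int p ^ n > 0" using p_gt_1 by simp
  have m1: "int m = k * c mod int p ^ n" using ppos by (simp add: m_def)
  then have "int m < int (p ^ n)" using ppos by simp
  then have m2: "m < p ^ n" by (simp only: of_nat_less_iff)
  have "int p ^ n dvd k * c - int m" unfolding m1 by (simp add: minus_mod_eq_mult_div)
  then have 3: "av (of_int (k * c - int m)) \<le> (1 / real p) ^ n" by (rule av_of_int_dvd)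
  have "x - of_nat m = - (r - x) + ((r - of_int (k * c)) + of_int (k * c - int m))" by simp
  also have "av \<dots> \<le> (1 / real p) ^ n"
    by (intro av_add_le 2 3) (use r(2) av_diff_commute[of x r] in simp)
  finally show ?thesis using m2 by blast
qed

subsection \<open>The weight points\<close>

text \<open>
  Legendre's bound: the valuation of \<open>n!\<close> is at most \<open>(n - 1) / (p - 1)\<close>.
\<close>

lemma av_fact: "av (fact n) \<ge> (1 / real p) ^ ((n - 1) div (p - 1))"
proof (induction n rule: less_induct)
  case (less n)
  show ?case
  proof (cases "n < p")
    case True
    have "\<not> p dvd fact n" using True prime_dvd_fact_iff[OF prime_p] by simp
    then have "\<not> int p dvd int (fact n)" by (simp only: of_nat_dvd_iff not_False_eq_True)
    then have "\<not> int p dvd fact n" by (simp only: of_nat_fact not_False_eq_True)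
    then have "av (of_int (fact n)) = 1" by (rule av_of_int_unit)
    then show ?thesis using p_gt_1 by (simp add: power_le_one)
  next
    case False
    define q where "q = n div p"
    have q: "q \<ge> 1" "q < n" using False p_gt_1 by (auto simp: q_def div_greater_zero_iff Suc_le_eq)
    have prodc: "av (\<Prod>i\<in>{k * p + 1..k * p + r}. of_nat i) = 1" if "r < p" for k r
      using that
    proof (induction r)
      case (Suc r)
      have "\<not> int p dvd int (k * p + Suc r)"
      proof
        assume "int p dvd int (k * p + Suc r)"
        then have "p dvd k * p + Suc r" by (simp only: of_nat_dvd_iff)
        then have "p dvd Suc r" by (metis dvd_add_right_iff dvd_triv_right)
        with Suc.prems show False by (auto dest: dvd_imp_le)
      qed
      then have "av (of_int (int (k * p + Suc r))) = 1" by (rule av_of_int_unit)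
      then have "av (of_nat (k * p + Suc r)) = 1" by (simp only: of_int_of_nat_eq)
      moreover have "{k * p + 1..k * p + Suc r} = insert (k * p + Suc r) {k * p + 1..k * p + r}" by auto
      ultimately show ?case using Suc by (simp add: av_mult del: of_nat_add of_nat_Suc)
    qed simp
    have step: "av (fact (k * p)) = (1 / real p) ^ k * av (fact k)" for k
    proof (induction k)
      case (Suc k)
      have "(fact (Suc k * p) :: 'c) = fact (k * p) * (\<Prod>i\<in>{k * p + 1..k * p + (p - 1)}. of_nat i) * of_nat (Suc k * p)"
      proof -
        have s: "{1..Suc k * p} = {1..k * p} \<union> ({k * p + 1..k * p + (p - 1)} \<union> {Suc k * p})"
          using p_gt_1 by auto
        have "(fact (Suc k * p) :: 'c) = (\<Prod>i\<in>{1..Suc k * p}. of_nat i)" by (simp add: fact_prod)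
        also have "\<dots> = (\<Prod>i\<in>{1..k * p}. of_nat i) * ((\<Prod>i\<in>{k * p + 1..k * p + (p - 1)}. of_nat i) * of_nat (Suc k * p))"
          unfolding s using p_gt_1 by (subst prod.union_disjoint; (subst prod.union_disjoint)?) auto
        finally show ?thesis by (simp add: fact_prod mult.assoc)
      qed
      then have "av (fact (Suc k * p)) = av (fact (k * p)) * 1 * (av (of_nat (Suc k)) * av (of_nat p))"
        using prodc[of "p - 1" k] p_gt_1 by (simp only: av_mult of_nat_mult)
      also have "\<dots> = (1 / real p) ^ Suc k * av (fact (Suc k))"
        by (simp only: Suc.IH av_p fact_Suc av_mult of_nat_fact power_Suc mult_1_right mult_ac of_nat_mult)
      finally show ?case .
    qed simp
    define r where "r = n mod p"
    have n: "n = q * p + r" "r < p" using p_gt_1 by (auto simp: q_def r_def)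
    have "(fact n :: 'c) = fact (q * p) * (\<Prod>i\<in>{q * p + 1..q * p + r}. of_nat i)"
    proof -
      have "{1..n} = {1..q * p} \<union> {q * p + 1..q * p + r}" using n by auto
      then have "(\<Prod>i\<in>{1..n}. of_nat i :: 'c) = (\<Prod>i\<in>{1..q * p}. of_nat i) * (\<Prod>i\<in>{q * p + 1..q * p + r}. of_nat i)"
        by (simp only:) (rule prod.union_disjoint, auto)
      then show ?thesis by (simp add: fact_prod)
    qed
    then have "av (fact n) = (1 / real p) ^ q * av (fact q)"
      using prodc[OF n(2), of q] step[of q] by (simp only: av_mult mult_1_right)
    also have "\<dots> \<ge> (1 / real p) ^ q * (1 / real p) ^ ((q - 1) div (p - 1))"
      by (intro mult_left_mono less.IH q) simp
    also have "(1 / real p) ^ q * (1 / real p) ^ ((q - 1) div (p - 1)) = (1 / real p) ^ (q + (q - 1) div (p - 1))"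
      by (simp add: power_add)
    also have "\<dots> \<ge> (1 / real p) ^ ((n - 1) div (p - 1))"
    proof (rule power_decreasing)
      have "q + (q - 1) div (p - 1) = (q - 1 + q * (p - 1)) div (p - 1)" using p_gt_1 by simp
      also have "q - 1 + q * (p - 1) = q * p - 1" using q p_gt_1 by (cases p) (auto simp: algebra_simps)
      also have "(q * p - 1) div (p - 1) \<le> (n - 1) div (p - 1)" using n by (intro div_le_mono) simp
      finally show "q + (q - 1) div (p - 1) \<le> (n - 1) div (p - 1)" .
    qed (use p_gt_1 in auto)
    finally show ?thesis .
  qed
qed

lemma av_exp_term:
  assumes p5: "p \<ge> 3" and x: "av x \<le> 1 / real p" and n: "n \<ge> 1"
  shows "av (x ^ n / fact n) \<le> (1 / real p) ^ (n - (n - 1) div 2)"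
proof -
  have "(n - 1) div (p - 1) \<le> (n - 1) div 2" using p5 by (intro div_le_mono2) auto
  then have "(1 / real p) ^ ((n - 1) div 2) \<le> (1 / real p) ^ ((n - 1) div (p - 1))"
    using p_gt_1 by (intro power_decreasing) auto
  also have "\<dots> \<le> av (fact n)" by (rule av_fact)
  finally have f: "(1 / real p) ^ ((n - 1) div 2) \<le> av (fact n)" .
  have "av (x ^ n / fact n) = av x ^ n / av (fact n)" by (simp add: av_divide av_power)
  also have "\<dots> \<le> (1 / real p) ^ n / (1 / real p) ^ ((n - 1) div 2)"
    using f x p_gt_1 by (intro frac_le power_mono) auto
  also have "\<dots> = (1 / real p) ^ (n - (n - 1) div 2)"
    using p_gt_1 by (intro power_diff[symmetric]) auto
  finally show ?thesis .
qed

text \<open>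
  The exponential series at a multiple of \<open>p\<close> converges, and all its terms after the first have
  valuation at least one.
\<close>

lemma w_point_small:
  assumes p5: "p \<ge> 3"
  shows "av (w_point p k) \<le> 1 / real p"
proof -
  define x :: 'c where "x = of_nat p * of_int (k - 2)"
  have x: "av x \<le> 1 / real p"
    unfolding x_def av_mult av_p using mult_left_mono[OF av_of_int_le_1[of "k - 2"], of "1 / real p"] by simp
  define X where "X n = (\<Sum>i<n. x ^ i / fact i)" for n
  have conv: "av (X (Suc n) - X n) < e" if "e > 0" "(1 / real p) ^ N < e" "n \<ge> 2 * N + 1" for e N n
  proof -
    have "av (x ^ n / fact n) \<le> (1 / real p) ^ (n - (n - 1) div 2)" by (rule av_exp_term[OF p5 x]) (use that in simp)
    also have "\<dots> \<le> (1 / real p) ^ N" using that p_gt_1 by (intro power_decreasing) auto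
    finally show ?thesis using that by (simp add: X_def)
  qed
  have "Cauchy X"
  proof (rule Cauchy_av)
    fix e :: real assume "e > 0"
    moreover then obtain N where "(1 / real p) ^ N < e" using ex_p_power_lt[of e 0] by blast
    ultimately show "\<exists>N. \<forall>n\<ge>N. av (X (Suc n) - X n) < e" using conv by blast
  qed
  then obtain L where L: "X \<longlonglongrightarrow> L" using Cauchy_convergent_iff convergent_def by blast
  then have "(\<lambda>n. x ^ n / fact n) sums L" unfolding sums_def X_def[abs_def] .
  then have eL: "padic_exp x = L" unfolding padic_exp_def by (rule sums_unique[symmetric])
  have "av (L - 1) \<le> 1 / real p"
  proof (rule tendsto_av_le[OF L])
    fix n :: nat assume "1 \<le> n"
    then show "av (X n - 1) \<le> 1 / real p"
    proof (induction n rule: dec_induct)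
      case base
      show ?case by (simp add: X_def)
    next
      case (step n)
      have "av (x ^ n / fact n) \<le> (1 / real p) ^ (n - (n - 1) div 2)" by (rule av_exp_term[OF p5 x]) (use step in simp)
      also have "\<dots> \<le> (1 / real p) ^ 1" using step p_gt_1 by (intro power_decreasing) auto
      finally have "av (x ^ n / fact n) \<le> 1 / real p" by simp
      moreover have "X (Suc n) - 1 = (X n - 1) + x ^ n / fact n" by (simp add: X_def)
      ultimately show ?case using step by (simp only:) (rule av_add_le)
    qed
  qed simp
  moreover have "w_point p k = L - 1" unfolding w_point_def x_def[symmetric] eL ..
  ultimately show ?thesis by simp
qed

end

section \<open>The coefficient ring\<close>

context padic
begin

definition Qp_subspace :: "'c set \<Rightarrow> bool" where
  "Qp_subspace V \<longleftrightarrow> 0 \<in> V \<and> (\<forall>x\<in>V. \<forall>y\<in>V. x + y \<in> V) \<and> (\<forall>q\<in>Qp. \<forall>x\<in>V. q * x \<in> V)"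

lemma Qp_subspace_line:
  assumes V: "Qp_subspace V"
  shows "Qp_subspace {v + q * b | v q. v \<in> V \<and> q \<in> Qp}"
proof -
  let ?W = "{v + q * b | v q. v \<in> V \<and> q \<in> Qp}"
  have "0 \<in> ?W"
    using V by (intro CollectI exI[of _ 0] conjI) (auto simp: Qp_subspace_def)
  moreover have "x + y \<in> ?W" if xy: "x \<in> ?W" "y \<in> ?W" for x y
  proof -
    obtain v q where v: "x = v + q * b" "v \<in> V" "q \<in> Qp" using xy(1) by blast
    obtain v' q' where v': "y = v' + q' * b" "v' \<in> V" "q' \<in> Qp" using xy(2) by blast
    have "x + y = (v + v') + (q + q') * b" by (simp add: v v' algebra_simps)
    moreover have "v + v' \<in> V" "q + q' \<in> Qp" using V v v' by (auto simp: Qp_subspace_def)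
    ultimately show ?thesis by blast
  qed
  moreover have "c * x \<in> ?W" if c: "c \<in> Qp" and x: "x \<in> ?W" for c x
  proof -
    obtain v q where v: "x = v + q * b" "v \<in> V" "q \<in> Qp" using x by blast
    have "c * x = c * v + (c * q) * b" by (simp add: v algebra_simps)
    moreover have "c * v \<in> V" "c * q \<in> Qp" using V v c by (auto simp: Qp_subspace_def)
    ultimately show ?thesis by blast
  qed
  ultimately show ?thesis unfolding Qp_subspace_def by simp
qed

text \<open>
  Finite-dimensional subspaces over the complete field of p-adic numbers are closed: the coordinate
  along a vector outside a closed subspace is controlled by the distance to this subspace.
\<close>

lemma closed_line:
  assumes V: "Qp_subspace V" "closed V"
  shows "closed {v + q * b | v q. v \<in> V \<and> q \<in> Qp}"
proof (cases "b \<in> V")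
  case True
  have "{v + q * b | v q. v \<in> V \<and> q \<in> Qp} = V"
  proof (rule equalityI; rule subsetI)
    fix x assume "x \<in> V"
    then have "x = x + 0 * b" by simp
    then show "x \<in> {v + q * b | v q. v \<in> V \<and> q \<in> Qp}" using \<open>x \<in> V\<close> Qp_0 by blast
  qed (use V True in \<open>auto simp: Qp_subspace_def\<close>)
  then show ?thesis using V by simp
next
  case False
  have "open (- V)" using V by (simp add: open_Compl)
  then obtain \<delta> where \<delta>: "\<delta> > 0" "\<forall>y. dist y b < \<delta> \<longrightarrow> y \<in> - V"
    using False unfolding open_dist by blast
  have low: "av q * \<delta> \<le> av (v + q * b)" if v: "v \<in> V" "q \<in> Qp" for v q
  proof (cases "q = 0")
    case False
    define y where "y = - (inverse q * v)"
    have "y = (- inverse q) * v" by (simp add: y_def)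
    moreover have "- inverse q \<in> Qp" using v by simp
    ultimately have "y \<in> V" using V v unfolding Qp_subspace_def by metis
    then have "\<not> dist y b < \<delta>" using \<delta> by auto
    then have "\<delta> \<le> av (b - y)" using dist_av[of b y] by (simp add: dist_commute)
    moreover have "v + q * b = q * (b - y)" using False by (simp add: y_def field_simps)
    ultimately show ?thesis by (simp add: av_mult mult_left_mono)
  qed simp
  show ?thesis unfolding closed_sequential_limits
  proof (intro allI impI)
    fix X z assume "(\<forall>n. X n \<in> {v + q * b | v q. v \<in> V \<and> q \<in> Qp}) \<and> X \<longlonglongrightarrow> z"
    then have X: "\<And>n. \<exists>v q. X n = v + q * b \<and> v \<in> V \<and> q \<in> Qp" and z: "X \<longlonglongrightarrow> z" by auto
    from X obtain v q where vq: "\<And>n. X n = v n + q n * b" "\<And>n. v n \<in> V" "\<And>n. q n \<in> Qp" by metis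
    have d: "dist (q m) (q n) * \<delta> \<le> dist (X m) (X n)" for m n
    proof -
      have "X m - X n = (v m + (-1) * v n) + (q m - q n) * b" by (simp add: vq algebra_simps)
      moreover have "v m + (-1) * v n \<in> V" using V vq unfolding Qp_subspace_def by (metis Qp_1 Qp_minus)
      moreover have "q m - q n \<in> Qp" using vq by simp
      ultimately have "av (q m - q n) * \<delta> \<le> av (X m - X n)" using low[of "v m + (-1) * v n" "q m - q n"] by (simp only:)
      then show ?thesis using dist_av[of "q m" "q n"] dist_av[of "X m" "X n"] by simp
    qed
    have "Cauchy X" using z by (rule LIMSEQ_imp_Cauchy)
    have "Cauchy q"
    proof (rule metric_CauchyI)
      fix e :: real assume "e > 0"
      then have "e * \<delta> > 0" using \<delta> by simp
      then obtain N where N: "\<And>m n. m \<ge> N \<Longrightarrow> n \<ge> N \<Longrightarrow> dist (X m) (X n) < e * \<delta>"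
        using metric_CauchyD[OF \<open>Cauchy X\<close>] by blast
      have "dist (q m) (q n) < e" if "m \<ge> N" "n \<ge> N" for m n
        using le_less_trans[OF d N[OF that]] \<delta>(1) by simp
      then show "\<exists>N. \<forall>m\<ge>N. \<forall>n\<ge>N. dist (q m) (q n) < e" by blast
    qed
    then obtain q0 where q0: "q \<longlonglongrightarrow> q0" using Cauchy_convergent_iff convergent_def by blast
    have "q0 \<in> Qp" using closed_Qp q0 vq(3) unfolding closed_sequential_limits by blast
    have "(\<lambda>n. X n + (- b) * q n) \<longlonglongrightarrow> z + (- b) * q0"
      by (intro tendsto_add_av z tendsto_mult_left_av q0)
    moreover have "(\<lambda>n. X n + (- b) * q n) = v" by (simp add: vq fun_eq_iff mult.commute)
    ultimately have "z + (- b) * q0 \<in> V" using V(2) vq(2) unfolding closed_sequential_limits by metis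
    moreover have "z = (z + (- b) * q0) + q0 * b" by (simp add: mult.commute)
    ultimately show "z \<in> {v + q * b | v q. v \<in> V \<and> q \<in> Qp}" using \<open>q0 \<in> Qp\<close> by blast
  qed
qed

lemma av_power_diff:
  assumes "av y \<le> 1" "av z \<le> 1"
  shows "av (y ^ n - z ^ n) \<le> av (y - z)"
proof -
  have "av (\<Sum>i<n. z ^ (n - Suc i) * y ^ i) \<le> 1"
    using assms by (intro av_sum_le) (auto simp: av_mult av_power mult_le_one power_le_one)
  then show ?thesis
    unfolding power_diff_sumr2[of y n z] av_mult using mult_left_mono[of _ 1 "av (y - z)"] by simp
qed

text \<open>
  The cofactor of \<open>y - z\<close> in \<open>y ^ p - z ^ p\<close> is a sum of \<open>p\<close> terms that agree modulo \<open>p\<close>.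
\<close>

lemma av_power_p_diff:
  assumes "av y \<le> 1" "av z \<le> 1" "av (y - z) \<le> (1 / real p) ^ Suc n"
  shows "av (y ^ p - z ^ p) \<le> (1 / real p) ^ Suc (Suc n)"
proof -
  let ?S = "\<Sum>i<p. z ^ (p - Suc i) * y ^ i"
  have small: "av (y - z) \<le> 1 / real p"
  proof -
    have "(1 / real p) ^ Suc n \<le> (1 / real p) ^ 1" using p_gt_1 by (intro power_decreasing) auto
    with assms(3) show ?thesis by simp
  qed
  have e: "?S = (\<Sum>i<p. z ^ (p - Suc i) * (y ^ i - z ^ i)) + of_nat p * z ^ (p - 1)"
  proof -
    have "z ^ (p - Suc i) * z ^ i = z ^ (p - 1)" if "i < p" for i
    proof -
      have "p - Suc i + i = p - 1" using that by simp
      then show ?thesis by (metis power_add)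
    qed
    then have "(\<Sum>i<p. z ^ (p - Suc i) * z ^ i) = of_nat p * z ^ (p - 1)" by simp
    then show ?thesis by (simp add: right_diff_distrib sum_subtractf)
  qed
  have "av ?S \<le> 1 / real p"
    unfolding e
  proof (rule av_add_le)
    show "av (\<Sum>i<p. z ^ (p - Suc i) * (y ^ i - z ^ i)) \<le> 1 / real p"
      by (intro av_sum_le av_mult_le_1 order_trans[OF av_power_diff[OF assms(1,2)] small])
        (auto simp: av_power power_le_one assms)
    show "av (of_nat p * z ^ (p - 1)) \<le> 1 / real p"
      unfolding av_mult av_p using mult_left_mono[of "av (z ^ (p - 1))" 1 "1 / real p"] assms(2)
      by (simp add: av_power power_le_one)
  qed
  then have "av (y - z) * av ?S \<le> (1 / real p) ^ Suc n * (1 / real p)"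
    using assms(3) by (intro mult_mono) auto
  then show ?thesis unfolding power_diff_sumr2[of y p z] av_mult by (simp add: mult.commute)
qed

end

locale coeff_ring = padic p "TYPE('c::{field_char_0,complete_space})" for p :: nat +
  fixes E :: "'c::{field_char_0,complete_space} set" and \<pi> :: 'c and red :: "'c \<Rightarrow> 'f::field"
  assumes E_ext: "finite_ext_Qp_sqrt_p p E" and uniformizer: "uniformizer p E \<pi>"
    and residue_map: "residue_map p E red"
begin

abbreviation OE :: "'c set" where "OE \<equiv> integers p E"

lemma Qp_sub_E: "Qp \<subseteq> E"
proof
  fix x :: 'c assume x: "x \<in> Qp"
  obtain r where "{x + y * r | x y. x \<in> Qp \<and> y \<in> Qp} \<subseteq> E"
    using E_ext unfolding finite_ext_Qp_sqrt_p_def Let_def by blast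
  moreover have "x = x + 0 * r" by simp
  ultimately show "x \<in> E" using x Qp_0 by blast
qed

lemma subfield_E: "subfield E (ring_on UNIV)"
  using E_ext by (simp add: finite_ext_Qp_sqrt_p_def)

lemma E_add: "x \<in> E \<Longrightarrow> y \<in> E \<Longrightarrow> x + y \<in> E"
proof -
  have "subgroup E (add_monoid (ring_on UNIV :: 'c ring))"
    using subfield_E unfolding subfield_def subdomain_def subcring_def subring_def by simp
  then show "x \<in> E \<Longrightarrow> y \<in> E \<Longrightarrow> x + y \<in> E" using subgroup.m_closed by (fastforce simp: ring_on_def)
qed

lemma E_mult: "x \<in> E \<Longrightarrow> y \<in> E \<Longrightarrow> x * y \<in> E"
proof -
  have "submonoid E (ring_on UNIV :: 'c ring)"
    using subfield_E unfolding subfield_def subdomain_def subcring_def subring_def by simp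
  then show "x \<in> E \<Longrightarrow> y \<in> E \<Longrightarrow> x * y \<in> E" using submonoid.m_closed by (fastforce simp: ring_on_def)
qed

lemma E_0: "0 \<in> E" and E_1: "1 \<in> E" and E_of_nat: "of_nat n \<in> E"
  using Qp_sub_E Qp_0 Qp_1 Qp_of_nat by blast+

lemma E_minus: "x \<in> E \<Longrightarrow> - x \<in> E"
  using E_mult[of "-1" x] subsetD[OF Qp_sub_E Qp_minus[OF Qp_1]] by simp

lemma E_diff: "x \<in> E \<Longrightarrow> y \<in> E \<Longrightarrow> x - y \<in> E"
  using E_add[of x "- y"] E_minus by simp

lemma E_inverse: "x \<in> E \<Longrightarrow> inverse x \<in> E"
proof (cases "x = 0")
  case False
  assume "x \<in> E"
  have "Units ((ring_on UNIV :: 'c ring)\<lparr>carrier := E\<rparr>) = E - {\<zero>\<^bsub>ring_on UNIV\<^esub>}"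
    using subfield_E unfolding subfield_def subfield_axioms_def by simp
  then have "x \<in> Units ((ring_on UNIV :: 'c ring)\<lparr>carrier := E\<rparr>)" using \<open>x \<in> E\<close> False by (simp add: ring_on_def)
  then obtain y where "y \<in> E" "x * y = 1" unfolding Units_def by (auto simp: ring_on_def)
  then show ?thesis using inverse_unique by metis
qed (simp add: E_0)

lemma E_divide: "x \<in> E \<Longrightarrow> y \<in> E \<Longrightarrow> x / y \<in> E"
  by (simp add: divide_inverse E_mult E_inverse)

text \<open>
  The field is spanned over the p-adic numbers by finitely many lines, which are added one at a time.
\<close>

lemma closed_E: "closed E"
proof -
  obtain r B where L: "{x + y * r | x y. x \<in> Qp \<and> y \<in> Qp} \<subseteq> E" and B: "finite B" "B \<subseteq> E"
    and span: "\<forall>x\<in>E. \<exists>c\<in>B \<rightarrow> {x + y * r | x y. x \<in> Qp \<and> y \<in> Qp}. x = (\<Sum>b\<in>B. c b * b)"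
    using E_ext unfolding finite_ext_Qp_sqrt_p_def Let_def by blast
  define L where "L = {x + y * r | x y. x \<in> Qp \<and> y \<in> Qp}"
  have "Qp_subspace {\<Sum>b\<in>S. c b * b | c. c \<in> S \<rightarrow> L} \<and> closed {\<Sum>b\<in>S. c b * b | c. c \<in> S \<rightarrow> L}" if "finite S" for S
    using that
  proof (induction S rule: finite_induct)
    case empty
    then show ?case by (simp add: Qp_subspace_def)
  next
    case (insert s S)
    let ?V = "{\<Sum>b\<in>S. c b * b | c. c \<in> S \<rightarrow> L}"
    let ?V1 = "{v + q * s | v q. v \<in> ?V \<and> q \<in> Qp}"
    let ?V2 = "{v + q * (r * s) | v q. v \<in> ?V1 \<and> q \<in> Qp}"
    have "{\<Sum>b\<in>insert s S. c b * b | c. c \<in> insert s S \<rightarrow> L} = ?V2"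
    proof (rule equalityI; rule subsetI)
      fix z assume "z \<in> {\<Sum>b\<in>insert s S. c b * b | c. c \<in> insert s S \<rightarrow> L}"
      then obtain c where c: "z = (\<Sum>b\<in>insert s S. c b * b)" "c \<in> insert s S \<rightarrow> L" by blast
      have "c s \<in> L" using c(2) by auto
      then obtain x y where xy: "c s = x + y * r" "x \<in> Qp" "y \<in> Qp" unfolding L_def by blast
      have "z = ((\<Sum>b\<in>S. c b * b) + x * s) + y * (r * s)"
        using insert.hyps by (simp add: c xy algebra_simps)
      moreover have "(\<Sum>b\<in>S. c b * b) \<in> ?V" using c(2) by blast
      ultimately show "z \<in> ?V2" using xy by blast
    next
      fix z assume "z \<in> ?V2"
      then obtain c x y where c: "z = ((\<Sum>b\<in>S. c b * b) + x * s) + y * (r * s)" "c \<in> S \<rightarrow> L"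
        and xy: "x \<in> Qp" "y \<in> Qp" by blast
      define c' where "c' = c(s := x + y * r)"
      have "x + y * r \<in> L" unfolding L_def using xy by blast
      then have "c' \<in> insert s S \<rightarrow> L" using c(2) by (auto simp: c'_def)
      moreover have "(\<Sum>b\<in>S. c' b * b) = (\<Sum>b\<in>S. c b * b)"
        using insert.hyps by (intro sum.cong refl) (auto simp: c'_def)
      then have "z = (\<Sum>b\<in>insert s S. c' b * b)"
        using insert.hyps by (simp add: c c'_def algebra_simps)
      ultimately show "z \<in> {\<Sum>b\<in>insert s S. c b * b | c. c \<in> insert s S \<rightarrow> L}" by blast
    qed
    moreover have "Qp_subspace ?V" "closed ?V" using insert.IH by simp_all
    ultimately show ?case
      using Qp_subspace_line[of ?V s] closed_line[of ?V s]
        Qp_subspace_line[of ?V1 "r * s"] closed_line[of ?V1 "r * s"] by (simp only:)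
  qed
  then have "closed {\<Sum>b\<in>B. c b * b | c. c \<in> B \<rightarrow> L}" using B by blast
  moreover have "{\<Sum>b\<in>B. c b * b | c. c \<in> B \<rightarrow> L} = E"
  proof (rule equalityI; rule subsetI)
    fix z assume "z \<in> {\<Sum>b\<in>B. c b * b | c. c \<in> B \<rightarrow> L}"
    then obtain c where c: "z = (\<Sum>b\<in>B. c b * b)" "c \<in> B \<rightarrow> L" by blast
    have "(\<Sum>b\<in>S. c b * b) \<in> E" if "S \<subseteq> B" for S
    proof -
      have "finite S" using that B finite_subset by blast
      then show ?thesis using that
      proof (induction S rule: finite_induct)
        case (insert s S)
        have "c s \<in> E" "s \<in> E" using insert.prems c(2) L B unfolding L_def by blast+
        then show ?case using insert by (simp add: E_add E_mult)
      qed (simp add: E_0)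
    qed
    then show "z \<in> E" using c by blast
  qed (use span L_def in blast)
  ultimately show ?thesis by simp
qed

lemma OE_iff: "x \<in> OE \<longleftrightarrow> x \<in> E \<and> av x \<le> 1"
  by (simp add: integers_def vp_nonneg_iff)

lemma OE_closed [simp]:
  "x \<in> OE \<Longrightarrow> y \<in> OE \<Longrightarrow> x + y \<in> OE" "x \<in> OE \<Longrightarrow> y \<in> OE \<Longrightarrow> x - y \<in> OE"
  "x \<in> OE \<Longrightarrow> y \<in> OE \<Longrightarrow> x * y \<in> OE" "x \<in> OE \<Longrightarrow> - x \<in> OE" "0 \<in> OE" "1 \<in> OE" "of_nat n \<in> OE"
  by (auto simp: OE_iff E_add E_diff E_mult E_minus E_0 E_1 E_of_nat av_of_nat_le_1
      intro: av_add_le av_diff_le av_mult_le_1)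

lemma OE_sum [simp]: "(\<And>i. i \<in> I \<Longrightarrow> f i \<in> OE) \<Longrightarrow> (\<Sum>i\<in>I. f i) \<in> OE"
  by (induction I rule: infinite_finite_induct) auto

lemma OE_power [simp]: "x \<in> OE \<Longrightarrow> x ^ n \<in> OE"
  by (induction n) auto

lemma av_OE: "x \<in> OE \<Longrightarrow> av x \<le> 1"
  by (simp add: OE_iff)

lemma Zp_sub_OE: "x \<in> Zp p \<Longrightarrow> x \<in> OE"
  using Qp_sub_E by (auto simp: OE_iff Zp_iff)

lemma OE_lim: "X \<longlonglongrightarrow> L \<Longrightarrow> (\<And>n. X n \<in> OE) \<Longrightarrow> L \<in> OE"
proof -
  assume X: "X \<longlonglongrightarrow> L" and O: "\<And>n. X n \<in> OE"
  have "L \<in> E" using closed_E X O unfolding closed_sequential_limits by (metis OE_iff)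
  moreover have "av (L - 0) \<le> 1" by (rule tendsto_av_le[OF X]) (use O av_OE in auto)
  ultimately show ?thesis by (simp add: OE_iff)
qed

lemma red_add: "x \<in> OE \<Longrightarrow> y \<in> OE \<Longrightarrow> red (x + y) = red x + red y"
  and red_mult: "x \<in> OE \<Longrightarrow> y \<in> OE \<Longrightarrow> red (x * y) = red x * red y"
  and red_1 [simp]: "red 1 = 1"
  and red_surj: "\<exists>x\<in>OE. red x = k"
  and red_eq_0: "x \<in> OE \<Longrightarrow> red x = 0 \<longleftrightarrow> av x < 1"
proof -
  have h: "red \<in> ring_hom (ring_on OE) (ring_on UNIV)" and s: "red ` OE = UNIV"
    and k: "{x \<in> OE. red x = 0} = {x \<in> OE. 0 < vp p x}"
    using residue_map by (simp_all add: residue_map_def)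
  show "x \<in> OE \<Longrightarrow> y \<in> OE \<Longrightarrow> red (x + y) = red x + red y" "x \<in> OE \<Longrightarrow> y \<in> OE \<Longrightarrow> red (x * y) = red x * red y" "red 1 = 1"
    using h by (simp_all add: ring_hom_def ring_on_def)
  show "\<exists>x\<in>OE. red x = k" using s by (metis UNIV_I imageE)
  show "x \<in> OE \<Longrightarrow> red x = 0 \<longleftrightarrow> av x < 1" using k by (auto simp: vp_pos_iff)
qed

lemma red_0 [simp]: "red 0 = 0"
  using red_add[OF OE_closed(5) OE_closed(5)] by (metis add_cancel_right_right)

lemma red_minus: "x \<in> OE \<Longrightarrow> red (- x) = - red x"
  using red_add[of x "- x"] by (simp add: eq_neg_iff_add_eq_0 add.commute)

lemma red_diff: "x \<in> OE \<Longrightarrow> y \<in> OE \<Longrightarrow> red (x - y) = red x - red y"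
  using red_add[of x "- y"] by (simp add: red_minus)

lemma red_sum: "(\<And>i. i \<in> I \<Longrightarrow> f i \<in> OE) \<Longrightarrow> red (\<Sum>i\<in>I. f i) = (\<Sum>i\<in>I. red (f i))"
  by (induction I rule: infinite_finite_induct) (auto simp: red_add)

lemma red_power: "x \<in> OE \<Longrightarrow> red (x ^ n) = red x ^ n"
  by (induction n) (auto simp: red_mult)

lemma red_of_nat: "red (of_nat n) = of_nat n"
  by (induction n) (auto simp: red_add)

lemma red_eq_iff: "x \<in> OE \<Longrightarrow> y \<in> OE \<Longrightarrow> red x = red y \<longleftrightarrow> av (x - y) < 1"
  using red_eq_0[of "x - y"] by (simp add: red_diff)

lemma red_eq_close: "x \<in> OE \<Longrightarrow> y \<in> OE \<Longrightarrow> av (x - y) \<le> (1 / real p) ^ Suc n \<Longrightarrow> red x = red y"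
proof -
  assume xy: "x \<in> OE" "y \<in> OE" "av (x - y) \<le> (1 / real p) ^ Suc n"
  have "(1 / real p) ^ Suc n < 1" using p_gt_1 by (intro power_Suc_less_one) auto
  with xy show ?thesis by (simp add: red_eq_iff)
qed

lemma uniformizer_props: "\<pi> \<in> OE" "av \<pi> < 1" "\<pi> \<noteq> 0"
  "x \<in> E \<Longrightarrow> av x < 1 \<Longrightarrow> \<exists>y\<in>OE. x = \<pi> * y"
proof -
  have 1: "{x \<in> E. av x < 1} = (\<lambda>y. \<pi> * y) ` OE" and 2: "\<pi> \<in> OE"
    using uniformizer by (simp_all add: uniformizer_def vp_pos_iff)
  show "\<pi> \<in> OE" by (rule 2)
  have "\<pi> * 1 \<in> {x \<in> E. av x < 1}" unfolding 1 by (rule imageI) simp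
  then show "av \<pi> < 1" by simp
  show "x \<in> E \<Longrightarrow> av x < 1 \<Longrightarrow> \<exists>y\<in>OE. x = \<pi> * y" using 1 by blast
  have "of_nat p \<in> {x \<in> E. av x < 1}" using p_gt_1 by (simp add: E_of_nat av_p)
  then obtain y where "of_nat p = \<pi> * y" unfolding 1 by blast
  moreover have "(of_nat p :: 'c) \<noteq> 0" using p_gt_1 by simp
  ultimately show "\<pi> \<noteq> 0" by auto
qed

sublocale F: char_p p "TYPE('f)"
proof
  show "prime p" by (rule prime_p)
  have "red (of_nat p) = 0" using p_gt_1 by (subst red_eq_0) (auto simp: av_p)
  then show "of_nat p = (0 :: 'f)" by (simp add: red_of_nat)
qed

lemma red_Zp: "x \<in> Zp p \<Longrightarrow> red x \<in> Fp"
proof -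
  assume x: "x \<in> Zp p"
  then obtain k where "av (x - of_nat k) \<le> (1 / real p) ^ Suc 0" using Zp_approx_nat[of x "Suc 0"] by auto
  then have "red x = red (of_nat k)" using x by (intro red_eq_close[of _ _ 0]) (auto intro: Zp_sub_OE)
  then show ?thesis by (simp add: red_of_nat)
qed

lemma red_Zp_units: "x \<in> Zp_units p \<Longrightarrow> red x \<in> Fp \<and> red x \<noteq> 0"
  using red_Zp[of x] red_eq_0[of x] Zp_sub_OE[of x] by (auto simp: Zp_units_iff Zp_iff)

lemma Fp_lift: "k \<in> Fp \<Longrightarrow> \<exists>x\<in>Zp p. red x = k"
  unfolding F.Fp_eq using red_of_nat by (metis Zp_closed(8) imageE)

subsection \<open>Teichmueller representatives\<close>

text \<open>
  The powers \<open>k ^ (p ^ n)\<close> of an integer \<open>k\<close> that lifts \<open>x\<close> converge to it.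
\<close>

lemma teichmueller_exists:
  assumes x: "x \<in> \<Delta>"
  shows "\<exists>t. t \<in> Zp_units p \<and> t ^ (p - 1) = 1 \<and> red t = x"
proof -
  obtain k where k: "x = of_nat k" using x unfolding \<Delta>_def F.Fp_eq by auto
  have kp: "\<not> int p dvd int k" using x k F.of_nat_eq_0_iff_p[of k] by (simp add: \<Delta>_def)
  define X where "X n = (of_nat k :: 'c) ^ (p ^ n)" for n
  have X1: "av (X n) \<le> 1" for n unfolding X_def av_power using av_of_nat_le_1 by (simp add: power_le_one)
  have XS: "X (Suc n) = X n ^ p" for n by (simp add: X_def mult.commute flip: power_mult)
  have step: "av (X (Suc n) - X n) \<le> (1 / real p) ^ Suc n" for n
  proof (induction n)
    case 0
    have "(of_int (int k ^ p - int k) :: 'f) = of_nat k ^ p - of_nat k" by simp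
    also have "\<dots> = 0" using F.Fp_power_p[of "of_nat k"] by simp
    finally have "int p dvd int k ^ p - int k" unfolding F.of_int_eq_0_iff_p .
    then have "int p ^ Suc 0 dvd int k ^ p - int k" by simp
    then have "av (of_int (int k ^ p - int k)) \<le> (1 / real p) ^ Suc 0" by (rule av_of_int_dvd)
    then show ?case by (simp add: X_def)
  next
    case (Suc n)
    then show ?case unfolding XS[of "Suc n"] XS[of n] using av_power_p_diff[OF X1 X1, of "Suc n" n n] XS[of n] by simp
  qed
  have "av (X (Suc n) - X n) \<le> (1 / real p) ^ n" for n
    using step[of n] power_decreasing[of n "Suc n" "1 / real p"] p_gt_1 by simp
  then obtain L where L: "X \<longlonglongrightarrow> L" "\<And>n. av (L - X n) \<le> (1 / real p) ^ n"
    using convergent_p_power[of X] by blast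
  have "X n \<in> Qp" for n by (simp add: X_def)
  then have LQ: "L \<in> Qp" using closed_Qp L(1) unfolding closed_sequential_limits by blast
  have "L - of_nat k = (L - X 1) + (X 1 - X 0)" by (simp add: X_def)
  then have close: "av (L - of_nat k) \<le> 1 / real p"
    using av_add_le[of "L - X 1" "1 / real p" "X 1 - X 0"] L(2)[of 1] step[of 0] by simp
  have k1: "av (of_nat k) = 1" using av_of_int_unit[OF kp] by simp
  have "av L = av (of_nat k)"
    using close k1 p_gt_1 by (intro av_eq_of_close) (auto intro: le_less_trans)
  then have L1: "av L = 1" using k1 by simp
  have "L ^ p - L = 0"
  proof (rule eq_0_if_small)
    fix n
    have 1: "av (L ^ p - X n ^ p) \<le> (1 / real p) ^ n"
      using av_power_diff[of L "X n" p] L1 X1[of n] L(2)[of n] by simp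
    have 2: "av (L - X (Suc n)) \<le> (1 / real p) ^ n"
      using L(2)[of "Suc n"] power_decreasing[of n "Suc n" "1 / real p"] p_gt_1 by simp
    have "L ^ p - L = (L ^ p - X n ^ p) - (L - X (Suc n))" by (simp add: XS)
    then show "av (L ^ p - L) \<le> (1 / real p) ^ n" using av_diff_le[OF 1 2] by simp
  qed
  moreover have "L ^ p = L * L ^ (p - 1)" using p_gt_1 by (simp add: power_eq_if)
  moreover have "L \<noteq> 0" using L1 by auto
  ultimately have "L ^ (p - 1) = 1" by simp
  moreover have LZ: "L \<in> Zp_units p" using LQ L1 by (simp add: Zp_units_iff)
  moreover have "red L = x"
  proof -
    have "L \<in> OE" using LZ Zp_sub_OE by (simp add: Zp_units_iff Zp_iff)
    then have "red L = red (of_nat k)" by (rule red_eq_close[of _ _ 0]) (use close in auto)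
    then show ?thesis by (simp add: red_of_nat k)
  qed
  ultimately show ?thesis by blast
qed

lemma teichmueller_unique:
  assumes t: "t \<in> Zp_units p" "t ^ (p - 1) = 1" and u: "u \<in> Zp_units p" "u ^ (p - 1) = 1"
    and r: "red t = red u"
  shows "t = u"
proof (rule ccontr)
  assume ne: "t \<noteq> u"
  have tO: "t \<in> OE" "u \<in> OE" using t u Zp_sub_OE by (auto simp: Zp_units_iff Zp_iff)
  let ?S = "\<Sum>i<p - 1. u ^ (p - 1 - Suc i) * t ^ i"
  have "(t - u) * ?S = 0" using power_diff_sumr2[of t "p - 1" u] t u by simp
  then have "?S = 0" using ne by simp
  then have "0 = red ?S" by simp
  also have "\<dots> = (\<Sum>i<p - 1. red u ^ (p - 1 - Suc i) * red u ^ i)"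
    using tO r by (subst red_sum) (auto simp: red_mult red_power)
  also have "\<dots> = (\<Sum>i<p - 1. red u ^ (p - 2))"
  proof (intro sum.cong refl)
    fix i assume "i \<in> {..<p - 1}"
    then have "p - 1 - Suc i + i = p - 2" by simp
    then show "red u ^ (p - 1 - Suc i) * red u ^ i = red u ^ (p - 2)" by (metis power_add)
  qed
  also have "\<dots> = of_nat (p - 1) * red u ^ (p - 2)" by simp
  finally have "of_nat (p - 1) = (0 :: 'f)" using red_Zp_units[OF u(1)] by simp
  then have "p dvd p - 1" by (simp only: F.of_nat_eq_0_iff_p)
  then show False using p_gt_1 by (auto dest: dvd_imp_le)
qed

abbreviation teich :: "'f \<Rightarrow> 'c" where "teich \<equiv> teichmueller p red"

lemma teich:
  assumes "x \<in> \<Delta>"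
  shows "teich x \<in> Zp_units p" "teich x ^ (p - 1) = 1" "red (teich x) = x"
proof -
  have "\<exists>!t. t \<in> Zp_units p \<and> t ^ (p - 1) = 1 \<and> red t = x"
  proof (rule ex_ex1I)
    show "\<exists>t. t \<in> Zp_units p \<and> t ^ (p - 1) = 1 \<and> red t = x" by (rule teichmueller_exists[OF assms])
  qed (use teichmueller_unique in blast)
  then have "teich x \<in> Zp_units p \<and> teich x ^ (p - 1) = 1 \<and> red (teich x) = x"
    unfolding teichmueller_def by (rule theI')
  then show "teich x \<in> Zp_units p" "teich x ^ (p - 1) = 1" "red (teich x) = x" by auto
qed

lemma teich_eqI: "t \<in> Zp_units p \<Longrightarrow> t ^ (p - 1) = 1 \<Longrightarrow> red t = x \<Longrightarrow> teich x = t"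
proof -
  assume t: "t \<in> Zp_units p" "t ^ (p - 1) = 1" "red t = x"
  then have "x \<in> \<Delta>" using red_Zp_units[of t] by (auto simp: \<Delta>_def)
  then show ?thesis using teichmueller_unique[OF teich(1,2) t(1,2)] teich(3) t(3) by simp
qed

lemma teich_OE: "x \<in> \<Delta> \<Longrightarrow> teich x \<in> OE"
  using teich(1)[of x] Zp_sub_OE by (simp add: Zp_units_iff Zp_iff)

lemma teich_mult: "x \<in> \<Delta> \<Longrightarrow> y \<in> \<Delta> \<Longrightarrow> teich (x * y) = teich x * teich y"
proof (rule teich_eqI)
  assume x: "x \<in> \<Delta>" and y: "y \<in> \<Delta>"
  show "teich x * teich y \<in> Zp_units p"
    using teich(1)[OF x] teich(1)[OF y] by (auto simp: Zp_units_iff av_mult)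
  show "(teich x * teich y) ^ (p - 1) = 1"
    unfolding power_mult_distrib teich(2)[OF x] teich(2)[OF y] by simp
  show "red (teich x * teich y) = x * y" using x y by (simp add: red_mult teich_OE teich)
qed

lemma teich_1 [simp]: "teich 1 = 1"
  by (rule teich_eqI) (auto simp: Zp_units_iff)

lemma teich_powi_minus:
  assumes "x \<in> \<Delta>" "s \<le> p - 1"
  shows "teich x powi (- int s) = teich x ^ (p - 1 - s)"
proof -
  have "p - 1 - s + s = p - 1" using assms(2) by simp
  then have "teich x ^ (p - 1 - s) * teich x ^ s = 1"
    using teich(2)[OF assms(1)] by (metis power_add)
  then have "inverse (teich x ^ s) = teich x ^ (p - 1 - s)" by (metis inverse_unique mult.commute)
  then show ?thesis by (simp add: power_int_minus)
qed

text \<open>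
  Different exponents in the range differ on the group of units of \<open>Fp\<close>, which has no smaller
  exponent than \<open>p - 1\<close>.
\<close>

lemma exponent_char_of_exponent:
  assumes s: "s \<in> {0..p - 2}"
  shows "exponent p a red (char_of_exponent p a red s) = s"
proof -
  have val: "red (char_of_exponent p a red s (x, 1)) = x ^ (p - 1 - s)" if "x \<in> \<Delta>" "s \<in> {0..p - 2}" for x s
    using that by (simp add: char_of_exponent_def teich_powi_minus red_power teich_OE teich) (simp add: \<Delta>_def)
  have uniq: "s' \<le> t'" if st: "s' \<in> {0..p - 2}" "t' \<in> {0..p - 2}"
    and eq: "char_of_exponent p a red s' = char_of_exponent p a red t'" for s' t'
  proof (rule ccontr)
    assume lt: "\<not> s' \<le> t'"
    have "(p - 1) dvd (s' - t')"
    proof (rule F.exponent_dvd)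
      fix x :: 'f assume x: "x \<in> Fp" "x \<noteq> 0"
      have "p - 1 - t' = (p - 1 - s') + (s' - t')" using lt st by auto
      moreover have "x ^ (p - 1 - s') = x ^ (p - 1 - t')"
        using val[of x s'] val[of x t'] st eq x by (simp add: \<Delta>_def)
      ultimately have "x ^ (p - 1 - s') * x ^ (s' - t') = x ^ (p - 1 - s') * 1" by (metis mult.right_neutral power_add)
      then show "x ^ (s' - t') = 1" using x by simp
    qed
    moreover have "0 < s' - t'" "s' - t' < p - 1" using lt st by auto
    ultimately show False by (meson nat_dvd_not_less)
  qed
  show ?thesis unfolding exponent_def
  proof (rule the_equality)
    fix t' assume "t' \<in> {0..p - 2} \<and> char_of_exponent p a red s = char_of_exponent p a red t'"
    then show "t' = s" using uniq[of s t'] uniq[of t' s] s by auto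
  qed (use s in simp)
qed

end

section \<open>The completed group ring\<close>

context coeff_ring
begin

subsection \<open>Congruence cosets\<close>

abbreviation KK :: "('c^2^2) set" where "KK \<equiv> carrier (GL2 (Zp p))"

text \<open>
  Congruence modulo \<open>p ^ n\<close>, its classes in the maximal compact group, the set of these classes, and
  a chosen member of a class. The set is the carrier of the finite group \<open>K_level p n\<close>; describing it by
  congruences avoids coset calculations.
\<close>

definition cg :: "nat \<Rightarrow> 'c^2^2 \<Rightarrow> 'c^2^2 \<Rightarrow> bool" where
  "cg n g h \<longleftrightarrow> (\<forall>i j. av (g $ i $ j - h $ i $ j) \<le> (1 / real p) ^ n)"

definition cl :: "nat \<Rightarrow> 'c^2^2 \<Rightarrow> ('c^2^2) set" where "cl n g = {h \<in> KK. cg n h g}"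

definition Lv :: "nat \<Rightarrow> ('c^2^2) set set" where "Lv n = cl n ` KK"

definition rp :: "('c^2^2) set \<Rightarrow> 'c^2^2" where "rp C = (SOME g. g \<in> C)"

lemma KK_iff: "g \<in> KK \<longleftrightarrow> (\<forall>i j. g $ i $ j \<in> Zp p) \<and> av (det g) = 1"
proof -
  have "av (det g) = 1 \<longleftrightarrow> (\<exists>u\<in>Zp p. det g * u = 1)" if h: "\<forall>i j. g $ i $ j \<in> Zp p"
  proof
    have dZ: "det g \<in> Zp p" unfolding det_2 using h by auto
    assume a1: "av (det g) = 1"
    then have "det g \<noteq> 0" by auto
    moreover have "inverse (det g) \<in> Zp p" using dZ a1 by (auto simp: Zp_iff av_inverse)
    ultimately show "\<exists>u\<in>Zp p. det g * u = 1" by (intro bexI[of _ "inverse (det g)"]) auto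
  next
    have dZ: "det g \<in> Zp p" unfolding det_2 using h by auto
    assume "\<exists>u\<in>Zp p. det g * u = 1"
    then obtain u where u: "u \<in> Zp p" "det g * u = 1" by blast
    then have "av (det g) * av u = 1" by (simp flip: av_mult)
    moreover have "av (det g) \<le> 1" "av u \<le> 1" using dZ u by (auto simp: Zp_iff)
    ultimately show "av (det g) = 1"
      using mult_left_mono[of "av u" 1 "av (det g)"] by simp
  qed
  then show ?thesis unfolding in_GL2_iff by blast
qed

lemma KK_entry [simp]: "g \<in> KK \<Longrightarrow> g $ i $ j \<in> Zp p" and KK_det: "g \<in> KK \<Longrightarrow> av (det g) = 1"
  by (simp_all only: KK_iff)

lemma KK_entry_le: "g \<in> KK \<Longrightarrow> av (g $ i $ j) \<le> 1" and KK_entry_OE: "g \<in> KK \<Longrightarrow> g $ i $ j \<in> OE"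
  using KK_entry[of g i j] Zp_sub_OE by (auto simp: Zp_iff)

lemma KK_det_nz: "g \<in> KK \<Longrightarrow> det g \<noteq> 0"
  using KK_det by force

lemma KK_mult [simp]: "g \<in> KK \<Longrightarrow> h \<in> KK \<Longrightarrow> g ** h \<in> KK"
  unfolding KK_iff by (simp add: det_mul av_mult matrix2_mult_entry)

lemma KK_1 [simp]: "mat 1 \<in> KK"
  unfolding KK_iff by (simp add: forall_2)

lemma KK_inv2 [simp]: "g \<in> KK \<Longrightarrow> inv2 g \<in> KK"
proof -
  assume g: "g \<in> KK"
  have "x / det g \<in> Zp p" if "x \<in> Zp p" for x
  proof -
    have "det g \<in> Zp p" unfolding det_2 using g by auto
    then show ?thesis using that KK_det[OF g] by (auto simp: Zp_iff av_divide)
  qed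
  then show ?thesis using g det_inv2[OF KK_det_nz[OF g]] KK_det[OF g]
    unfolding KK_iff[of "inv2 g"] by (simp add: forall_2 av_inverse)
qed

lemma KK_cancel:
  fixes g h k :: "'c^2^2"
  assumes "g \<in> KK"
  shows "(h ** g) ** inv2 g = h" "(h ** inv2 g) ** g = h" "inv2 g ** (g ** k) = k" "g ** (inv2 g ** k) = k"
  using inv2_left[OF KK_det_nz[OF assms]] inv2_right[OF KK_det_nz[OF assms]]
  by (simp_all flip: matrix_mul_assoc) (simp_all add: matrix_mul_assoc)

lemma cg_refl [simp]: "cg n g g"
  by (simp add: cg_def)

lemma cg_sym: "cg n g h \<Longrightarrow> cg n h g"
  by (simp add: cg_def av_diff_commute)

lemma cg_trans: "cg n g h \<Longrightarrow> cg n h k \<Longrightarrow> cg n g k"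
  unfolding cg_def
proof (intro allI)
  fix i j assume "\<forall>i j. av (g $ i $ j - h $ i $ j) \<le> (1 / real p) ^ n" "\<forall>i j. av (h $ i $ j - k $ i $ j) \<le> (1 / real p) ^ n"
  then have "av ((g $ i $ j - h $ i $ j) + (h $ i $ j - k $ i $ j)) \<le> (1 / real p) ^ n" by (intro av_add_le) auto
  then show "av (g $ i $ j - k $ i $ j) \<le> (1 / real p) ^ n" by simp
qed

lemma cg_mono: "cg n g h \<Longrightarrow> m \<le> n \<Longrightarrow> cg m g h"
  unfolding cg_def
proof (intro allI)
  fix i j assume g: "\<forall>i j. av (g $ i $ j - h $ i $ j) \<le> (1 / real p) ^ n" and "m \<le> n"
  have "av (g $ i $ j - h $ i $ j) \<le> (1 / real p) ^ n" using g by simp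
  also have "\<dots> \<le> (1 / real p) ^ m" using p_gt_1 \<open>m \<le> n\<close> by (intro power_decreasing) auto
  finally show "av (g $ i $ j - h $ i $ j) \<le> (1 / real p) ^ m" .
qed

lemma cg_mult_left: "k \<in> KK \<Longrightarrow> cg n g h \<Longrightarrow> cg n (k ** g) (k ** h)"
  unfolding cg_def
proof (intro allI)
  fix i j assume k: "k \<in> KK" and g: "\<forall>i j. av (g $ i $ j - h $ i $ j) \<le> (1 / real p) ^ n"
  have "(k ** g) $ i $ j - (k ** h) $ i $ j = k $ i $ 1 * (g $ 1 $ j - h $ 1 $ j) + k $ i $ 2 * (g $ 2 $ j - h $ 2 $ j)"
    by (simp add: matrix2_mult_entry algebra_simps)
  also have "av \<dots> \<le> (1 / real p) ^ n" using g by (intro av_add_le av_mult_le_1 KK_entry_le[OF k]) auto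
  finally show "av ((k ** g) $ i $ j - (k ** h) $ i $ j) \<le> (1 / real p) ^ n" .
qed

lemma cg_mult_right: "k \<in> KK \<Longrightarrow> cg n g h \<Longrightarrow> cg n (g ** k) (h ** k)"
  unfolding cg_def
proof (intro allI)
  fix i j assume k: "k \<in> KK" and g: "\<forall>i j. av (g $ i $ j - h $ i $ j) \<le> (1 / real p) ^ n"
  have "(g ** k) $ i $ j - (h ** k) $ i $ j = k $ 1 $ j * (g $ i $ 1 - h $ i $ 1) + k $ 2 $ j * (g $ i $ 2 - h $ i $ 2)"
    by (simp add: matrix2_mult_entry algebra_simps)
  also have "av \<dots> \<le> (1 / real p) ^ n" using g by (intro av_add_le av_mult_le_1 KK_entry_le[OF k]) auto
  finally show "av ((g ** k) $ i $ j - (h ** k) $ i $ j) \<le> (1 / real p) ^ n" .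
qed

lemma cg_0: "g \<in> KK \<Longrightarrow> h \<in> KK \<Longrightarrow> cg 0 g h"
  unfolding cg_def using KK_entry_le by (auto intro: av_diff_le)

lemma in_cl: "h \<in> cl n g \<longleftrightarrow> h \<in> KK \<and> cg n h g"
  by (simp add: cl_def)

lemma cl_self [simp]: "g \<in> KK \<Longrightarrow> g \<in> cl n g"
  by (simp add: cl_def)

lemma cl_eq_iff: "g \<in> KK \<Longrightarrow> h \<in> KK \<Longrightarrow> cl n g = cl n h \<longleftrightarrow> cg n g h"
proof
  assume "g \<in> KK" "cl n g = cl n h"
  then show "cg n g h" using cl_self in_cl by blast
next
  assume "cg n g h"
  then show "cl n g = cl n h" unfolding cl_def using cg_sym cg_trans by blast
qed

lemma Lv_cl [simp]: "g \<in> KK \<Longrightarrow> cl n g \<in> Lv n"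
  by (simp add: Lv_def)

lemma Lv_eq_cl: "C \<in> Lv n \<Longrightarrow> g \<in> C \<Longrightarrow> C = cl n g \<and> g \<in> KK"
  unfolding Lv_def using cl_eq_iff in_cl cg_sym by blast

lemma rp_in: "C \<in> Lv n \<Longrightarrow> rp C \<in> C"
proof -
  assume "C \<in> Lv n"
  then have "\<exists>g. g \<in> C" unfolding Lv_def using cl_self by blast
  then show ?thesis unfolding rp_def by (rule someI_ex)
qed

lemma rp_KK [simp]: "C \<in> Lv n \<Longrightarrow> rp C \<in> KK" and cl_rp: "C \<in> Lv n \<Longrightarrow> cl n (rp C) = C"
  using rp_in Lv_eq_cl by blast+

lemma cg_rp: "g \<in> KK \<Longrightarrow> cg n (rp (cl n g)) g"
  using rp_in[of "cl n g" n] by (simp add: in_cl)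

lemma congruence_subgroup_eq: "congruence_subgroup p n = cl n (mat 1)"
  unfolding congruence_subgroup_def cl_def cg_def by (simp add: vp_ge_iff)

lemma Lv_eq: "carrier (K_level p n) = Lv n"
proof -
  have "congruence_subgroup p n #>\<^bsub>GL2 (Zp p)\<^esub> g = cl n g" if g: "g \<in> KK" for g
  proof (rule equalityI; rule subsetI)
    fix x assume "x \<in> congruence_subgroup p n #>\<^bsub>GL2 (Zp p)\<^esub> g"
    then obtain k where "k \<in> cl n (mat 1)" "x = k ** g"
      unfolding r_coset_def congruence_subgroup_eq by auto
    then show "x \<in> cl n g" using g cg_mult_right[OF g, of n k "mat 1"] by (simp add: in_cl)
  next
    fix x assume x: "x \<in> cl n g"
    have "cg n (x ** inv2 g) (mat 1)"
      using cg_mult_right[of "inv2 g" n x g] x g inv2_right[OF KK_det_nz[OF g]] by (simp add: in_cl)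
    then have "x ** inv2 g \<in> cl n (mat 1)" using x g by (simp add: in_cl)
    moreover have "x = (x ** inv2 g) ** g" using KK_cancel[OF g] by simp
    ultimately show "x \<in> congruence_subgroup p n #>\<^bsub>GL2 (Zp p)\<^esub> g"
      unfolding r_coset_def congruence_subgroup_eq by auto
  qed
  then show ?thesis by (auto simp: FactGroup_def RCOSETS_def Lv_def)
qed

lemma set_mult_cl:
  assumes g: "g \<in> KK" and h: "h \<in> KK"
  shows "set_mult (GL2 (Zp p)) (cl n g) (cl n h) = cl n (g ** h)"
proof (rule equalityI; rule subsetI)
  fix z assume "z \<in> set_mult (GL2 (Zp p)) (cl n g) (cl n h)"
  then obtain x y where xy: "z = x ** y" "x \<in> cl n g" "y \<in> cl n h" unfolding set_mult_def by auto
  have "cg n (x ** y) (g ** y)" using xy by (intro cg_mult_right) (auto simp: in_cl)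
  moreover have "cg n (g ** y) (g ** h)" using xy g by (intro cg_mult_left) (auto simp: in_cl)
  ultimately show "z \<in> cl n (g ** h)" using xy cg_trans by (auto simp: in_cl)
next
  fix z assume z: "z \<in> cl n (g ** h)"
  have "cg n (inv2 g ** z) (inv2 g ** (g ** h))" using z g by (intro cg_mult_left) (auto simp: in_cl)
  then have "inv2 g ** z \<in> cl n h" using z g KK_cancel[OF g] by (simp add: in_cl)
  moreover have "z = g ** (inv2 g ** z)" using KK_cancel[OF g] by simp
  ultimately show "z \<in> set_mult (GL2 (Zp p)) (cl n g) (cl n h)"
    unfolding set_mult_def using g by force
qed

lemma finite_Lv [simp]: "finite (Lv n)"
proof (rule finite_subset)
  let ?I = "{..<p ^ n}"
  let ?M = "\<lambda>(x, y, z, t). {h \<in> KK. cg n h (mat2 (of_nat x) (of_nat y) (of_nat z) (of_nat t))}"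
  show "Lv n \<subseteq> ?M ` (?I \<times> ?I \<times> ?I \<times> ?I)"
  proof
    fix C assume C: "C \<in> Lv n"
    define g where "g = rp C"
    have g: "g \<in> KK" "C = cl n g" using C by (simp_all add: g_def cl_rp)
    have "\<exists>k<p ^ n. av (g $ i $ j - of_nat k) \<le> (1 / real p) ^ n" for i j
      by (rule Zp_approx_nat) (use g in simp)
    then obtain k where k: "\<And>i j. k i j < p ^ n" "\<And>i j. av (g $ i $ j - of_nat (k i j)) \<le> (1 / real p) ^ n"
      by metis
    define M where "M = mat2 (of_nat (k 1 1)) (of_nat (k 1 2)) (of_nat (k 2 1)) (of_nat (k 2 2) :: 'c)"
    have gM: "cg n g M" unfolding cg_def M_def using k(2) by (simp add: forall_2)
    then have "C = {h \<in> KK. cg n h M}" unfolding g(2) cl_def using cg_sym cg_trans by blast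
    then show "C \<in> ?M ` (?I \<times> ?I \<times> ?I \<times> ?I)"
      using k(1) by (intro image_eqI[of _ _ "(k 1 1, k 1 2, k 2 1, k 2 2)"]) (auto simp: M_def)
  qed
qed auto

lemma Lv_0: "Lv 0 = {KK}"
proof -
  have "cl 0 g = KK" if "g \<in> KK" for g using that cg_0 by (auto simp: in_cl)
  moreover have "KK \<noteq> {}" using KK_1 by blast
  ultimately show ?thesis unfolding Lv_def by (auto simp: image_iff)
qed

lemma Lv_disjoint: "C \<in> Lv n \<Longrightarrow> C' \<in> Lv n \<Longrightarrow> C \<inter> C' \<noteq> {} \<Longrightarrow> C = C'"
  using Lv_eq_cl by blast

lemma Lv_sub_iff: "m \<le> n \<Longrightarrow> C \<in> Lv m \<Longrightarrow> D \<in> Lv n \<Longrightarrow> D \<subseteq> C \<longleftrightarrow> rp D \<in> C"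
proof
  assume m: "m \<le> n" and C: "C \<in> Lv m" and D: "D \<in> Lv n" and r: "rp D \<in> C"
  show "D \<subseteq> C"
  proof
    fix x assume "x \<in> D"
    then have x: "x \<in> KK" "cg n x (rp D)" using cl_rp[OF D] in_cl by blast+
    have "C = cl m (rp D)" using Lv_eq_cl[OF C r] by simp
    then show "x \<in> C" using x cg_mono[OF _ m] by (simp add: in_cl)
  qed
qed (use rp_in in blast)

lemma sum_Lv_split:
  assumes "m \<le> n"
  shows "(\<Sum>C\<in>Lv m. \<Sum>D\<in>{D \<in> Lv n. D \<subseteq> C}. \<phi> C D) = (\<Sum>D\<in>Lv n. \<phi> (cl m (rp D)) D)"
proof -
  have "(\<Sum>C\<in>Lv m. \<Sum>D\<in>{D \<in> Lv n. D \<subseteq> C}. \<phi> C D) = (\<Sum>C\<in>Lv m. \<Sum>D\<in>Lv n. if D \<subseteq> C then \<phi> C D else 0)"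
    by (rule sum.cong[OF refl], rule sum.inter_filter) simp
  also have "\<dots> = (\<Sum>D\<in>Lv n. \<Sum>C\<in>Lv m. if D \<subseteq> C then \<phi> C D else 0)" by (rule sum.swap)
  also have "\<dots> = (\<Sum>D\<in>Lv n. \<Sum>C\<in>Lv m. if C = cl m (rp D) then \<phi> (cl m (rp D)) D else 0)"
  proof (intro sum.cong refl)
    fix D C assume D: "D \<in> Lv n" and C: "C \<in> Lv m"
    have "D \<subseteq> C \<longleftrightarrow> C = cl m (rp D)"
      unfolding Lv_sub_iff[OF assms C D] using Lv_eq_cl[OF C] rp_KK[OF D] cl_self by blast
    then show "(if D \<subseteq> C then \<phi> C D else 0) = (if C = cl m (rp D) then \<phi> (cl m (rp D)) D else 0)" by auto
  qed
  also have "\<dots> = (\<Sum>D\<in>Lv n. \<phi> (cl m (rp D)) D)" by (intro sum.cong refl) simp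
  finally show ?thesis .
qed

subsection \<open>Elements of the completed group ring\<close>

abbreviation RR :: "(nat \<Rightarrow> ('c^2^2) set \<Rightarrow> 'c) ring" where "RR \<equiv> iwasawa_ring p OE"

abbreviation convolution (infixl "\<star>" 70) where "x \<star> y \<equiv> x \<otimes>\<^bsub>RR\<^esub> y"

lemma RR_iff: "x \<in> carrier RR \<longleftrightarrow> (\<forall>n. (\<forall>C\<in>Lv n. x n C \<in> OE) \<and> (\<forall>C. C \<notin> Lv n \<longrightarrow> x n C = 0) \<and>
    (\<forall>C\<in>Lv n. x n C = (\<Sum>D\<in>{D \<in> Lv (Suc n). D \<subseteq> C}. x (Suc n) D)))"
  unfolding iwasawa_ring_def group_ring_def Lv_eq by auto

lemma RR_OE: "x \<in> carrier RR \<Longrightarrow> C \<in> Lv n \<Longrightarrow> x n C \<in> OE"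
  and RR_outside: "x \<in> carrier RR \<Longrightarrow> C \<notin> Lv n \<Longrightarrow> x n C = 0"
  and RR_compat: "x \<in> carrier RR \<Longrightarrow> C \<in> Lv n \<Longrightarrow> x n C = (\<Sum>D\<in>{D \<in> Lv (Suc n). D \<subseteq> C}. x (Suc n) D)"
  unfolding RR_iff by blast+

lemma RR_add: "x \<oplus>\<^bsub>RR\<^esub> y = (\<lambda>n C. x n C + y n C)"
  by (simp add: iwasawa_ring_def group_ring_def)

lemma RR_mult: "(x \<star> y) n C =
    (\<Sum>(h, k)\<in>{(h, k). h \<in> Lv n \<and> k \<in> Lv n \<and> set_mult (GL2 (Zp p)) h k = C}. x n h * y n k)"
  by (simp add: iwasawa_ring_def group_ring_def Lv_eq)

lemma RR_add_closed: "x \<in> carrier RR \<Longrightarrow> y \<in> carrier RR \<Longrightarrow> (\<lambda>n C. x n C + y n C) \<in> carrier RR"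
proof -
  assume x: "x \<in> carrier RR" and y: "y \<in> carrier RR"
  show ?thesis unfolding RR_iff
  proof (intro allI conjI ballI impI)
    fix n C
    show "C \<in> Lv n \<Longrightarrow> x n C + y n C \<in> OE" by (intro OE_closed RR_OE[OF x] RR_OE[OF y])
    show "C \<notin> Lv n \<Longrightarrow> x n C + y n C = 0" by (simp add: RR_outside[OF x] RR_outside[OF y])
    assume C: "C \<in> Lv n"
    show "x n C + y n C = (\<Sum>D\<in>{D \<in> Lv (Suc n). D \<subseteq> C}. x (Suc n) D + y (Suc n) D)"
      unfolding sum.distrib using RR_compat[OF x C] RR_compat[OF y C] by (simp only:)
  qed
qed

lemma RR_zero_closed: "(\<lambda>n C. 0) \<in> carrier RR"
  unfolding RR_iff by simp

lemma RR_sum_closed: "(\<And>i. i \<in> I \<Longrightarrow> f i \<in> carrier RR) \<Longrightarrow> (\<lambda>n C. \<Sum>i\<in>I. f i n C) \<in> carrier RR"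
  by (induction I rule: infinite_finite_induct) (simp_all add: RR_zero_closed RR_add_closed)

lemma RR_compat_iterated:
  assumes x: "x \<in> carrier RR" and C: "C \<in> Lv m"
  shows "x m C = (\<Sum>D\<in>{D \<in> Lv (m + k). D \<subseteq> C}. x (m + k) D)"
proof (induction k)
  case 0
  have "{D \<in> Lv m. D \<subseteq> C} = {C}"
  proof (rule equalityI; rule subsetI)
    fix D assume D: "D \<in> {D \<in> Lv m. D \<subseteq> C}"
    then have "D \<inter> C \<noteq> {}" using rp_in by blast
    then show "D \<in> {C}" using Lv_disjoint[of D m C] D C by simp
  qed (use C in auto)
  then show ?case by simp
next
  case (Suc k)
  have "(\<Sum>D\<in>{D \<in> Lv (m + k). D \<subseteq> C}. x (m + k) D) = (\<Sum>D\<in>Lv (m + k). if D \<subseteq> C then x (m + k) D else 0)"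
    by (rule sum.inter_filter) simp
  also have "\<dots> = (\<Sum>D\<in>Lv (m + k). \<Sum>B\<in>{B \<in> Lv (Suc (m + k)). B \<subseteq> D}. if D \<subseteq> C then x (Suc (m + k)) B else 0)"
  proof (intro sum.cong refl)
    fix D assume D: "D \<in> Lv (m + k)"
    show "(if D \<subseteq> C then x (m + k) D else 0) = (\<Sum>B\<in>{B \<in> Lv (Suc (m + k)). B \<subseteq> D}. if D \<subseteq> C then x (Suc (m + k)) B else 0)"
      using RR_compat[OF x D] by (cases "D \<subseteq> C") simp_all
  qed
  also have "\<dots> = (\<Sum>B\<in>Lv (Suc (m + k)). if cl (m + k) (rp B) \<subseteq> C then x (Suc (m + k)) B else 0)"
    by (rule sum_Lv_split) simp
  also have "\<dots> = (\<Sum>B\<in>Lv (Suc (m + k)). if B \<subseteq> C then x (Suc (m + k)) B else 0)"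
  proof (intro sum.cong refl)
    fix B assume B: "B \<in> Lv (Suc (m + k))"
    have "cl (m + k) (rp B) \<subseteq> C \<longleftrightarrow> rp B \<in> C"
      using Lv_sub_iff[of m "m + k" C "cl (m + k) (rp B)"] C B cg_rp[of "rp B" "m + k"] cg_mono[of "m + k" _ _ m]
        Lv_eq_cl[OF C] cl_self rp_KK[OF B] rp_in[of "cl (m + k) (rp B)" "m + k"]
      by (metis (no_types, lifting) Lv_cl cg_sym in_cl le_add1 rp_KK)
    also have "\<dots> \<longleftrightarrow> B \<subseteq> C" using Lv_sub_iff[of m "Suc (m + k)" C B] C B by simp
    finally show "(if cl (m + k) (rp B) \<subseteq> C then x (Suc (m + k)) B else 0) = (if B \<subseteq> C then x (Suc (m + k)) B else 0)" by simp
  qed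
  also have "\<dots> = (\<Sum>B\<in>{B \<in> Lv (Suc (m + k)). B \<subseteq> C}. x (Suc (m + k)) B)"
    by (rule sum.inter_filter[symmetric]) simp
  finally show ?case unfolding Suc add_Suc_right .
qed

lemma pt_eq: "pt p c g n C = (if C \<in> Lv n \<and> g \<in> C then c else 0)"
  by (simp add: pt_def Lv_eq)

lemma pt_cl: "g \<in> KK \<Longrightarrow> pt p c g n C = (if C = cl n g then c else 0)"
  unfolding pt_eq using Lv_eq_cl Lv_cl cl_self by metis

lemma pt_RR [simp]:
  assumes c: "c \<in> OE" and g: "g \<in> KK"
  shows "pt p c g \<in> carrier RR"
  unfolding RR_iff
proof (intro allI conjI ballI impI)
  fix n C
  show "pt p c g n C \<in> OE" using c by (simp add: pt_eq)
  show "C \<notin> Lv n \<Longrightarrow> pt p c g n C = 0" by (simp add: pt_eq)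
  assume C: "C \<in> Lv n"
  have "(\<Sum>D\<in>{D \<in> Lv (Suc n). D \<subseteq> C}. pt p c g (Suc n) D) =
      (\<Sum>D\<in>{D \<in> Lv (Suc n). D \<subseteq> C}. if D = cl (Suc n) g then c else 0)"
    by (simp add: pt_cl[OF g])
  also have "\<dots> = (if cl (Suc n) g \<subseteq> C then c else 0)" using g by simp
  also have "cl (Suc n) g \<subseteq> C \<longleftrightarrow> g \<in> C"
  proof
    assume "g \<in> C"
    then have "C = cl n g" using Lv_eq_cl[OF C] by blast
    then show "cl (Suc n) g \<subseteq> C" using cg_mono[of "Suc n" _ g n] by (auto simp: in_cl)
  qed (use g in auto)
  finally show "pt p c g n C = (\<Sum>D\<in>{D \<in> Lv (Suc n). D \<subseteq> C}. pt p c g (Suc n) D)" using C by (simp add: pt_eq)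
qed

lemma finite_pairs: "finite {(h, k). h \<in> Lv n \<and> k \<in> Lv n \<and> Q h k}"
  by (rule finite_subset[of _ "Lv n \<times> Lv n"]) auto

text \<open>
  Multiplication by a group element translates a measure.
\<close>

lemma RR_mult_pt_right:
  assumes g: "g \<in> KK" and u: "u \<in> KK"
  shows "(x \<star> pt p c u) n (cl n (g ** u)) = x n (cl n g) * c"
proof -
  let ?S = "{(h, k). h \<in> Lv n \<and> k \<in> Lv n \<and> set_mult (GL2 (Zp p)) h k = cl n (g ** u)}"
  have "(\<Sum>(h, k)\<in>?S. x n h * pt p c u n k) = (\<Sum>(h, k)\<in>{(cl n g, cl n u)}. x n h * pt p c u n k)"
  proof (rule sum.mono_neutral_right[OF finite_pairs], goal_cases)
    case 1
    then show ?case using g u by (simp add: set_mult_cl)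
  next
    case 2
    show ?case
    proof
      fix i assume i: "i \<in> ?S - {(cl n g, cl n u)}"
      obtain h k where hk: "i = (h, k)" by force
      have "k \<noteq> cl n u"
      proof
        assume k: "k = cl n u"
        have h: "h \<in> Lv n" using i hk by simp
        have "cl n (rp h ** u) = cl n (g ** u)"
          using i hk k set_mult_cl[OF rp_KK[OF h] u, of n] cl_rp[OF h] by simp
        then have "cg n (rp h ** u) (g ** u)" using cl_eq_iff h g u by simp
        then have "cg n (rp h) g" using cg_mult_right[of "inv2 u" n "rp h ** u" "g ** u"] u KK_cancel[OF u] by simp
        then have "h = cl n g" using cl_eq_iff[of "rp h" g n] h g cl_rp[OF h] by simp
        with i hk k show False by simp
      qed
      then show "(case i of (h, k) \<Rightarrow> x n h * pt p c u n k) = 0" by (simp add: hk pt_cl[OF u])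
    qed
  qed
  then show ?thesis unfolding RR_mult by (simp add: pt_cl[OF u])
qed

lemma RR_mult_pt_left:
  assumes g: "g \<in> KK" and u: "u \<in> KK"
  shows "(pt p c u \<star> x) n (cl n (u ** g)) = c * x n (cl n g)"
proof -
  let ?S = "{(h, k). h \<in> Lv n \<and> k \<in> Lv n \<and> set_mult (GL2 (Zp p)) h k = cl n (u ** g)}"
  have "(\<Sum>(h, k)\<in>?S. pt p c u n h * x n k) = (\<Sum>(h, k)\<in>{(cl n u, cl n g)}. pt p c u n h * x n k)"
  proof (rule sum.mono_neutral_right[OF finite_pairs], goal_cases)
    case 1
    then show ?case using g u by (simp add: set_mult_cl)
  next
    case 2
    show ?case
    proof
      fix i assume i: "i \<in> ?S - {(cl n u, cl n g)}"
      obtain h k where hk: "i = (h, k)" by force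
      have "h \<noteq> cl n u"
      proof
        assume h: "h = cl n u"
        have k: "k \<in> Lv n" using i hk by simp
        have "cl n (u ** rp k) = cl n (u ** g)"
          using i hk h set_mult_cl[OF u rp_KK[OF k], of n] cl_rp[OF k] by simp
        then have "cg n (u ** rp k) (u ** g)" using cl_eq_iff k g u by simp
        then have "cg n (rp k) g" using cg_mult_left[of "inv2 u" n "u ** rp k" "u ** g"] u KK_cancel[OF u] by simp
        then have "k = cl n g" using cl_eq_iff[of "rp k" g n] k g cl_rp[OF k] by simp
        with i hk h show False by simp
      qed
      then show "(case i of (h, k) \<Rightarrow> pt p c u n h * x n k) = 0" by (simp add: hk pt_cl[OF u])
    qed
  qed
  then show ?thesis unfolding RR_mult by (simp add: pt_cl[OF u])
qed

lemma RR_mult_outside: "C \<notin> Lv n \<Longrightarrow> (x \<star> y) n C = 0"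
proof -
  assume C: "C \<notin> Lv n"
  have "set_mult (GL2 (Zp p)) h k \<in> Lv n" if "h \<in> Lv n" "k \<in> Lv n" for h k
    using set_mult_cl[OF rp_KK[OF that(1)] rp_KK[OF that(2)], of n] that by (simp add: cl_rp)
  then have no: "{(h, k). h \<in> Lv n \<and> k \<in> Lv n \<and> set_mult (GL2 (Zp p)) h k = C} = {}" using C by blast
  show ?thesis unfolding RR_mult no by simp
qed

lemma pt_mult:
  assumes g: "g \<in> KK" and h: "h \<in> KK"
  shows "pt p c g \<star> pt p d h = pt p (c * d) (g ** h)"
proof (intro ext)
  fix n C
  show "(pt p c g \<star> pt p d h) n C = pt p (c * d) (g ** h) n C"
  proof (cases "C \<in> Lv n")
    case True
    define k where "k = rp C ** inv2 h"
    have k: "k \<in> KK" "C = cl n (k ** h)" using True h by (simp_all add: k_def KK_cancel cl_rp)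
    have "(pt p c g \<star> pt p d h) n C = pt p c g n (cl n k) * d"
      unfolding k(2) by (rule RR_mult_pt_right[OF k(1) h])
    moreover have "cl n k = cl n g \<longleftrightarrow> C = cl n (g ** h)"
    proof -
      have "cg n k g \<longleftrightarrow> cg n (k ** h) (g ** h)"
        using cg_mult_right[OF h, of n k g] cg_mult_right[of "inv2 h" n "k ** h" "g ** h"] h KK_cancel[OF h] by auto
      then show ?thesis using k g h cl_eq_iff by simp
    qed
    ultimately show ?thesis using g h by (simp add: pt_cl)
  next
    case False
    then show ?thesis by (simp add: RR_mult_outside pt_eq)
  qed
qed

lemma av_RR_mult_le:
  assumes x: "x \<in> carrier RR" and y: "\<And>C. C \<in> Lv n \<Longrightarrow> av (y n C) \<le> r" and r: "0 \<le> r"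
  shows "av ((x \<star> y) n C) \<le> r"
  unfolding RR_mult
proof (rule av_sum_le[OF _ r])
  fix i assume "i \<in> {(h, k). h \<in> Lv n \<and> k \<in> Lv n \<and> set_mult (GL2 (Zp p)) h k = C}"
  then show "av (case i of (h, k) \<Rightarrow> x n h * y n k) \<le> r"
    using RR_OE[OF x] y by (auto intro!: av_mult_le_1 simp: av_OE)
qed

subsection \<open>Integration\<close>

text \<open>
  An element of the completed group ring is a measure on the compact group; Riemann sums of a function
  that respects the congruences converge in the complete ring of integers. The Lipschitz condition with constant one makes all error terms explicit.
\<close>

definition uniform :: "('c^2^2 \<Rightarrow> 'c) \<Rightarrow> bool" where
  "uniform \<omega> \<longleftrightarrow> (\<forall>g\<in>KK. \<omega> g \<in> OE) \<and> (\<forall>n. \<forall>g\<in>KK. \<forall>h\<in>KK. cg n g h \<longrightarrow> av (\<omega> g - \<omega> h) \<le> (1 / real p) ^ n)"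

definition riemann :: "nat \<Rightarrow> ('c^2^2 \<Rightarrow> 'c) \<Rightarrow> (nat \<Rightarrow> ('c^2^2) set \<Rightarrow> 'c) \<Rightarrow> 'c" where
  "riemann n \<omega> x = (\<Sum>C\<in>Lv n. x n C * \<omega> (rp C))"

definition intg :: "('c^2^2 \<Rightarrow> 'c) \<Rightarrow> (nat \<Rightarrow> ('c^2^2) set \<Rightarrow> 'c) \<Rightarrow> 'c" where
  "intg \<omega> x = lim (\<lambda>n. riemann n \<omega> x)"

lemma uniformD: "uniform \<omega> \<Longrightarrow> g \<in> KK \<Longrightarrow> \<omega> g \<in> OE"
  "uniform \<omega> \<Longrightarrow> g \<in> KK \<Longrightarrow> h \<in> KK \<Longrightarrow> cg n g h \<Longrightarrow> av (\<omega> g - \<omega> h) \<le> (1 / real p) ^ n"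
  by (simp_all add: uniform_def)

lemma riemann_OE: "uniform \<omega> \<Longrightarrow> x \<in> carrier RR \<Longrightarrow> riemann n \<omega> x \<in> OE"
  unfolding riemann_def by (intro OE_sum OE_closed(3) RR_OE uniformD) auto

lemma riemann_step:
  assumes \<omega>: "uniform \<omega>" and x: "x \<in> carrier RR"
  shows "av (riemann (Suc n) \<omega> x - riemann n \<omega> x) \<le> (1 / real p) ^ n"
proof -
  have "riemann n \<omega> x = (\<Sum>C\<in>Lv n. \<Sum>D\<in>{D \<in> Lv (Suc n). D \<subseteq> C}. x (Suc n) D * \<omega> (rp C))"
    unfolding riemann_def by (intro sum.cong refl) (simp add: RR_compat[OF x] sum_distrib_right)
  also have "\<dots> = (\<Sum>D\<in>Lv (Suc n). x (Suc n) D * \<omega> (rp (cl n (rp D))))"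
    by (rule sum_Lv_split) simp
  finally have "riemann (Suc n) \<omega> x - riemann n \<omega> x =
      (\<Sum>D\<in>Lv (Suc n). x (Suc n) D * (\<omega> (rp D) - \<omega> (rp (cl n (rp D)))))"
    by (simp add: riemann_def right_diff_distrib sum_subtractf)
  also have "av \<dots> \<le> (1 / real p) ^ n"
  proof (rule av_sum_le)
    fix D assume D: "D \<in> Lv (Suc n)"
    show "av (x (Suc n) D * (\<omega> (rp D) - \<omega> (rp (cl n (rp D))))) \<le> (1 / real p) ^ n"
    proof (rule av_mult_le_1)
      show "av (x (Suc n) D) \<le> 1" by (rule av_OE[OF RR_OE[OF x D]])
      have r: "rp D \<in> KK" using D by simp
      show "av (\<omega> (rp D) - \<omega> (rp (cl n (rp D)))) \<le> (1 / real p) ^ n"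
        by (rule uniformD(2)[OF \<omega> r]) (use r cg_sym[OF cg_rp[OF r]] rp_KK[OF Lv_cl[OF r]] in auto)
    qed
  qed simp
  finally show ?thesis .
qed

lemma intg:
  assumes "uniform \<omega>" "x \<in> carrier RR"
  shows "(\<lambda>n. riemann n \<omega> x) \<longlonglongrightarrow> intg \<omega> x" "av (intg \<omega> x - riemann n \<omega> x) \<le> (1 / real p) ^ n" "intg \<omega> x \<in> OE"
proof -
  obtain L where L: "(\<lambda>n. riemann n \<omega> x) \<longlonglongrightarrow> L" "\<forall>n. av (L - riemann n \<omega> x) \<le> (1 / real p) ^ n"
    using convergent_p_power[of "\<lambda>n. riemann n \<omega> x"] riemann_step[OF assms] by blast
  have "intg \<omega> x = L" unfolding intg_def using L(1) by (rule limI)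
  then show "(\<lambda>n. riemann n \<omega> x) \<longlonglongrightarrow> intg \<omega> x" "av (intg \<omega> x - riemann n \<omega> x) \<le> (1 / real p) ^ n"
    using L by simp_all
  then show "intg \<omega> x \<in> OE" using OE_lim riemann_OE[OF assms] by blast
qed

lemma intg_eqI: "uniform \<omega> \<Longrightarrow> x \<in> carrier RR \<Longrightarrow> (\<lambda>n. riemann n \<omega> x) \<longlonglongrightarrow> L \<Longrightarrow> intg \<omega> x = L"
  using intg(1) LIMSEQ_unique by blast

lemma intg_add: "uniform \<omega> \<Longrightarrow> x \<in> carrier RR \<Longrightarrow> y \<in> carrier RR \<Longrightarrow>
    intg \<omega> (\<lambda>n C. x n C + y n C) = intg \<omega> x + intg \<omega> y"
proof (rule intg_eqI)
  assume "uniform \<omega>" "x \<in> carrier RR" "y \<in> carrier RR"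
  then have "(\<lambda>n. riemann n \<omega> x + riemann n \<omega> y) \<longlonglongrightarrow> intg \<omega> x + intg \<omega> y"
    by (intro tendsto_add_av intg)
  then show "(\<lambda>n. riemann n \<omega> (\<lambda>n C. x n C + y n C)) \<longlonglongrightarrow> intg \<omega> x + intg \<omega> y"
    by (simp add: riemann_def distrib_right sum.distrib)
qed (simp_all add: RR_add_closed)

lemma intg_linear:
  assumes "finite I" "\<And>i. i \<in> I \<Longrightarrow> uniform (\<omega> i)" "uniform (\<lambda>g. \<Sum>i\<in>I. c i * \<omega> i g)" "x \<in> carrier RR"
  shows "intg (\<lambda>g. \<Sum>i\<in>I. c i * \<omega> i g) x = (\<Sum>i\<in>I. c i * intg (\<omega> i) x)"
proof (rule intg_eqI[OF assms(3,4)])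
  have "(\<lambda>n. \<Sum>i\<in>I. c i * riemann n (\<omega> i) x) \<longlonglongrightarrow> (\<Sum>i\<in>I. c i * intg (\<omega> i) x)"
    by (intro tendsto_sum_av tendsto_mult_left_av intg assms)
  moreover have "(\<Sum>i\<in>I. c i * riemann n (\<omega> i) x) = riemann n (\<lambda>g. \<Sum>i\<in>I. c i * \<omega> i g) x" for n
    unfolding riemann_def sum_distrib_left by (subst sum.swap) (simp add: mult_ac)
  ultimately show "(\<lambda>n. riemann n (\<lambda>g. \<Sum>i\<in>I. c i * \<omega> i g) x) \<longlonglongrightarrow> (\<Sum>i\<in>I. c i * intg (\<omega> i) x)" by simp
qed

lemma uniform_translate: "uniform \<omega> \<Longrightarrow> u \<in> KK \<Longrightarrow> uniform (\<lambda>g. \<omega> (g ** u))"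
proof -
  assume \<omega>: "uniform \<omega>" and u: "u \<in> KK"
  show ?thesis unfolding uniform_def
    using uniformD(1)[OF \<omega>] uniformD(2)[OF \<omega>] cg_mult_right[OF u] KK_mult[OF _ u] by simp
qed

text \<open>
  Riemann sums of both sides differ only by the choice of representatives of the cosets.
\<close>

lemma intg_translate:
  assumes \<omega>: "uniform \<omega>" and x: "x \<in> carrier RR" and xu: "x \<star> pt p c u \<in> carrier RR"
    and u: "u \<in> KK" and c: "c \<in> OE"
  shows "intg \<omega> (x \<star> pt p c u) = c * intg (\<lambda>g. \<omega> (g ** u)) x"
proof (rule intg_eqI[OF \<omega> xu])
  have "(\<lambda>n. c * riemann n (\<lambda>g. \<omega> (g ** u)) x) \<longlonglongrightarrow> c * intg (\<lambda>g. \<omega> (g ** u)) x"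
    by (intro tendsto_mult_left_av intg uniform_translate \<omega> u x)
  then show "(\<lambda>n. riemann n \<omega> (x \<star> pt p c u)) \<longlonglongrightarrow> c * intg (\<lambda>g. \<omega> (g ** u)) x"
  proof (rule tendsto_same)
    fix n
    have "riemann n \<omega> (x \<star> pt p c u) = (\<Sum>D\<in>Lv n. (x \<star> pt p c u) n (cl n (rp D ** u)) * \<omega> (rp (cl n (rp D ** u))))"
      unfolding riemann_def
    proof (rule sum.reindex_bij_witness[of _ "\<lambda>D. cl n (rp D ** u)" "\<lambda>C. cl n (rp C ** inv2 u)"])
      have *: "cl n (rp (cl n (rp C ** v)) ** w) = C" if "C \<in> Lv n" "v \<in> KK" "w \<in> KK" "\<And>h :: 'c^2^2. (h ** v) ** w = h" for C v w
      proof -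
        have "cg n (rp (cl n (rp C ** v)) ** w) (rp C ** v ** w)"
          using that by (intro cg_mult_right cg_rp) auto
        then have "cg n (rp (cl n (rp C ** v)) ** w) (rp C)" using that by simp
        then have "cl n (rp (cl n (rp C ** v)) ** w) = cl n (rp C)" using that rp_KK[OF Lv_cl, of "rp C ** v" n] by (subst cl_eq_iff) auto
        then show ?thesis using that by (simp add: cl_rp)
      qed
      fix C assume C: "C \<in> Lv n"
      show "cl n (rp (cl n (rp C ** inv2 u)) ** u) = C" "cl n (rp (cl n (rp C ** u)) ** inv2 u) = C"
        by (rule *[OF C]; use u in \<open>simp add: KK_cancel\<close>)+
      then show "(x \<star> pt p c u) n (cl n (rp (cl n (rp C ** inv2 u)) ** u)) * \<omega> (rp (cl n (rp (cl n (rp C ** inv2 u)) ** u))) =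
          (x \<star> pt p c u) n C * \<omega> (rp C)" by simp
    qed (use u in auto)
    also have "\<dots> = (\<Sum>D\<in>Lv n. x n D * c * \<omega> (rp (cl n (rp D ** u))))"
      using u by (intro sum.cong refl) (simp add: RR_mult_pt_right cl_rp)
    finally have "c * riemann n (\<lambda>g. \<omega> (g ** u)) x - riemann n \<omega> (x \<star> pt p c u) =
        (\<Sum>D\<in>Lv n. (x n D * c) * (\<omega> (rp D ** u) - \<omega> (rp (cl n (rp D ** u)))))"
      by (simp add: riemann_def sum_distrib_left right_diff_distrib sum_subtractf mult_ac)
    also have "av \<dots> \<le> (1 / real p) ^ n"
    proof (rule av_sum_le)
      fix D assume D: "D \<in> Lv n"
      show "av ((x n D * c) * (\<omega> (rp D ** u) - \<omega> (rp (cl n (rp D ** u))))) \<le> (1 / real p) ^ n"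
      proof (rule av_mult_le_1)
        show "av (x n D * c) \<le> 1" using RR_OE[OF x D] c by (intro av_OE) simp
        have r: "rp D ** u \<in> KK" using D u by simp
        show "av (\<omega> (rp D ** u) - \<omega> (rp (cl n (rp D ** u)))) \<le> (1 / real p) ^ n"
          by (rule uniformD(2)[OF \<omega> r]) (use r cg_sym[OF cg_rp[OF r]] rp_KK[OF Lv_cl[OF r]] in auto)
      qed
    qed simp
    finally show "av (c * riemann n (\<lambda>g. \<omega> (g ** u)) x - riemann n \<omega> (x \<star> pt p c u)) \<le> (1 / real p) ^ n" .
  qed
qed

end

section \<open>Integral polynomials\<close>

context coeff_ring
begin

definition intp :: "'c poly \<Rightarrow> bool" where "intp F \<longleftrightarrow> (\<forall>i. coeff F i \<in> OE)"

definition redp :: "'c poly \<Rightarrow> 'f poly" where "redp F = map_poly red F"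

definition closep :: "real \<Rightarrow> 'c poly \<Rightarrow> 'c poly \<Rightarrow> bool" where
  "closep r F F' \<longleftrightarrow> (\<forall>i. av (coeff F i - coeff F' i) \<le> r)"

lemma coeff_redp [simp]: "coeff (redp F) i = red (coeff F i)"
  by (simp add: redp_def coeff_map_poly)

lemma intpD: "intp F \<Longrightarrow> coeff F i \<in> OE"
  by (simp add: intp_def)

lemma intp_mult: "intp F \<Longrightarrow> intp F' \<Longrightarrow> intp (F * F')"
  unfolding intp_def coeff_mult by auto

lemma intp_1 [simp]: "intp 1" and intp_0 [simp]: "intp 0"
  by (simp_all add: intp_def one_pCons coeff_pCons split: nat.split)

lemma intp_power: "intp F \<Longrightarrow> intp (F ^ n)"
  by (induction n) (auto intro: intp_mult)

lemma intp_linear: "x \<in> OE \<Longrightarrow> y \<in> OE \<Longrightarrow> intp [:x, y:]"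
  by (simp add: intp_def coeff_pCons split: nat.split)

lemma intp_add: "intp F \<Longrightarrow> intp F' \<Longrightarrow> intp (F + F')"
  and intp_smult: "c \<in> OE \<Longrightarrow> intp F \<Longrightarrow> intp (smult c F)"
  by (simp_all add: intp_def)

lemma redp_mult: "intp F \<Longrightarrow> intp F' \<Longrightarrow> redp (F * F') = redp F * redp F'"
  by (rule poly_eqI) (simp add: coeff_mult red_sum red_mult intp_def)

lemma redp_add: "intp F \<Longrightarrow> intp F' \<Longrightarrow> redp (F + F') = redp F + redp F'"
  by (rule poly_eqI) (simp add: red_add intp_def)

lemma redp_smult: "c \<in> OE \<Longrightarrow> intp F \<Longrightarrow> redp (smult c F) = smult (red c) (redp F)"
  by (rule poly_eqI) (simp add: red_mult intp_def)

lemma redp_power: "intp F \<Longrightarrow> redp (F ^ n) = redp F ^ n"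
proof (induction n)
  case 0
  show ?case by (rule poly_eqI) (simp add: one_pCons coeff_pCons split: nat.split)
next
  case (Suc n)
  then show ?case by (simp add: redp_mult intp_power)
qed

lemma redp_linear: "redp [:x, y:] = [:red x, red y:]"
  by (rule poly_eqI) (simp add: coeff_pCons split: nat.split)

lemma degree_redp: "degree (redp F) \<le> degree F"
  by (rule degree_le) (simp add: coeff_eq_0)

lemma closep_mult:
  assumes "intp F" "intp K'" "closep r F F'" "closep r K K'" "intp F'" "intp K" "0 \<le> r"
  shows "closep r (F * K) (F' * K')"
  unfolding closep_def
proof
  fix i
  have "coeff (F * K) i - coeff (F' * K') i = (\<Sum>k\<le>i.
      coeff F k * (coeff K (i - k) - coeff K' (i - k)) +
      coeff K' (i - k) * (coeff F k - coeff F' k))"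
    unfolding coeff_mult by (simp add: algebra_simps flip: sum_subtractf)
  also have "av \<dots> \<le> r"
    using assms unfolding closep_def by (intro av_sum_le av_add_le av_mult_le_1 av_OE intpD) auto
  finally show "av (coeff (F * K) i - coeff (F' * K') i) \<le> r" .
qed

lemma closep_refl: "0 \<le> r \<Longrightarrow> closep r F F"
  by (simp add: closep_def)

lemma closep_power:
  assumes "intp F" "intp F'" "closep r F F'" "0 \<le> r"
  shows "closep r (F ^ n) (F' ^ n)"
  using assms by (induction n) (auto intro!: closep_mult intp_power closep_refl)

lemma slash_row_intp: "g \<in> KK \<Longrightarrow> intp ([:g $ 1 $ 2, g $ 1 $ 1:] ^ i * [:g $ 2 $ 2, g $ 2 $ 1:] ^ j)"
  by (intro intp_mult intp_power intp_linear KK_entry_OE)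

lemma intp_slash: "g \<in> KK \<Longrightarrow> intp F \<Longrightarrow> intp (slash m g F)"
  unfolding intp_def coeff_slash using slash_row_intp by (intro allI OE_sum OE_closed) (auto simp: intp_def)

lemma redp_slash:
  assumes g: "g \<in> KK" and F: "intp F"
  shows "redp (slash m g F) = slash m (map_matrix red g) (redp F)"
proof (rule poly_eqI)
  fix k
  have row: "redp ([:g $ 1 $ 2, g $ 1 $ 1:] ^ i * [:g $ 2 $ 2, g $ 2 $ 1:] ^ j) =
      [:red (g $ 1 $ 2), red (g $ 1 $ 1):] ^ i * [:red (g $ 2 $ 2), red (g $ 2 $ 1):] ^ j" for i j
    using g by (simp add: redp_mult redp_power redp_linear intp_power intp_linear KK_entry_OE)
  have "red (coeff (slash m g F) k) = (\<Sum>i\<le>m. red (coeff F i) *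
      coeff (redp ([:g $ 1 $ 2, g $ 1 $ 1:] ^ i * [:g $ 2 $ 2, g $ 2 $ 1:] ^ (m - i))) k)"
    unfolding coeff_slash using intpD[OF slash_row_intp[OF g]] intpD[OF F] by (subst red_sum) (auto simp: red_mult)
  then show "coeff (redp (slash m g F)) k = coeff (slash m (map_matrix red g) (redp F)) k"
    unfolding row by (simp add: coeff_slash)
qed

text \<open>
  The matrix coefficients of the polynomial representation are integral polynomials in the entries.
\<close>

lemma closep_slash:
  assumes h: "h \<in> KK" "cg n h (mat 1)" and F: "intp F" "degree F \<le> m"
  shows "closep ((1 / real p) ^ n) (slash m h F) F"
  unfolding closep_def
proof
  fix k
  define r where "r = (1 / real p) ^ n"
  have r: "0 \<le> r" by (simp add: r_def)
  have lin: "closep r [:x, y:] [:x', y':]" if "av (x - x') \<le> r" "av (y - y') \<le> r" for x y x' y'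
    using that r by (simp add: closep_def coeff_pCons split: nat.split)
  have hh: "av (h $ i $ j - (mat 1 :: 'c^2^2) $ i $ j) \<le> r" for i j using h(2) by (simp add: cg_def r_def)
  have row: "closep r ([:h $ 1 $ 2, h $ 1 $ 1:] ^ i * [:h $ 2 $ 2, h $ 2 $ 1:] ^ j)
      ([:(mat 1 :: 'c^2^2) $ 1 $ 2, (mat 1 :: 'c^2^2) $ 1 $ 1:] ^ i * [:(mat 1 :: 'c^2^2) $ 2 $ 2, (mat 1 :: 'c^2^2) $ 2 $ 1:] ^ j)" for i j
  proof -
    have i: "intp [:k $ 1 $ 2, k $ 1 $ 1:]" "intp [:k $ 2 $ 2, k $ 2 $ 1:]" if "k \<in> KK" for k
      using that by (simp_all only: intp_linear KK_entry_OE)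
    show ?thesis
      by (rule closep_mult[OF intp_power[OF i(1)[OF h(1)]] intp_power[OF i(2)[OF KK_1]]
          closep_power[OF i(1)[OF h(1)] i(1)[OF KK_1] lin[OF hh hh] r]
          closep_power[OF i(2)[OF h(1)] i(2)[OF KK_1] lin[OF hh hh] r]
          intp_power[OF i(1)[OF KK_1]] intp_power[OF i(2)[OF h(1)]] r])
  qed
  have "coeff (slash m h F) k - coeff (slash m (mat 1) F) k =
     (\<Sum>i\<le>m. coeff F i * (coeff ([:h $ 1 $ 2, h $ 1 $ 1:] ^ i * [:h $ 2 $ 2, h $ 2 $ 1:] ^ (m - i)) k -
       coeff ([:(mat 1 :: 'c^2^2) $ 1 $ 2, (mat 1 :: 'c^2^2) $ 1 $ 1:] ^ i * [:(mat 1 :: 'c^2^2) $ 2 $ 2, (mat 1 :: 'c^2^2) $ 2 $ 1:] ^ (m - i)) k))"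
    unfolding coeff_slash by (simp only: right_diff_distrib sum_subtractf)
  also have "av \<dots> \<le> r"
    using row r unfolding closep_def by (intro av_sum_le av_mult_le_1 av_OE intpD[OF F(1)]) auto
  finally show "av (coeff (slash m h F) k - coeff F k) \<le> (1 / real p) ^ n"
    using F(2) by (simp add: slash_mat_1 r_def)
qed

lemma lift_poly:
  "\<exists>F'. degree F' \<le> m \<and> intp F' \<and> (degree F \<le> m \<longrightarrow> redp F' = F)"
proof -
  have "\<exists>c. c \<in> OE \<and> red c = k" for k using red_surj by blast
  then obtain s where s: "\<And>k. s k \<in> OE" "\<And>k. red (s k) = k" by metis
  define F' where "F' = (\<Sum>i\<le>m. monom (s (coeff F i)) i)"
  have c: "coeff F' i = (if i \<le> m then s (coeff F i) else 0)" for i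
    by (simp add: F'_def coeff_sum)
  have "degree F' \<le> m" by (rule degree_le) (simp add: c)
  moreover have "intp F'" using s by (simp add: intp_def c)
  moreover have "redp F' = F" if "degree F \<le> m"
    using that s by (intro poly_eqI) (simp add: c coeff_eq_0)
  ultimately show ?thesis by blast
qed

lemma map_matrix_1: "map_matrix red (mat 1 :: 'c^2^2) = mat 1"
  by (rule matrix2_eqI) simp_all

lemma continuous_map_av:
  "continuous_map X euclidean (\<phi> :: 'x \<Rightarrow> 'c) \<longleftrightarrow>
     (\<forall>x\<in>topspace X. \<forall>e>0. \<exists>V. openin X V \<and> x \<in> V \<and> (\<forall>y\<in>V. av (\<phi> y - \<phi> x) < e))"
proof
  assume c: "continuous_map X euclidean \<phi>"
  show "\<forall>x\<in>topspace X. \<forall>e>0. \<exists>V. openin X V \<and> x \<in> V \<and> (\<forall>y\<in>V. av (\<phi> y - \<phi> x) < e)"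
  proof (intro ballI allI impI)
    fix x and e :: real assume x: "x \<in> topspace X" and e: "e > 0"
    have "openin X {y \<in> topspace X. \<phi> y \<in> ball (\<phi> x) e}"
    proof -
      have "openin euclidean (ball (\<phi> x) e)" by simp
      with c show ?thesis unfolding continuous_map_def by blast
    qed
    moreover have "av (\<phi> y - \<phi> x) < e" if "\<phi> y \<in> ball (\<phi> x) e" for y
      using that dist_av[of "\<phi> y" "\<phi> x"] by (simp add: dist_commute)
    ultimately show "\<exists>V. openin X V \<and> x \<in> V \<and> (\<forall>y\<in>V. av (\<phi> y - \<phi> x) < e)"
      using x e by (intro exI[of _ "{y \<in> topspace X. \<phi> y \<in> ball (\<phi> x) e}"]) auto
  qed
next
  assume h: "\<forall>x\<in>topspace X. \<forall>e>0. \<exists>V. openin X V \<and> x \<in> V \<and> (\<forall>y\<in>V. av (\<phi> y - \<phi> x) < e)"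
  show "continuous_map X euclidean \<phi>"
    unfolding continuous_map_def
  proof (intro conjI allI impI)
    fix W :: "'c set" assume W: "openin euclidean W"
    show "openin X {x \<in> topspace X. \<phi> x \<in> W}"
    proof (subst openin_subopen, intro ballI)
      fix x assume x: "x \<in> {x \<in> topspace X. \<phi> x \<in> W}"
      then obtain e where e: "e > 0" "\<And>z. dist z (\<phi> x) < e \<Longrightarrow> z \<in> W"
        using W by (auto simp: open_dist)
      from h x e(1) obtain V where V: "openin X V" "x \<in> V" "\<forall>y\<in>V. av (\<phi> y - \<phi> x) < e" by blast
      have "V \<subseteq> {x \<in> topspace X. \<phi> x \<in> W}"
        using V e(2) openin_subset[OF V(1)] dist_av by fastforce
      with V show "\<exists>V. openin X V \<and> x \<in> V \<and> V \<subseteq> {x \<in> topspace X. \<phi> x \<in> W}" by blast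
    qed
  qed simp
qed

lemma continuous_map_add_av:
  assumes "continuous_map X euclidean (\<phi> :: 'x \<Rightarrow> 'c)" "continuous_map X euclidean \<psi>"
  shows "continuous_map X euclidean (\<lambda>x. \<phi> x + \<psi> x)"
  unfolding continuous_map_av
proof (intro ballI allI impI)
  fix x and e :: real assume x: "x \<in> topspace X" and e: "e > 0"
  obtain V where V: "openin X V" "x \<in> V" "\<forall>y\<in>V. av (\<phi> y - \<phi> x) < e"
    using assms(1) x e unfolding continuous_map_av by blast
  obtain W where W: "openin X W" "x \<in> W" "\<forall>y\<in>W. av (\<psi> y - \<psi> x) < e"
    using assms(2) x e unfolding continuous_map_av by blast
  have "av (\<phi> y + \<psi> y - (\<phi> x + \<psi> x)) < e" if "y \<in> V \<inter> W" for y
  proof -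
    have "av (\<phi> y + \<psi> y - (\<phi> x + \<psi> x)) = av ((\<phi> y - \<phi> x) + (\<psi> y - \<psi> x))" by (simp add: algebra_simps)
    also have "\<dots> \<le> max (av (\<phi> y - \<phi> x)) (av (\<psi> y - \<psi> x))" by (rule av_add)
    also have "\<dots> < e" using V W that by simp
    finally show ?thesis .
  qed
  then show "\<exists>V. openin X V \<and> x \<in> V \<and> (\<forall>y\<in>V. av (\<phi> y + \<psi> y - (\<phi> x + \<psi> x)) < e)"
    using V W by (intro exI[of _ "V \<inter> W"]) auto
qed

lemma continuous_map_mult_av:
  assumes "continuous_map X euclidean (\<phi> :: 'x \<Rightarrow> 'c)"
  shows "continuous_map X euclidean (\<lambda>x. c * \<phi> x)"
  unfolding continuous_map_av
proof (intro ballI allI impI)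
  fix x and e :: real assume x: "x \<in> topspace X" and e: "e > 0"
  have "e / (av c + 1) > 0" using e by (simp add: add_nonneg_pos)
  then obtain V where V: "openin X V" "x \<in> V" "\<forall>y\<in>V. av (\<phi> y - \<phi> x) < e / (av c + 1)"
    using assms x unfolding continuous_map_av by blast
  have "av (c * \<phi> y - c * \<phi> x) < e" if "y \<in> V" for y
  proof -
    have "av (c * \<phi> y - c * \<phi> x) = av c * av (\<phi> y - \<phi> x)" by (simp add: av_mult flip: right_diff_distrib)
    also have "\<dots> \<le> (av c + 1) * av (\<phi> y - \<phi> x)" by (intro mult_right_mono) auto
    also have "\<dots> < e"
    proof -
      have "av (\<phi> y - \<phi> x) < e / (av c + 1)" using V(3) that by blast
      moreover have "av c + 1 > 0" by (simp add: add_nonneg_pos)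
      ultimately show ?thesis by (simp add: pos_less_divide_eq mult.commute)
    qed
    finally show ?thesis .
  qed
  then show "\<exists>V. openin X V \<and> x \<in> V \<and> (\<forall>y\<in>V. av (c * \<phi> y - c * \<phi> x) < e)" using V by blast
qed

end

section \<open>The rank of the module of forms\<close>

text \<open>
  Projectivity is what lets reduced maps be lifted to forms, and the generators of the kernel of \<open>\<theta>\<close> are
  those for which a form is seen to be small, so that its reduction is a map on \<open>P\<close>.
\<close>

locale iwasawa_module = coeff_ring p E \<pi> red + env: envelope p a P
  for p :: nat and E :: "'c::{field_char_0,complete_space} set" and \<pi> :: 'c and red :: "'c \<Rightarrow> 'f::field"
    and a :: nat and P :: "('f^2^2 \<Rightarrow> 'f, 'q) module" +
  fixes H :: "(nat \<Rightarrow> ('c^2^2) set \<Rightarrow> 'c, 'h) module" (structure) and \<theta> :: "'h \<Rightarrow> 'q"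
  assumes H_projective: "fg_projective (iwasawa_ring p (integers p E)) H"
    and \<theta>_surj: "\<theta> ` carrier H = carrier P"
    and \<theta>_add: "\<And>x y. x \<in> carrier H \<Longrightarrow> y \<in> carrier H \<Longrightarrow> \<theta> (x \<oplus> y) = \<theta> x \<oplus>\<^bsub>P\<^esub> \<theta> y"
    and \<theta>_act: "\<And>x c g. x \<in> carrier H \<Longrightarrow> c \<in> integers p E \<Longrightarrow> g \<in> carrier (GL2 (Zp p)) \<Longrightarrow>
          \<theta> (pt p c g \<odot> x) = (\<lambda>h. if h = map_matrix red g then red c else 0) \<odot>\<^bsub>P\<^esub> \<theta> x"
    and \<theta>_kernel: "{x \<in> carrier H. \<theta> x = \<zero>\<^bsub>P\<^esub>} =
          generate (add_monoid H)
            {r \<odot> x | r x. r \<in> insert (pt p \<pi> (mat 1)) (augmentation_ideal p (integers p E)) \<and>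
                             x \<in> carrier H}"
begin

lemma RMH: "right_module RR H"
  using H_projective by (simp add: fg_projective_def)

lemma ring_RR: "ring RR" and abelian_H: "abelian_group H"
  using RMH by (simp_all add: right_module_def)

lemma H_closed [simp]: "r \<in> carrier RR \<Longrightarrow> x \<in> carrier H \<Longrightarrow> r \<odot> x \<in> carrier H"
  by (rule right_module.act_closed[OF RMH])

lemma H_add_closed [simp]: "x \<in> carrier H \<Longrightarrow> y \<in> carrier H \<Longrightarrow> x \<oplus> y \<in> carrier H"
  using abelian_H by (simp add: abelian_groupE(1))

lemma H_l_distr: "r \<in> carrier RR \<Longrightarrow> s \<in> carrier RR \<Longrightarrow> x \<in> carrier H \<Longrightarrow>
    (\<lambda>n C. r n C + s n C) \<odot> x = r \<odot> x \<oplus> s \<odot> x"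
  using right_module.act_l_distr[OF RMH, of r s x] by (simp add: RR_add)

lemma H_assoc: "r \<in> carrier RR \<Longrightarrow> s \<in> carrier RR \<Longrightarrow> x \<in> carrier H \<Longrightarrow>
    s \<odot> (r \<odot> x) = (r \<star> s) \<odot> x"
  by (rule right_module.act_assoc[OF RMH, symmetric])

lemma pt_pt_H: "c \<in> OE \<Longrightarrow> d \<in> OE \<Longrightarrow> g \<in> KK \<Longrightarrow> h \<in> KK \<Longrightarrow> x \<in> carrier H \<Longrightarrow>
    pt p d h \<odot> (pt p c g \<odot> x) = pt p (c * d) (g ** h) \<odot> x"
  by (simp add: H_assoc pt_mult)

lemma RR_mult_closed: "x \<in> carrier RR \<Longrightarrow> y \<in> carrier RR \<Longrightarrow> x \<star> y \<in> carrier RR"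
  using monoid.m_closed[OF ring.is_monoid[OF ring_RR]] .

lemma additive_RR_sum:
  fixes L :: "'h \<Rightarrow> 'v::ab_group_add"
  assumes L: "\<And>x y. x \<in> carrier H \<Longrightarrow> y \<in> carrier H \<Longrightarrow> L (x \<oplus> y) = L x + L y"
    and I: "finite I" and f: "\<And>i. i \<in> I \<Longrightarrow> f i \<in> carrier RR" and x: "x \<in> carrier H"
  shows "L ((\<lambda>n C. \<Sum>i\<in>I. f i n C) \<odot> x) = (\<Sum>i\<in>I. L (f i \<odot> x))"
  using I f
proof (induction I rule: finite_induct)
  case empty
  have "L ((\<lambda>n C. 0) \<odot> x) = L ((\<lambda>n C. 0) \<odot> x) + L ((\<lambda>n C. 0) \<odot> x)"
    using H_l_distr[OF RR_zero_closed RR_zero_closed x] L[OF H_closed[OF RR_zero_closed x] H_closed[OF RR_zero_closed x]] by simp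
  then show ?case by (simp only: add_cancel_right_right) simp
next
  case (insert i I)
  have s: "(\<lambda>n C. \<Sum>i\<in>I. f i n C) \<in> carrier RR" by (rule RR_sum_closed) (use insert.prems in simp)
  have fi: "f i \<in> carrier RR" using insert.prems by simp
  have "(\<lambda>n C. \<Sum>i\<in>insert i I. f i n C) = (\<lambda>n C. f i n C + (\<Sum>i\<in>I. f i n C))"
    using insert.hyps by simp
  then have "L ((\<lambda>n C. \<Sum>i\<in>insert i I. f i n C) \<odot> x) = L (f i \<odot> x) + L ((\<lambda>n C. \<Sum>i\<in>I. f i n C) \<odot> x)"
    by (simp add: H_l_distr[OF fi s x] L fi s x)
  then show ?case using insert by simp
qed

subsection \<open>Maps on the reduction\<close>

lemma \<theta>_P [simp]: "x \<in> carrier H \<Longrightarrow> \<theta> x \<in> carrier P"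
  using \<theta>_surj by blast

lemma \<theta>_pt: "x \<in> carrier H \<Longrightarrow> c \<in> OE \<Longrightarrow> g \<in> KK \<Longrightarrow>
    \<theta> (pt p c g \<odot> x) = env.ptP (red c) (map_matrix red g) \<odot>\<^bsub>P\<^esub> \<theta> x"
  unfolding env.ptP_def by (rule \<theta>_act)

lemma \<theta>_kernel_aug: "x \<in> carrier H \<Longrightarrow> r \<in> augmentation_ideal p OE \<Longrightarrow> \<theta> (r \<odot> x) = \<zero>\<^bsub>P\<^esub>"
proof -
  assume "x \<in> carrier H" "r \<in> augmentation_ideal p OE"
  then have "r \<odot> x \<in> {x \<in> carrier H. \<theta> x = \<zero>\<^bsub>P\<^esub>}"
    unfolding \<theta>_kernel by (intro generate.incl) blast
  then show ?thesis by simp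
qed

lemma aug_iff: "r \<in> augmentation_ideal p OE \<longleftrightarrow> r \<in> carrier RR \<and>
    (\<forall>n C. C \<inter> cl 1 (mat 1) = {} \<longrightarrow> r n C = 0) \<and> r 0 KK = 0"
  by (simp add: augmentation_ideal_def congruence_subgroup_eq)

text \<open>
  Modulo the augmentation ideal of the first congruence subgroup a measure is the sum of its masses
  on the cosets of this subgroup.
\<close>

lemma restrict_coset:
  assumes r: "r \<in> carrier RR" and C: "C \<in> Lv 1" and b: "b \<in> carrier H"
    and L: "\<And>x y. x \<in> carrier H \<Longrightarrow> y \<in> carrier H \<Longrightarrow> L (x \<oplus> y) = L x + (L y :: 'f poly)"
    and L0: "\<And>x s. x \<in> carrier H \<Longrightarrow> s \<in> augmentation_ideal p OE \<Longrightarrow> L (s \<odot> x) = 0"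
    and Lc: "\<And>x c. x \<in> carrier H \<Longrightarrow> c \<in> OE \<Longrightarrow> L (pt p c (mat 1) \<odot> x) = smult (red c) (L x)"
  defines "rC \<equiv> (\<lambda>n D. if n = 0 then (if D \<in> Lv 0 then r 1 C else 0) else if D \<subseteq> C then r n D else 0)"
  shows "rC \<in> carrier RR" "L (rC \<odot> b) = smult (red (r 1 C)) (L (pt p 1 (rp C) \<odot> b))"
proof -
  show rC: "rC \<in> carrier RR"
    unfolding RR_iff
  proof (intro allI conjI ballI impI)
    fix n D
    show "D \<in> Lv n \<Longrightarrow> rC n D \<in> OE" using RR_OE[OF r] C by (simp add: rC_def)
    show "D \<notin> Lv n \<Longrightarrow> rC n D = 0" using RR_outside[OF r] by (cases "n = 0") (auto simp: rC_def)
    assume D: "D \<in> Lv n"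
    show "rC n D = (\<Sum>D'\<in>{D' \<in> Lv (Suc n). D' \<subseteq> D}. rC (Suc n) D')"
    proof (cases "n = 0")
      case True
      have "{D' \<in> Lv (Suc n). D' \<subseteq> D} = Lv 1"
        using D True Lv_0 Lv_eq_cl in_cl by auto
      moreover have "D' \<subseteq> C \<longleftrightarrow> D' = C" if "D' \<in> Lv 1" for D'
        using Lv_disjoint[OF that C] rp_in[OF that] by blast
      then have "(\<Sum>D'\<in>Lv 1. rC (Suc n) D') = (\<Sum>D'\<in>Lv 1. if D' = C then r 1 C else 0)"
        using True by (intro sum.cong refl) (simp add: rC_def)
      ultimately show ?thesis using True D C by (simp add: rC_def)
    next
      case False
      show ?thesis
      proof (cases "D \<subseteq> C")
        case True
        then have "(\<Sum>D'\<in>{D' \<in> Lv (Suc n). D' \<subseteq> D}. rC (Suc n) D') = (\<Sum>D'\<in>{D' \<in> Lv (Suc n). D' \<subseteq> D}. r (Suc n) D')"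
          by (intro sum.cong refl) (auto simp: rC_def)
        then show ?thesis using True False RR_compat[OF r D] by (simp add: rC_def)
      next
        case nsub: False
        have "rC (Suc n) D' = 0" if D': "D' \<in> Lv (Suc n)" "D' \<subseteq> D" for D'
        proof -
          have "\<not> D' \<subseteq> C"
          proof
            assume "D' \<subseteq> C"
            then have "rp D' \<in> C \<inter> D" using rp_in[OF D'(1)] D' by blast
            then have "rp D' \<in> C" "D = cl n (rp D')" using Lv_eq_cl[OF D] by auto
            then have "D \<subseteq> C" using Lv_eq_cl[OF C \<open>rp D' \<in> C\<close>] False cg_mono[of n _ "rp D'" 1] by (auto simp: in_cl)
            with nsub show False by simp
          qed
          then show ?thesis by (simp add: rC_def)
        qed
        then show ?thesis using nsub False by (simp add: rC_def)
      qed
    qed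
  qed
  define g where "g = rp C"
  have g: "g \<in> KK" "C = cl 1 g" using C by (simp_all add: g_def cl_rp)
  define c where "c = r 1 C"
  have c: "c \<in> OE" using RR_OE[OF r C] by (simp add: c_def)
  \<comment> \<open>Translated back to the first congruence subgroup, the part of the measure on the coset differs from
    its mass at the identity by an element of the augmentation ideal.\<close>
  define t where "t = pt p 1 (inv2 g) \<star> rC"
  have ptg: "pt p 1 (inv2 g) \<in> carrier RR" using g by simp
  have t: "t \<in> carrier RR" unfolding t_def by (rule RR_mult_closed[OF ptg rC])
  have tval: "t n (cl n h) = rC n (cl n (g ** h))" if "h \<in> KK" for n h
    using RR_mult_pt_left[of "g ** h" "inv2 g" 1 rC n] that g KK_cancel[OF g(1)] by (simp add: t_def)
  interpret R: ring RR by (rule ring_RR)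
  have one: "\<one>\<^bsub>RR\<^esub> = pt p 1 (mat 1)"
  proof (intro ext)
    fix n D
    have "pt p 1 (mat 1) \<star> \<one>\<^bsub>RR\<^esub> = pt p 1 (mat 1)" by (rule R.r_one) simp
    moreover have "(pt p 1 (mat 1) \<star> \<one>\<^bsub>RR\<^esub>) n D = \<one>\<^bsub>RR\<^esub> n D"
    proof (cases "D \<in> Lv n")
      case True
      then show ?thesis using RR_mult_pt_left[of "rp D" "mat 1" 1 "\<one>\<^bsub>RR\<^esub>" n] by (simp add: cl_rp)
    next
      case False
      then show ?thesis using RR_mult_outside RR_outside[OF R.one_closed] by (simp add: pt_eq)
    qed
    ultimately show "\<one>\<^bsub>RR\<^esub> n D = pt p 1 (mat 1) n D" by simp
  qed
  have "pt p 1 g \<star> t = (pt p 1 g \<star> pt p 1 (inv2 g)) \<star> rC"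
    unfolding t_def using g ptg rC by (simp add: R.m_assoc)
  also have "pt p 1 g \<star> pt p 1 (inv2 g) = \<one>\<^bsub>RR\<^esub>"
    unfolding one using g pt_mult[of g "inv2 g" 1 1] inv2_right[OF KK_det_nz[OF g(1)]] by simp
  also have "\<one>\<^bsub>RR\<^esub> \<star> rC = rC" by (rule R.l_one[OF rC])
  finally have rCt: "rC \<odot> b = t \<odot> (pt p 1 g \<odot> b)" using H_assoc[of "pt p 1 g" t b] g t b by simp
  define s where "s = (\<lambda>n D. t n D + pt p (- c) (mat 1) n D)"
  have mc: "pt p (- c) (mat 1) \<in> carrier RR" using c by simp
  have s: "s \<in> augmentation_ideal p OE"
    unfolding aug_iff
  proof (intro conjI allI impI)
    show "s \<in> carrier RR" unfolding s_def by (rule RR_add_closed[OF t mc])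
    have KK0: "KK = cl 0 (mat 1)" using Lv_0 Lv_cl[OF KK_1, of 0] by simp
    have "t 0 KK = c"
      using tval[of "mat 1" 0] Lv_0 Lv_cl[of "g ** mat 1" 0] g by (simp add: KK0[symmetric] rC_def c_def)
    moreover have "pt p (- c) (mat 1) 0 KK = - c"
      by (subst KK0) (simp only: pt_cl[OF KK_1] if_True simp_thms)
    ultimately show "s 0 KK = 0" by (simp add: s_def)
    fix n D assume disj: "D \<inter> cl 1 (mat 1) = {}"
    show "s n D = 0"
    proof (cases "D \<in> Lv n")
      case False
      then show ?thesis using RR_outside[OF t] RR_outside[OF mc] by (simp add: s_def)
    next
      case True
      have n: "n \<noteq> 0"
      proof
        assume "n = 0"
        then have "D = KK" using True Lv_0 by simp
        then show False using disj KK_1 cl_self[OF KK_1, of 1] by blast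
      qed
      have m1: "mat 1 \<notin> D" using disj cl_self[OF KK_1, of 1] by blast
      have "t n D = rC n (cl n (g ** rp D))" using tval[of "rp D" n] True by (simp add: cl_rp)
      also have "\<dots> = 0"
      proof -
        have "\<not> cl n (g ** rp D) \<subseteq> C"
        proof
          assume "cl n (g ** rp D) \<subseteq> C"
          then have "g ** rp D \<in> cl 1 g" using g True cl_self[of "g ** rp D" n] by auto
          then have "cg 1 (g ** rp D) (g ** mat 1)" by (simp add: in_cl)
          then have "cg 1 (inv2 g ** (g ** rp D)) (inv2 g ** (g ** mat 1))"
            by (rule cg_mult_left[OF KK_inv2[OF g(1)]])
          then have "rp D \<in> cl 1 (mat 1)" using True g by (simp only: KK_cancel[OF g(1)]) (simp add: in_cl)
          then show False using disj rp_in[OF True] by blast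
        qed
        then show ?thesis using n by (simp add: rC_def)
      qed
      finally show ?thesis using m1 by (simp add: s_def pt_eq)
    qed
  qed
  define b' where "b' = pt p 1 g \<odot> b"
  have b': "b' \<in> carrier H" using g b by (simp add: b'_def)
  have "0 = L (s \<odot> b')" using L0[OF b' s] by simp
  also have "\<dots> = L (t \<odot> b') + L (pt p (- c) (mat 1) \<odot> b')"
    unfolding s_def using H_l_distr[OF t mc b'] L t mc b' by simp
  also have "L (pt p (- c) (mat 1) \<odot> b') = - smult (red c) (L b')"
    using c b' by (simp add: Lc red_minus)
  finally have "L (t \<odot> b') = smult (red c) (L b')" by simp
  then show "L (rC \<odot> b) = smult (red (r 1 C)) (L (pt p 1 (rp C) \<odot> b))"
    unfolding rCt by (simp add: b'_def c_def g_def)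
qed

lemma reduce_measure:
  assumes r: "r \<in> carrier RR" and b: "b \<in> carrier H"
    and L: "\<And>x y. x \<in> carrier H \<Longrightarrow> y \<in> carrier H \<Longrightarrow> L (x \<oplus> y) = L x + (L y :: 'f poly)"
    and L0: "\<And>x s. x \<in> carrier H \<Longrightarrow> s \<in> augmentation_ideal p OE \<Longrightarrow> L (s \<odot> x) = 0"
    and Lc: "\<And>x c. x \<in> carrier H \<Longrightarrow> c \<in> OE \<Longrightarrow> L (pt p c (mat 1) \<odot> x) = smult (red c) (L x)"
  shows "L (r \<odot> b) = (\<Sum>C\<in>Lv 1. smult (red (r 1 C)) (L (pt p 1 (rp C) \<odot> b)))"
proof -
  define rC where "rC C = (\<lambda>n D. if n = 0 then (if D \<in> Lv 0 then r 1 C else 0) else if D \<subseteq> C then r n D else 0)" for C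
  note rc = restrict_coset[OF r _ b L L0 Lc, folded rC_def]
  have "r = (\<lambda>n D. \<Sum>C\<in>Lv 1. rC C n D)"
  proof (intro ext)
    fix n D
    show "r n D = (\<Sum>C\<in>Lv 1. rC C n D)"
    proof (cases "D \<in> Lv n")
      case False
      then show ?thesis using RR_outside[OF r False] by (auto simp: rC_def intro!: sum.neutral)
    next
      case True
      show ?thesis
      proof (cases "n = 0")
        case n0: True
        then have D: "D = KK" using True Lv_0 by simp
        have "{C \<in> Lv (Suc 0). C \<subseteq> D} = Lv 1" using D Lv_eq_cl in_cl by auto
        then have "r 0 D = (\<Sum>C\<in>Lv 1. r 1 C)" using RR_compat[OF r, of D 0] True n0 by simp
        then show ?thesis using n0 True by (simp add: rC_def)
      next
        case n0: False
        have "(\<Sum>C\<in>Lv 1. rC C n D) = (\<Sum>C\<in>Lv 1. if C = cl 1 (rp D) then r n D else 0)"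
        proof (intro sum.cong refl)
          fix C assume C: "C \<in> Lv 1"
          have "D \<subseteq> C \<longleftrightarrow> rp D \<in> C" by (rule Lv_sub_iff[OF _ C True]) (use n0 in simp)
          also have "\<dots> \<longleftrightarrow> C = cl 1 (rp D)"
            using Lv_eq_cl[OF C, of "rp D"] cl_self[OF rp_KK[OF True], of 1] by metis
          finally have "D \<subseteq> C \<longleftrightarrow> C = cl 1 (rp D)" .
          then show "rC C n D = (if C = cl 1 (rp D) then r n D else 0)" using n0 by (simp add: rC_def)
        qed
        then show ?thesis using True by simp
      qed
    qed
  qed
  then have "L (r \<odot> b) = (\<Sum>C\<in>Lv 1. L (rC C \<odot> b))"
    using additive_RR_sum[of L "Lv 1" rC b] L rc(1) b by simp
  also have "\<dots> = (\<Sum>C\<in>Lv 1. smult (red (r 1 C)) (L (pt p 1 (rp C) \<odot> b)))"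
    by (intro sum.cong refl rc(2))
  finally show ?thesis .
qed

end

text \<open>
  The topology of the function space is that of pointwise convergence.
\<close>

lemma tendsto_coordinatewise:
  fixes X :: "nat \<Rightarrow> 'i \<Rightarrow> 'b::topological_space"
  assumes "\<And>i. (\<lambda>n. X n i) \<longlonglongrightarrow> x i"
  shows "X \<longlonglongrightarrow> x"
proof -
  have "limitin (product_topology (\<lambda>i. euclidean) UNIV) X x sequentially"
    unfolding limitin_componentwise using assms by (simp add: limitin_canonical_iff)
  then show ?thesis by (simp add: euclidean_product_topology limitin_canonical_iff)
qed

text \<open>
  A level group containing the first congruence subgroup, with a character that is trivial on the latter, and
  their reductions. The two cases of interest are the maximal compact group and the Iwahori subgroup.
\<close>

locale weight = iwasawa_module p E \<pi> red a P H \<theta>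
  for p :: nat and E :: "'c::{field_char_0,complete_space} set" and \<pi> :: 'c and red :: "'c \<Rightarrow> 'f::field"
    and a :: nat and P :: "('f^2^2 \<Rightarrow> 'f, 'q) module"
    and H :: "(nat \<Rightarrow> ('c^2^2) set \<Rightarrow> 'c, 'h) module" (structure) and \<theta> :: "'h \<Rightarrow> 'q" +
  fixes U :: "('c^2^2) set" and \<tau> :: "'c^2^2 \<Rightarrow> 'c" and m :: nat
    and Ub :: "('f^2^2) set" and \<tau>b :: "'f^2^2 \<Rightarrow> 'f"
  assumes U_KK: "U \<subseteq> KK" and U_mult: "u \<in> U \<Longrightarrow> v \<in> U \<Longrightarrow> u ** v \<in> U"
    and U_inv: "u \<in> U \<Longrightarrow> inv2 u \<in> U"
    and U_level: "u \<in> KK \<Longrightarrow> cg 1 u (mat 1) \<Longrightarrow> u \<in> U \<and> \<tau> u = 1"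
    and \<tau>_OE: "u \<in> U \<Longrightarrow> \<tau> u \<in> OE"
    and \<tau>_mult: "u \<in> U \<Longrightarrow> v \<in> U \<Longrightarrow> \<tau> (u ** v) = \<tau> u * \<tau> v"
    and \<tau>_red: "u \<in> U \<Longrightarrow> red (\<tau> u) = \<tau>b (map_matrix red u)"
    and Ub: "map_matrix red ` U = Ub"
begin

abbreviation FF :: "('c, 'h \<Rightarrow> 'c poly) module" where "FF \<equiv> forms p E H U \<tau> (m + 2)"

abbreviation TH :: "'h topology" where "TH \<equiv> canonical_topology RR H"

lemma U_sub [simp]: "u \<in> U \<Longrightarrow> u \<in> KK"
  using U_KK by blast

lemma U_1 [simp]: "mat 1 \<in> U" and \<tau>_1 [simp]: "\<tau> (mat 1) = 1"
  using U_level[of "mat 1"] by simp_all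

lemma topspace_TH: "topspace TH = carrier H"
proof -
  have "openin TH (carrier H)"
    unfolding openin_canonical_topology
  proof (intro conjI allI ballI)
    fix n f assume "f \<in> mod_hom RR (free_module RR n) H"
    then have "{x \<in> carrier (free_module RR n). f x \<in> carrier H} = carrier (free_module RR n)"
      by (auto simp: mod_hom_def)
    then show "openin (top_of_set (carrier (free_module RR n))) {x \<in> carrier (free_module RR n). f x \<in> carrier H}"
      by simp
  qed simp
  moreover have "V \<subseteq> carrier H" if "openin TH V" for V using that by (simp add: openin_canonical_topology)
  ultimately show ?thesis unfolding topspace_def by blast
qed

lemma FF_iff: "\<phi> \<in> carrier FF \<longleftrightarrow> \<phi> \<in> extensional (carrier H) \<and>
    (\<forall>x\<in>carrier H. degree (\<phi> x) \<le> m \<and> intp (\<phi> x)) \<and>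
    (\<forall>x\<in>carrier H. \<forall>y\<in>carrier H. \<phi> (x \<oplus> y) = \<phi> x + \<phi> y) \<and>
    (\<forall>c\<in>OE. \<forall>x\<in>carrier H. \<phi> (pt p c (mat 1) \<odot> x) = smult c (\<phi> x)) \<and>
    (\<forall>i. continuous_map TH euclidean (\<lambda>x. coeff (\<phi> x) i)) \<and>
    (\<forall>u\<in>U. \<forall>x\<in>carrier H. \<phi> (pt p 1 u \<odot> x) = smult (\<tau> u) (slash m u (\<phi> x)))"
  unfolding forms_def mod_hom_def ring_on_def restrict_scalars_def poly_module_def intp_def
  by (auto simp: Pi_iff)

lemma FFD:
  assumes "\<phi> \<in> carrier FF"
  shows "\<phi> \<in> extensional (carrier H)"
    and "x \<in> carrier H \<Longrightarrow> degree (\<phi> x) \<le> m" and "x \<in> carrier H \<Longrightarrow> intp (\<phi> x)"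
    and "x \<in> carrier H \<Longrightarrow> y \<in> carrier H \<Longrightarrow> \<phi> (x \<oplus> y) = \<phi> x + \<phi> y"
    and "c \<in> OE \<Longrightarrow> x \<in> carrier H \<Longrightarrow> \<phi> (pt p c (mat 1) \<odot> x) = smult c (\<phi> x)"
    and "continuous_map TH euclidean (\<lambda>x. coeff (\<phi> x) i)"
    and "u \<in> U \<Longrightarrow> x \<in> carrier H \<Longrightarrow> \<phi> (pt p 1 u \<odot> x) = smult (\<tau> u) (slash m u (\<phi> x))"
  using assms unfolding FF_iff by blast+

lemma FF_pt:
  assumes "\<phi> \<in> carrier FF" "c \<in> OE" "g \<in> KK" "x \<in> carrier H"
  shows "\<phi> (pt p c g \<odot> x) = smult c (\<phi> (pt p 1 g \<odot> x))"
  using FFD(5)[OF assms(1,2), of "pt p 1 g \<odot> x"] pt_pt_H[of 1 c g "mat 1" x] assms by simp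

subsection \<open>Reduction of forms\<close>

text \<open>
  The approximation of a measure by point masses at representatives of the cosets of level \<open>N\<close>.
\<close>

definition atomic :: "nat \<Rightarrow> (nat \<Rightarrow> ('c^2^2) set \<Rightarrow> 'c) \<Rightarrow> nat \<Rightarrow> ('c^2^2) set \<Rightarrow> 'c" where
  "atomic N r = (\<lambda>n D. \<Sum>C\<in>Lv N. pt p (r N C) (rp C) n D)"

lemma atomic_RR: "r \<in> carrier RR \<Longrightarrow> atomic N r \<in> carrier RR"
  unfolding atomic_def by (rule RR_sum_closed) (simp add: RR_OE)

lemma atomic_eq:
  assumes r: "r \<in> carrier RR" and n: "n \<le> N"
  shows "atomic N r n D = r n D"
proof (cases "D \<in> Lv n")
  case True
  have "atomic N r n D = (\<Sum>C\<in>Lv N. if C \<subseteq> D then r N C else 0)"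
    unfolding atomic_def using True by (intro sum.cong refl) (simp add: pt_eq Lv_sub_iff[OF n True])
  also have "\<dots> = (\<Sum>C\<in>{C \<in> Lv N. C \<subseteq> D}. r N C)" by (rule sum.inter_filter[symmetric]) simp
  also have "\<dots> = r n D" using RR_compat_iterated[OF r True, of "N - n"] n by simp
  finally show ?thesis .
next
  case False
  then show ?thesis by (simp add: atomic_def pt_eq RR_outside[OF r])
qed

lemma FF_atomic:
  assumes \<phi>: "\<phi> \<in> carrier FF" and r: "r \<in> carrier RR" and x: "x \<in> carrier H"
  shows "\<phi> (atomic N r \<odot> x) = (\<Sum>C\<in>Lv N. smult (r N C) (\<phi> (pt p 1 (rp C) \<odot> x)))"
proof -
  have "\<phi> (atomic N r \<odot> x) = (\<Sum>C\<in>Lv N. \<phi> (pt p (r N C) (rp C) \<odot> x))"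
    unfolding atomic_def by (rule additive_RR_sum[OF FFD(4)[OF \<phi>]]) (simp_all add: x RR_OE[OF r])
  also have "\<dots> = (\<Sum>C\<in>Lv N. smult (r N C) (\<phi> (pt p 1 (rp C) \<odot> x)))"
    by (intro sum.cong refl FF_pt[OF \<phi>]) (simp_all add: x RR_OE[OF r])
  finally show ?thesis .
qed

text \<open>
  Point masses are dense in the completed group ring, and a form is continuous along the orbit map
  \<open>r \<mapsto> r \<odot> x\<close>, which is linear on the free module of rank one. Equivariance controls a form only on point
  masses; density extends this to all measures.
\<close>

lemma FF_density:
  assumes \<phi>: "\<phi> \<in> carrier FF" and r: "r \<in> carrier RR" and x: "x \<in> carrier H" and e: "e > 0"
  shows "\<exists>N\<ge>1. av (coeff (\<phi> (atomic N r \<odot> x)) i - coeff (\<phi> (r \<odot> x)) i) < e"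
proof -
  let ?F = "free_module RR 1"
  define f where "f y = y 0 \<odot> x" for y :: "nat \<Rightarrow> nat \<Rightarrow> ('c^2^2) set \<Rightarrow> 'c"
  define e1 where "e1 r = (\<lambda>k\<in>{..<1::nat}. r)" for r :: "nat \<Rightarrow> ('c^2^2) set \<Rightarrow> 'c"
  have f: "f \<in> mod_hom RR ?F H"
    unfolding mod_hom_def
  proof (intro CollectI conjI ballI)
    have y0: "y 0 \<in> carrier RR" if "y \<in> carrier ?F" for y using that by (auto simp: carrier_free)
    then show "f \<in> carrier ?F \<rightarrow> carrier H" using x by (auto simp: f_def)
    show "f (y \<oplus>\<^bsub>?F\<^esub> z) = f y \<oplus> f z" if "y \<in> carrier ?F" "z \<in> carrier ?F" for y z
      using H_l_distr[OF y0[OF that(1)] y0[OF that(2)] x] by (simp add: f_def free_add RR_add)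
    show "f (s \<odot>\<^bsub>?F\<^esub> y) = s \<odot> f y" if "s \<in> carrier RR" "y \<in> carrier ?F" for s y
      using H_assoc[OF y0[OF that(2)] that(1) x] by (simp add: f_def free_module_def)
  qed
  have e1: "e1 s \<in> carrier ?F" "f (e1 s) = s \<odot> x" if "s \<in> carrier RR" for s
    using that by (auto simp: e1_def carrier_free f_def)
  obtain V where V: "openin TH V" "r \<odot> x \<in> V"
    "\<forall>y\<in>V. av (coeff (\<phi> y) i - coeff (\<phi> (r \<odot> x)) i) < e"
    using FFD(6)[OF \<phi>, of i] r x e unfolding continuous_map_av topspace_TH by (meson H_closed)
  have "openin (top_of_set (carrier ?F)) {y \<in> carrier ?F. f y \<in> V}"
    using V(1) f unfolding openin_canonical_topology by blast
  then obtain W where W: "open W" "{y \<in> carrier ?F. f y \<in> V} = carrier ?F \<inter> W"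
    unfolding openin_open by blast
  have "e1 r \<in> {y \<in> carrier ?F. f y \<in> V}" using e1[OF r] V(2) by simp
  then have "e1 r \<in> W" unfolding W(2) by blast
  moreover have "(\<lambda>N. e1 (atomic N r)) \<longlonglongrightarrow> e1 r"
  proof (intro tendsto_coordinatewise)
    fix k n D
    have "eventually (\<lambda>N. e1 (atomic N r) k n D = e1 r k n D) sequentially"
      unfolding eventually_sequentially using atomic_eq[OF r] by (intro exI[of _ n]) (auto simp: e1_def)
    then show "(\<lambda>N. e1 (atomic N r) k n D) \<longlonglongrightarrow> e1 r k n D" by (rule tendsto_eventually)
  qed
  ultimately have "eventually (\<lambda>N. e1 (atomic N r) \<in> W) sequentially"
    using W(1) topological_tendstoD by blast
  then obtain N0 where N0: "\<And>N. N \<ge> N0 \<Longrightarrow> e1 (atomic N r) \<in> W" unfolding eventually_sequentially by blast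
  define N where "N = max N0 1"
  have "e1 (atomic N r) \<in> carrier ?F \<inter> W" using N0[of N] e1(1)[OF atomic_RR[OF r]] by (simp add: N_def)
  then have "atomic N r \<odot> x \<in> V" unfolding W(2)[symmetric] using e1(2)[OF atomic_RR[OF r]] by simp
  then show ?thesis using V(3) by (intro exI[of _ N]) (simp add: N_def)
qed

text \<open>
  On the first congruence subgroup the action on polynomials is trivial modulo \<open>p\<close>, so modulo \<open>p\<close> the value
  on a measure with support there is a multiple of its total mass.
\<close>

lemma FF_augmentation:
  assumes \<phi>: "\<phi> \<in> carrier FF" and r: "r \<in> augmentation_ideal p OE" and x: "x \<in> carrier H"
  shows "av (coeff (\<phi> (r \<odot> x)) i) < 1"
proof -
  have rR: "r \<in> carrier RR" and r1: "\<And>n C. C \<inter> cl 1 (mat 1) = {} \<Longrightarrow> r n C = 0" and r0: "r 0 KK = 0"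
    using r unfolding aug_iff by blast+
  define q where "q = 1 / real p"
  have q: "0 < q" "q < 1" using p_gt_1 by (simp_all add: q_def)
  obtain N where N: "N \<ge> 1"
    "av (coeff (\<phi> (atomic N r \<odot> x)) i - coeff (\<phi> (r \<odot> x)) i) < q"
    using FF_density[OF \<phi> rR x q(1)] by blast
  define \<gamma> where "\<gamma> C = coeff (\<phi> (pt p 1 (rp C) \<odot> x)) i" for C
  have KK0: "KK \<in> Lv 0" using Lv_0 by simp
  have "{D \<in> Lv (0 + N). D \<subseteq> KK} = Lv N" using Lv_eq_cl in_cl by auto
  then have tot: "(\<Sum>C\<in>Lv N. r N C) = 0" using RR_compat_iterated[OF rR KK0, of N] r0 by simp
  have "coeff (\<phi> (atomic N r \<odot> x)) i = (\<Sum>C\<in>Lv N. r N C * \<gamma> C)"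
    unfolding FF_atomic[OF \<phi> rR x] by (simp add: coeff_sum \<gamma>_def)
  also have "\<dots> = (\<Sum>C\<in>Lv N. r N C * (\<gamma> C - coeff (\<phi> x) i))"
    using tot by (simp add: right_diff_distrib sum_subtractf flip: sum_distrib_right)
  also have "av \<dots> \<le> q"
  proof (rule av_sum_le)
    fix C assume C: "C \<in> Lv N"
    show "av (r N C * (\<gamma> C - coeff (\<phi> x) i)) \<le> q"
    proof (cases "r N C = 0")
      case False
      then have "C \<inter> cl 1 (mat 1) \<noteq> {}" using r1[of C N] by blast
      then obtain g where g: "g \<in> C" "g \<in> KK" "cg 1 g (mat 1)" using in_cl by blast
      have "C = cl N g" using Lv_eq_cl[OF C g(1)] by simp
      then have "cg N (rp C) g" using rp_in[OF C] by (simp add: in_cl)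
      then have "cg 1 (rp C) (mat 1)" using cg_mono[OF _ N(1)] g(3) cg_trans by blast
      then have u: "rp C \<in> U" "\<tau> (rp C) = 1" "cg 1 (rp C) (mat 1)" using U_level C by simp_all
      have "closep ((1 / real p) ^ 1) (slash m (rp C) (\<phi> x)) (\<phi> x)"
        by (rule closep_slash) (use u FFD(2,3)[OF \<phi> x] C in auto)
      then have "av (\<gamma> C - coeff (\<phi> x) i) \<le> q"
        by (simp add: closep_def \<gamma>_def FFD(7)[OF \<phi> u(1) x] u(2) q_def)
      then show ?thesis by (intro av_mult_le_1 av_OE RR_OE[OF rR C])
    qed (use q in simp)
  qed (use q in simp)
  finally have "av (coeff (\<phi> (atomic N r \<odot> x)) i -
      (coeff (\<phi> (atomic N r \<odot> x)) i - coeff (\<phi> (r \<odot> x)) i)) \<le> q"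
    by (rule av_diff_le) (use N(2) in simp)
  then have "av (coeff (\<phi> (r \<odot> x)) i) \<le> q" unfolding diff_diff_eq2 by simp
  then show ?thesis using q(2) by simp
qed

lemma FF_zero: "\<phi> \<in> carrier FF \<Longrightarrow> \<phi> \<zero> = 0"
proof -
  assume \<phi>: "\<phi> \<in> carrier FF"
  interpret HH: abelian_group H by (rule abelian_H)
  have "\<phi> \<zero> = \<phi> \<zero> + \<phi> \<zero>" using FFD(4)[OF \<phi>, of "\<zero>" "\<zero>"] by simp
  then show ?thesis by (simp only: add_cancel_right_right)
qed

text \<open>
  The bound on the generators of the kernel of \<open>\<theta>\<close> persists on the subgroup that they generate.
\<close>

lemma FF_kernel:
  assumes \<phi>: "\<phi> \<in> carrier FF" and x: "x \<in> carrier H" "\<theta> x = \<zero>\<^bsub>P\<^esub>"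
  shows "av (coeff (\<phi> x) i) < 1"
proof -
  interpret HH: abelian_group H by (rule abelian_H)
  define K where "K = {x \<in> carrier H. \<forall>i. av (coeff (\<phi> x) i) < 1}"
  have K0: "\<zero> \<in> K" using FF_zero[OF \<phi>] by (simp add: K_def)
  have sub: "subgroup K (add_monoid H)"
  proof (rule HH.add.subgroupI)
    show "K \<subseteq> carrier H" by (auto simp: K_def)
    show "K \<noteq> {}" using K0 by blast
    fix y assume y: "y \<in> K"
    then have yH: "y \<in> carrier H" by (simp add: K_def)
    have "\<phi> (\<ominus> y) + \<phi> y = 0"
      using FFD(4)[OF \<phi> HH.a_inv_closed[OF yH] yH] HH.l_neg[OF yH] FF_zero[OF \<phi>] by simp
    then have "\<phi> (\<ominus> y) = - \<phi> y" by (simp add: eq_neg_iff_add_eq_0)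
    then show "\<ominus> y \<in> K" using y yH by (simp add: K_def)
    fix z assume z: "z \<in> K"
    have "av (coeff (\<phi> y) i + coeff (\<phi> z) i) < 1" for i
      using av_add[of "coeff (\<phi> y) i" "coeff (\<phi> z) i"] y z by (simp add: K_def order.strict_trans1)
    then show "y \<oplus> z \<in> K" using y z FFD(4)[OF \<phi>] by (simp add: K_def)
  qed
  have "{r \<odot> x | r x. r \<in> insert (pt p \<pi> (mat 1)) (augmentation_ideal p OE) \<and> x \<in> carrier H} \<subseteq> K"
  proof safe
    fix y assume y: "y \<in> carrier H"
    have "av (\<pi> * coeff (\<phi> y) i) < 1" for i
    proof -
      have "av \<pi> * av (coeff (\<phi> y) i) \<le> av \<pi> * 1"
        using av_OE[OF intpD[OF FFD(3)[OF \<phi> y]]] by (intro mult_left_mono) auto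
      then show ?thesis using uniformizer_props(2) unfolding av_mult by linarith
    qed
    then show "pt p \<pi> (mat 1) \<odot> y \<in> K"
      using y uniformizer_props(1) by (simp add: K_def FFD(5)[OF \<phi>])
  next
    fix r y assume r: "r \<in> augmentation_ideal p OE" and y: "y \<in> carrier H"
    have "r \<in> carrier RR" using r by (simp add: aug_iff)
    then show "r \<odot> y \<in> K" using FF_augmentation[OF \<phi> r y] y by (simp add: K_def)
  qed
  then have "{x \<in> carrier H. \<theta> x = \<zero>\<^bsub>P\<^esub>} \<subseteq> K"
    unfolding \<theta>_kernel by (rule HH.add.generate_subgroup_incl[OF _ sub])
  then show ?thesis using x by (auto simp: K_def)
qed

lemma FF_respects_\<theta>:
  assumes \<phi>: "\<phi> \<in> carrier FF" and x: "x \<in> carrier H" and y: "y \<in> carrier H" and eq: "\<theta> x = \<theta> y"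
  shows "redp (\<phi> x) = redp (\<phi> y)"
proof (rule poly_eqI)
  fix i
  interpret HH: abelian_group H by (rule abelian_H)
  interpret PP: abelian_group P using env.abelian_P .
  define d where "d = x \<oplus> \<ominus> y"
  have d: "d \<in> carrier H" "d \<oplus> y = x" using x y by (simp_all add: d_def HH.a_assoc HH.l_neg)
  have "\<theta> d \<oplus>\<^bsub>P\<^esub> \<theta> y = \<zero>\<^bsub>P\<^esub> \<oplus>\<^bsub>P\<^esub> \<theta> y" using \<theta>_add[OF d(1) y] d(2) eq y by simp
  then have "\<theta> d = \<zero>\<^bsub>P\<^esub>" using d(1) y by (simp only: PP.add.right_cancel \<theta>_P PP.zero_closed)
  then have "av (coeff (\<phi> x) i - coeff (\<phi> y) i) < 1"
    using FF_kernel[OF \<phi> d(1), of i] FFD(4)[OF \<phi> d(1) y] d(2) by simp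
  then have "red (coeff (\<phi> x) i) = red (coeff (\<phi> y) i)"
    using intpD[OF FFD(3)[OF \<phi>]] x y by (simp add: red_eq_iff)
  then show "coeff (redp (\<phi> x)) i = coeff (redp (\<phi> y)) i" by simp
qed

definition redf :: "('h \<Rightarrow> 'c poly) \<Rightarrow> 'q \<Rightarrow> 'f poly" where
  "redf \<phi> z = (if z \<in> carrier P then redp (\<phi> (SOME x. x \<in> carrier H \<and> \<theta> x = z)) else 0)"

lemma redf_\<theta>: "\<phi> \<in> carrier FF \<Longrightarrow> x \<in> carrier H \<Longrightarrow> redf \<phi> (\<theta> x) = redp (\<phi> x)"
proof -
  assume \<phi>: "\<phi> \<in> carrier FF" and x: "x \<in> carrier H"
  have "\<exists>y. y \<in> carrier H \<and> \<theta> y = \<theta> x" using x by blast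
  from someI_ex[OF this] have "redp (\<phi> (SOME y. y \<in> carrier H \<and> \<theta> y = \<theta> x)) = redp (\<phi> x)"
    by (intro FF_respects_\<theta>[OF \<phi> _ x]) auto
  then show ?thesis using x by (simp add: redf_def)
qed

lemma redf_HomP: "\<phi> \<in> carrier FF \<Longrightarrow> redf \<phi> \<in> env.HomP Ub m \<tau>b"
proof (rule env.HomPI)
  assume \<phi>: "\<phi> \<in> carrier FF"
  have pre: "\<exists>x. x \<in> carrier H \<and> \<theta> x = z" if "z \<in> carrier P" for z using that unfolding \<theta>_surj[symmetric] by blast
  show "redf \<phi> z = 0" if "z \<notin> carrier P" for z using that by (simp add: redf_def)
  show "degree (redf \<phi> z) \<le> m" if z: "z \<in> carrier P" for z
    using pre[OF z] redf_\<theta>[OF \<phi>] FFD(2)[OF \<phi>] degree_redp order_trans by metis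
  show "redf \<phi> (y \<oplus>\<^bsub>P\<^esub> z) = redf \<phi> y + redf \<phi> z" if yz: "y \<in> carrier P" "z \<in> carrier P" for y z
  proof -
    obtain x x' where x: "x \<in> carrier H" "\<theta> x = y" "x' \<in> carrier H" "\<theta> x' = z" using pre yz by meson
    have "redf \<phi> (\<theta> (x \<oplus> x')) = redp (\<phi> x) + redp (\<phi> x')"
      using x by (simp add: redf_\<theta>[OF \<phi>] FFD(4)[OF \<phi>] redp_add FFD(3)[OF \<phi>])
    then show ?thesis using x by (simp add: \<theta>_add redf_\<theta>[OF \<phi>, symmetric])
  qed
  show "redf \<phi> (env.ptP c u \<odot>\<^bsub>P\<^esub> z) = smult (c * \<tau>b u) (slash m u (redf \<phi> z))"
    if z: "z \<in> carrier P" and u: "u \<in> Ub" for z u c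
  proof -
    obtain x where x: "x \<in> carrier H" "\<theta> x = z" using pre z by blast
    obtain v where v: "v \<in> U" "u = map_matrix red v" using u Ub by blast
    obtain d where d: "d \<in> OE" "red d = c" using red_surj by blast
    have "redf \<phi> (\<theta> (pt p d v \<odot> x)) = redp (\<phi> (pt p d v \<odot> x))"
      using x v d by (intro redf_\<theta>[OF \<phi>]) simp
    also have "\<phi> (pt p d v \<odot> x) = smult d (smult (\<tau> v) (slash m v (\<phi> x)))"
      using FF_pt[OF \<phi> d(1) U_sub[OF v(1)] x(1)] FFD(7)[OF \<phi> v(1) x(1)] by simp
    also have "redp \<dots> = smult (c * \<tau>b u) (slash m u (redf \<phi> z))"
      using v d x \<tau>_OE[OF v(1)] FFD(3)[OF \<phi> x(1)] redf_\<theta>[OF \<phi> x(1)]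
      by (simp only: redp_smult intp_smult intp_slash U_sub redp_slash \<tau>_red smult_smult red_mult OE_closed)
    finally show ?thesis using x v d by (simp add: \<theta>_pt)
  qed
qed

end

context iwasawa_module
begin

lemma uniform_cong: "(\<And>g. g \<in> KK \<Longrightarrow> \<omega> g = \<omega>' g) \<Longrightarrow> uniform \<omega> \<longleftrightarrow> uniform \<omega>'"
  by (simp add: uniform_def)

lemma intg_cong: "(\<And>g. g \<in> KK \<Longrightarrow> \<omega> g = \<omega>' g) \<Longrightarrow> intg \<omega> x = intg \<omega>' x"
  by (simp add: intg_def riemann_def)

lemma intg_mult_close:
  assumes \<omega>: "uniform \<omega>" and x: "x \<in> carrier RR" and y: "y \<in> carrier RR" "y' \<in> carrier RR"
    and close: "\<And>C. C \<in> Lv N \<Longrightarrow> av (y N C - y' N C) \<le> (1 / real p) ^ N"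
  shows "av (intg \<omega> (x \<star> y) - intg \<omega> (x \<star> y')) \<le> (1 / real p) ^ N"
proof -
  let ?I = "\<lambda>y. intg \<omega> (x \<star> y)" and ?R = "\<lambda>y. riemann N \<omega> (x \<star> y)"
  let ?d = "\<lambda>n C. y n C - y' n C"
  have "(x \<star> y) N C - (x \<star> y') N C = (x \<star> ?d) N C" for C
    unfolding RR_mult by (simp add: case_prod_beta right_diff_distrib flip: sum_subtractf)
  then have "?R y - ?R y' = (\<Sum>C\<in>Lv N. (x \<star> ?d) N C * \<omega> (rp C))"
    by (simp add: riemann_def flip: sum_subtractf left_diff_distrib)
  also have "av \<dots> \<le> (1 / real p) ^ N"
  proof (rule av_sum_le)
    fix C assume C: "C \<in> Lv N"
    have "av (\<omega> (rp C) * (x \<star> ?d) N C) \<le> (1 / real p) ^ N"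
      by (rule av_mult_le_1[OF av_OE[OF uniformD(1)[OF \<omega> rp_KK[OF C]]]], rule av_RR_mult_le[OF x])
        (use close in simp_all)
    then show "av ((x \<star> ?d) N C * \<omega> (rp C)) \<le> (1 / real p) ^ N" by (simp add: mult.commute)
  qed simp
  finally have "av ((?I y - ?R y) + (?R y - ?R y') - (?I y' - ?R y')) \<le> (1 / real p) ^ N"
    by (rule av_diff_le[OF av_add_le[OF intg(2)[OF \<omega> RR_mult_closed[OF x y(1)]]]
          intg(2)[OF \<omega> RR_mult_closed[OF x y(2)]]])
  then show ?thesis by simp
qed

end

context weight
begin

subsection \<open>Lifting of reduced forms\<close>

text \<open>
  A representative of the coset of \<open>g\<close> modulo the level group, which depends only on the coset, and the
  remaining factor of \<open>g\<close> in the level group.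
\<close>

definition cr :: "'c^2^2 \<Rightarrow> 'c^2^2" where "cr g = (SOME r. r \<in> KK \<and> inv2 r ** g \<in> U)"

definition co :: "'c^2^2 \<Rightarrow> 'c^2^2" where "co g = inv2 (cr g) ** g"

lemma cr_co:
  assumes "g \<in> KK"
  shows "cr g \<in> KK" "co g \<in> U" "cr g ** co g = g"
proof -
  have "\<exists>r. r \<in> KK \<and> inv2 r ** g \<in> U"
    using assms inv2_left[OF KK_det_nz[OF assms]] by (intro exI[of _ g]) simp
  from someI_ex[OF this] show "cr g \<in> KK" "co g \<in> U" unfolding cr_def co_def by blast+
  then show "cr g ** co g = g" by (simp add: co_def KK_cancel)
qed

lemma cr_translate:
  assumes g: "g \<in> KK" and u: "u \<in> U"
  shows "cr (g ** u) = cr g" "co (g ** u) = co g ** u"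
proof -
  have "inv2 r ** (g ** u) \<in> U \<longleftrightarrow> inv2 r ** g \<in> U" for r
  proof
    assume "inv2 r ** (g ** u) \<in> U"
    then have "(inv2 r ** (g ** u)) ** inv2 u \<in> U" using U_inv[OF u] U_mult by blast
    then show "inv2 r ** g \<in> U" using KK_cancel(1)[OF U_sub[OF u], of "inv2 r ** g"] by (simp add: matrix_mul_assoc)
  next
    assume "inv2 r ** g \<in> U"
    then have "(inv2 r ** g) ** u \<in> U" using u U_mult by blast
    then show "inv2 r ** (g ** u) \<in> U" by (simp add: matrix_mul_assoc)
  qed
  then show "cr (g ** u) = cr g" by (simp add: cr_def)
  then show "co (g ** u) = co g ** u" by (simp add: co_def matrix_mul_assoc)
qed

text \<open>
  On a generator \<open>b j\<close> prescribe the polynomial-valued function \<open>W j\<close> on the group: a lift of the given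
  values at coset representatives, extended equivariantly over the cosets of the level group. Its coefficients
  \<open>\<omega> j i\<close> are uniform, so they can be integrated against the coordinates \<open>\<kappa> j x\<close>, which are measures.
  Equivariance of the result is invariance of the integral under translation. Modulo the uniformizer the integral is
  the Riemann sum of level one, and this reproduces the given map.
\<close>

lemma lift_form:
  assumes f: "f \<in> env.HomP Ub m \<tau>b"
  shows "\<exists>\<phi>. \<phi> \<in> carrier FF \<and> redf \<phi> = f"
proof -
  obtain n \<kappa> b where cb: "coords RR H TYPE('f poly) n \<kappa> b" using coords_exist[OF H_projective] by blast
  note cD = coordsD[OF cb]
  define lft where "lft F = (SOME F'. degree F' \<le> m \<and> intp F' \<and> (degree F \<le> m \<longrightarrow> redp F' = F))" for F :: "'f poly"
  have lft: "degree (lft F) \<le> m \<and> intp (lft F) \<and> (degree F \<le> m \<longrightarrow> redp (lft F) = F)" for F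
    unfolding lft_def by (rule someI_ex[OF lift_poly])
  define W where "W j g = smult (\<tau> (co g)) (slash m (co g) (lft (f (\<theta> (pt p 1 (cr g) \<odot> b j)))))" for j g
  have Wd: "degree (W j g) \<le> m" for j g
    unfolding W_def by (rule order_trans[OF degree_smult_le degree_slash])
  have Wi: "intp (W j g)" if "g \<in> KK" for j g
    unfolding W_def using cr_co[OF that] lft \<tau>_OE by (intro intp_smult intp_slash) auto
  have Wu: "W j (g ** u) = smult (\<tau> u) (slash m u (W j g))" if "g \<in> KK" "u \<in> U" for j g u
    unfolding W_def cr_translate[OF that] using lft cr_co[OF that(1)] that(2)
    by (simp add: \<tau>_mult slash_compose slash_smult mult.commute)
  have Wr: "redp (W j g) = f (\<theta> (pt p 1 g \<odot> b j))" if g: "g \<in> KK" and j: "j < n" for j g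
  proof -
    let ?z = "\<theta> (pt p 1 (cr g) \<odot> b j)"
    have z: "?z \<in> carrier P" using cr_co[OF g] cD(1)[OF j] by simp
    have u: "map_matrix red (co g) \<in> Ub" using cr_co[OF g] Ub by blast
    have "redp (W j g) = smult (red (\<tau> (co g))) (slash m (map_matrix red (co g)) (redp (lft (f ?z))))"
      unfolding W_def using cr_co[OF g] lft \<tau>_OE by (simp add: redp_smult intp_slash redp_slash)
    also have "\<dots> = f (env.ptP 1 (map_matrix red (co g)) \<odot>\<^bsub>P\<^esub> ?z)"
      using env.HomPD(4)[OF f z u, of 1] lft env.HomPD(2)[OF f] \<tau>_red cr_co[OF g] by simp
    also have "env.ptP 1 (map_matrix red (co g)) \<odot>\<^bsub>P\<^esub> ?z = \<theta> (pt p 1 g \<odot> b j)"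
      using \<theta>_pt[of "pt p 1 (cr g) \<odot> b j" 1 "co g"] pt_pt_H[of 1 1 "cr g" "co g" "b j"] cr_co[OF g] cD(1)[OF j] by simp
    finally show ?thesis .
  qed
  define \<omega> where "\<omega> j i g = coeff (W j g) i" for j i g
  have \<omega>: "uniform (\<omega> j i)" for j i
    unfolding uniform_def
  proof (intro conjI ballI allI impI)
    show "\<omega> j i g \<in> OE" if "g \<in> KK" for g using Wi[OF that] by (simp add: \<omega>_def intp_def)
    fix k g h assume g: "g \<in> KK" and h: "h \<in> KK" and gh: "cg k g h"
    show "av (\<omega> j i g - \<omega> j i h) \<le> (1 / real p) ^ k"
    proof (cases "k = 0")
      case True
      then show ?thesis using Wi[OF g] Wi[OF h] by (simp add: \<omega>_def intp_def av_OE)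
    next
      case False
      \<comment> \<open>Positive levels lie in the first congruence subgroup, where the character is trivial.\<close>
      define v where "v = inv2 g ** h"
      have v: "v \<in> KK" "h = g ** v" using g h by (simp_all add: v_def KK_cancel)
      have "cg k (inv2 g ** h) (inv2 g ** g)" using cg_mult_left[OF KK_inv2[OF g] cg_sym[OF gh]] .
      then have vc: "cg k v (mat 1)" using inv2_left[OF KK_det_nz[OF g]] by (simp add: v_def)
      then have "v \<in> U" "\<tau> v = 1" using U_level[OF v(1)] cg_mono[OF vc, of 1] False by auto
      then have "W j h = slash m v (W j g)" using Wu[OF g] v by simp
      then have "closep ((1 / real p) ^ k) (W j h) (W j g)" using closep_slash[OF v(1) vc Wi[OF g] Wd] by simp
      then show ?thesis by (simp add: closep_def \<omega>_def av_diff_commute)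
    qed
  qed
  define c where "c x i = (\<Sum>j<n. intg (\<omega> j i) (\<kappa> j x))" for x i
  define \<phi> where "\<phi> x = (if x \<in> carrier H then \<Sum>i\<le>m. monom (c x i) i else undefined)" for x
  have co\<phi>: "coeff (\<phi> x) i = (if i \<le> m then c x i else 0)" if "x \<in> carrier H" for x i
    using that by (simp add: \<phi>_def coeff_sum)
  have cOE: "c x i \<in> OE" if "x \<in> carrier H" for x i
    unfolding c_def by (intro OE_sum intg(3) \<omega>) (use that cD(2) in auto)
  have c_add: "c (x \<oplus> y) i = c x i + c y i" if "x \<in> carrier H" "y \<in> carrier H" for x y i
    unfolding c_def sum.distrib[symmetric] using that
    by (intro sum.cong refl) (simp add: cD(3) RR_add intg_add[OF \<omega> cD(2) cD(2)])
  have \<phi>_add: "\<phi> (x \<oplus> y) = \<phi> x + \<phi> y" if "x \<in> carrier H" "y \<in> carrier H" for x y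
    using that by (intro poly_eqI) (simp add: co\<phi> c_add)
  have \<phi>_pt: "\<phi> (pt p d u \<odot> x) = smult (d * \<tau> u) (slash m u (\<phi> x))"
    if d: "d \<in> OE" and u: "u \<in> U" and x: "x \<in> carrier H" for d u x
  proof (rule poly_eqI)
    fix k
    define M where "M i = coeff ([:u $ 1 $ 2, u $ 1 $ 1:] ^ i * [:u $ 2 $ 2, u $ 2 $ 1:] ^ (m - i)) k" for i
    have ptx: "pt p d u \<odot> x \<in> carrier H" using d u x by simp
    show "coeff (\<phi> (pt p d u \<odot> x)) k = coeff (smult (d * \<tau> u) (slash m u (\<phi> x))) k"
    proof (cases "k \<le> m")
      case True
      have "intg (\<omega> j k) (\<kappa> j (pt p d u \<odot> x)) = (\<Sum>i\<le>m. d * \<tau> u * M i * intg (\<omega> j i) (\<kappa> j x))" if j: "j < n" for j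
      proof -
        have eq: "\<omega> j k (g ** u) = (\<Sum>i\<le>m. (\<tau> u * M i) * \<omega> j i g)" if "g \<in> KK" for g
          using Wu[OF that u, of j] by (simp add: \<omega>_def coeff_slash M_def sum_distrib_left mult_ac)
        have un: "uniform (\<lambda>g. \<Sum>i\<le>m. (\<tau> u * M i) * \<omega> j i g)"
          by (rule iffD1[OF uniform_cong[OF eq] uniform_translate[OF \<omega> U_sub[OF u]]])
        have "intg (\<omega> j k) (\<kappa> j (pt p d u \<odot> x)) = d * intg (\<lambda>g. \<omega> j k (g ** u)) (\<kappa> j x)"
          unfolding cD(4)[OF j x pt_RR[OF d U_sub[OF u]]]
          by (intro intg_translate \<omega> cD(2)[OF j x] RR_mult_closed pt_RR U_sub d u)
        also have "intg (\<lambda>g. \<omega> j k (g ** u)) (\<kappa> j x) = intg (\<lambda>g. \<Sum>i\<le>m. (\<tau> u * M i) * \<omega> j i g) (\<kappa> j x)"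
          by (rule intg_cong[OF eq])
        also have "\<dots> = (\<Sum>i\<le>m. (\<tau> u * M i) * intg (\<omega> j i) (\<kappa> j x))"
          by (rule intg_linear[OF _ \<omega> un cD(2)[OF j x]]) simp
        finally show ?thesis by (simp add: sum_distrib_left mult_ac)
      qed
      then have "c (pt p d u \<odot> x) k = (\<Sum>j<n. \<Sum>i\<le>m. d * \<tau> u * M i * intg (\<omega> j i) (\<kappa> j x))"
        unfolding c_def by (intro sum.cong refl) simp
      also have "\<dots> = (\<Sum>i\<le>m. \<Sum>j<n. d * \<tau> u * M i * intg (\<omega> j i) (\<kappa> j x))" by (rule sum.swap)
      also have "\<dots> = (\<Sum>i\<le>m. d * \<tau> u * (c x i * M i))"
        unfolding c_def by (intro sum.cong refl) (simp add: sum_distrib_left sum_distrib_right mult_ac)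
      finally show ?thesis using True co\<phi>[OF ptx] co\<phi>[OF x] by (simp add: coeff_slash M_def sum_distrib_left)
    next
      case False
      have "degree (slash m u (\<phi> x)) \<le> m" by (rule degree_slash)
      then show ?thesis using False co\<phi>[OF ptx] by (simp add: coeff_eq_0)
    qed
  qed
  have \<phi>_deg: "degree (\<phi> x) \<le> m" if "x \<in> carrier H" for x
    by (rule degree_le) (simp add: co\<phi>[OF that])
  have cont: "continuous_map TH euclidean (\<lambda>x. coeff (\<phi> x) i)" for i
    unfolding continuous_map_av topspace_TH
  proof (intro ballI allI impI)
    fix x0 and e :: real assume x0: "x0 \<in> carrier H" and e: "e > 0"
    obtain N where N: "(1 / real p) ^ N < e" using ex_p_power_lt[OF e, of 0] by blast
    define q where "q = (1 / real p) ^ N"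
    have q0: "q > 0" using p_gt_1 by (simp add: q_def)
    \<comment> \<open>The preimage of this set under a linear map from a free module contains, with each point, all
      points whose components agree with it up to \<open>q\<close> at the finite level \<open>N\<close>.\<close>
    let ?V = "{y \<in> carrier H. av (coeff (\<phi> y) i - coeff (\<phi> x0) i) < e}"
    have "openin TH ?V"
      unfolding openin_canonical_topology
    proof (intro conjI allI ballI)
      fix l h assume h: "h \<in> mod_hom RR (free_module RR l) H"
      let ?F = "free_module RR l"
      have hH: "h y \<in> carrier H" if "y \<in> carrier ?F" for y using h that by (auto simp: mod_hom_def)
      have hadd: "h (y \<oplus>\<^bsub>?F\<^esub> z) = h y \<oplus> h z" if "y \<in> carrier ?F" "z \<in> carrier ?F" for y z
        using h that by (auto simp: mod_hom_def)
      have hs: "h (r \<odot>\<^bsub>?F\<^esub> y) = r \<odot> h y" if "r \<in> carrier RR" "y \<in> carrier ?F" for r y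
        using h that by (auto simp: mod_hom_def)
      have yR: "y k \<in> carrier RR" if "y \<in> carrier ?F" "k < l" for y k using that by (auto simp: carrier_free)
      have expand: "coeff (\<phi> (h y)) i = (\<Sum>k<l. if i \<le> m then \<Sum>j<n. intg (\<omega> j i) (\<kappa> j (h (gen RR l k)) \<star> y k) else 0)"
        if y: "y \<in> carrier ?F" for y
      proof -
        have "coeff (\<phi> (h y)) i = (\<Sum>k<l. coeff (\<phi> (h (y k \<odot>\<^bsub>?F\<^esub> gen RR l k))) i)"
          by (rule free_expand[OF ring_RR _ y]) (simp add: hadd hH \<phi>_add)
        also have "\<dots> = (\<Sum>k<l. if i \<le> m then \<Sum>j<n. intg (\<omega> j i) (\<kappa> j (h (gen RR l k)) \<star> y k) else 0)"
        proof (intro sum.cong refl)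
          fix k assume "k \<in> {..<l}"
          then have k: "y k \<in> carrier RR" using yR[OF y] by simp
          show "coeff (\<phi> (h (y k \<odot>\<^bsub>?F\<^esub> gen RR l k))) i =
            (if i \<le> m then \<Sum>j<n. intg (\<omega> j i) (\<kappa> j (h (gen RR l k)) \<star> y k) else 0)"
            unfolding hs[OF k gen_closed[OF ring_RR]] using k hH[OF gen_closed[OF ring_RR]] by (simp add: co\<phi> c_def cD(4))
        qed
        finally show ?thesis .
      qed
      show "openin (top_of_set (carrier ?F)) {y \<in> carrier ?F. h y \<in> ?V}"
      proof (subst openin_subopen, intro ballI)
        fix y0 assume y0: "y0 \<in> {y \<in> carrier ?F. h y \<in> ?V}"
        define W where "W = (\<Inter>k\<in>{..<l}. \<Inter>C\<in>Lv N. (\<lambda>y. y k N C) -` ball (y0 k N C) q)"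
        have "open ((\<lambda>y :: nat \<Rightarrow> nat \<Rightarrow> ('c^2^2) set \<Rightarrow> 'c. y k N C) -` ball (y0 k N C) q)" for k C
        proof (rule open_vimage[OF open_ball])
          have c1: "continuous_on UNIV (\<lambda>y :: nat \<Rightarrow> nat \<Rightarrow> ('c^2^2) set \<Rightarrow> 'c. y k)"
            by (rule continuous_on_product_coordinates)
          then have c2: "continuous_on UNIV (\<lambda>y :: nat \<Rightarrow> nat \<Rightarrow> ('c^2^2) set \<Rightarrow> 'c. y k N)"
            by (rule continuous_on_product_then_coordinatewise)
          then show "continuous_on UNIV (\<lambda>y :: nat \<Rightarrow> nat \<Rightarrow> ('c^2^2) set \<Rightarrow> 'c. y k N C)"
            by (rule continuous_on_product_then_coordinatewise)
        qed
        then have "open W" unfolding W_def by (intro open_INT finite_lessThan finite_Lv ballI)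
        then have "openin (top_of_set (carrier ?F)) (carrier ?F \<inter> W)" by (simp add: openin_open_Int)
        moreover have "y0 \<in> carrier ?F \<inter> W" using y0 q0 by (simp add: W_def)
        moreover have "carrier ?F \<inter> W \<subseteq> {y \<in> carrier ?F. h y \<in> ?V}"
        proof
          fix y assume y: "y \<in> carrier ?F \<inter> W"
          have close: "av (y k N C - y0 k N C) \<le> q" if "k < l" "C \<in> Lv N" for k C
          proof -
            have "y0 k N C \<in> ball (y k N C) q" using y that by (auto simp: W_def dist_commute)
            then have "dist (y k N C) (y0 k N C) < q" by simp
            then show ?thesis unfolding dist_av[of "y k N C" "y0 k N C"] by (rule less_imp_le)
          qed
          have "av (intg (\<omega> j i) (\<kappa> j (h (gen RR l k)) \<star> y k) - intg (\<omega> j i) (\<kappa> j (h (gen RR l k)) \<star> y0 k)) \<le> q"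
            if "k < l" "j < n" for k j
            unfolding q_def
            by (rule intg_mult_close[OF \<omega> cD(2)[OF that(2) hH[OF gen_closed[OF ring_RR]]]])
              (use yR y y0 that close[unfolded q_def] in auto)
          then have "av (coeff (\<phi> (h y)) i - coeff (\<phi> (h y0)) i) \<le> q"
            using y y0 q0 by (cases "i \<le> m") (auto simp: expand simp flip: sum_subtractf intro!: av_sum_le)
          then have "av ((coeff (\<phi> (h y)) i - coeff (\<phi> (h y0)) i) +
              (coeff (\<phi> (h y0)) i - coeff (\<phi> x0) i)) < e"
            using y0 N unfolding q_def[symmetric]
            by (intro order.strict_trans1[OF av_add]) simp
          then show "y \<in> {y \<in> carrier ?F. h y \<in> ?V}" using y hH by simp
        qed
        ultimately show "\<exists>T. openin (top_of_set (carrier ?F)) T \<and> y0 \<in> T \<and> T \<subseteq> {y \<in> carrier ?F. h y \<in> ?V}" by blast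
      qed
    qed auto
    then show "\<exists>V. openin TH V \<and> x0 \<in> V \<and> (\<forall>y\<in>V. av (coeff (\<phi> y) i - coeff (\<phi> x0) i) < e)"
      using x0 e by (intro exI[of _ ?V]) simp
  qed
  have \<phi>FF: "\<phi> \<in> carrier FF"
    unfolding FF_iff
  proof (intro conjI ballI allI)
    show "\<phi> \<in> extensional (carrier H)" by (simp add: extensional_def \<phi>_def)
    fix x assume x: "x \<in> carrier H"
    show "degree (\<phi> x) \<le> m" by (rule \<phi>_deg[OF x])
    show "intp (\<phi> x)" using cOE[OF x] by (simp add: intp_def co\<phi>[OF x])
    show "\<phi> (x \<oplus> y) = \<phi> x + \<phi> y" if "y \<in> carrier H" for y by (rule \<phi>_add[OF x that])
    show "\<phi> (pt p c (mat 1) \<odot> x) = smult c (\<phi> x)" if "c \<in> OE" for c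
      using \<phi>_pt[OF that U_1 x] \<phi>_deg[OF x] by (simp add: slash_mat_1)
    show "\<phi> (pt p 1 u \<odot> x) = smult (\<tau> u) (slash m u (\<phi> x))" if "u \<in> U" for u
      using \<phi>_pt[OF _ that x, of 1] by simp
  qed (rule cont)
  have red: "redp (\<phi> x) = f (\<theta> x)" if x: "x \<in> carrier H" for x
  proof (rule poly_eqI)
    fix i
    define L where "L x = f (\<theta> x)" for x
    have Ladd: "L (x \<oplus> y) = L x + L y" if "x \<in> carrier H" "y \<in> carrier H" for x y
      using that by (simp add: L_def \<theta>_add env.HomPD(3)[OF f])
    have L0: "L (s \<odot> x) = 0" if "x \<in> carrier H" "s \<in> augmentation_ideal p OE" for x s
    proof -
      interpret PP: abelian_group P using env.abelian_P .
      have "f \<zero>\<^bsub>P\<^esub> = f \<zero>\<^bsub>P\<^esub> + f \<zero>\<^bsub>P\<^esub>" using env.HomPD(3)[OF f, of "\<zero>\<^bsub>P\<^esub>" "\<zero>\<^bsub>P\<^esub>"] by simp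
      then have "f \<zero>\<^bsub>P\<^esub> = 0" by (simp only: add_cancel_right_right)
      then show ?thesis using \<theta>_kernel_aug[OF that] by (simp add: L_def)
    qed
    have Lc: "L (pt p d (mat 1) \<odot> x) = smult (red d) (L x)" if "x \<in> carrier H" "d \<in> OE" for x d
    proof -
      have 1: "mat 1 \<in> Ub" using Ub map_matrix_1 U_1 by (metis imageI)
      have \<tau>1: "\<tau>b (mat 1) = 1" using \<tau>_red[OF U_1] by (simp add: map_matrix_1)
      show ?thesis
        using env.HomPD(4)[OF f \<theta>_P[OF that(1)] 1, of "red d"] env.HomPD(2)[OF f] that
        by (simp add: L_def \<theta>_pt map_matrix_1 slash_mat_1 \<tau>1)
    qed
    have "L x = (\<Sum>j<n. L (\<kappa> j x \<odot> b j))" by (rule cD(5)[OF Ladd x])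
    also have "\<dots> = (\<Sum>j<n. \<Sum>C\<in>Lv 1. smult (red (\<kappa> j x 1 C)) (L (pt p 1 (rp C) \<odot> b j)))"
      by (intro sum.cong refl reduce_measure[OF _ _ Ladd L0 Lc]) (simp_all add: cD x)
    also have "\<dots> = (\<Sum>j<n. \<Sum>C\<in>Lv 1. smult (red (\<kappa> j x 1 C)) (redp (W j (rp C))))"
      by (intro sum.cong refl) (simp add: Wr L_def)
    finally have Lx: "coeff (L x) i = (\<Sum>j<n. \<Sum>C\<in>Lv 1. red (\<kappa> j x 1 C) * red (\<omega> j i (rp C)))"
      by (simp add: coeff_sum \<omega>_def)
    have "red (c x i) = (\<Sum>j<n. red (intg (\<omega> j i) (\<kappa> j x)))"
      unfolding c_def by (rule red_sum) (use intg(3)[OF \<omega> cD(2)] x in auto)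
    also have "\<dots> = (\<Sum>j<n. \<Sum>C\<in>Lv 1. red (\<kappa> j x 1 C) * red (\<omega> j i (rp C)))"
    proof (intro sum.cong refl)
      fix j assume "j \<in> {..<n}"
      then have k: "\<kappa> j x \<in> carrier RR" using cD(2) x by simp
      have "av (intg (\<omega> j i) (\<kappa> j x) - riemann 1 (\<omega> j i) (\<kappa> j x)) < 1"
        using intg(2)[OF \<omega>[of j i] k, of 1] p_gt_1 by (simp add: order.strict_trans1)
      then have "red (intg (\<omega> j i) (\<kappa> j x)) = red (riemann 1 (\<omega> j i) (\<kappa> j x))"
        using red_eq_iff intg(3)[OF \<omega> k] riemann_OE[OF \<omega> k] by blast
      also have "\<dots> = (\<Sum>C\<in>Lv 1. red (\<kappa> j x 1 C * \<omega> j i (rp C)))"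
        unfolding riemann_def by (rule red_sum) (intro OE_closed RR_OE[OF k] uniformD(1)[OF \<omega>] rp_KK)
      also have "\<dots> = (\<Sum>C\<in>Lv 1. red (\<kappa> j x 1 C) * red (\<omega> j i (rp C)))"
        by (intro sum.cong refl red_mult RR_OE[OF k] uniformD(1)[OF \<omega>] rp_KK)
      finally show "red (intg (\<omega> j i) (\<kappa> j x)) = (\<Sum>C\<in>Lv 1. red (\<kappa> j x 1 C) * red (\<omega> j i (rp C)))" .
    qed
    finally have cx: "red (c x i) = coeff (L x) i" unfolding Lx .
    show "coeff (redp (\<phi> x)) i = coeff (f (\<theta> x)) i"
    proof (cases "i \<le> m")
      case True
      then show ?thesis using cx by (simp add: co\<phi>[OF x] L_def)
    next
      case False
      then show ?thesis using env.HomPD(2)[OF f, of "\<theta> x"] by (simp add: co\<phi>[OF x] coeff_eq_0)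
    qed
  qed
  have "redf \<phi> = f"
  proof
    fix z
    show "redf \<phi> z = f z"
    proof (cases "z \<in> carrier P")
      case True
      then obtain x where "x \<in> carrier H" "z = \<theta> x" using \<theta>_surj by blast
      then show ?thesis using redf_\<theta>[OF \<phi>FF] red by simp
    next
      case False
      then show ?thesis using env.HomPD(1)[OF f] by (simp add: redf_def)
    qed
  qed
  with \<phi>FF show ?thesis by blast
qed

end

context coeff_ring
begin

subsection \<open>Uniqueness of the rank\<close>

abbreviation OM :: "nat \<Rightarrow> ('c, nat \<Rightarrow> 'c) module" where "OM d \<equiv> free_module (ring_on OE) d"

lemma OM_simps: "carrier (OM d) = {..<d} \<rightarrow>\<^sub>E OE" "x \<oplus>\<^bsub>OM d\<^esub> y = (\<lambda>i\<in>{..<d}. x i + y i)"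
  "c \<odot>\<^bsub>OM d\<^esub> x = (\<lambda>i\<in>{..<d}. x i * c)" "carrier (ring_on OE) = OE"
  by (simp_all add: free_module_def ring_on_def)

abbreviation unit_vec :: "nat \<Rightarrow> nat \<Rightarrow> nat \<Rightarrow> 'c" where "unit_vec \<equiv> gen (ring_on OE)"

lemma ring_OE: "ring (ring_on OE)"
  by (rule ringI; unfold_locales) (auto simp: ring_on_def algebra_simps Units_def intro!: bexI[of _ "- _"])

lemma unit_vec_eq: "unit_vec d i = (\<lambda>k\<in>{..<d}. if k = i then 1 else 0)"
  unfolding gen_def ring_on_def by (auto simp: restrict_def fun_eq_iff)

lemma unit_vec_OM [simp]: "unit_vec d i \<in> carrier (OM d)"
  by (rule gen_closed[OF ring_OE])

lemma OM_expand:
  assumes h: "h \<in> mod_hom (ring_on OE) (OM d) (OM e)" and x: "x \<in> carrier (OM d)" and j: "j < e"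
  shows "h x j = (\<Sum>i<d. x i * h (unit_vec d i) j)"
proof -
  have hadd: "h (y \<oplus>\<^bsub>OM d\<^esub> z) = h y \<oplus>\<^bsub>OM e\<^esub> h z" if "y \<in> carrier (OM d)" "z \<in> carrier (OM d)" for y z
    using h that by (auto simp: mod_hom_def)
  have "h x j = (\<Sum>i<d. h (x i \<odot>\<^bsub>OM d\<^esub> unit_vec d i) j)"
    by (rule free_expand[OF ring_OE _ x]) (simp only: hadd, simp add: OM_simps j)
  also have "\<dots> = (\<Sum>i<d. x i * h (unit_vec d i) j)"
  proof (intro sum.cong refl)
    fix i assume "i \<in> {..<d}"
    then have "x i \<in> carrier (ring_on OE)" using x by (auto simp: carrier_free)
    then have "h (x i \<odot>\<^bsub>OM d\<^esub> unit_vec d i) = x i \<odot>\<^bsub>OM e\<^esub> h (unit_vec d i)"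
      using h unit_vec_OM unfolding mod_hom_def by blast
    then show "h (x i \<odot>\<^bsub>OM d\<^esub> unit_vec d i) j = x i * h (unit_vec d i) j"
      using j by (simp add: OM_simps mult.commute)
  qed
  finally show ?thesis .
qed

text \<open>
  Two bases give matrices \<open>A\<close> and \<open>B\<close> with \<open>A B\<close> and \<open>B A\<close> the identity matrices of the two sizes.
  These have the same trace, and in characteristic zero the trace determines the size.
\<close>

lemma free_rank_eqI:
  fixes M :: "('c, 'm) module"
  assumes f: "f \<in> mod_hom (ring_on OE) (OM d) M" "bij_betw f (carrier (OM d)) (carrier M)"
  shows "free_rank (ring_on OE) M = d"
  unfolding free_rank_def
proof (rule the_equality)
  show "\<exists>f\<in>mod_hom (ring_on OE) (OM d) M. bij_betw f (carrier (OM d)) (carrier M)" using f by blast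
next
  have transfer: "\<exists>h\<in>mod_hom (ring_on OE) (OM d) (OM e). \<forall>x\<in>carrier (OM d). g (h x) = f x"
    if f: "f \<in> mod_hom (ring_on OE) (OM d) M" and g: "g \<in> mod_hom (ring_on OE) (OM e) M"
      and gb: "bij_betw g (carrier (OM e)) (carrier M)" for f g d e
  proof -
    define h where "h x = inv_into (carrier (OM e)) g (f x)" for x
    have fM: "f x \<in> carrier M" if "x \<in> carrier (OM d)" for x using f that by (auto simp: mod_hom_def)
    have h: "h x \<in> carrier (OM e)" "g (h x) = f x" if "x \<in> carrier (OM d)" for x
      using fM[OF that] gb unfolding h_def by (auto simp: bij_betw_def inv_into_into f_inv_into_f)
    have inj: "y = z" if "y \<in> carrier (OM e)" "z \<in> carrier (OM e)" "g y = g z" for y z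
      using gb that by (auto simp: bij_betw_def inj_on_def)
    have add: "y \<oplus>\<^bsub>OM n\<^esub> z \<in> carrier (OM n)" if "y \<in> carrier (OM n)" "z \<in> carrier (OM n)" for y z n
      using that by (auto simp: OM_simps PiE_iff)
    have smul: "r \<odot>\<^bsub>OM n\<^esub> z \<in> carrier (OM n)" if "r \<in> OE" "z \<in> carrier (OM n)" for r z n
      using that by (auto simp: OM_simps PiE_iff)
    have "h \<in> mod_hom (ring_on OE) (OM d) (OM e)"
      unfolding mod_hom_def
    proof (intro CollectI conjI ballI)
      show "h \<in> carrier (OM d) \<rightarrow> carrier (OM e)" using h by blast
      show "h (x \<oplus>\<^bsub>OM d\<^esub> y) = h x \<oplus>\<^bsub>OM e\<^esub> h y" if "x \<in> carrier (OM d)" "y \<in> carrier (OM d)" for x y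
      proof (rule inj)
        show "g (h (x \<oplus>\<^bsub>OM d\<^esub> y)) = g (h x \<oplus>\<^bsub>OM e\<^esub> h y)"
          using f g that h[OF that(1)] h[OF that(2)] h(2)[OF add[OF that]] by (simp add: mod_hom_def)
      qed (use h add that in auto)
      show "h (r \<odot>\<^bsub>OM d\<^esub> x) = r \<odot>\<^bsub>OM e\<^esub> h x" if "r \<in> carrier (ring_on OE)" "x \<in> carrier (OM d)" for r x
      proof (rule inj)
        have r: "r \<in> OE" using that(1) by (simp add: OM_simps)
        show "g (h (r \<odot>\<^bsub>OM d\<^esub> x)) = g (r \<odot>\<^bsub>OM e\<^esub> h x)"
          using f g that h[OF that(2)] h(2)[OF smul[OF r that(2)]] by (simp add: mod_hom_def)
        show "h (r \<odot>\<^bsub>OM d\<^esub> x) \<in> carrier (OM e)" "r \<odot>\<^bsub>OM e\<^esub> h x \<in> carrier (OM e)"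
          using h smul r that by auto
      qed
    qed
    with h show ?thesis by blast
  qed
  fix e assume "\<exists>g\<in>mod_hom (ring_on OE) (OM e) M. bij_betw g (carrier (OM e)) (carrier M)"
  then obtain g where g: "g \<in> mod_hom (ring_on OE) (OM e) M" "bij_betw g (carrier (OM e)) (carrier M)" by blast
  obtain h where h: "h \<in> mod_hom (ring_on OE) (OM d) (OM e)" "\<And>x. x \<in> carrier (OM d) \<Longrightarrow> g (h x) = f x"
    using transfer[OF f(1) g] by blast
  obtain k where k: "k \<in> mod_hom (ring_on OE) (OM e) (OM d)" "\<And>x. x \<in> carrier (OM e) \<Longrightarrow> f (k x) = g x"
    using transfer[OF g(1) f] by blast
  have hE: "h x \<in> carrier (OM e)" if "x \<in> carrier (OM d)" for x using h(1) that by (auto simp: mod_hom_def)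
  have kD: "k x \<in> carrier (OM d)" if "x \<in> carrier (OM e)" for x using k(1) that by (auto simp: mod_hom_def)
  have kh: "k (h x) = x" if "x \<in> carrier (OM d)" for x
    using f(2) hE[OF that] kD[OF hE[OF that]] h(2)[OF that] k(2)[OF hE[OF that]] that by (auto simp: bij_betw_def inj_on_def)
  have hk: "h (k x) = x" if "x \<in> carrier (OM e)" for x
    using g(2) kD[OF that] hE[OF kD[OF that]] k(2)[OF that] h(2)[OF kD[OF that]] that by (auto simp: bij_betw_def inj_on_def)
  have "(of_nat d :: 'c) = (\<Sum>i<d. k (h (unit_vec d i)) i)" unfolding kh[OF unit_vec_OM] by (simp add: unit_vec_eq)
  also have "\<dots> = (\<Sum>i<d. \<Sum>j<e. h (unit_vec d i) j * k (unit_vec e j) i)"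
    by (intro sum.cong refl OM_expand[OF k(1) hE]) auto
  also have "\<dots> = (\<Sum>j<e. \<Sum>i<d. k (unit_vec e j) i * h (unit_vec d i) j)"
    by (subst sum.swap) (simp add: mult.commute)
  also have "\<dots> = (\<Sum>j<e. h (k (unit_vec e j)) j)"
    by (intro sum.cong refl OM_expand[OF h(1) kD, symmetric]) auto
  also have "\<dots> = of_nat e" unfolding hk[OF unit_vec_OM] by (simp add: unit_vec_eq)
  finally show "e = d" by simp
qed

end

context weight
begin

subsection \<open>Lifting a basis\<close>

lemma FF_add:
  assumes \<phi>: "\<phi> \<in> carrier FF" and \<psi>: "\<psi> \<in> carrier FF"
  shows "(\<lambda>x\<in>carrier H. \<phi> x + \<psi> x) \<in> carrier FF"
  unfolding FF_iff
proof (intro conjI ballI allI)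
  fix i
  show "continuous_map TH euclidean (\<lambda>x. coeff ((\<lambda>x\<in>carrier H. \<phi> x + \<psi> x) x) i)"
    by (rule continuous_map_eq[OF continuous_map_add_av[OF FFD(6)[OF \<phi>, of i] FFD(6)[OF \<psi>, of i]]])
      (simp add: topspace_TH)
qed (use FFD(2-5,7)[OF \<phi>] FFD(2-5,7)[OF \<psi>] in
    \<open>auto simp: degree_add_le intp_add slash_add smult_add_right algebra_simps\<close>)

lemma FF_smult_general:
  assumes \<phi>: "\<phi> \<in> carrier FF" and int: "\<And>x. x \<in> carrier H \<Longrightarrow> intp (smult c (\<phi> x))"
  shows "(\<lambda>x\<in>carrier H. smult c (\<phi> x)) \<in> carrier FF"
  unfolding FF_iff
proof (intro conjI ballI allI)
  fix i
  show "continuous_map TH euclidean (\<lambda>x. coeff ((\<lambda>x\<in>carrier H. smult c (\<phi> x)) x) i)"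
    by (rule continuous_map_eq[OF continuous_map_mult_av[OF FFD(6)[OF \<phi>, of i], of c]])
      (simp add: topspace_TH)
  fix x assume x: "x \<in> carrier H"
  show "degree ((\<lambda>x\<in>carrier H. smult c (\<phi> x)) x) \<le> m"
    using order_trans[OF degree_smult_le FFD(2)[OF \<phi> x]] x by simp
qed (use FFD(4,5,7)[OF \<phi>] int in \<open>auto simp: slash_smult smult_add_right mult.commute\<close>)

lemma FF_smult: "\<phi> \<in> carrier FF \<Longrightarrow> c \<in> OE \<Longrightarrow> (\<lambda>x\<in>carrier H. smult c (\<phi> x)) \<in> carrier FF"
  by (rule FF_smult_general) (auto intro!: intp_smult intro: FFD(3))

lemma FF_zero_closed: "(\<lambda>x\<in>carrier H. 0) \<in> carrier FF"
proof -
  have "continuous_map TH euclidean (\<lambda>x. coeff ((\<lambda>x\<in>carrier H. 0) x :: 'c poly) i)" for i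
    by (rule continuous_map_eq[of _ _ "\<lambda>_. 0"]) (simp_all add: topspace_TH)
  then show ?thesis unfolding FF_iff by simp
qed

lemma FF_comb:
  fixes d :: nat
  assumes "\<And>i. i < d \<Longrightarrow> \<Phi> i \<in> carrier FF" "\<And>i. i < d \<Longrightarrow> c i \<in> OE"
  shows "(\<lambda>x\<in>carrier H. \<Sum>i<d. smult (c i) (\<Phi> i x)) \<in> carrier FF"
  using assms
proof (induction d)
  case 0
  then show ?case using FF_zero_closed by (simp only: lessThan_0 sum.empty)
next
  case (Suc d)
  have "(\<lambda>x\<in>carrier H. (\<lambda>x\<in>carrier H. \<Sum>i<d. smult (c i) (\<Phi> i x)) x +
      (\<lambda>x\<in>carrier H. smult (c d) (\<Phi> d x)) x) \<in> carrier FF"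
    by (intro FF_add FF_smult Suc.IH) (use Suc.prems in auto)
  moreover have "(\<lambda>x\<in>carrier H. (\<lambda>x\<in>carrier H. \<Sum>i<d. smult (c i) (\<Phi> i x)) x +
      (\<lambda>x\<in>carrier H. smult (c d) (\<Phi> d x)) x) = (\<lambda>x\<in>carrier H. \<Sum>i<Suc d. smult (c i) (\<Phi> i x))"
    by (auto simp: restrict_def)
  ultimately show ?case by (simp only:)
qed

lemma FF_divide:
  assumes \<phi>: "\<phi> \<in> carrier FF" and small: "\<And>x. x \<in> carrier H \<Longrightarrow> redp (\<phi> x) = 0"
  shows "\<exists>\<psi>. \<psi> \<in> carrier FF \<and> (\<forall>x\<in>carrier H. \<phi> x = smult \<pi> (\<psi> x))"
proof -
  have "intp (smult (inverse \<pi>) (\<phi> x))" if x: "x \<in> carrier H" for x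
    unfolding intp_def
  proof
    fix i
    have O: "coeff (\<phi> x) i \<in> OE" by (rule intpD[OF FFD(3)[OF \<phi> x]])
    have "red (coeff (\<phi> x) i) = 0" using arg_cong[OF small[OF x], of "\<lambda>F. coeff F i"] by simp
    then have "coeff (\<phi> x) i \<in> E" "av (coeff (\<phi> x) i) < 1"
      using O red_eq_0[OF O] by (simp_all add: OE_iff)
    then obtain y where "y \<in> OE" "coeff (\<phi> x) i = \<pi> * y" using uniformizer_props(4) by blast
    then show "coeff (smult (inverse \<pi>) (\<phi> x)) i \<in> OE"
      using uniformizer_props(3) by (simp add: field_simps)
  qed
  then have "(\<lambda>x\<in>carrier H. smult (inverse \<pi>) (\<phi> x)) \<in> carrier FF" by (rule FF_smult_general[OF \<phi>])
  then show ?thesis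
    using uniformizer_props(3) by (intro exI[of _ "\<lambda>x\<in>carrier H. smult (inverse \<pi>) (\<phi> x)"]) simp
qed

lemma redp_comb:
  fixes d :: nat
  assumes "\<And>i. i < d \<Longrightarrow> intp (F i)" "\<And>i. i < d \<Longrightarrow> c i \<in> OE"
  shows "redp (\<Sum>i<d. smult (c i) (F i)) = (\<Sum>i<d. smult (red (c i)) (redp (F i)))"
proof (rule poly_eqI)
  fix k
  show "coeff (redp (\<Sum>i<d. smult (c i) (F i))) k =
      coeff (\<Sum>i<d. smult (red (c i)) (redp (F i))) k"
    using assms by (simp add: coeff_sum intp_def, subst red_sum) (simp_all add: red_mult)
qed


definition comb :: "nat \<Rightarrow> (nat \<Rightarrow> 'h \<Rightarrow> 'c poly) \<Rightarrow> (nat \<Rightarrow> 'c) \<Rightarrow> 'h \<Rightarrow> 'c poly" where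
  "comb d \<Phi> c x = (\<Sum>i<d. smult (c i) (\<Phi> i x))"

text \<open>
  One step of successive approximation: a combination of the lifts agrees with a form modulo the
  uniformizer, and the difference can be divided by it.
\<close>

lemma FF_step:
  assumes B: "fun_basis (env.HomP Ub m \<tau>b) d f"
    and \<Phi>: "\<And>i. i < d \<Longrightarrow> \<Phi> i \<in> carrier FF" "\<And>i. i < d \<Longrightarrow> redf (\<Phi> i) = f i"
    and \<phi>: "\<phi> \<in> carrier FF"
  shows "\<exists>c \<psi>. (\<forall>i. c i \<in> OE) \<and> \<psi> \<in> carrier FF \<and>
    (\<forall>x\<in>carrier H. \<phi> x = comb d \<Phi> c x + smult \<pi> (\<psi> x))"
proof -
  obtain k where k: "redf \<phi> = (\<lambda>z. \<Sum>i<d. smult (k i) (f i z))"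
    using fun_basisD(2)[OF B redf_HomP[OF \<phi>]] by (rule exE)
  define c where "c i = (SOME y. y \<in> OE \<and> red y = k i)" for i
  have c: "c i \<in> OE \<and> red (c i) = k i" for i
    unfolding c_def by (rule someI_ex) (use red_surj[of "k i"] in blast)
  have cO: "c i \<in> OE" for i using c by blast
  define \<rho> where "\<rho> = (\<lambda>x\<in>carrier H. comb d \<Phi> c x)"
  have \<rho>: "\<rho> \<in> carrier FF" unfolding \<rho>_def comb_def by (rule FF_comb) (use \<Phi> cO in auto)
  have m\<rho>: "(\<lambda>x\<in>carrier H. smult (- 1) (\<rho> x)) \<in> carrier FF" by (rule FF_smult[OF \<rho>]) simp
  define \<delta> where "\<delta> = (\<lambda>x\<in>carrier H. \<phi> x + (\<lambda>x\<in>carrier H. smult (- 1) (\<rho> x)) x)"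
  have \<delta>: "\<delta> \<in> carrier FF" unfolding \<delta>_def by (rule FF_add[OF \<phi> m\<rho>])
  have "redp (\<delta> x) = 0" if x: "x \<in> carrier H" for x
  proof -
    have "redp (\<rho> x) = (\<Sum>i<d. smult (k i) (redp (\<Phi> i x)))"
      using x \<Phi> c FFD(3)[OF \<Phi>(1) x] by (simp add: \<rho>_def comb_def redp_comb)
    also have "\<dots> = redp (\<phi> x)"
      using redf_\<theta>[OF \<phi> x] redf_\<theta>[OF \<Phi>(1) x] \<Phi>(2) by (simp add: k)
    finally have "redp (\<rho> x) = redp (\<phi> x)" .
    moreover have "redp (\<delta> x) = redp (\<phi> x) + redp (smult (- 1) (\<rho> x))"
      using redp_add[OF FFD(3)[OF \<phi> x] FFD(3)[OF m\<rho> x]] x by (simp add: \<delta>_def)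
    moreover have "redp (smult (- 1) (\<rho> x)) = - redp (\<rho> x)"
      using redp_smult[of "- 1" "\<rho> x"] FFD(3)[OF \<rho> x] by (simp add: red_minus)
    ultimately show ?thesis by simp
  qed
  then obtain \<psi> where \<psi>: "\<psi> \<in> carrier FF" "\<And>x. x \<in> carrier H \<Longrightarrow> \<delta> x = smult \<pi> (\<psi> x)"
    using FF_divide[OF \<delta>] by meson
  have "\<phi> x = comb d \<Phi> c x + smult \<pi> (\<psi> x)" if x: "x \<in> carrier H" for x
    using \<psi>(2)[OF x] x by (simp add: \<delta>_def \<rho>_def algebra_simps)
  then show ?thesis using cO \<psi>(1) by (intro exI[of _ c] exI[of _ \<psi>]) simp
qed

text \<open>
  The coefficients found by successive approximation form convergent series in powers of the
  uniformizer.
\<close>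

lemma FF_span:
  assumes B: "fun_basis (env.HomP Ub m \<tau>b) d f"
    and \<Phi>: "\<And>i. i < d \<Longrightarrow> \<Phi> i \<in> carrier FF" "\<And>i. i < d \<Longrightarrow> redf (\<Phi> i) = f i"
    and \<phi>: "\<phi> \<in> carrier FF"
  shows "\<exists>c. (\<forall>i. c i \<in> OE) \<and> (\<forall>x\<in>carrier H. \<phi> x = comb d \<Phi> c x)"
proof -
  define S where "S \<phi> = (SOME (c, \<psi>). (\<forall>i. c i \<in> OE) \<and> \<psi> \<in> carrier FF \<and>
    (\<forall>x\<in>carrier H. \<phi> x = comb d \<Phi> c x + smult \<pi> (\<psi> x)))" for \<phi>
  have S: "(\<forall>i. fst (S \<phi>) i \<in> OE) \<and> snd (S \<phi>) \<in> carrier FF \<and>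
    (\<forall>x\<in>carrier H. \<phi> x = comb d \<Phi> (fst (S \<phi>)) x + smult \<pi> (snd (S \<phi>) x))" if \<phi>: "\<phi> \<in> carrier FF" for \<phi>
  proof -
    have "\<exists>c\<psi>. (\<lambda>(c, \<psi>). (\<forall>i. c i \<in> OE) \<and> \<psi> \<in> carrier FF \<and>
      (\<forall>x\<in>carrier H. \<phi> x = comb d \<Phi> c x + smult \<pi> (\<psi> x))) c\<psi>"
      unfolding split_paired_Ex prod.case by (rule FF_step[OF B \<Phi> \<phi>])
    from someI_ex[OF this] have "(\<lambda>(c, \<psi>). (\<forall>i. c i \<in> OE) \<and> \<psi> \<in> carrier FF \<and>
      (\<forall>x\<in>carrier H. \<phi> x = comb d \<Phi> c x + smult \<pi> (\<psi> x))) (S \<phi>)"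
      unfolding S_def .
    then show ?thesis unfolding case_prod_beta .
  qed
  define \<psi> where "\<psi> k = ((\<lambda>\<phi>. snd (S \<phi>)) ^^ k) \<phi>" for k
  define c where "c k = fst (S (\<psi> k))" for k
  have \<psi>FF: "\<psi> k \<in> carrier FF" for k
  proof (induction k)
    case 0
    show ?case using \<phi> by (simp add: \<psi>_def)
  next
    case (Suc k)
    then show ?case using S[OF Suc] by (simp add: \<psi>_def)
  qed
  have cO: "c k i \<in> OE" for k i using S[OF \<psi>FF] by (simp add: c_def)
  have st: "\<psi> k x = comb d \<Phi> (c k) x + smult \<pi> (\<psi> (Suc k) x)" if "x \<in> carrier H" for k x
    using S[OF \<psi>FF, of k] that by (simp add: c_def \<psi>_def)
  define X where "X i n = (\<Sum>k<n. \<pi> ^ k * c k i)" for i n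
  have XO: "X i n \<in> OE" for i n
    unfolding X_def using cO uniformizer_props(1) by (intro OE_sum OE_closed(3) OE_power) auto
  have iter: "\<phi> x = comb d \<Phi> (\<lambda>i. X i n) x + smult (\<pi> ^ n) (\<psi> n x)" if x: "x \<in> carrier H" for x n
  proof (induction n)
    case 0
    show ?case by (simp add: X_def comb_def \<psi>_def)
  next
    case (Suc n)
    have "comb d \<Phi> (\<lambda>i. X i (Suc n)) x = comb d \<Phi> (\<lambda>i. X i n) x + smult (\<pi> ^ n) (comb d \<Phi> (c n) x)"
      by (simp add: comb_def X_def smult_add_left sum.distrib smult_sum_right)
    then show ?case using Suc st[OF x, of n] by (simp add: smult_add_right add.assoc mult.commute)
  qed
  let ?q = "av \<pi>"
  have q: "0 \<le> ?q" "?q < 1" using uniformizer_props(2) by auto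
  have qn: "(\<lambda>n. ?q ^ n) \<longlonglongrightarrow> 0" by (rule LIMSEQ_realpow_zero[OF q])
  have stepX: "av (X i (Suc n) - X i n) \<le> ?q ^ n" for i n
  proof -
    have "av (\<pi> ^ n * c n i) \<le> ?q ^ n * 1"
      unfolding av_mult av_power using av_OE[OF cO] by (intro mult_left_mono) auto
    then show ?thesis by (simp add: X_def)
  qed
  have tail: "av (X i (n + l) - X i n) \<le> ?q ^ n" for i n l
  proof (induction l)
    case (Suc l)
    have "av (X i (Suc (n + l)) - X i (n + l)) \<le> ?q ^ n"
      by (rule order_trans[OF stepX]) (use q in \<open>auto intro!: power_decreasing\<close>)
    then have "av ((X i (Suc (n + l)) - X i (n + l)) + (X i (n + l) - X i n)) \<le> ?q ^ n"
      by (rule av_add_le[OF _ Suc])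
    then show ?case by simp
  qed simp
  have "Cauchy (X i)" for i
  proof (rule Cauchy_av)
    fix e :: real assume "e > 0"
    then obtain N where "\<forall>n\<ge>N. norm (?q ^ n - 0) < e" using qn unfolding LIMSEQ_iff by blast
    then show "\<exists>N. \<forall>n\<ge>N. av (X i (Suc n) - X i n) < e"
      using stepX q by (intro exI[of _ N]) (auto intro: order.strict_trans1)
  qed
  then have "convergent (X i)" for i by (simp add: Cauchy_convergent_iff)
  then have lim: "X i \<longlonglongrightarrow> lim (X i)" for i by (simp add: convergent_LIMSEQ_iff)
  define C where "C i = lim (X i)" for i
  have CO: "C i \<in> OE" for i unfolding C_def by (rule OE_lim[OF lim XO])
  have CX: "av (C i - X i n) \<le> ?q ^ n" for i n
    unfolding C_def
  proof (rule tendsto_av_le[OF lim, of n])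
    fix k assume "k \<ge> n"
    then show "av (X i k - X i n) \<le> ?q ^ n" using tail[of i n "k - n"] by simp
  qed (use q in simp)
  have "\<phi> x = comb d \<Phi> C x" if x: "x \<in> carrier H" for x
  proof (rule poly_eqI)
    fix j
    let ?D = "coeff (\<phi> x) j - coeff (comb d \<Phi> C x) j"
    have "av ?D \<le> ?q ^ n" for n
    proof -
      have "?D = (\<Sum>i<d. coeff (\<Phi> i x) j * (X i n - C i)) + coeff (\<psi> n x) j * \<pi> ^ n"
        by (subst iter[OF x, of n]) (simp add: comb_def coeff_sum right_diff_distrib sum_subtractf mult.commute)
      also have "av \<dots> \<le> ?q ^ n"
      proof (intro av_add_le av_sum_le av_mult_le_1)
        show "av (coeff (\<Phi> i x) j) \<le> 1" if "i \<in> {..<d}" for i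
          by (rule av_OE[OF intpD[OF FFD(3)[OF \<Phi>(1) x]]]) (use that in simp)
        show "av (X i n - C i) \<le> ?q ^ n" for i using CX[of i n] by (simp only: av_diff_commute)
        show "av (coeff (\<psi> n x) j) \<le> 1"
          by (rule av_OE[OF intpD[OF FFD(3)[OF \<psi>FF x]]])
        show "av (\<pi> ^ n) \<le> ?q ^ n" by (simp add: av_power)
      qed (use q in simp)
      finally show ?thesis .
    qed
    then have "av ?D \<le> 0" by (intro LIMSEQ_le_const[OF qn]) auto
    then show "coeff (\<phi> x) j = coeff (comb d \<Phi> C x) j" by simp
  qed
  then show ?thesis using CO by (intro exI[of _ C]) simp
qed

text \<open>
  Divide a relation by a coefficient of largest absolute value and reduce it.
\<close>

lemma FF_independent:
  assumes B: "fun_basis (env.HomP Ub m \<tau>b) d f"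
    and \<Phi>: "\<And>i. i < d \<Longrightarrow> \<Phi> i \<in> carrier FF" "\<And>i. i < d \<Longrightarrow> redf (\<Phi> i) = f i"
    and c: "\<And>i. i < d \<Longrightarrow> c i \<in> OE" and z: "\<And>x. x \<in> carrier H \<Longrightarrow> comb d \<Phi> c x = 0" and i: "i < d"
  shows "c i = 0"
proof (rule ccontr)
  assume ci: "c i \<noteq> 0"
  define M where "M = Max ((\<lambda>i. av (c i)) ` {..<d})"
  have "M \<in> (\<lambda>i. av (c i)) ` {..<d}" unfolding M_def by (rule Max_in) (use i in auto)
  then obtain l where l: "l < d" "M = av (c l)" by auto
  have Mge: "av (c k) \<le> av (c l)" if "k < d" for k
    unfolding l(2)[symmetric] M_def by (rule Max_ge) (use that in auto)
  have cl0: "c l \<noteq> 0" using Mge[OF i] ci by auto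
  define c' where "c' k = c k / c l" for k
  have c'O: "c' k \<in> OE" if "k < d" for k
    using c[OF that] c[OF l(1)] Mge[OF that] cl0 unfolding c'_def OE_iff
    by (auto simp: E_divide av_divide)
  have z': "comb d \<Phi> c' x = 0" if x: "x \<in> carrier H" for x
  proof -
    have "comb d \<Phi> c' x = smult (inverse (c l)) (comb d \<Phi> c x)"
      by (simp add: comb_def c'_def smult_sum_right divide_inverse mult.commute)
    then show ?thesis using z[OF x] by simp
  qed
  have "(\<lambda>x. \<Sum>i<d. smult (red (c' i)) (f i x)) = (\<lambda>_. 0)"
  proof
    fix y
    show "(\<Sum>i<d. smult (red (c' i)) (f i y)) = 0"
    proof (cases "y \<in> carrier P")
      case True
      then obtain x where x: "x \<in> carrier H" "y = \<theta> x" using \<theta>_surj by blast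
      have "(\<Sum>i<d. smult (red (c' i)) (f i y)) = (\<Sum>i<d. smult (red (c' i)) (redp (\<Phi> i x)))"
        using redf_\<theta>[OF \<Phi>(1) x(1)] \<Phi>(2) x(2) by (intro sum.cong refl) simp
      also have "\<dots> = redp (comb d \<Phi> c' x)"
        using redp_comb[of d "\<lambda>i. \<Phi> i x" c'] FFD(3)[OF \<Phi>(1) x(1)] c'O by (simp add: comb_def)
      also have "\<dots> = 0" unfolding z'[OF x(1)] by (rule poly_eqI) simp
      finally show ?thesis .
    next
      case False
      then show ?thesis using env.HomPD(1)[OF fun_basisD(1)[OF B]] by simp
    qed
  qed
  from fun_basisD(3)[OF B this] have "red (c' l) = 0" using l(1) by simp
  then show False using cl0 by (simp add: c'_def)
qed

text \<open>
  By the topological Nakayama lemma, lifts of a basis of the reductions form a basis of the module of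
  forms.
\<close>

theorem free_rank_forms:
  assumes "has_dim (env.HomP Ub m \<tau>b) d"
  shows "free_rank (ring_on OE) FF = d"
proof -
  obtain f where B: "fun_basis (env.HomP Ub m \<tau>b) d f" using assms by (auto simp: has_dim_def)
  define \<Phi> where "\<Phi> i = (SOME \<phi>. \<phi> \<in> carrier FF \<and> redf \<phi> = f i)" for i
  have \<Phi>': "\<Phi> i \<in> carrier FF \<and> redf (\<Phi> i) = f i" if "i < d" for i
    unfolding \<Phi>_def by (rule someI_ex[OF lift_form[OF fun_basisD(1)[OF B that]]])
  then have \<Phi>: "\<And>i. i < d \<Longrightarrow> \<Phi> i \<in> carrier FF" "\<And>i. i < d \<Longrightarrow> redf (\<Phi> i) = f i" by simp_all
  define \<Psi> where "\<Psi> c = (\<lambda>x\<in>carrier H. comb d \<Phi> c x)" for c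
  have FF_simps: "\<phi> \<oplus>\<^bsub>FF\<^esub> \<psi> = (\<lambda>x\<in>carrier H. \<phi> x + \<psi> x)" "r \<odot>\<^bsub>FF\<^esub> \<phi> = (\<lambda>x\<in>carrier H. smult r (\<phi> x))" for \<phi> \<psi> r
    by (simp_all add: forms_def)
  have \<Psi>FF: "\<Psi> c \<in> carrier FF" if "c \<in> carrier (OM d)" for c
    unfolding \<Psi>_def comb_def by (rule FF_comb[OF \<Phi>(1)]) (use that in \<open>auto simp: OM_simps\<close>)
  have hom: "\<Psi> \<in> mod_hom (ring_on OE) (OM d) FF"
    unfolding mod_hom_def
  proof (intro CollectI conjI ballI)
    show "\<Psi> \<in> carrier (OM d) \<rightarrow> carrier FF" using \<Psi>FF by blast
    show "\<Psi> (x \<oplus>\<^bsub>OM d\<^esub> y) = \<Psi> x \<oplus>\<^bsub>FF\<^esub> \<Psi> y" for x y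
      unfolding FF_simps by (auto simp: \<Psi>_def comb_def OM_simps smult_add_left sum.distrib restrict_def fun_eq_iff)
    show "\<Psi> (r \<odot>\<^bsub>OM d\<^esub> x) = r \<odot>\<^bsub>FF\<^esub> \<Psi> x" for r x
      unfolding FF_simps by (auto simp: \<Psi>_def comb_def OM_simps smult_sum_right mult.commute restrict_def fun_eq_iff)
  qed
  have "bij_betw \<Psi> (carrier (OM d)) (carrier FF)"
    unfolding bij_betw_def
  proof
    show "inj_on \<Psi> (carrier (OM d))"
    proof (rule inj_onI)
      fix c c' assume c: "c \<in> carrier (OM d)" "c' \<in> carrier (OM d)" and eq: "\<Psi> c = \<Psi> c'"
      have "c i - c' i = 0" if i: "i < d" for i
      proof (rule FF_independent[OF B \<Phi>, of "\<lambda>i. c i - c' i"])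
        show "c k - c' k \<in> OE" if "k < d" for k
          using PiE_mem[OF c(1)[unfolded OM_simps], of k] PiE_mem[OF c(2)[unfolded OM_simps], of k] that by simp
        show "comb d \<Phi> (\<lambda>i. c i - c' i) x = 0" if "x \<in> carrier H" for x
          using fun_cong[OF eq, of x] that by (simp add: \<Psi>_def comb_def smult_diff_left sum_subtractf)
      qed (use i in auto)
      then show "c = c'" using c unfolding OM_simps by (intro PiE_ext[OF c[unfolded OM_simps]]) auto
    qed
    show "\<Psi> ` carrier (OM d) = carrier FF"
    proof (intro equalityI subsetI)
      fix \<phi> assume "\<phi> \<in> \<Psi> ` carrier (OM d)"
      then show "\<phi> \<in> carrier FF" using \<Psi>FF by blast
    next
      fix \<phi> assume \<phi>: "\<phi> \<in> carrier FF"
      obtain c where c: "\<forall>i. c i \<in> OE" "\<forall>x\<in>carrier H. \<phi> x = comb d \<Phi> c x"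
        using FF_span[OF B \<Phi> \<phi>] by meson
      have "\<phi> = \<Psi> (restrict c {..<d})"
      proof
        fix x
        show "\<phi> x = \<Psi> (restrict c {..<d}) x"
          using c(2) FFD(1)[OF \<phi>] by (cases "x \<in> carrier H") (auto simp: \<Psi>_def comb_def extensional_def)
      qed
      moreover have "restrict c {..<d} \<in> carrier (OM d)" using c(1) by (simp add: OM_simps)
      ultimately show "\<phi> \<in> \<Psi> ` carrier (OM d)" by blast
    qed
  qed
  then show ?thesis by (rule free_rank_eqI[OF hom])
qed

end

section \<open>The ranks of the spaces of classical forms\<close>

context iwasawa_module
begin

lemma red_det: "g \<in> KK \<Longrightarrow> red (det g) = det (map_matrix red g)"
  by (simp add: det_2 red_diff red_mult KK_entry_OE)

lemma map_matrix_level_1: "u \<in> KK \<Longrightarrow> cg 1 u (mat 1) \<Longrightarrow> map_matrix red u = mat 1"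
proof -
  assume u: "u \<in> KK" "cg 1 u (mat 1)"
  have "red (u $ i $ j) = red ((mat 1 :: 'c^2^2) $ i $ j)" for i j
    by (rule red_eq_close[of _ _ 0]) (use u KK_entry_OE KK_1 in \<open>auto simp: cg_def\<close>)
  then show ?thesis by (intro matrix2_eqI) simp_all
qed

lemma red_unit: "x \<in> Zp p \<Longrightarrow> av x = 1 \<Longrightarrow> red x \<in> \<Delta>"
  using red_Zp_units[of x] by (simp add: Zp_iff Zp_units_iff \<Delta>_def)

lemma KK_det_Zp: "g \<in> KK \<Longrightarrow> det g \<in> Zp p"
  by (simp add: det_2)

lemma av_1_of_red: "x \<in> Zp p \<Longrightarrow> red x \<noteq> 0 \<Longrightarrow> av x = 1"
proof -
  assume x: "x \<in> Zp p" "red x \<noteq> 0"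
  have O: "x \<in> OE" using x Zp_sub_OE by blast
  show ?thesis using red_eq_0[OF O] x(2) av_OE[OF O] by simp
qed

text \<open>
  Entries can be lifted one by one, since invertibility is decided modulo \<open>p\<close>.
\<close>

lemma map_matrix_KK: "map_matrix red ` KK = env.G"
proof (intro equalityI subsetI)
  fix h assume "h \<in> map_matrix red ` KK"
  then obtain g where g: "g \<in> KK" "h = map_matrix red g" by blast
  have "det h \<noteq> 0" using red_unit[OF KK_det_Zp[OF g(1)] KK_det[OF g(1)]] red_det[OF g(1)] g(2) by (simp add: \<Delta>_def)
  then show "h \<in> env.G" using g red_Zp by (simp add: env.in_G_iff)
next
  fix h assume h: "h \<in> env.G"
  obtain L where L: "\<And>k. k \<in> Fp \<Longrightarrow> L k \<in> Zp p \<and> red (L k) = k" using Fp_lift by metis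
  have hF: "h $ i $ j \<in> Fp" for i j using h unfolding env.in_G_iff by blast
  define g where "g = mat2 (L (h $ 1 $ 1)) (L (h $ 1 $ 2)) (L (h $ 2 $ 1)) (L (h $ 2 $ 2))"
  have "\<forall>i j. g $ i $ j \<in> Zp p" using L[OF hF] by (simp add: forall_2 g_def)
  then have e: "g $ i $ j \<in> Zp p" for i j by blast
  have hg: "h = map_matrix red g" using L[OF hF] by (intro matrix2_eqI) (simp_all add: g_def)
  have OE: "g $ i $ j \<in> OE" for i j using e Zp_sub_OE by blast
  have "red (det g) = det h" unfolding hg by (simp add: det_2 red_diff red_mult OE)
  then have "av (det g) = 1" using h e by (intro av_1_of_red) (auto simp: det_2 env.in_G_iff)
  then have "g \<in> KK" using e by (simp add: KK_iff)
  then show "h \<in> map_matrix red ` KK" using hg by blast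
qed

text \<open>
  A p-adic integer that vanishes in the residue field is divisible by \<open>p\<close>, not only by the
  uniformizer of the larger field.
\<close>

lemma Iwahori_iff: "g \<in> Iwahori p \<longleftrightarrow> g \<in> KK \<and> red (g $ 2 $ 1) = 0"
proof
  assume g: "g \<in> Iwahori p"
  then obtain y where y: "y \<in> Zp p" "g $ 2 $ 1 = of_nat p * y" by (auto simp: Iwahori_def)
  have Z: "g $ 1 $ 1 \<in> Zp p" "g $ 2 $ 2 \<in> Zp p" "g $ 1 $ 2 \<in> Zp p" "av (g $ 1 $ 1) = 1" "av (g $ 2 $ 2) = 1"
    using g by (auto simp: Iwahori_def Zp_units_iff Zp_iff)
  have small: "av (g $ 2 $ 1) < 1"
    using y p_gt_1 mult_left_mono[of "av y" 1 "1 / real p"] by (simp add: av_mult av_p Zp_iff order.strict_trans1)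
  have Z21: "g $ 2 $ 1 \<in> Zp p" using y small by (simp add: Zp_iff)
  have Z': "\<forall>i j. g $ i $ j \<in> Zp p" unfolding forall_2 using Z Z21 by blast
  have "av (g $ 1 $ 2 * g $ 2 $ 1) < 1"
    using small Z(3) mult_right_mono[of "av (g $ 1 $ 2)" 1 "av (g $ 2 $ 1)"] by (simp add: av_mult Zp_iff)
  then have "av (det g - g $ 1 $ 1 * g $ 2 $ 2) < av (g $ 1 $ 1 * g $ 2 $ 2)" using Z by (simp add: det_2 av_mult)
  then have "av (det g) = av (g $ 1 $ 1 * g $ 2 $ 2)" by (rule av_eq_of_close)
  then have "g \<in> KK" using Z Z' by (simp add: KK_iff av_mult)
  moreover have "red (g $ 2 $ 1) = 0" using small red_eq_0[of "g $ 2 $ 1"] Z21 Zp_sub_OE by blast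
  ultimately
  show "g \<in> KK \<and> red (g $ 2 $ 1) = 0" by blast
next
  assume g: "g \<in> KK \<and> red (g $ 2 $ 1) = 0"
  have O: "g $ i $ j \<in> OE" for i j using g KK_entry_OE by blast
  have small: "av (g $ 2 $ 1) < 1" using g red_eq_0[OF O] by blast
  have "g $ 2 $ 1 \<in> Zp p" using g by simp
  then have "av (g $ 2 $ 1 - of_nat 0) \<le> (1 / real p) ^ 1"
  proof -
    obtain k where k: "k < p ^ 1" "av (g $ 2 $ 1 - of_nat k) \<le> (1 / real p) ^ 1"
      using Zp_approx_nat[OF \<open>g $ 2 $ 1 \<in> Zp p\<close>, of 1] by blast
    have "av (g $ 2 $ 1 - (g $ 2 $ 1 - of_nat k)) < 1"
      using av_diff[of "g $ 2 $ 1" "g $ 2 $ 1 - of_nat k"] small k p_gt_1 by (simp add: order.strict_trans1)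
    then have "av (of_int (int k)) < 1" by simp
    then have "int p dvd int k" by (simp only: av_of_int_lt_1)
    then have "k = 0" using k(1) by (auto dest: zdvd_imp_le)
    with k(2) show ?thesis by simp
  qed
  then have "g $ 2 $ 1 / of_nat p \<in> Zp p"
    using g p_gt_1 KK_entry[of g 2 1] by (simp add: Zp_iff av_divide av_p field_simps)
  then have "g $ 2 $ 1 \<in> (\<lambda>x. of_nat p * x) ` Zp p" using p_gt_1 by (intro image_eqI[of _ _ "g $ 2 $ 1 / of_nat p"]) simp_all
  moreover have "av (g $ 1 $ 1) = 1" "av (g $ 2 $ 2) = 1"
  proof -
    have "red (g $ 1 $ 1) * red (g $ 2 $ 2) = red (det g)" using g O by (simp add: det_2 red_diff red_mult)
    moreover have "red (det g) \<noteq> 0" using g red_unit[OF KK_det_Zp KK_det] by (simp add: \<Delta>_def)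
    ultimately have "red (g $ 1 $ 1) \<noteq> 0" "red (g $ 2 $ 2) \<noteq> 0" by auto
    then show "av (g $ 1 $ 1) = 1" "av (g $ 2 $ 2) = 1" using g av_1_of_red by simp_all
  qed
  ultimately show "g \<in> Iwahori p" using g KK_entry[of g] by (simp add: Iwahori_def Zp_units_iff Zp_iff)
qed

lemma map_matrix_Iwahori: "map_matrix red ` Iwahori p = env.B"
proof (intro equalityI subsetI)
  fix h assume "h \<in> map_matrix red ` Iwahori p"
  then obtain g where g: "g \<in> KK" "red (g $ 2 $ 1) = 0" "h = map_matrix red g" using Iwahori_iff by blast
  then have "h \<in> env.G" using map_matrix_KK by blast
  moreover have "h $ 2 $ 1 = 0" using g by simp
  ultimately show "h \<in> env.B" unfolding env.B_def by blast
next
  fix h assume "h \<in> env.B"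
  then have h: "h \<in> map_matrix red ` KK" "h $ 2 $ 1 = 0" unfolding map_matrix_KK env.B_def by blast+
  then obtain g where g: "g \<in> KK" "h = map_matrix red g" by blast
  then have "g \<in> Iwahori p" using h(2) unfolding Iwahori_iff by simp
  then show "h \<in> map_matrix red ` Iwahori p" using g(2) by blast
qed

lemma d_ur_eq:
  assumes s: "s \<le> p - 1" and m: "[m + 2 * (p - 1 - s) = a] (mod (p - 1))"
  shows "d_ur p E red H (\<lambda>x\<in>\<Delta>. teich x powi (- int s)) (m + 2) = env.dim_ur m (p - 1 - s)"
proof -
  define j where "j = p - 1 - s"
  let ?\<eta> = "\<lambda>x\<in>\<Delta>. teich x powi (- int s)"
  have \<eta>: "?\<eta> x = teich x ^ j" if "x \<in> \<Delta>" for x using that s by (simp add: teich_powi_minus j_def)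
  have D: "red (det g) \<in> \<Delta>" if "g \<in> KK" for g using red_unit[OF KK_det_Zp KK_det] that by blast
  interpret W: weight p E \<pi> red a P H \<theta> KK "\<lambda>g. ?\<eta> (red (det g))" m env.G "env.chG j"
  proof
    show "u \<in> KK \<and> ?\<eta> (red (det u)) = 1" if "u \<in> KK" "cg 1 u (mat 1)" for u
    proof -
      have 1: "(1 :: 'f) \<in> \<Delta>" using D[OF KK_1] by simp
      have "red (det u) = 1" using that by (simp add: red_det map_matrix_level_1)
      then show ?thesis using \<eta>[OF 1] that by simp
    qed
    show "?\<eta> (red (det u)) \<in> OE" if "u \<in> KK" for u
      unfolding \<eta>[OF D[OF that]] using D[OF that] teich_OE by simp
    show "?\<eta> (red (det (u ** v))) = ?\<eta> (red (det u)) * ?\<eta> (red (det v))" if "u \<in> KK" "v \<in> KK" for u v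
    proof -
      have "red (det (u ** v)) = red (det u) * red (det v)"
        using that KK_det_Zp Zp_sub_OE by (auto simp: det_mul intro!: red_mult)
      then show ?thesis
        unfolding \<eta>[OF D[OF that(1)]] \<eta>[OF D[OF that(2)]] \<eta>[OF D[OF KK_mult[OF that]]]
        by (simp add: teich_mult D that power_mult_distrib)
    qed
    show "red (?\<eta> (red (det u))) = env.chG j (map_matrix red u)" if "u \<in> KK" for u
      unfolding \<eta>[OF D[OF that]] using D[OF that] that by (simp add: red_power teich_OE teich env.chG_def red_det)
    show "map_matrix red ` KK = env.G" by (rule map_matrix_KK)
  qed simp_all
  show ?thesis
    unfolding d_ur_def using W.free_rank_forms[OF env.has_dim_G] m by (simp add: j_def)
qed

lemma d_Iw_eq:
  assumes s: "s \<le> p - 1"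
  defines "\<eta> \<equiv> \<lambda>x\<in>\<Delta>. teich x powi (- int s)"
  shows "d_Iw p E red H (\<lambda>(x, y). \<eta> x * \<eta> y) (m + 2) =
    (\<Sum>i\<le>m. env.eB (p - 1 - s + i) (p - 1 - s + (m - i)))"
proof -
  define j where "j = p - 1 - s"
  have \<eta>: "\<eta> x = teich x ^ j" if "x \<in> \<Delta>" for x using that s by (simp add: teich_powi_minus j_def \<eta>_def)
  have K: "u \<in> KK" if "u \<in> Iwahori p" for u using that by (simp add: Iwahori_iff)
  have D: "red (u $ 1 $ 1) \<in> \<Delta>" "red (u $ 2 $ 2) \<in> \<Delta>" if "u \<in> Iwahori p" for u
    using that red_unit[of "u $ 1 $ 1"] red_unit[of "u $ 2 $ 2"] by (auto simp: Iwahori_def Zp_units_iff Zp_iff)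
  have ent: "red ((u ** v) $ 1 $ 1) = red (u $ 1 $ 1) * red (v $ 1 $ 1)"
    "red ((u ** v) $ 2 $ 2) = red (u $ 2 $ 2) * red (v $ 2 $ 2)" "red ((u ** v) $ 2 $ 1) = 0"
    if "u \<in> Iwahori p" "v \<in> Iwahori p" for u v :: "'c^2^2"
    using that KK_entry_OE[OF K[OF that(1)]] KK_entry_OE[OF K[OF that(2)]]
    by (simp_all add: matrix2_mult_entry red_add red_mult Iwahori_iff)
  have mult: "u ** v \<in> Iwahori p" if "u \<in> Iwahori p" "v \<in> Iwahori p" for u v :: "'c^2^2"
    using ent(3)[OF that] K that by (simp add: Iwahori_iff)
  interpret W: weight p E \<pi> red a P H \<theta> "Iwahori p"
    "\<lambda>g. (\<lambda>(x, y). \<eta> x * \<eta> y) (red (g $ 1 $ 1), red (g $ 2 $ 2))" m env.B "env.chB j j"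
  proof (unfold_locales, goal_cases)
    case 1
    then show ?case using K by blast
  next
    case (2 u v)
    then show ?case by (rule mult)
  next
    case (3 u)
    have "inv2 u $ 2 $ 1 = - (u $ 2 $ 1) * inverse (det u)" by (simp add: inv2_def divide_inverse)
    moreover have "inverse (det u) \<in> OE"
    proof -
      have "det u \<in> OE" using KK_det_Zp[OF K[OF 3]] Zp_sub_OE by blast
      then show ?thesis using KK_det[OF K[OF 3]] E_divide[OF E_1, of "det u"] by (simp add: OE_iff av_inverse inverse_eq_divide av_divide)
    qed
    ultimately have "red (inv2 u $ 2 $ 1) = 0"
      using 3 KK_entry_OE[OF K[OF 3]] by (simp add: red_minus red_mult Iwahori_iff)
    then show ?case using K[OF 3] by (simp add: Iwahori_iff)
  next
    case (4 u)
    have "map_matrix red u $ i $ j = (mat 1 :: 'f^2^2) $ i $ j" for i j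
      unfolding map_matrix_level_1[OF 4] ..
    then have e: "red (u $ i $ j) = (mat 1 :: 'f^2^2) $ i $ j" for i j by simp
    then have "u \<in> Iwahori p" using 4 by (simp add: Iwahori_iff)
    moreover have "(1 :: 'f) \<in> \<Delta>" using red_unit[of 1] by simp
    ultimately show ?case using \<eta>[of 1] by (simp add: e)
  next
    case (5 u)
    then show ?case using D[OF 5] by (simp add: \<eta> teich_OE)
  next
    case (6 u v)
    then show ?case using D[OF 6(1)] D[OF 6(2)] D[OF mult[OF 6]] ent[OF 6]
      by (simp add: \<eta> teich_mult power_mult_distrib)
  next
    case (7 u)
    then show ?case using D[OF 7] by (simp add: \<eta> teich_OE teich env.chB_def red_power red_mult)
  next
    case 8
    show ?case by (rule map_matrix_Iwahori)
  qed
  show ?thesis unfolding d_Iw_def using W.free_rank_forms[OF env.has_dim_B] by (simp add: j_def)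
qed

end

section \<open>Convexity of the ghost degrees\<close>

text \<open>
  The counting function of the set is zero at first, unbounded, and grows by at most one over any three
  consecutive steps; so it stays at each positive value for at least three steps. The argument uses the count
  of elements below \<open>x\<close>, which starts at zero and so covers the initial values as well.
\<close>

lemma spaced_counting:
  fixes \<Theta> :: "nat set"
  assumes inf: "infinite \<Theta>" and spaced: "\<And>t t'. t \<in> \<Theta> \<Longrightarrow> t' \<in> \<Theta> \<Longrightarrow> t < t' \<Longrightarrow> t + 3 \<le> t'" and n: "n \<ge> 1"
  shows "\<exists>x. \<forall>\<kappa>\<in>{x, x + 1, x + 2}. card {t \<in> \<Theta>. t \<le> \<kappa>} = n"
proof -
  define M where "M x = card {t \<in> \<Theta>. t < x}" for x
  have mono: "M x \<le> M y" if "x \<le> y" for x y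
    unfolding M_def by (rule card_mono) (use that in auto)
  have jump: "M (x + 3) \<le> M x + 1" for x
  proof -
    have "t = t'" if "t \<in> \<Theta>" "t' \<in> \<Theta>" "x \<le> t" "t < x + 3" "x \<le> t'" "t' < x + 3" for t t'
      using spaced[of t t'] spaced[of t' t] that by linarith
    then have "card {t \<in> \<Theta>. x \<le> t \<and> t < x + 3} \<le> Suc 0"
      by (subst card_le_Suc0_iff_eq) auto
    moreover have "{t \<in> \<Theta>. t < x + 3} = {t \<in> \<Theta>. t < x} \<union> {t \<in> \<Theta>. x \<le> t \<and> t < x + 3}" by auto
    ultimately show ?thesis unfolding M_def using card_Un_le[of "{t \<in> \<Theta>. t < x}" "{t \<in> \<Theta>. x \<le> t \<and> t < x + 3}"] by simp
  qed
  have "\<exists>x. n \<le> M x"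
  proof -
    obtain S where S: "S \<subseteq> \<Theta>" "finite S" "card S = n" using infinite_arbitrarily_large[OF inf] by blast
    have "S \<subseteq> {t \<in> \<Theta>. t < Suc (Max S)}" using S by (auto simp: less_Suc_eq_le)
    then have "n \<le> M (Suc (Max S))" unfolding M_def S(3)[symmetric] by (rule card_mono[rotated]) simp
    then show ?thesis by blast
  qed
  define y where "y = (LEAST x. n \<le> M x)"
  have y: "n \<le> M y" unfolding y_def by (rule LeastI_ex) fact
  have "y \<noteq> 0"
  proof
    assume "y = 0"
    then show False using y n by (simp add: M_def)
  qed
  then obtain x where x: "y = Suc x" by (cases y) auto
  have "\<not> n \<le> M x" using not_less_Least[of x "\<lambda>x. n \<le> M x"] x unfolding y_def by simp
  then have "M \<kappa> = n" if "\<kappa> \<in> {x + 1, x + 2, x + 3}" for \<kappa>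
    using that jump[of x] y mono[of "Suc x" \<kappa>] mono[of \<kappa> "x + 3"] x by auto
  moreover have "card {t \<in> \<Theta>. t \<le> \<kappa>} = M (\<kappa> + 1)" for \<kappa> by (simp add: M_def less_Suc_eq_le)
  ultimately show ?thesis by (intro exI[of _ x]) simp
qed

text \<open>
  The ghost multiplicity for ranks \<open>u\<close> and \<open>d\<close>.
\<close>

definition tent :: "nat \<Rightarrow> nat \<Rightarrow> nat \<Rightarrow> nat" where
  "tent u d n = (if u < n \<and> n < d - u then min (n - u) (d - u - n) else 0)"

lemma int_tent:
  "u \<le> c \<Longrightarrow> int (tent u (2 * c) n) = max 0 (min (int n - int u) (2 * int c - int u - int n))"
  by (auto simp: tent_def min_def max_def)

text \<open>
  The slopes change at \<open>u\<close>, at \<open>c\<close> and at \<open>2 c - u\<close>, and the change at the last point, which is positive, is dropped.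
\<close>

lemma tent_second_difference:
  assumes "u \<le> c" "n \<ge> 1"
  shows "int (tent u (2 * c) (n + 1)) + int (tent u (2 * c) (n - 1)) - 2 * int (tent u (2 * c) n) \<ge>
    of_bool (u = n) - 2 * of_bool (c = n)"
proof -
  have n: "int (n - 1) = int n - 1" using assms(2) by simp
  show ?thesis
    unfolding int_tent[OF assms(1)] n using assms(1)
    by (cases "int n < int u"; cases "int n = int u"; cases "int n < int c"; cases "int n = int c";
        cases "int n \<le> 2 * int c - int u") (simp_all add: max_def min_def)
qed

lemma tent_sums_convex:
  fixes N C :: "nat \<Rightarrow> nat"
  assumes NC: "\<And>\<kappa>. N \<kappa> \<le> C \<kappa>" and C: "inj C" and fin: "\<And>n. finite {\<kappa>. N \<kappa> \<le> n}"
    and three: "\<exists>x. \<forall>\<kappa>\<in>{x, x + 1, x + 2}. N \<kappa> = n" and n: "n \<ge> 1"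
  defines "D \<equiv> \<lambda>n. \<Sum>\<kappa> | tent (N \<kappa>) (2 * C \<kappa>) n \<noteq> 0. tent (N \<kappa>) (2 * C \<kappa>) n"
  shows "2 * D n < D (n + 1) + D (n - 1)"
proof -
  define K where "K = {\<kappa>. N \<kappa> \<le> n + 1}"
  have K: "finite K" unfolding K_def by (rule fin)
  have D: "D k = (\<Sum>\<kappa>\<in>K. tent (N \<kappa>) (2 * C \<kappa>) k)" if "k \<le> n + 1" for k
    unfolding D_def by (rule sum.mono_neutral_left[OF K]) (use that in \<open>auto simp: K_def tent_def split: if_splits\<close>)
  obtain x where x: "\<forall>\<kappa>\<in>{x, x + 1, x + 2}. N \<kappa> = n" using three by blast
  have "{x, x + 1, x + 2} \<subseteq> {\<kappa> \<in> K. N \<kappa> = n}" using x by (auto simp: K_def)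
  then have "card {x, x + 1, x + 2} \<le> card {\<kappa> \<in> K. N \<kappa> = n}" using K by (intro card_mono) auto
  then have c3: "3 \<le> card {\<kappa> \<in> K. N \<kappa> = n}" by simp
  have "card {\<kappa> \<in> K. C \<kappa> = n} \<le> card {n}"
    by (rule card_inj_on_le[of C]) (use C in \<open>auto intro: inj_on_subset\<close>)
  then have c1: "card {\<kappa> \<in> K. C \<kappa> = n} \<le> 1" by simp
  have "int (D (n + 1)) + int (D (n - 1)) - 2 * int (D n) = (\<Sum>\<kappa>\<in>K. int (tent (N \<kappa>) (2 * C \<kappa>) (n + 1)) +
      int (tent (N \<kappa>) (2 * C \<kappa>) (n - 1)) - 2 * int (tent (N \<kappa>) (2 * C \<kappa>) n))"
    by (simp add: D sum.distrib sum_subtractf sum_distrib_left)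
  also have "\<dots> \<ge> (\<Sum>\<kappa>\<in>K. of_bool (N \<kappa> = n) - 2 * of_bool (C \<kappa> = n))"
    by (rule sum_mono) (rule tent_second_difference[OF NC n])
  also have "(\<Sum>\<kappa>\<in>K. of_bool (N \<kappa> = n) - 2 * of_bool (C \<kappa> = n) :: int) =
      int (card {\<kappa> \<in> K. N \<kappa> = n}) - 2 * int (card {\<kappa> \<in> K. C \<kappa> = n})"
  proof -
    have "(\<Sum>\<kappa>\<in>K. of_bool (Q \<kappa>) :: int) = int (card {\<kappa> \<in> K. Q \<kappa>})" for Q
      using K by (simp add: sum_of_bool_eq Int_def)
    then show ?thesis by (simp add: sum_subtractf flip: sum_distrib_left)
  qed
  finally show ?thesis using c3 c1 by linarith
qed

subsection \<open>The ranks as functions of the weight\<close>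

lemma residue_count:
  fixes q s m :: nat
  assumes q: "q > 0" and s: "s < q"
  shows "card {i. i \<le> m + q \<and> [i = s] (mod q)} = Suc (card {i. i \<le> m \<and> [i = s] (mod q)})"
proof -
  have bij: "{i. i \<le> m + q \<and> [i = s] (mod q)} = insert s ((\<lambda>i. i + q) ` {i. i \<le> m \<and> [i = s] (mod q)})"
  proof (intro equalityI subsetI)
    fix i assume i: "i \<in> {i. i \<le> m + q \<and> [i = s] (mod q)}"
    show "i \<in> insert s ((\<lambda>i. i + q) ` {i. i \<le> m \<and> [i = s] (mod q)})"
    proof (cases "i < q")
      case True
      then show ?thesis using i s by (simp add: cong_def)
    next
      case False
      then have "i = (i - q) + q" "[i - q = s] (mod q)" "i - q \<le> m"
        using i by (auto simp: cong_def le_mod_geq)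
      then show ?thesis by blast
    qed
  next
    fix i assume "i \<in> insert s ((\<lambda>i. i + q) ` {i. i \<le> m \<and> [i = s] (mod q)})"
    then show "i \<in> {i. i \<le> m + q \<and> [i = s] (mod q)}" using s by (auto simp: cong_def)
  qed
  have "s \<notin> (\<lambda>i. i + q) ` {i. i \<le> m \<and> [i = s] (mod q)}" using s by auto
  then show ?thesis unfolding bij by (simp add: card_image)
qed

lemma residue_count_reflect:
  fixes q s a m :: nat
  assumes "[m = a + 2 * s] (mod q)"
  shows "card {i. i \<le> m \<and> [i = a + s] (mod q)} = card {i. i \<le> m \<and> [i = s] (mod q)}"
proof (rule bij_betw_same_card[of "\<lambda>i. m - i"], rule bij_betwI[of _ _ _ "\<lambda>i. m - i"])
  have *: "[m - i = y] (mod q)" if "i \<le> m" "[i = x] (mod q)" "x + y = a + 2 * s" for i x y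
  proof -
    have "[(m - i) + i = y + x] (mod q)" using assms that by (simp add: add.commute)
    moreover have "[y + x = y + i] (mod q)" using that(2) cong_sym cong_add_lcancel_nat by blast
    ultimately have "[(m - i) + i = y + i] (mod q)" by (rule cong_trans)
    then show ?thesis by (simp only: cong_add_rcancel_nat)
  qed
  show "(\<lambda>i. m - i) \<in> {i. i \<le> m \<and> [i = a + s] (mod q)} \<rightarrow> {i. i \<le> m \<and> [i = s] (mod q)}"
    using *[of _ "a + s" s] by auto
  show "(\<lambda>i. m - i) \<in> {i. i \<le> m \<and> [i = s] (mod q)} \<rightarrow> {i. i \<le> m \<and> [i = a + s] (mod q)}"
    using *[of _ s "a + s"] by auto
qed auto

definition ur_count :: "nat \<Rightarrow> nat \<Rightarrow> nat \<Rightarrow> nat \<Rightarrow> nat" where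
  "ur_count p a s m = card {i. i * (p + 1) + a \<le> m \<and> [i = s] (mod (p - 1))} +
     card {i. i * (p + 1) + p \<le> m \<and> [i = a + s] (mod (p - 1))}"

text \<open>
  The numbers \<open>i\<close> in the first set are at most \<open>m / 2\<close>, and reflection \<open>i \<mapsto> m - i\<close> moves the second set into
  the same residue class above \<open>m / 2\<close>.
\<close>

lemma ur_count_le:
  assumes p: "p \<ge> 2" and m: "[m = a + 2 * s] (mod (p - 1))"
  shows "ur_count p a s m \<le> card {i. i \<le> m \<and> [i = s] (mod (p - 1))}"
proof -
  let ?A = "{i. i * (p + 1) + a \<le> m \<and> [i = s] (mod (p - 1))}"
  let ?B = "{i. i * (p + 1) + p \<le> m \<and> [i = a + s] (mod (p - 1))}"
  have leA: "i * 2 \<le> m" if "i \<in> ?A" for i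
  proof -
    have "i * 2 \<le> i * (p + 1)" using p by (intro mult_le_mono) auto
    moreover have "i * (p + 1) + a \<le> m" using that by blast
    ultimately show ?thesis by linarith
  qed
  have leB: "i * 2 < m" if "i \<in> ?B" for i
  proof -
    have "i * 2 \<le> i * (p + 1)" using p by (intro mult_le_mono) auto
    moreover have "i * (p + 1) + p \<le> m" using that by blast
    ultimately show ?thesis using p by linarith
  qed
  have finB: "finite ?B" by (rule finite_subset[of _ "{..m}"]) (use leB in force)+
  have finA: "finite ?A" by (rule finite_subset[of _ "{..m}"]) (use leA in force)+
  have cong: "[m - i = s] (mod (p - 1))" if "i \<in> ?B" for i
  proof -
    have i: "i \<le> m" using leB[OF that] by simp
    have "s + (a + s) = a + 2 * s" "(m - i) + i = m" using i by simp_all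
    then have "[(m - i) + i = s + (a + s)] (mod (p - 1))" using m by (simp only:)
    moreover have "[s + (a + s) = s + i] (mod (p - 1))" using that cong_sym cong_add_lcancel_nat by blast
    ultimately have "[(m - i) + i = s + i] (mod (p - 1))" by (rule cong_trans)
    then show ?thesis by (simp only: cong_add_rcancel_nat)
  qed
  have inj: "inj_on (\<lambda>i. m - i) ?B"
  proof (rule inj_onI)
    fix i i' assume "i \<in> ?B" "i' \<in> ?B" "m - i = m - i'"
    then show "i = i'" using leB[of i] leB[of i'] by linarith
  qed
  have disj: "?A \<inter> (\<lambda>i. m - i) ` ?B = {}"
  proof -
    have "False" if "i \<in> ?B" "m - i \<in> ?A" for i using leB[OF that(1)] leA[OF that(2)] by linarith
    then show ?thesis by blast
  qed
  have "ur_count p a s m = card (?A \<union> (\<lambda>i. m - i) ` ?B)"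
    unfolding ur_count_def card_Un_disjoint[OF finA finite_imageI[OF finB] disj] card_image[OF inj] ..
  also have "\<dots> \<le> card {i. i \<le> m \<and> [i = s] (mod (p - 1))}"
  proof (rule card_mono)
    show "?A \<union> (\<lambda>i. m - i) ` ?B \<subseteq> {i. i \<le> m \<and> [i = s] (mod (p - 1))}"
      using leA cong by force
  qed simp
  finally show ?thesis .
qed

lemma residue_class_card:
  fixes s Q c d M :: nat
  assumes "s < Q"
  shows "card {i. i * c + d \<le> M \<and> [i = s] (mod Q)} = card {q. (s + Q * q) * c + d \<le> M}"
proof -
  have "{i. i * c + d \<le> M \<and> [i = s] (mod Q)} = (\<lambda>q. s + Q * q) ` {q. (s + Q * q) * c + d \<le> M}"
  proof (intro equalityI subsetI)
    fix i assume i: "i \<in> {i. i * c + d \<le> M \<and> [i = s] (mod Q)}"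
    then have "i mod Q = s" using assms by (simp add: cong_def)
    then have "i = s + Q * (i div Q)" using mult_div_mod_eq[of Q i] by simp
    then show "i \<in> (\<lambda>q. s + Q * q) ` {q. (s + Q * q) * c + d \<le> M}"
      using i by (intro image_eqI[of _ _ "i div Q"]) auto
  next
    fix i assume "i \<in> (\<lambda>q. s + Q * q) ` {q. (s + Q * q) * c + d \<le> M}"
    then show "i \<in> {i. i * c + d \<le> M \<and> [i = s] (mod Q)}" by (auto simp: cong_def)
  qed
  moreover have "inj_on (\<lambda>q. s + Q * q) X" for X using assms by (auto simp: inj_on_def)
  ultimately show ?thesis by (simp add: card_image)
qed

text \<open>
  Write \<open>Q = p - 1\<close> and \<open>L = p + 1\<close>. In both sets the numbers \<open>i\<close> run through a progression of difference
  \<open>Q\<close>, so the bounds \<open>i (p + 1)\<close> grow by \<open>Q L\<close>, that is by \<open>L\<close> in the number \<open>\<kappa>\<close> of the weight. The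
  first thresholds are \<open>t1\<close> and \<open>t2\<close>, and \<open>t2 - t1\<close> is \<open>a + 2\<close> modulo \<open>L\<close>; here \<open>a + 2\<close> and \<open>L - (a + 2)\<close> are
  at least three.
\<close>

lemma ur_count_thresholds:
  fixes p a s :: nat
  assumes p: "a + 4 \<le> p" and a: "1 \<le> a" and s: "s < p - 1"
  defines "m \<equiv> \<lambda>\<kappa>. (a + 2 * s) mod (p - 1) + (p - 1) * \<kappa>"
  shows "\<exists>\<Theta>. infinite \<Theta> \<and> (\<forall>t\<in>\<Theta>. \<forall>t'\<in>\<Theta>. t < t' \<longrightarrow> t + 3 \<le> t') \<and>
    (\<forall>\<kappa>. ur_count p a s (m \<kappa>) = card {t \<in> \<Theta>. t \<le> \<kappa>})"
proof -
  define Q where "Q = p - 1"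
  have Q: "p = Q + 1" "a + 3 \<le> Q" "s < Q" using p s by (simp_all add: Q_def)
  define e where "e = (a + 2 * s) div Q"
  define f where "f = (a + s) div Q"
  define r where "r = (a + s) mod Q"
  define m0 where "m0 = (a + 2 * s) mod Q"
  have m0: "a + 2 * s = m0 + Q * e" by (simp add: m0_def e_def)
  have r: "a + s = r + Q * f" "r < Q" using Q by (simp_all add: r_def f_def)
  have f1: "f \<le> 1"
  proof -
    have "a + s < 2 * Q" using Q by simp
    then have "f < 2" unfolding f_def by (simp add: less_mult_imp_div_less)
    then show ?thesis by simp
  qed
  define L where "L = Q + 2"
  define t1 where "t1 = e + s"
  define t2 where "t2 = r + e + 2 - 2 * f"
  have t2: "t2 + 2 * f = r + e + 2" using f1 by (simp add: t2_def)
  have "t2 + L * f = r + Q * f + e + 2" using t2 by (simp add: L_def algebra_simps)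
  then have t21: "t2 + L * f = t1 + a + 2" using r(1) by (simp add: t1_def)
  define \<Theta> where "\<Theta> = range (\<lambda>q. t1 + L * q) \<union> range (\<lambda>q. t2 + L * q)"
  have L6: "L \<ge> 5" using Q by (simp add: L_def)
  then have inj: "inj (\<lambda>q. t + L * q)" for t by (auto simp: inj_on_def)
  have gap: "(0 < int L * k + d \<longrightarrow> 3 \<le> int L * k + d)" if d: "d = 0 \<or> 3 \<le> d \<and> d + 3 \<le> int L" for k d :: int
  proof (cases "k \<ge> 0")
    case k: True
    show ?thesis
    proof (cases "k = 0")
      case False
      then have "int L * 1 \<le> int L * k" using k by (intro mult_left_mono) auto
      then have "5 \<le> int L * k" using L6 by linarith
      then show ?thesis using d by auto
    qed (use d in auto)
  next
    case False
    then have "int L * k \<le> int L * (- 1)" by (intro mult_left_mono) auto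
    then show ?thesis using d Q by (auto simp: L_def)
  qed
  have spaced: "t + 3 \<le> t'" if t: "t \<in> \<Theta>" "t' \<in> \<Theta>" "t < t'" for t t'
  proof -
    have i21: "int t2 = int t1 + int a + 2 - int L * int f"
    proof -
      have "int t2 + int L * int f = int (t2 + L * f)" by simp
      also have "\<dots> = int (t1 + a + 2)" by (simp only: t21)
      also have "\<dots> = int t1 + int a + 2" by simp
      finally have "int t2 + int L * int f = int t1 + int a + 2" .
      then show ?thesis by (rule iffD2[OF eq_diff_eq])
    qed
    have "\<exists>k d. int t' - int t = int L * k + d \<and> (d = 0 \<or> 3 \<le> d \<and> d + 3 \<le> int L)"
    proof -
      consider q q' where "t = t1 + L * q" "t' = t1 + L * q'" | q q' where "t = t2 + L * q" "t' = t2 + L * q'"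
        | q q' where "t = t1 + L * q" "t' = t2 + L * q'" | q q' where "t = t2 + L * q" "t' = t1 + L * q'"
        using t unfolding \<Theta>_def by blast
      then show ?thesis
      proof cases
        case (1 q q')
        then show ?thesis by (intro exI[of _ "int q' - int q"] exI[of _ 0]) (simp add: algebra_simps)
      next
        case (2 q q')
        then show ?thesis by (intro exI[of _ "int q' - int q"] exI[of _ 0]) (simp add: algebra_simps)
      next
        case (3 q q')
        then show ?thesis using Q a
          by (intro exI[of _ "int q' - int q - int f"] exI[of _ "int a + 2"]) (simp add: i21 algebra_simps L_def)
      next
        case (4 q q')
        then show ?thesis using Q a
          by (intro exI[of _ "int q' - int q + int f - 1"] exI[of _ "int L - int a - 2"]) (simp add: i21 algebra_simps L_def)
      qed
    qed
    then obtain k d where kd: "int t' - int t = int L * k + d" "d = 0 \<or> 3 \<le> d \<and> d + 3 \<le> int L" by blast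
    have "3 \<le> int t' - int t" using gap[OF kd(2), of k] t(3) unfolding kd(1)[symmetric] by simp
    then show ?thesis by simp
  qed
  have disj: "range (\<lambda>q. t1 + L * q) \<inter> range (\<lambda>q. t2 + L * q) = {}"
  proof -
    have "False" if "t1 + L * q = t2 + L * q'" for q q'
    proof -
      have "int (t1 + L * q + L * f) = int (t2 + L * q' + L * f)" using that by simp
      also have "t2 + L * q' + L * f = t1 + a + 2 + L * q'" using t21 by linarith
      finally have eq: "int L * (int q + int f - int q') = int a + 2" by (simp add: algebra_simps)
      then have "int L * (int q + int f - int q' - 1) + (int L - int a - 2) = 0" by (simp add: algebra_simps)
      then have "int L * (int q + int f - int q' - 1) < 0" using Q by (simp add: L_def)
      then have "int q + int f - int q' - 1 < 0" by (simp add: mult_less_0_iff)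
      then have "int L * (int q + int f - int q') \<le> 0" by (simp add: mult_le_0_iff)
      then show False using eq by simp
    qed
    then show ?thesis by blast
  qed
  have "ur_count p a s (m \<kappa>) = card {t \<in> \<Theta>. t \<le> \<kappa>}" for \<kappa>
  proof -
    have M: "m \<kappa> = m0 + Q * \<kappa>" by (simp add: m_def m0_def Q_def)
    have Q0: "Q > 0" using Q by simp
    have c1: "(s + Q * q) * (p + 1) + a \<le> m \<kappa> \<longleftrightarrow> t1 + L * q \<le> \<kappa>" for q
    proof -
      have "(s + Q * q) * (p + 1) + a = m0 + Q * (t1 + L * q)"
        using m0 unfolding Q(1) L_def t1_def by (simp add: algebra_simps)
      then show ?thesis unfolding M using Q0 by simp
    qed
    have c2: "(r + Q * q) * (p + 1) + p \<le> m \<kappa> \<longleftrightarrow> t2 + L * q \<le> \<kappa>" for q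
    proof -
      \<comment> \<open>The bound is not in the class of the weights modulo \<open>Q\<close>; the excess \<open>a + 1\<close>, which lies strictly between \<open>0\<close>
        and \<open>Q\<close>, is absorbed by rounding up to the next weight.\<close>
      have "(r + Q * q) * (p + 1) + p + Q * (2 * f) = r * Q + 2 * (r + Q * f) + Q * (L * q) + Q + 1"
        unfolding Q(1) L_def by (simp add: algebra_simps)
      also have "\<dots> = r * Q + (a + 2 * s) + a + Q * (L * q) + Q + 1" using r(1) by simp
      also have "\<dots> = m0 + Q * (r + e + 1 + L * q) + (a + 1)" unfolding m0 by (simp add: algebra_simps)
      finally have "(r + Q * q) * (p + 1) + p + Q * (2 * f) = m0 + Q * (r + e + 1 + L * q) + (a + 1)" .
      then have "(r + Q * q) * (p + 1) + p + Q * (2 * f) + Q = m0 + Q * ((r + e + 2) + L * q) + (a + 1)"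
        by (simp only:) (simp add: algebra_simps)
      also have "\<dots> = m0 + Q * (t2 + L * q) + (a + 1) + Q * (2 * f)"
        unfolding t2[symmetric] by (simp add: algebra_simps)
      finally have eq: "(r + Q * q) * (p + 1) + p + Q = m0 + Q * (t2 + L * q) + (a + 1)" by linarith
      show ?thesis
      proof
        assume "(r + Q * q) * (p + 1) + p \<le> m \<kappa>"
        then have "Q * (t2 + L * q) < Q * (\<kappa> + 1)" using eq unfolding M by simp
        then have "t2 + L * q < \<kappa> + 1" using mult_less_cancel1 by blast
        then show "t2 + L * q \<le> \<kappa>" by simp
      next
        assume "t2 + L * q \<le> \<kappa>"
        then have "Q * (t2 + L * q) \<le> Q * \<kappa>" by simp
        then show "(r + Q * q) * (p + 1) + p \<le> m \<kappa>" using eq Q(2) unfolding M by linarith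
      qed
    qed
    have "[i = a + s] (mod Q) \<longleftrightarrow> [i = r] (mod Q)" for i by (simp add: cong_def r_def)
    then have "ur_count p a s (m \<kappa>) = card {q. t1 + L * q \<le> \<kappa>} + card {q. t2 + L * q \<le> \<kappa>}"
      unfolding ur_count_def Q_def[symmetric]
      using residue_class_card[OF Q(3), of "p + 1" a "m \<kappa>"] residue_class_card[OF r(2), of "p + 1" p "m \<kappa>"]
      by (simp only: c1 c2)
    also have "\<dots> = card ((\<lambda>q. t1 + L * q) ` {q. t1 + L * q \<le> \<kappa>}) + card ((\<lambda>q. t2 + L * q) ` {q. t2 + L * q \<le> \<kappa>})"
      by (simp add: card_image inj_on_subset[OF inj])
    also have "\<dots> = card ((\<lambda>q. t1 + L * q) ` {q. t1 + L * q \<le> \<kappa>} \<union> (\<lambda>q. t2 + L * q) ` {q. t2 + L * q \<le> \<kappa>})"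
    proof (rule card_Un_disjoint[symmetric])
      have "finite ((\<lambda>q. t + L * q) ` {q. t + L * q \<le> \<kappa>})" for t by (rule finite_subset[of _ "{..\<kappa>}"]) auto
      then show "finite ((\<lambda>q. t1 + L * q) ` {q. t1 + L * q \<le> \<kappa>})" "finite ((\<lambda>q. t2 + L * q) ` {q. t2 + L * q \<le> \<kappa>})" by simp_all
    qed (use disj in blast)
    also have "(\<lambda>q. t1 + L * q) ` {q. t1 + L * q \<le> \<kappa>} \<union> (\<lambda>q. t2 + L * q) ` {q. t2 + L * q \<le> \<kappa>} = {t \<in> \<Theta>. t \<le> \<kappa>}"
      unfolding \<Theta>_def by blast
    finally show ?thesis .
  qed
  moreover have "infinite \<Theta>" unfolding \<Theta>_def using range_inj_infinite[OF inj] by simp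
  ultimately show ?thesis using spaced by blast
qed

section \<open>Newton polygons of convex sequences\<close>

lemma convex_sequence_above_chord:
  fixes V :: "nat \<Rightarrow> real"
  assumes V: "\<And>j. V (Suc j) - V j \<le> V (Suc (Suc j)) - V (Suc j)"
  shows "V n + (V (Suc n) - V n) * (real k - real n) \<le> V k"
proof -
  have mono: "V (Suc i) - V i \<le> V (Suc j) - V j" if "i \<le> j" for i j
    using that by (rule lift_Suc_mono_le[of "\<lambda>j. V (Suc j) - V j", OF V])
  have up: "V n + (V (Suc n) - V n) * real l \<le> V (n + l)" for l
  proof (induction l)
    case (Suc l)
    then show ?case using mono[of n "n + l"] by (simp add: algebra_simps)
  qed simp
  have down: "V n - (V (Suc n) - V n) * real l \<le> V (n - l)" if "l \<le> n" for l
    using that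
  proof (induction l)
    case (Suc l)
    have "Suc (n - Suc l) = n - l" using Suc.prems by simp
    then have "V (n - l) - V (n - Suc l) \<le> V (Suc n) - V n" using mono[of "n - Suc l" n] by simp
    then show ?case using Suc by (simp add: algebra_simps)
  qed simp
  show ?thesis
  proof (cases "n \<le> k")
    case True
    then show ?thesis using up[of "k - n"] by (simp add: of_nat_diff)
  next
    case False
    then show ?thesis using down[of "n - k"] by (simp add: of_nat_diff algebra_simps)
  qed
qed

text \<open>
  All points lie above the line through two consecutive ones, so the hull lies in a half-plane whose boundary
  contains the chord.
\<close>

lemma newton_polygon_convex:
  fixes c :: "nat \<Rightarrow> 'c::{field_char_0,complete_space}" and V :: "nat \<Rightarrow> real"
  assumes c: "\<And>n. c n \<noteq> 0" and v: "\<And>n. real_of_ereal (vp p (c n)) = V n"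
    and V: "\<And>j. V (Suc j) - V j \<le> V (Suc (Suc j)) - V (Suc j)"
    and x: "real n \<le> x" "x \<le> real n + 1"
  shows "newton_polygon p c x = ereal (V n + (V (Suc n) - V n) * (x - real n))"
proof -
  let ?P = "{(real n, real_of_ereal (vp p (c n))) | n. c n \<noteq> 0}"
  define s where "s = V (Suc n) - V n"
  have P: "?P = range (\<lambda>n. (real n, V n))" using c v by auto
  have "convex hull ?P \<subseteq> {z. inner (- s, 1) z \<ge> V n - s * real n}"
  proof (rule hull_minimal)
    show "?P \<subseteq> {z. inner (- s, 1) z \<ge> V n - s * real n}"
      unfolding P using convex_sequence_above_chord[of V n, OF V] by (auto simp: s_def algebra_simps)
    show "convex {z. inner (- s, 1) z \<ge> V n - s * real n}" by (rule convex_halfspace_ge)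
  qed
  then have lower: "V n + s * (x - real n) \<le> y" if "(x, y) \<in> convex hull ?P" for y
    using that by (auto simp: algebra_simps)
  have "(x, V n + s * (x - real n)) \<in> convex hull ?P"
  proof -
    have "(1 - (x - real n)) *\<^sub>R (real n, V n) + (x - real n) *\<^sub>R (real (Suc n), V (Suc n)) \<in> convex hull ?P"
    proof (rule convexD[OF convex_convex_hull])
      show "(real n, V n) \<in> convex hull ?P" "(real (Suc n), V (Suc n)) \<in> convex hull ?P"
        unfolding P by (rule hull_inc, rule range_eqI, rule refl)+
    qed (use x in auto)
    moreover have "(1 - (x - real n)) *\<^sub>R (real n, V n) + (x - real n) *\<^sub>R (real (Suc n), V (Suc n)) =
        (x, V n + s * (x - real n))"
      by (simp add: s_def algebra_simps)
    ultimately show ?thesis by simp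
  qed
  then have "newton_polygon p c x = ereal (V n + s * (x - real n))"
    unfolding newton_polygon_def by (intro Inf_eqI) (auto dest: lower)
  then show ?thesis by (simp add: s_def)
qed

section \<open>The slopes of the ghost series\<close>

text \<open>
  The weights in the class of \<open>k\<^sub>\<epsilon>\<close>, diminished by two and numbered by \<open>\<kappa>\<close>.
\<close>

definition weight_of :: "nat \<Rightarrow> nat \<Rightarrow> nat \<Rightarrow> nat \<Rightarrow> nat" where
  "weight_of p a s \<kappa> = (a + 2 * s) mod (p - 1) + (p - 1) * \<kappa>"

definition ghost_tent :: "nat \<Rightarrow> nat \<Rightarrow> nat \<Rightarrow> nat \<Rightarrow> nat \<Rightarrow> nat" where
  "ghost_tent p a s \<kappa> = tent (ur_count p a s (weight_of p a s \<kappa>))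
     (2 * card {i. i \<le> weight_of p a s \<kappa> \<and> [i = s] (mod (p - 1))})"

definition ghost_degree :: "nat \<Rightarrow> nat \<Rightarrow> nat \<Rightarrow> nat \<Rightarrow> nat" where
  "ghost_degree p a s n = (\<Sum>\<kappa> | ghost_tent p a s \<kappa> n \<noteq> 0. ghost_tent p a s \<kappa> n)"

lemma weight_of_cong: "[weight_of p a s \<kappa> = a + 2 * s] (mod (p - 1))"
  by (simp add: weight_of_def cong_def)

lemma thresholds:
  fixes p a s :: nat
  assumes p: "a + 4 \<le> p" and a: "1 \<le> a" and s: "s < p - 1"
  shows "finite {\<kappa>. ur_count p a s (weight_of p a s \<kappa>) \<le> n}"
    and "n \<ge> 1 \<Longrightarrow> \<exists>x. \<forall>\<kappa>\<in>{x, x + 1, x + 2}. ur_count p a s (weight_of p a s \<kappa>) = n"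
proof -
  obtain \<Theta> where \<Theta>: "infinite \<Theta>" "\<And>t t'. t \<in> \<Theta> \<Longrightarrow> t' \<in> \<Theta> \<Longrightarrow> t < t' \<Longrightarrow> t + 3 \<le> t'"
    "\<And>\<kappa>. ur_count p a s (weight_of p a s \<kappa>) = card {t \<in> \<Theta>. t \<le> \<kappa>}"
    using ur_count_thresholds[OF assms] unfolding weight_of_def by blast
  show "\<exists>x. \<forall>\<kappa>\<in>{x, x + 1, x + 2}. ur_count p a s (weight_of p a s \<kappa>) = n" if "n \<ge> 1"
    unfolding \<Theta>(3) by (rule spaced_counting[OF \<Theta>(1,2) that])
  obtain S where S: "S \<subseteq> \<Theta>" "finite S" "card S = Suc n" using infinite_arbitrarily_large[OF \<Theta>(1)] by blast
  have "\<kappa> < Max S" if "card {t \<in> \<Theta>. t \<le> \<kappa>} \<le> n" for \<kappa>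
  proof (rule ccontr)
    assume "\<not> \<kappa> < Max S"
    then have "t \<le> \<kappa>" if "t \<in> S" for t using Max_ge[OF S(2) that] by simp
    then have "S \<subseteq> {t \<in> \<Theta>. t \<le> \<kappa>}" using S(1) by blast
    then have "card S \<le> card {t \<in> \<Theta>. t \<le> \<kappa>}" by (intro card_mono) auto
    then show False using that S(3) by simp
  qed
  then show "finite {\<kappa>. ur_count p a s (weight_of p a s \<kappa>) \<le> n}"
    unfolding \<Theta>(3) by (intro finite_subset[OF _ finite_lessThan[of "Max S"]] subsetI) simp
qed

lemma ghost_degree_convex:
  fixes p a s :: nat
  assumes p: "a + 4 \<le> p" and a: "1 \<le> a" and s: "s < p - 1" and n: "n \<ge> 1"
  shows "2 * ghost_degree p a s n < ghost_degree p a s (n + 1) + ghost_degree p a s (n - 1)"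
  unfolding ghost_degree_def ghost_tent_def
proof (rule tent_sums_convex[OF _ _ thresholds(1)[OF p a s] thresholds(2)[OF p a s n] n])
  let ?C = "\<lambda>\<kappa>. card {i. i \<le> weight_of p a s \<kappa> \<and> [i = s] (mod (p - 1))}"
  show "ur_count p a s (weight_of p a s \<kappa>) \<le> ?C \<kappa>" for \<kappa>
    by (rule ur_count_le) (use p a weight_of_cong in auto)
  have "?C (Suc \<kappa>) = Suc (?C \<kappa>)" for \<kappa>
  proof -
    have "weight_of p a s (Suc \<kappa>) = weight_of p a s \<kappa> + (p - 1)" by (simp add: weight_of_def)
    then show ?thesis using residue_count[of "p - 1" s "weight_of p a s \<kappa>"] s by (simp only:)
  qed
  then have "strict_mono ?C" by (simp add: strict_mono_Suc_iff)
  then show "inj ?C" by (rule strict_mono_imp_inj_on)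
qed

context iwasawa_module
begin

context
  fixes s :: nat
  assumes s: "s < p - 1"
begin

lemma cong_shift: "[p - 1 - s + i = x] (mod (p - 1)) \<longleftrightarrow> [i = x + s] (mod (p - 1))"
proof -
  have "[p - 1 - s + i = x] (mod (p - 1)) \<longleftrightarrow> [p - 1 - s + i + s = x + s] (mod (p - 1))"
    by (simp only: cong_add_rcancel_nat)
  also have "p - 1 - s + i + s = i + (p - 1)" using s by simp
  also have "[i + (p - 1) = x + s] (mod (p - 1)) \<longleftrightarrow> [i = x + s] (mod (p - 1))"
    by (simp only: cong_def mod_add_self2)
  finally show ?thesis .
qed

lemma dvd_shift: "(p - 1) dvd (p - 1 - s + i) \<longleftrightarrow> [i = s] (mod (p - 1))"
  using cong_shift[of i 0] by (simp only: cong_0_iff add_0)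

lemma dim_ur_ur_count: "env.dim_ur m (p - 1 - s) = ur_count p a s m"
  by (simp only: env.dim_ur_def ur_count_def cong_shift dvd_shift)

text \<open>
  Both conditions in \<open>eB\<close> reduce to congruences for \<open>i\<close> alone, because the weight is in the right class; the two
  classes are exchanged by the reflection \<open>i \<mapsto> m - i\<close>.
\<close>

lemma sum_eB:
  assumes m: "[m = a + 2 * s] (mod (p - 1))"
  shows "(\<Sum>i\<le>m. env.eB (p - 1 - s + i) (p - 1 - s + (m - i))) = 2 * card {i. i \<le> m \<and> [i = s] (mod (p - 1))}"
proof -
  have refl: "[m - i = x] (mod (p - 1)) \<longleftrightarrow> [i = y] (mod (p - 1))" if "i \<le> m" "x + y = a + 2 * s" for i x y
  proof -
    have "[m - i = x] (mod (p - 1)) \<longleftrightarrow> [m - i + i = x + i] (mod (p - 1))"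
      by (simp only: cong_add_rcancel_nat)
    also have "\<dots> \<longleftrightarrow> [x + y = x + i] (mod (p - 1))"
      using that m cong_trans cong_sym by (metis le_add_diff_inverse2)
    also have "\<dots> \<longleftrightarrow> [i = y] (mod (p - 1))" by (simp only: cong_add_lcancel_nat cong_sym_eq)
    finally show ?thesis .
  qed
  have "env.eB (p - 1 - s + i) (p - 1 - s + (m - i)) =
      of_bool ([i = a + s] (mod (p - 1))) + of_bool ([i = s] (mod (p - 1)))" if i: "i \<le> m" for i
  proof -
    have "[m - i = s] (mod (p - 1)) \<longleftrightarrow> [i = a + s] (mod (p - 1))" by (rule refl[OF i]) simp
    moreover have "[m - i = a + s] (mod (p - 1)) \<longleftrightarrow> [i = s] (mod (p - 1))" by (rule refl[OF i]) simp
    ultimately show ?thesis unfolding env.eB_def cong_shift dvd_shift by simp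
  qed
  then have "(\<Sum>i\<le>m. env.eB (p - 1 - s + i) (p - 1 - s + (m - i))) =
      (\<Sum>i\<le>m. of_bool ([i = a + s] (mod (p - 1)))) + (\<Sum>i\<le>m. of_bool ([i = s] (mod (p - 1))))"
    by (simp add: sum.distrib)
  also have "\<dots> = card {i. i \<le> m \<and> [i = a + s] (mod (p - 1))} + card {i. i \<le> m \<and> [i = s] (mod (p - 1))}"
    by (simp add: sum_of_bool_eq Int_def)
  also have "\<dots> = 2 * card {i. i \<le> m \<and> [i = s] (mod (p - 1))}" using residue_count_reflect[OF m] by simp
  finally show ?thesis .
qed

abbreviation \<epsilon>s :: "'f \<times> 'f \<Rightarrow> 'c" where "\<epsilon>s \<equiv> char_of_exponent p a red s"

lemma exponent_s: "exponent p a red \<epsilon>s = s"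
  using exponent_char_of_exponent[of s] s by simp

lemma ghost_mult_eq:
  "ghost_mult p a E red H \<epsilon>s n (weight_of p a s \<kappa> + 2) = ghost_tent p a s \<kappa> n"
proof -
  let ?m = "weight_of p a s \<kappa>"
  have s': "s \<le> p - 1" using s by simp
  have "[?m + 2 * (p - 1 - s) = a + 2 * s + 2 * (p - 1 - s)] (mod (p - 1))"
    using weight_of_cong by (simp only: cong_add_rcancel_nat)
  also have "a + 2 * s + 2 * (p - 1 - s) = a + (p - 1) * 2" using s by simp
  also have "[a + (p - 1) * 2 = a] (mod (p - 1))" by (simp only: cong_def mod_mult_self2)
  finally have m: "[?m + 2 * (p - 1 - s) = a] (mod (p - 1))" .
  show ?thesis
    unfolding ghost_mult_def Let_def \<epsilon>\<^sub>1_def exponent_s d_Iw_eq[OF s'] d_ur_eq[OF s' m] dim_ur_ur_count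
      sum_eB[OF weight_of_cong] ghost_tent_def tent_def ..
qed

lemma ghost_index_set:
  "{k. k \<ge> 2 \<and> [k = k_of p a red \<epsilon>s] (mod (p - 1)) \<and> ghost_mult p a E red H \<epsilon>s n k \<noteq> 0} =
   (\<lambda>\<kappa>. weight_of p a s \<kappa> + 2) ` {\<kappa>. ghost_tent p a s \<kappa> n \<noteq> 0}"
proof -
  define W where "W \<kappa> = weight_of p a s \<kappa> + 2" for \<kappa>
  have ko: "k_of p a red \<epsilon>s = (a + 2 * s) mod (p - 1) + 2" by (simp add: k_of_def exponent_s)
  have weights: "k \<ge> 2 \<and> [k = k_of p a red \<epsilon>s] (mod (p - 1)) \<longleftrightarrow> (\<exists>\<kappa>. k = W \<kappa>)" for k
  proof
    assume k: "k \<ge> 2 \<and> [k = k_of p a red \<epsilon>s] (mod (p - 1))"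
    define l where "l = k - 2"
    have "2 \<le> k" using k by blast
    then have kl: "k = l + 2" unfolding l_def by (rule le_add_diff_inverse2[symmetric])
    have "[l + 2 = (a + 2 * s) mod (p - 1) + 2] (mod (p - 1))" using k unfolding kl ko by blast
    then have "[l = (a + 2 * s) mod (p - 1)] (mod (p - 1))" by (simp only: cong_add_rcancel_nat)
    then have "l mod (p - 1) = (a + 2 * s) mod (p - 1)" by (simp add: cong_def)
    then have "l = weight_of p a s (l div (p - 1))"
      using mod_mult_div_eq[of l "p - 1"] by (simp add: weight_of_def)
    then have "k = W (l div (p - 1))" unfolding W_def kl by (rule arg_cong)
    then show "\<exists>\<kappa>. k = W \<kappa>" by blast
  next
    assume "\<exists>\<kappa>. k = W \<kappa>"
    then obtain \<kappa> where k: "k = weight_of p a s \<kappa> + 2" unfolding W_def by blast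
    have "[weight_of p a s \<kappa> = (a + 2 * s) mod (p - 1)] (mod (p - 1))" by (simp add: weight_of_def cong_def)
    then show "k \<ge> 2 \<and> [k = k_of p a red \<epsilon>s] (mod (p - 1))"
      unfolding ko k by (simp only: cong_add_rcancel_nat le_add2 simp_thms)
  qed
  show ?thesis
    unfolding ghost_mult_eq[symmetric] W_def[symmetric]
  proof (intro equalityI subsetI)
    fix k assume k: "k \<in> {k. k \<ge> 2 \<and> [k = k_of p a red \<epsilon>s] (mod (p - 1)) \<and> ghost_mult p a E red H \<epsilon>s n k \<noteq> 0}"
    then obtain \<kappa> where "k = W \<kappa>" using weights[of k] by blast
    then show "k \<in> W ` {\<kappa>. ghost_mult p a E red H \<epsilon>s n (W \<kappa>) \<noteq> 0}" using k by blast
  next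
    fix k assume "k \<in> W ` {\<kappa>. ghost_mult p a E red H \<epsilon>s n (W \<kappa>) \<noteq> 0}"
    then obtain \<kappa> where "k = W \<kappa>" "ghost_mult p a E red H \<epsilon>s n (W \<kappa>) \<noteq> 0" by blast
    then show "k \<in> {k. k \<ge> 2 \<and> [k = k_of p a red \<epsilon>s] (mod (p - 1)) \<and> ghost_mult p a E red H \<epsilon>s n k \<noteq> 0}"
      using weights[of k] by blast
  qed
qed

lemma ghost_coeff_eq:
  defines "I \<equiv> \<lambda>n. {\<kappa>. ghost_tent p a s \<kappa> n \<noteq> 0}"
  shows "ghost_coeff p a E red H \<epsilon>s n = (\<Prod>\<kappa>\<in>I n. [:- w_point p (int (weight_of p a s \<kappa> + 2)), 1:] ^
      ghost_tent p a s \<kappa> n)"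
proof -
  have "inj_on (\<lambda>\<kappa>. weight_of p a s \<kappa> + 2) (I n)" using s by (auto simp: inj_on_def weight_of_def)
  then show ?thesis
    unfolding ghost_coeff_def ghost_index_set I_def
    by (simp only: prod.reindex o_def ghost_mult_eq)
qed

lemma degree_ghost_coeff: "degree (ghost_coeff p a E red H \<epsilon>s n) = ghost_degree p a s n"
proof -
  have "degree ([:- x, 1:] ^ k :: 'c poly) = k" for x k by (rule degree_linear_power)
  then show ?thesis
    unfolding ghost_coeff_eq ghost_degree_def by (subst degree_prod_eq_sum_degree) auto
qed

text \<open>
  All zeros of the ghost coefficients have valuation at least one, so at a point of valuation below
  one every linear factor has the valuation of the point itself.
\<close>

lemma av_ghost_coeff:
  assumes w: "1 / real p < av w"
  shows "av (poly (ghost_coeff p a E red H \<epsilon>s n) w) = av w ^ ghost_degree p a s n"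
proof -
  have "p \<ge> 3" using env.a_le env.a_ge by simp
  then have "av (w_point p k) < av w" for k using w_point_small[of k] w by simp
  then have wk: "av (w - w_point p k) = av w" for k
    using av_eq_of_close[of "w - w_point p k" w] by simp
  have prod: "av (\<Prod>i\<in>I. f i) = (\<Prod>i\<in>I. av (f i))" for I :: "nat set" and f
    by (induction I rule: infinite_finite_induct) (simp_all add: av_mult)
  show ?thesis
    unfolding ghost_coeff_eq ghost_degree_def
    by (simp add: poly_prod prod av_power wk power_sum del: of_nat_add)
qed

end

end

theorem corollary4p14:
  fixes p a :: nat
    and E :: "'c::{field_char_0,complete_space} set"
    and \<pi> :: 'c
    and red :: "'c \<Rightarrow> 'f::field"
    and H :: "(nat \<Rightarrow> ('c^2^2) set \<Rightarrow> 'c, 'h) module"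
    and H_act :: "'h \<Rightarrow> 'c^2^2 \<Rightarrow> 'h"
    and P :: "('f^2^2 \<Rightarrow> 'f, 'q) module"
    and \<theta> :: "'h \<Rightarrow> 'q"
    and H0 :: "('c, 'h0) module"
    and T0 :: "'h0 topology"
    and H0_act :: "'h0 \<Rightarrow> 'c^2^2 \<Rightarrow> 'h0"
    and \<Phi> :: "'h \<Rightarrow> nat \<Rightarrow> 'c set \<Rightarrow> 'h0"
    and \<epsilon> :: "'f \<times> 'f \<Rightarrow> 'c"
    and w :: 'c
  assumes "ghost_setting p a E \<pi> red H H_act P \<theta> H0 T0 H0_act \<Phi>"
    and "relevant_character p a red \<epsilon>"
    and "0 < vp p w" and "vp p w < 1"
  defines "g \<equiv> ghost_coeff p a E red H \<epsilon>"
  defines "s \<equiv> \<lambda>n. real_of_ereal (vp p w) * (real (degree (g n)) - real (degree (g (n - 1))))"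
  shows "(\<forall>n\<ge>1. is_newton_slope p (\<lambda>n. poly (g n) w) n (s n)) \<and> strict_mono_on {1..} s"
proof -
  interpret gs: ghost_setting p a E \<pi> red H H_act P \<theta> H0 T0 H0_act \<Phi> by fact
  interpret cr: coeff_ring p E \<pi> red
    using gs.prime_p gs.Cp gs.E_ext gs.uniformizer gs.residue_map by unfold_locales
  have ap: "1 \<le> a" "a + 4 \<le> p" using gs.a_ge_1 gs.a_le gs.p_ge_5 by simp_all
  interpret iw: iwasawa_module p E \<pi> red a P H \<theta>
    using ap gs.P_envelope gs.H_projective gs.\<theta>_surj gs.\<theta>_add gs.\<theta>_act gs.\<theta>_kernel by unfold_locales
  obtain e where e: "e \<in> {0..p - 2}" "\<epsilon> = char_of_exponent p a red e"
    using assms(2) by (auto simp: relevant_character_def)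
  have e': "e < p - 1" using e(1) gs.p_ge_5 by auto
  define D where "D n = ghost_degree p a e n" for n
  have degree: "degree (g n) = D n" for n
    unfolding g_def e(2) D_def by (rule iw.degree_ghost_coeff[OF e'])
  have w0: "w \<noteq> 0" using assms(4) by (auto simp: vp_def)
  have w1: "1 / real p < dist w 0" using assms(4) cr.vp_ge_1_iff[of w] by (simp add: not_le[symmetric])
  have av: "dist (poly (g n) w) 0 = dist w 0 ^ D n" for n
    unfolding g_def e(2) D_def by (rule iw.av_ghost_coeff[OF e' w1])
  define v where "v = real_of_ereal (vp p w)"
  have v: "v = - log (real p) (dist w 0)" using w0 by (simp add: v_def vp_def)
  have v0: "0 < v"
    using assms(3) w0 by (simp add: v vp_def)
  have c0: "poly (g n) w \<noteq> 0" for n using av[of n] w0 by auto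
  have vc: "real_of_ereal (vp p (poly (g n) w)) = v * real (D n)" for n
    using c0[of n] w0 by (simp add: vp_def av v log_nat_power)
  have conv: "real (D (Suc n)) - real (D n) < real (D (Suc (Suc n))) - real (D (Suc n))" for n
    using ghost_degree_convex[OF ap(2,1) e', of "Suc n"] by (simp add: D_def)
  have s_Suc: "s (Suc n) = v * (real (D (Suc n)) - real (D n))" for n
    by (simp add: s_def v_def degree)
  have step: "s (Suc n) < s (Suc (Suc n))" for n
    unfolding s_Suc using conv v0 by (rule mult_strict_left_mono)
  have V: "v * real (D (Suc n)) - v * real (D n) \<le> v * real (D (Suc (Suc n))) - v * real (D (Suc n))" for n
    using step[of n] unfolding s_Suc by (simp add: algebra_simps)
  have "is_newton_slope p (\<lambda>n. poly (g n) w) n (s n)" if n: "n \<ge> 1" for n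
  proof -
    obtain k where k: "n = Suc k" using n by (cases n) auto
    have np: "newton_polygon p (\<lambda>n. poly (g n) w) x = ereal (v * real (D k) + s n * (x - real k))"
      if "real k \<le> x" "x \<le> real k + 1" for x
      using newton_polygon_convex[of "\<lambda>n. poly (g n) w" p "\<lambda>n. v * real (D n)", OF c0 vc V that]
      by (simp add: k s_Suc right_diff_distrib)
    show ?thesis unfolding is_newton_slope_def using np by (auto simp: k)
  qed
  moreover have "strict_mono_on {1..} s"
  proof (rule strict_mono_onI)
    fix i j :: nat assume "i \<in> {1..}" "j \<in> {1..}" "i < j"
    then obtain i' j' where "i = Suc i'" "j = Suc j'" "i' < j'" by (cases i; cases j) auto
    then show "s i < s j" using lift_Suc_mono_less[of "\<lambda>n. s (Suc n)", OF step] by simp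
  qed
  ultimately show ?thesis by blast
qed

end
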